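(* Let $G$ be a right-angled Artin group or the fundamental group of a compact special cube complex, and let $R$, acting on $X$, be the subdivision rule associated to $G$ (constructed in the context). Then the growth function of $G$ is the number of non-ideal tiles in $R^n(X)$; that is, the function $n\mapsto \#\{\text{non-ideal tiles of } R^n(X)\}$ is the growth function of $G$, up to the usual equivalence of growth functions (degree of growth).
   Context: A growth function for a group $G$ is a function $g:\mathbb N\to\mathbb N$ such that $g(n)$ is the number of elements of $G$ at distance $n$ from the identity in the word metric of some finite generating set. Growth functions depend on the generating set; only the degree of growth (polynomial of degree $d$, exponential, etc.) is a well-defined invariant of $G$. The subdivision rule for a right-angled Artin group $A$ with generators $e_1,\dots,e_d$. Let $I=[-1,1]$ and let $I'_A$ be $I^d$ with all ridges $\{x_i=\pm1,\ x_j=\pm1\}$ removed for each pair with $[e_i,e_j]\ne1$. Let $I_A$ be the truncation of $I'_A$ in which the deleted (ideal) cells are expanded to facets, called ideal facets, so that two non-ideal facets meet if and only if the corresponding generators are distinct and commute. Gluing opposite non-ideal facets gives a manifold $T_A$ with $\pi_1(T_A)=A$; its universal cover is tiled by copies $gI_A$, $g\in A$. Let $B(0,0)=I_A$, let $B(i+1,0)$ be the union of $B(i,0)$ and all copies of $I_A$ meeting it, and $S(i,0)=\partial B(i,0)$, a $(d-1)$-sphere. The tiling $R^n(X)$, $n\ge0$, is the tiling of $S(n+1,0)$ whose tiles are the ideal facets (ideal tiles) and, for each copy $gI_A$ in $B(n+1,0)\setminus B(n,0)$, the union of the non-ideal facets of $gI_A$ lying in $S(n+1,0)$ (a non-ideal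 tile, corresponding to $g$). Extending the walls separating the tiles identifies each $R^{n+1}(X)$ with a subdivision of $R^n(X)$, where $X=R^0(X)$. The subdivision rule for a compact special cube complex $Y$ (a compact nonpositively curved cube complex with a local isometry to the Salvetti complex of some right-angled Artin group $A$, i.e. the standard cube complex with one vertex $b_0$, one loop per generator, and one $n$-torus per $n$-clique of the defining graph). Lift the local isometry to an embedding of universal covers $\widetilde Y\hookrightarrow\widetilde X_A$, where $\widetilde X_A$ is the universal cover of the Salvetti complex, with lifted basepoint $\tilde b_0\in\widetilde Y$. The tilings for $\pi_1(Y)$ are those for $A$, except that a non-ideal tile corresponding to $g\in A$ remains non-ideal only if $g\tilde b_0\in\widetilde Y$; all other tiles are labeled ideal. *)

theory Defs
  imports "HOL-Analysis.Analysis" "HOL-Algebra.Generated_Groups"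
begin

section \<open>Growth functions\<close>

definition finite_generating_set :: "('g, 'm) monoid_scheme \<Rightarrow> 'g set \<Rightarrow> bool" where
  "finite_generating_set G S \<longleftrightarrow> finite S \<and> S \<subseteq> carrier G \<and> generate G S = carrier G"

definition word_norm :: "('g, 'm) monoid_scheme \<Rightarrow> 'g set \<Rightarrow> 'g \<Rightarrow> nat" where
  "word_norm G S x =
     (LEAST n. \<exists>ws. length ws = n \<and> set ws \<subseteq> S \<union> m_inv G ` S \<and>
                     foldr (mult G) ws (one G) = x)"

definition growth_function :: "('g, 'm) monoid_scheme \<Rightarrow> 'g set \<Rightarrow> nat \<Rightarrow> nat" where
  "growth_function G S n = card {x \<in> carrier G. word_norm G S x = n}"

text \<open>
  Growth functions count spheres.  Their degree of growth is compared in the usual way, through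
  the cumulative functions (which count balls): these are the ones for which weak domination
  makes the equivalence class independent of the generating set.  The additive constant outside
  matters only for the trivial group.
\<close>

definition growth_dominated :: "(nat \<Rightarrow> nat) \<Rightarrow> (nat \<Rightarrow> nat) \<Rightarrow> bool" where
  "growth_dominated a b \<longleftrightarrow> (\<exists>C. \<forall>n. (\<Sum>k\<le>n. a k) \<le> C * (\<Sum>k\<le>C * n + C. b k) + C)"

definition growth_equivalent :: "(nat \<Rightarrow> nat) \<Rightarrow> (nat \<Rightarrow> nat) \<Rightarrow> bool" where
  "growth_equivalent a b \<longleftrightarrow> growth_dominated a b \<and> growth_dominated b a"

definition is_growth_of :: "(nat \<Rightarrow> nat) \<Rightarrow> ('g, 'm) monoid_scheme \<Rightarrow> bool" where
  "is_growth_of a G \<longleftrightarrow>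
     (\<exists>S. finite_generating_set G S) \<and>
     (\<forall>S. finite_generating_set G S \<longrightarrow> growth_equivalent a (growth_function G S))"


section \<open>Fundamental groups and universal covers\<close>

definition path_class :: "'a::topological_space set \<Rightarrow> (real \<Rightarrow> 'a) \<Rightarrow> (real \<Rightarrow> 'a) set" where
  "path_class X p = {q. homotopic_paths X p q}"

definition fundamental_group ::
    "'a::topological_space set \<Rightarrow> 'a \<Rightarrow> (real \<Rightarrow> 'a) set monoid" where
  "fundamental_group X x0 =
     \<lparr> carrier = {path_class X p | p.
                    path p \<and> path_image p \<subseteq> X \<and> pathstart p = x0 \<and> pathfinish p = x0},
       mult = (\<lambda>a b. {r. \<exists>p\<in>a. \<exists>q\<in>b. homotopic_paths X (p +++ q) r}),
       one = path_class X (\<lambda>_. x0) \<rparr>"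

text \<open>
  The standard model of the universal cover (of a connected, locally simply connected space):
  homotopy classes of paths issuing from the base point, the covering map being the end point.
  Its topology is generated by the sets of all continuations of a given class inside an open set.
\<close>

definition universal_cover ::
    "'a::topological_space set \<Rightarrow> 'a \<Rightarrow> (real \<Rightarrow> 'a) set set" where
  "universal_cover X x0 =
     {path_class X p | p. path p \<and> path_image p \<subseteq> X \<and> pathstart p = x0}"

definition universal_cover_topology ::
    "'a::topological_space set \<Rightarrow> 'a \<Rightarrow> (real \<Rightarrow> 'a) set topology" where
  "universal_cover_topology X x0 =
     topology_generated_by
       {{path_class X (p +++ q) | q.
           path q \<and> path_image q \<subseteq> X \<inter> V \<and> pathstart q = pathfinish p} | p V.
        path p \<and> path_image p \<subseteq> X \<and> pathstart p = x0 \<and> open V}"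

text \<open>
  The lift to universal covers of a continuous map \<open>f\<close> into \<open>Z\<close>, taking base point to base point.
\<close>

definition lift_map ::
    "'b::topological_space set \<Rightarrow> ('a::topological_space \<Rightarrow> 'b) \<Rightarrow>
       (real \<Rightarrow> 'a) set \<Rightarrow> (real \<Rightarrow> 'b) set" where
  "lift_map Z f c = {r. \<exists>p\<in>c. homotopic_paths Z (f \<circ> p) r}"


section \<open>Right-angled Artin groups\<close>

text \<open>
  A letter \<open>(i, True)\<close> stands for the generator \<open>e\<^sub>i\<close> and \<open>(i, False)\<close> for its inverse;
  \<open>E\<close> is the adjacency relation of the defining graph.
\<close>

type_synonym 'e word = "('e \<times> bool) list"

inductive raag_step :: "('e \<Rightarrow> 'e \<Rightarrow> bool) \<Rightarrow> 'e word \<Rightarrow> 'e word \<Rightarrow> bool" for E where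
  cancel: "raag_step E (u @ [(i, s), (i, \<not> s)] @ v) (u @ v)"
| commute: "E i j \<Longrightarrow> raag_step E (u @ [(i, s), (j, t)] @ v) (u @ [(j, t), (i, s)] @ v)"

definition word_class :: "('e \<Rightarrow> 'e \<Rightarrow> bool) \<Rightarrow> 'e word \<Rightarrow> 'e word set" where
  "word_class E w = {w'. equivclp (raag_step E) w w'}"

definition raag :: "('e \<Rightarrow> 'e \<Rightarrow> bool) \<Rightarrow> 'e word set monoid" where
  "raag E =
     \<lparr> carrier = range (word_class E),
       mult = (\<lambda>a b. {w. \<exists>u\<in>a. \<exists>v\<in>b. w \<in> word_class E (u @ v)}),
       one = word_class E [] \<rparr>"

text \<open>
  Both \<open>T\<^sub>A\<close> and the Salvetti complex are realised inside the torus of all \<open>z :: complex ^ 'e\<close> with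
  \<open>norm (z $ i) = 1\<close>, with base point \<open>1\<close>; the generator \<open>e\<^sub>i\<close> is the \<open>i\<close>-th coordinate circle.
\<close>

definition generator_loop :: "'e::finite \<Rightarrow> real \<Rightarrow> complex ^ 'e" where
  "generator_loop i t = (\<chi> k. if k = i then cis (2 * pi * t) else 1)"

fun word_loop :: "'e::finite word \<Rightarrow> real \<Rightarrow> complex ^ 'e" where
  "word_loop [] = (\<lambda>_. 1)"
| "word_loop ((i, s) # w) =
     (if s then generator_loop i else reversepath (generator_loop i)) +++ word_loop w"

text \<open>
  The action of the group on the universal cover of \<open>X\<close> by deck transformations, where \<open>X\<close> is
  one of these two spaces.
\<close>

definition deck ::
    "(complex ^ 'e) set \<Rightarrow> 'e::finite word set \<Rightarrow> (real \<Rightarrow> complex ^ 'e) set \<Rightarrow>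
       (real \<Rightarrow> complex ^ 'e) set" where
  "deck X g c = {r. \<exists>w\<in>g. \<exists>p\<in>c. homotopic_paths X (word_loop w +++ p) r}"


section \<open>The subdivision rule\<close>

text \<open>
  The cube \<open>[-1,1]\<^sup>d\<close> truncated along the ridges \<open>x\<^sub>i = \<plusminus>1, x\<^sub>j = \<plusminus>1\<close> of non-commuting pairs of
  generators.  Any bound strictly between 1 and 2 in place of \<open>3/2\<close> gives the same
  combinatorial type.
\<close>

definition truncated_cube :: "('e::finite \<Rightarrow> 'e \<Rightarrow> bool) \<Rightarrow> (real ^ 'e) set" where
  "truncated_cube E =
     {x. (\<forall>i. \<bar>x $ i\<bar> \<le> 1) \<and> (\<forall>i j. i \<noteq> j \<and> \<not> E i j \<longrightarrow> \<bar>x $ i\<bar> + \<bar>x $ j\<bar> \<le> 3 / 2)}"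

definition nonideal_facets :: "('e::finite \<Rightarrow> 'e \<Rightarrow> bool) \<Rightarrow> (real ^ 'e) set set" where
  "nonideal_facets E = {{x \<in> truncated_cube E. x $ i = s} | i s. s \<in> {1, -1}}"

definition ideal_facets :: "('e::finite \<Rightarrow> 'e \<Rightarrow> bool) \<Rightarrow> (real ^ 'e) set set" where
  "ideal_facets E =
     {{x \<in> truncated_cube E. s * x $ i + t * x $ j = 3 / 2} | i j s t.
        i \<noteq> j \<and> \<not> E i j \<and> s \<in> {1, -1} \<and> t \<in> {1, -1}}"

text \<open>
  On the truncated cube the following map makes precisely the identifications of opposite
  non-ideal facets by translation, so its image is the manifold \<open>T\<^sub>A\<close>.
\<close>

definition glue :: "real ^ 'e \<Rightarrow> complex ^ 'e::finite" where
  "glue x = (\<chi> k. cis (pi * x $ k))"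

definition raag_manifold :: "('e::finite \<Rightarrow> 'e \<Rightarrow> bool) \<Rightarrow> (complex ^ 'e) set" where
  "raag_manifold E = glue ` truncated_cube E"

text \<open>
  \<open>cell_copy E g\<close> is the translate by \<open>g\<close> of the lift of \<open>glue\<close> to the universal cover that takes
  the centre \<open>0\<close> to the base point; it is computed along segments, the truncated cube being convex.
\<close>

definition cell_copy ::
    "('e::finite \<Rightarrow> 'e \<Rightarrow> bool) \<Rightarrow> 'e word set \<Rightarrow> real ^ 'e \<Rightarrow> (real \<Rightarrow> complex ^ 'e) set" where
  "cell_copy E g x =
     deck (raag_manifold E) g (path_class (raag_manifold E) (glue \<circ> linepath 0 x))"

abbreviation copy ::
    "('e::finite \<Rightarrow> 'e \<Rightarrow> bool) \<Rightarrow> 'e word set \<Rightarrow> (real \<Rightarrow> complex ^ 'e) set set" where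
  "copy E g \<equiv> cell_copy E g ` truncated_cube E"

fun cell_ball ::
    "('e::finite \<Rightarrow> 'e \<Rightarrow> bool) \<Rightarrow> nat \<Rightarrow> (real \<Rightarrow> complex ^ 'e) set set" where
  "cell_ball E 0 = copy E (one (raag E))"
| "cell_ball E (Suc n) =
     cell_ball E n \<union> \<Union> {copy E g | g. g \<in> carrier (raag E) \<and> copy E g \<inter> cell_ball E n \<noteq> {}}"

text \<open>
  The boundary of the ball as a manifold: its frontier in the universal cover, together with its
  part of the boundary of the universal cover, which consists of the ideal facets of all copies.
\<close>

definition cell_sphere ::
    "('e::finite \<Rightarrow> 'e \<Rightarrow> bool) \<Rightarrow> nat \<Rightarrow> (real \<Rightarrow> complex ^ 'e) set set" where
  "cell_sphere E n =
     universal_cover_topology (raag_manifold E) 1 frontier_of cell_ball E n \<union>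
     \<Union> {cell_copy E g ` F | g F. g \<in> carrier (raag E) \<and> copy E g \<subseteq> cell_ball E n \<and>
                                  F \<in> ideal_facets E}"

definition tile ::
    "('e::finite \<Rightarrow> 'e \<Rightarrow> bool) \<Rightarrow> nat \<Rightarrow> 'e word set \<Rightarrow> (real \<Rightarrow> complex ^ 'e) set set" where
  "tile E n g =
     \<Union> {cell_copy E g ` F | F. F \<in> nonideal_facets E \<and> cell_copy E g ` F \<subseteq> cell_sphere E (Suc n)}"

datatype tile_label = Ideal | Non_ideal

text \<open>
  The \<open>n\<close>-th tiling, as a set of labelled tiles.  The tile of a group element \<open>g\<close> is non-ideal
  exactly if \<open>g \<in> V\<close>; for the Artin group itself \<open>V\<close> is the whole group.
\<close>

definition tiling ::
    "('e::finite \<Rightarrow> 'e \<Rightarrow> bool) \<Rightarrow> 'e word set set \<Rightarrow> nat \<Rightarrow>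
       (tile_label \<times> (real \<Rightarrow> complex ^ 'e) set set) set" where
  "tiling E V n =
     {(Ideal, cell_copy E g ` F) | g F.
        g \<in> carrier (raag E) \<and> copy E g \<subseteq> cell_ball E (Suc n) \<and> F \<in> ideal_facets E} \<union>
     {(if g \<in> V then Non_ideal else Ideal, tile E n g) | g.
        g \<in> carrier (raag E) \<and> copy E g \<subseteq> cell_ball E (Suc n) \<and> \<not> copy E g \<subseteq> cell_ball E n}"

definition non_ideal_tiles :: "(tile_label \<times> 'p set) set \<Rightarrow> 'p set set" where
  "non_ideal_tiles R = {T. (Non_ideal, T) \<in> R}"


section \<open>Cube complexes\<close>

text \<open>
  The cube \<open>[0,1]\<^sup>n\<close>, its vertices, the distance between points of it, and the smallest face
  containing a given point.
\<close>

definition unit_cube :: "nat \<Rightarrow> (nat \<Rightarrow> real) set" where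
  "unit_cube n = {x. (\<forall>i<n. 0 \<le> x i \<and> x i \<le> 1) \<and> (\<forall>i\<ge>n. x i = 0)}"

definition corners :: "nat \<Rightarrow> (nat \<Rightarrow> real) set" where
  "corners n = {x \<in> unit_cube n. \<forall>i<n. x i \<in> {0, 1}}"

definition cube_dist :: "nat \<Rightarrow> (nat \<Rightarrow> real) \<Rightarrow> (nat \<Rightarrow> real) \<Rightarrow> real" where
  "cube_dist n x y = L2_set (\<lambda>i. x i - y i) {..<n}"

definition support_face :: "nat \<Rightarrow> (nat \<Rightarrow> real) \<Rightarrow> (nat \<Rightarrow> real) set" where
  "support_face n x = {z \<in> unit_cube n. \<forall>i<n. x i \<in> {0, 1} \<longrightarrow> z i = x i}"

definition cube_isometry ::
    "nat \<Rightarrow> (nat \<Rightarrow> real) set \<Rightarrow> nat \<Rightarrow> (nat \<Rightarrow> real) set \<Rightarrow>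
       ((nat \<Rightarrow> real) \<Rightarrow> nat \<Rightarrow> real) \<Rightarrow> bool" where
  "cube_isometry m F n F' h \<longleftrightarrow>
     bij_betw h F F' \<and> (\<forall>x\<in>F. \<forall>y\<in>F. cube_dist n (h x) (h y) = cube_dist m x y)"

text \<open>
  A cube complex is a space presented as a quotient of a disjoint union of cubes, glued along faces
  by isometries; this is the definition of Bridson and Haefliger for general polyhedral complexes:
  a characteristic map is injective on the interior of every face, though not necessarily on the
  whole cube, and several characteristic maps may have the same image.
\<close>

record ('a, 'c) cubed_space =
  points :: "'a set"
  cells :: "'c set"
  cell_dim :: "'c \<Rightarrow> nat"
  chart :: "'c \<Rightarrow> (nat \<Rightarrow> real) \<Rightarrow> 'a"

definition cube_complex :: "('a::topological_space, 'c) cubed_space \<Rightarrow> bool" where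
  "cube_complex K \<longleftrightarrow>
     points K = (\<Union>c\<in>cells K. chart K c ` unit_cube (cell_dim K c)) \<and>
     (\<forall>c\<in>cells K. \<forall>x\<in>unit_cube (cell_dim K c). \<forall>y\<in>unit_cube (cell_dim K c).
        support_face (cell_dim K c) x = support_face (cell_dim K c) y \<and>
        chart K c x = chart K c y \<longrightarrow> x = y) \<and>
     (\<forall>c\<in>cells K. \<forall>c'\<in>cells K.
        \<forall>x\<in>unit_cube (cell_dim K c). \<forall>x'\<in>unit_cube (cell_dim K c').
        chart K c x = chart K c' x' \<longrightarrow>
        (\<exists>h. cube_isometry (cell_dim K c) (support_face (cell_dim K c) x)
                           (cell_dim K c') (support_face (cell_dim K c') x') h \<and>
             (\<forall>z\<in>support_face (cell_dim K c) x. chart K c z = chart K c' (h z)))) \<and>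
     (\<forall>U \<subseteq> points K.
        openin (top_of_set (points K)) U \<longleftrightarrow>
        (\<forall>c\<in>cells K. openin (top_of_set (unit_cube (cell_dim K c)))
                             {x \<in> unit_cube (cell_dim K c). chart K c x \<in> U}))"

definition vertices :: "('a, 'c) cubed_space \<Rightarrow> 'a set" where
  "vertices K = (\<Union>c\<in>cells K. chart K c ` corners (cell_dim K c))"

text \<open>
  The link of a vertex.  Its vertices are the ends of edges there, represented by open half-edges,
  so that a loop contributes two of them.  Its open simplices are represented by the open corners
  of (faces of) cubes: \<open>corner_block K c x J\<close> is the open corner at \<open>x\<close> of the face of the
  cube \<open>c\<close> spanned by the directions in \<open>J\<close>.
\<close>

definition half_edge :: "('a, 'c) cubed_space \<Rightarrow> 'c \<Rightarrow> (nat \<Rightarrow> real) \<Rightarrow> nat \<Rightarrow> 'a set" where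
  "half_edge K c x i = (\<lambda>t. chart K c (x(i := \<bar>x i - t\<bar>))) ` {0<..<1/2}"

definition corner_block ::
    "('a, 'c) cubed_space \<Rightarrow> 'c \<Rightarrow> (nat \<Rightarrow> real) \<Rightarrow> nat set \<Rightarrow> 'a set" where
  "corner_block K c x J =
     chart K c ` {y \<in> unit_cube (cell_dim K c).
       \<forall>i<cell_dim K c. if i \<in> J then 0 < \<bar>y i - x i\<bar> \<and> \<bar>y i - x i\<bar> < 1/2 else y i = x i}"

definition vertex_corners :: "('a, 'c) cubed_space \<Rightarrow> 'a \<Rightarrow> ('c \<times> (nat \<Rightarrow> real)) set" where
  "vertex_corners K v = {(c, x). c \<in> cells K \<and> x \<in> corners (cell_dim K c) \<and> chart K c x = v}"

definition link_simplices :: "('a, 'c) cubed_space \<Rightarrow> 'a \<Rightarrow> 'a set set set" where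
  "link_simplices K v =
     {half_edge K c x ` J | c x J. (c, x) \<in> vertex_corners K v \<and> J \<subseteq> {..<cell_dim K c}}"

definition link_vertices :: "('a, 'c) cubed_space \<Rightarrow> 'a \<Rightarrow> 'a set set" where
  "link_vertices K v = \<Union> (link_simplices K v)"

definition simplicial_link :: "('a, 'c) cubed_space \<Rightarrow> 'a \<Rightarrow> bool" where
  "simplicial_link K v \<longleftrightarrow>
     (\<forall>(c, x)\<in>vertex_corners K v. inj_on (half_edge K c x) {..<cell_dim K c}) \<and>
     (\<forall>(c, x)\<in>vertex_corners K v. \<forall>(c', x')\<in>vertex_corners K v.
        \<forall>J \<subseteq> {..<cell_dim K c}. \<forall>J' \<subseteq> {..<cell_dim K c'}.
          half_edge K c x ` J = half_edge K c' x' ` J' \<longrightarrow>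
          corner_block K c x J = corner_block K c' x' J')"

definition flag_link :: "('a, 'c) cubed_space \<Rightarrow> 'a \<Rightarrow> bool" where
  "flag_link K v \<longleftrightarrow>
     (\<forall>\<Sigma> \<subseteq> link_vertices K v.
        finite \<Sigma> \<and> (\<forall>a\<in>\<Sigma>. \<forall>b\<in>\<Sigma>. {a, b} \<in> link_simplices K v) \<longrightarrow> \<Sigma> \<in> link_simplices K v)"

definition nonpositively_curved :: "('a, 'c) cubed_space \<Rightarrow> bool" where
  "nonpositively_curved K \<longleftrightarrow> (\<forall>v\<in>vertices K. simplicial_link K v \<and> flag_link K v)"

definition combinatorial_map ::
    "('a, 'c) cubed_space \<Rightarrow> ('b, 'd) cubed_space \<Rightarrow> ('a \<Rightarrow> 'b) \<Rightarrow> bool" where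
  "combinatorial_map K L f \<longleftrightarrow>
     (\<forall>c\<in>cells K. \<exists>d\<in>cells L. \<exists>h.
        cube_isometry (cell_dim K c) (unit_cube (cell_dim K c))
                      (cell_dim L d) (unit_cube (cell_dim L d)) h \<and>
        (\<forall>x\<in>unit_cube (cell_dim K c). f (chart K c x) = chart L d (h x)))"

text \<open>
  Local isometries of nonpositively curved cube complexes: combinatorial maps that embed every link
  as a full subcomplex.
\<close>

definition local_isometry ::
    "('a, 'c) cubed_space \<Rightarrow> ('b, 'd) cubed_space \<Rightarrow> ('a \<Rightarrow> 'b) \<Rightarrow> bool" where
  "local_isometry K L f \<longleftrightarrow>
     combinatorial_map K L f \<and>
     (\<forall>v\<in>vertices K.
        inj_on ((`) f) (link_vertices K v) \<and>
        (\<forall>\<Sigma> \<subseteq> link_vertices K v. (`) f ` \<Sigma> \<in> link_simplices L (f v) \<longrightarrow> \<Sigma> \<in> link_simplices K v))"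

text \<open>
  The Salvetti complex: the union of the coordinate subtori of the cliques.  Its cells are indexed by
  the duplicate-free enumerations \<open>xs\<close> of cliques, so each cube occurs once for every ordering of
  its coordinates.
\<close>

definition salvetti :: "('e::finite \<Rightarrow> 'e \<Rightarrow> bool) \<Rightarrow> (complex ^ 'e, 'e list) cubed_space" where
  "salvetti E =
     \<lparr> points = {z. (\<forall>i. norm (z $ i) = 1) \<and>
                    (\<forall>i j. i \<noteq> j \<and> z $ i \<noteq> 1 \<and> z $ j \<noteq> 1 \<longrightarrow> E i j)},
       cells = {xs. distinct xs \<and> (\<forall>i\<in>set xs. \<forall>j\<in>set xs. i \<noteq> j \<longrightarrow> E i j)},
       cell_dim = length,
       chart = (\<lambda>xs x. \<chi> i. \<Prod>k | k < length xs \<and> xs ! k = i. cis (2 * pi * x k)) \<rparr>"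

definition special_cube_complex ::
    "('e::finite \<Rightarrow> 'e \<Rightarrow> bool) \<Rightarrow> ('a::topological_space, 'c) cubed_space \<Rightarrow>
       ('a \<Rightarrow> complex ^ 'e) \<Rightarrow> bool" where
  "special_cube_complex E Y f \<longleftrightarrow>
     cube_complex Y \<and> connected (points Y) \<and> nonpositively_curved Y \<and>
     local_isometry Y (salvetti E) f"

text \<open>
  The group elements \<open>g\<close> for which the translate by \<open>g\<close> of the base vertex of the universal cover of
  the Salvetti complex lies in the embedded universal cover of \<open>Y\<close>.
\<close>

definition special_elements ::
    "('e::finite \<Rightarrow> 'e \<Rightarrow> bool) \<Rightarrow> ('a::topological_space, 'c) cubed_space \<Rightarrow>
       ('a \<Rightarrow> complex ^ 'e) \<Rightarrow> 'a \<Rightarrow> 'e word set set" where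
  "special_elements E Y f y0 =
     {g \<in> carrier (raag E).
        deck (points (salvetti E)) g (path_class (points (salvetti E)) (\<lambda>_. 1)) \<in>
        lift_map (points (salvetti E)) f ` universal_cover (points Y) y0}"

end

theory Submission
  imports Defs
begin

text \<open>
  Let \<open>A\<close> be the right-angled Artin group and call a product of pairwise commuting, distinct
  generators or their inverses a clique word.  Two copies of the truncated cube meet exactly if
  their group elements differ by a clique word on the right (\<open>copies_meet_iff\<close>), so the ball of
  radius \<open>n\<close> consists of the copies whose element has clique norm at most \<open>n\<close>, the clique norm being
  the word norm for the clique words (\<open>cell_ball_eq\<close>).  The tiles of the \<open>n\<close>-th tiling that are not
  ideal facets are therefore indexed by the elements of clique norm \<open>n + 1\<close>.  Distinct elements have
  distinct tiles: the clique norm has no dead ends, that is, some generator takes \<open>g\<close> one step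
  further out (\<open>clique_norm_extend\<close>), so the tile of \<open>g\<close> contains a whole facet, and the centre of
  a facet lies on just two copies, the other one being outside the ball (\<open>tile_inj\<close>).  Hence
  the non-ideal tiles are counted by the spheres of the clique norm inside the set \<open>V\<close> of admitted
  group elements (\<open>card_non_ideal_tiles\<close>).  For \<open>V = A\<close> this is, shifted by one, the growth function of \<open>A\<close>
  for the generating set of clique words, and growth does not depend on the generating set.

  All this presupposes that the copies really are different for different elements of \<open>A\<close>, that is,
  that loops in \<open>T\<^sub>A\<close> know the group element they spell.  This is proved by holonomy: passing through a
  non-ideal facet multiplies by its generator, and since the truncation removes the places where two
  facets of non-commuting generators are near each other, this rule is a cocycle for nearby points.
  Its product along a path is a homotopy invariant (\<open>homotopic_word_loop_spoke_imp\<close>).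

  The combinatorics of \<open>A\<close> rests on one normal form theorem: cancellation and commutation steps are
  confluent (\<open>confluence\<close>), which is seen by letting words act on pilings.  Since these steps neither
  lengthen a word nor raise its layers, reduced words realise the clique norm.

  For a special cube complex \<open>Y\<close> the local isometry to the Salvetti complex labels the edges by letters.
  Every path between vertices of \<open>Y\<close> is homotopic to an edge path (\<open>path_homotopic_epath\<close>), and the set
  \<open>V\<close> consists of the elements spelled by edge paths from the base vertex (\<open>special_elements_eq\<close>).
  Because links embed as full subcomplexes, an edge path stays an edge path, in the same homotopy class,
  when its word is reduced (\<open>spelled_step\<close>).  With confluence this gives two things: \<open>\<pi>\<^sub>1(Y)\<close> embeds in
  \<open>A\<close>, with image in \<open>V\<close> (\<open>loop_class_eq_iff\<close>), and every element of \<open>V\<close> is spelled by an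
  edge path of length bounded by a multiple of its clique norm (\<open>short_spelled\<close>), which is the
  convexity of the universal cover of \<open>Y\<close>.  Closing up edge paths along finitely many fixed connecting
  paths now turns elements of \<open>V\<close> into elements of \<open>\<pi>\<^sub>1(Y)\<close> of comparable length, at most one element for
  each vertex of \<open>Y\<close> being sent to the same loop class.  As in the Milnor--Schwarz lemma this
  compares the spheres in \<open>V\<close> with those of \<open>\<pi>\<^sub>1(Y)\<close> (\<open>growth_equivalent_orbit\<close>).
\<close>

section \<open>Right-angled Artin groups and the clique norm\<close>

locale raag_graph =
  fixes E :: "'e::finite \<Rightarrow> 'e \<Rightarrow> bool"
  assumes E_symp: "symp E" and E_irreflp: "irreflp E"
begin

lemma E_sym: "E i j \<Longrightarrow> E j i"
  using E_symp by (auto dest: sympD)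

lemma E_irrefl [simp]: "\<not> E i i"
  using E_irreflp by (auto dest: irreflpD)

abbreviation reduces :: "'e word \<Rightarrow> 'e word \<Rightarrow> bool" (infix "\<rightarrow>\<^sub>R" 50) where
  "u \<rightarrow>\<^sub>R v \<equiv> (raag_step E)\<^sup>*\<^sup>* u v"

abbreviation equiv_words :: "'e word \<Rightarrow> 'e word \<Rightarrow> bool" (infix "\<sim>\<^sub>R" 50) where
  "u \<sim>\<^sub>R v \<equiv> equivclp (raag_step E) u v"

abbreviation raag_product :: "'e word set \<Rightarrow> 'e word set \<Rightarrow> 'e word set" (infixl "\<cdot>" 70) where
  "g \<cdot> h \<equiv> g \<otimes>\<^bsub>raag E\<^esub> h"

subsection \<open>The group\<close>

lemma raag_step_context:
  assumes "raag_step E u v"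
  shows "raag_step E (a @ u @ b) (a @ v @ b)"
  using assms
proof cases
  case (cancel u' i s v')
  have "raag_step E ((a @ u') @ [(i, s), (i, \<not> s)] @ (v' @ b)) ((a @ u') @ (v' @ b))"
    by (rule raag_step.cancel)
  then show ?thesis using cancel by simp
next
  case (commute i j u' s t v')
  then have "raag_step E ((a @ u') @ [(i, s), (j, t)] @ (v' @ b)) ((a @ u') @ [(j, t), (i, s)] @ (v' @ b))"
    by (intro raag_step.commute)
  then show ?thesis using commute by simp
qed

lemma reduces_context: "u \<rightarrow>\<^sub>R v \<Longrightarrow> a @ u @ b \<rightarrow>\<^sub>R a @ v @ b"
  by (induction rule: rtranclp_induct) (auto intro: rtranclp.rtrancl_into_rtrancl raag_step_context)

lemma reduces_imp_equiv: "u \<rightarrow>\<^sub>R v \<Longrightarrow> u \<sim>\<^sub>R v"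
  by (induction rule: rtranclp_induct) (auto intro: equivclp_into_equivclp)

lemma equiv_context: "u \<sim>\<^sub>R v \<Longrightarrow> a @ u @ b \<sim>\<^sub>R a @ v @ b"
proof (induction rule: equivclp_induct)
  case (step y z)
  then show ?case
    by (meson equivclp_into_equivclp raag_step_context)
qed simp

lemma equiv_append: "u \<sim>\<^sub>R u' \<Longrightarrow> v \<sim>\<^sub>R v' \<Longrightarrow> u @ v \<sim>\<^sub>R u' @ v'"
  using equiv_context[of u u' "[]" v] equiv_context[of v v' u' "[]"]
  by (auto intro: equivclp_trans)

lemma word_class_eq_iff: "word_class E u = word_class E v \<longleftrightarrow> u \<sim>\<^sub>R v"
  unfolding word_class_def
  by (auto intro: equivclp_trans equivclp_sym)

lemma mem_word_class: "v \<in> word_class E u \<longleftrightarrow> u \<sim>\<^sub>R v"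
  by (simp add: word_class_def)

lemma word_class_self [simp]: "u \<in> word_class E u"
  by (simp add: mem_word_class)

lemma word_class_memD: "g \<in> carrier (raag E) \<Longrightarrow> w \<in> g \<Longrightarrow> g = word_class E w"
  by (metis (no_types, lifting) imageE mem_word_class monoid.select_convs(1) partial_object.select_convs(1) raag_def word_class_eq_iff)

lemma raag_mult [simp]: "word_class E u \<cdot> word_class E v = word_class E (u @ v)"
proof -
  have "w \<in> word_class E (u @ v) \<longleftrightarrow> (\<exists>u'\<in>word_class E u. \<exists>v'\<in>word_class E v. w \<in> word_class E (u' @ v'))" for w
  proof
    assume "\<exists>u'\<in>word_class E u. \<exists>v'\<in>word_class E v. w \<in> word_class E (u' @ v')"
    then obtain u' v' where "u \<sim>\<^sub>R u'" "v \<sim>\<^sub>R v'" "u' @ v' \<sim>\<^sub>R w"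
      by (auto simp: mem_word_class)
    then show "w \<in> word_class E (u @ v)"
      using equivclp_trans[OF equiv_append] by (simp add: mem_word_class)
  qed (use word_class_self in blast)
  then show ?thesis by (auto simp: raag_def)
qed

lemma raag_one: "\<one>\<^bsub>raag E\<^esub> = word_class E []"
  by (simp add: raag_def)

lemma word_class_carrier [simp]: "word_class E u \<in> carrier (raag E)"
  by (simp add: raag_def)

definition inv_word :: "'e word \<Rightarrow> 'e word" where
  "inv_word w = rev (map (\<lambda>(i, s). (i, \<not> s)) w)"

lemma inv_word_Cons: "inv_word ((i, s) # w) = inv_word w @ [(i, \<not> s)]"
  by (simp add: inv_word_def)

lemma inv_word_Nil [simp]: "inv_word [] = []"
  by (simp add: inv_word_def)

lemma inv_word_inv_word [simp]: "inv_word (inv_word w) = w"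
  by (induction w) (auto simp: inv_word_def rev_map)

lemma reduces_right_inverse: "w @ inv_word w \<rightarrow>\<^sub>R []"
proof (induction w)
  case (Cons x w)
  obtain i s where x: "x = (i, s)" by force
  have "[x] @ (w @ inv_word w) @ [(i, \<not> s)] \<rightarrow>\<^sub>R [x] @ [] @ [(i, \<not> s)]"
    by (rule reduces_context[OF Cons])
  moreover have "raag_step E [x, (i, \<not> s)] []"
    using raag_step.cancel[of E "[]" i s "[]"] x by simp
  ultimately show ?case
    using x by (simp add: inv_word_Cons)
qed simp

lemma equiv_left_inverse: "inv_word w @ w \<sim>\<^sub>R []"
  using reduces_imp_equiv[OF reduces_right_inverse[of "inv_word w"]] by simp

lemma group_raag: "group (raag E)"
proof (rule groupI)
  fix x y z assume "x \<in> carrier (raag E)" "y \<in> carrier (raag E)" "z \<in> carrier (raag E)"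
  then obtain u v w where "x = word_class E u" "y = word_class E v" "z = word_class E w"
    by (auto simp: raag_def)
  then show "x \<cdot> y \<cdot> z = x \<cdot> (y \<cdot> z)"
    by simp
next
  fix x y assume "x \<in> carrier (raag E)" "y \<in> carrier (raag E)"
  then obtain u v where "x = word_class E u" "y = word_class E v"
    by (auto simp: raag_def)
  then show "x \<cdot> y \<in> carrier (raag E)" "\<one>\<^bsub>raag E\<^esub> \<cdot> x = x"
    by (simp_all add: raag_one)
next
  fix x assume "x \<in> carrier (raag E)"
  then obtain w where w: "x = word_class E w" by (auto simp: raag_def)
  then show "\<exists>y\<in>carrier (raag E). y \<cdot> x = \<one>\<^bsub>raag E\<^esub>"
    by (intro bexI[of _ "word_class E (inv_word w)"])
      (auto simp: raag_one word_class_eq_iff equiv_left_inverse)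
qed (simp add: raag_one)

sublocale RG: group "raag E" by (rule group_raag)

lemma raag_carrierE:
  assumes "g \<in> carrier (raag E)" obtains w where "g = word_class E w"
  using assms by (auto simp: raag_def)

lemma equiv_cancel_right: "u @ w \<sim>\<^sub>R v @ w \<Longrightarrow> u \<sim>\<^sub>R v"
  using RG.right_cancel[of "word_class E w" "word_class E u" "word_class E v"]
  by (simp add: word_class_eq_iff)

subsection \<open>Pilings\<close>

definition noncomm :: "'e \<Rightarrow> 'e \<Rightarrow> bool" where
  "noncomm i j \<longleftrightarrow> i \<noteq> j \<and> \<not> E i j"

lemma noncomm_sym: "noncomm i j \<Longrightarrow> noncomm j i"
  by (auto simp: noncomm_def dest: E_sym)

lemma noncomm_irrefl [simp]: "\<not> noncomm i i"
  by (simp add: noncomm_def)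

lemma E_not_noncomm: "E i j \<Longrightarrow> \<not> noncomm i j \<and> \<not> noncomm j i \<and> i \<noteq> j \<and> j \<noteq> i"
  by (auto simp: noncomm_def dest: E_sym)

text \<open>
  Every generator has a stack of beads. A letter puts a signed bead (\<open>Some s\<close>) on its
  own stack and a blank bead (\<open>None\<close>) on the stack of each generator that does not
  commute with it. The blanks record the order of non-commuting letters, and that of commuting
  letters is forgotten.
\<close>
type_synonym ('x) piling = "'x \<Rightarrow> bool option list"

definition top :: "'e piling \<Rightarrow> 'e \<Rightarrow> bool option" where
  "top st i = (case st i of [] \<Rightarrow> None | Some s # _ \<Rightarrow> Some s | None # _ \<Rightarrow> None)"

definition push :: "'e \<times> bool \<Rightarrow> 'e piling \<Rightarrow> 'e piling" where
  "push x st = (\<lambda>j. if j = fst x then Some (snd x) # st j else if noncomm (fst x) j then None # st j else st j)"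

definition pop :: "'e \<Rightarrow> 'e piling \<Rightarrow> 'e piling" where
  "pop i st = (\<lambda>j. if j = i \<or> noncomm i j then tl (st j) else st j)"

text \<open>
  The action of a letter: it removes a bead of the opposite sign together with the blanks that
  came with it, and otherwise adds a bead.
\<close>
definition pact :: "'e \<times> bool \<Rightarrow> 'e piling \<Rightarrow> 'e piling" where
  "pact x st = (if top st (fst x) = Some (\<not> snd x) then pop (fst x) st else push x st)"

lemma pop_push [simp]: "pop i (push (i, s) st) = st"
  by (auto simp: pop_def push_def)

lemma top_push: "top (push (i, s) st) j = (if j = i then Some s else if noncomm i j then None else top st j)"
  by (auto simp: top_def push_def)

text \<open>
  Only in pilings built by pushing do the blanks match the beads, which is what makes the action
  of a letter invertible.
\<close>
inductive reachable :: "'e piling \<Rightarrow> bool" where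
  empty: "reachable (\<lambda>_. [])"
| push: "reachable st \<Longrightarrow> top st i \<noteq> Some (\<not> s) \<Longrightarrow> reachable (push (i, s) st)"

lemma push_commute: "E i j \<Longrightarrow> push (i, s) (push (j, t) st) = push (j, t) (push (i, s) st)"
  using E_not_noncomm[of i j] by (auto simp: push_def fun_eq_iff)

text \<open>
  A bead that lies on top of its stack may be taken to be the last one pushed, because the letters
  pushed after it left no blank on it and hence commute with it.
\<close>
lemma reachable_top:
  assumes "reachable st" "top st i = Some s"
  shows "\<exists>st'. reachable st' \<and> st = push (i, s) st' \<and> top st' i \<noteq> Some (\<not> s)"
  using assms
proof (induction arbitrary: i s rule: reachable.induct)
  case empty
  then show ?case by (simp add: top_def)
next
  case (push st j t)
  show ?case
  proof (cases "j = i")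
    case True
    then show ?thesis using push by (auto simp: top_push)
  next
    case False
    then have E: "E i j" "top st i = Some s"
      using push.prems by (auto simp: top_push noncomm_def split: if_splits dest: E_sym)
    then obtain st' where st': "reachable st'" "st = push (i, s) st'" "top st' i \<noteq> Some (\<not> s)"
      using push.IH by blast
    have "top st' j \<noteq> Some (\<not> t)"
      using push.hyps(2) st'(2) E_not_noncomm[OF E(1)] by (simp add: top_push)
    then have "reachable (push (j, t) st')" using st' by (intro reachable.push)
    moreover have "top (push (j, t) st') i \<noteq> Some (\<not> s)"
      using st'(3) E_not_noncomm[OF E(1)] by (simp add: top_push)
    ultimately show ?thesis
      using st'(2) push_commute[OF E(1)] by metis
  qed
qed

lemma reachable_pact: "reachable st \<Longrightarrow> reachable (pact x st)"
proof (cases x)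
  case (Pair i s)
  assume "reachable st"
  then show ?thesis
    using reachable_top[of st i "\<not> s"] reachable.push[of st i s] Pair
    by (auto simp: pact_def)
qed

lemma pact_inverse:
  assumes "reachable st"
  shows "pact (i, \<not> s) (pact (i, s) st) = st"
proof (cases "top st i = Some (\<not> s)")
  case True
  then obtain st' where "st = push (i, \<not> s) st'" "top st' i \<noteq> Some s"
    using reachable_top[OF assms True] by auto
  then show ?thesis by (simp add: pact_def top_push)
next
  case False
  then show ?thesis by (simp add: pact_def top_push)
qed

lemma pact_commute:
  assumes "reachable st" "E i j"
  shows "pact (i, s) (pact (j, t) st) = pact (j, t) (pact (i, s) st)"
proof -
  note nE = E_not_noncomm[OF assms(2)]
  have *: "pact (i, s) (pact (j, t) st) = pact (j, t) (pact (i, s) st)"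
    if E: "E i j" and tj: "top st j \<noteq> Some (\<not> t)" for i j s t
  proof (cases "top st i = Some (\<not> s)")
    case True
    then obtain st' where st': "st = push (i, \<not> s) st'" "top st' i \<noteq> Some s"
      using reachable_top[OF assms(1) True] by auto
    have "push (j, t) st = push (i, \<not> s) (push (j, t) st')"
      using push_commute[OF E] st'(1) by simp
    then show ?thesis
      using st' tj E_not_noncomm[OF E] by (simp add: pact_def top_push)
  next
    case False
    then show ?thesis
      using tj E_not_noncomm[OF E] push_commute[OF E] by (simp add: pact_def top_push)
  qed
  consider "top st j \<noteq> Some (\<not> t)" | "top st i \<noteq> Some (\<not> s)"
    | "top st j = Some (\<not> t)" "top st i = Some (\<not> s)" by blast
  then show ?thesis
  proof cases
    case 1
    then show ?thesis using * assms(2) by blast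
  next
    case 2
    then show ?thesis using *[of j i s t] E_sym[OF assms(2)] by simp
  next
    case 3
    then obtain st' where st': "reachable st'" "st = push (i, \<not> s) st'"
      using reachable_top[OF assms(1)] by blast
    moreover have "top st' j = Some (\<not> t)"
      using 3 st' nE by (simp add: top_push)
    ultimately obtain st'' where "st' = push (j, \<not> t) st''"
      using reachable_top by blast
    then have st2: "st = push (i, \<not> s) (push (j, \<not> t) st'')" "st = push (j, \<not> t) (push (i, \<not> s) st'')"
      using st' push_commute[OF assms(2)] by auto
    have "pact (i, s) (pact (j, t) st) = st''"
      by (subst st2(2)) (simp add: pact_def top_push nE)
    moreover have "pact (j, t) (pact (i, s) st) = st''"
      by (subst st2(1)) (simp add: pact_def top_push nE)
    ultimately show ?thesis by simp
  qed
qed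

definition pile :: "'e word \<Rightarrow> 'e piling" where
  "pile w = foldl (\<lambda>st x. pact x st) (\<lambda>_. []) w"

lemma pile_Nil [simp]: "pile [] = (\<lambda>_. [])"
  by (simp add: pile_def)

lemma pile_snoc [simp]: "pile (w @ [x]) = pact x (pile w)"
  by (simp add: pile_def)

lemma pile_append: "pile (u @ w) = foldl (\<lambda>st x. pact x st) (pile u) w"
  by (simp add: pile_def)

lemma reachable_pile [simp]: "reachable (pile w)"
  by (induction w rule: rev_induct) (auto intro: reachable.empty reachable_pact)

lemma pile_step: "raag_step E u v \<Longrightarrow> pile u = pile v"
proof (induction rule: raag_step.induct)
  case (commute i j u s t v)
  then show ?case using pact_commute[of "pile u" i j s t] by (simp add: pile_append)
qed (simp add: pile_append pact_inverse)

text \<open>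
  The letters act on reachable pilings by permutations that satisfy the relations of the group, so
  the piling of a word is an invariant of its class.
\<close>
lemma pile_equiv: "u \<sim>\<^sub>R v \<Longrightarrow> pile u = pile v"
  by (induction rule: equivclp_induct) (auto dest: pile_step)

subsection \<open>Levels\<close>

text \<open>
  Viennot's heap of pieces: a letter falls until it rests on an earlier letter that is equal to it
  or its inverse or does not commute with it. For a word \<open>w\<close>, \<open>levels w
  i\<close> is the level at which the last letter with generator \<open>i\<close> comes to rest,
  and \<open>0\<close> if there is none.
\<close>
definition level_of :: "('e \<Rightarrow> nat) \<Rightarrow> 'e \<Rightarrow> nat" where
  "level_of m i = Suc (Max {m k | k. k = i \<or> noncomm i k})"

definition levels :: "'e word \<Rightarrow> 'e \<Rightarrow> nat" where
  "levels w = foldl (\<lambda>m x. m(fst x := level_of m (fst x))) (\<lambda>_. 0) w"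

lemma levels_Nil [simp]: "levels [] = (\<lambda>_. 0)"
  by (simp add: levels_def)

lemma levels_snoc [simp]: "levels (w @ [x]) = (levels w)(fst x := level_of (levels w) (fst x))"
  by (simp add: levels_def)

lemma levels_append: "levels (u @ w) = foldl (\<lambda>m x. m(fst x := level_of m (fst x))) (levels u) w"
  by (simp add: levels_def)

lemma level_of_le_iff: "level_of m i \<le> Suc n \<longleftrightarrow> m i \<le> n \<and> (\<forall>k. noncomm i k \<longrightarrow> m k \<le> n)"
  unfolding level_of_def by (subst Suc_le_mono, subst Max_le_iff) auto

lemma level_of_gt: "k = i \<or> noncomm i k \<Longrightarrow> m k < level_of m i"
  using level_of_le_iff[of m i "level_of m i - 1"] by (auto simp: level_of_def)

lemma level_of_cong: "(\<And>k. k = i \<or> noncomm i k \<Longrightarrow> m k = m' k) \<Longrightarrow> level_of m i = level_of m' i"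
  unfolding level_of_def by (metis (mono_tags, lifting))

lemma level_of_mono:
  assumes "m \<le> m'" shows "level_of m i \<le> level_of m' i"
proof -
  obtain n where n: "level_of m' i = Suc n" by (simp add: level_of_def)
  then show ?thesis
    using level_of_le_iff[of m' i n] level_of_le_iff[of m i n] assms
    by (auto simp: le_fun_def intro: order_trans)
qed

lemma levels_foldl_mono:
  "m \<le> m' \<Longrightarrow> foldl (\<lambda>m x. m(fst x := level_of m (fst x))) m w \<le>
     foldl (\<lambda>m x. m(fst x := level_of m (fst x))) m' w"
proof (induction w arbitrary: m m')
  case (Cons x w)
  then have "m(fst x := level_of m (fst x)) \<le> m'(fst x := level_of m' (fst x))"
    using level_of_mono[OF Cons.prems] by (auto simp: le_fun_def)
  from Cons.IH[OF this] show ?case by (simp del: fun_upd_apply)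
qed simp

lemma levels_extend: "levels u \<le> levels (u @ w)"
proof (induction w rule: rev_induct)
  case (snoc x w)
  then show ?case
    unfolding append_assoc[symmetric] levels_snoc
    by (auto simp: le_fun_def intro: order_trans less_imp_le[OF level_of_gt])
qed simp

text \<open>
  Commuting neighbours do not see each other when they fall, and removing letters lets the others
  fall deeper.
\<close>
lemma levels_step: "raag_step E u v \<Longrightarrow> levels v \<le> levels u"
proof (induction rule: raag_step.induct)
  case (cancel u i s v)
  show ?case
    using levels_foldl_mono[OF levels_extend[of u "[(i, s), (i, \<not> s)]"], of v]
    by (simp add: levels_append)
next
  case (commute i j u s t v)
  have "levels (u @ [(i, s), (j, t)]) = levels (u @ [(j, t), (i, s)])"
  proof -
    note nE = E_not_noncomm[OF commute]
    have "level_of ((levels u)(j := level_of (levels u) j)) i = level_of (levels u) i"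
      "level_of ((levels u)(i := level_of (levels u) i)) j = level_of (levels u) j"
      using nE by (auto intro!: level_of_cong)
    then show ?thesis
      using nE by (simp add: levels_append fun_upd_twist del: fun_upd_apply)
  qed
  then show ?case
    using levels_append[of "u @ [(i, s), (j, t)]" v] levels_append[of "u @ [(j, t), (i, s)]" v] by simp
qed

lemma levels_reduces: "u \<rightarrow>\<^sub>R v \<Longrightarrow> levels v \<le> levels u"
  by (induction rule: rtranclp_induct) (auto dest: levels_step intro: order_trans)

subsection \<open>Reduced words and confluence\<close>

text \<open>
  A word is reduced if no letter cancels while its piling is built.
\<close>
inductive reduced :: "'e word \<Rightarrow> bool" where
  Nil: "reduced []"
| snoc: "reduced w \<Longrightarrow> top (pile w) i \<noteq> Some (\<not> s) \<Longrightarrow> reduced (w @ [(i, s)])"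

lemma pile_reduced_snoc: "top (pile w) i \<noteq> Some (\<not> s) \<Longrightarrow> pile (w @ [(i, s)]) = push (i, s) (pile w)"
  by (simp add: pact_def)

lemma commute_snoc: "E i j \<Longrightarrow> w @ [(i, s), (j, t)] \<rightarrow>\<^sub>R w @ [(j, t), (i, s)]"
  using raag_step.commute[of E i j w s t "[]"] by auto

text \<open>
  Words follow their pilings: a letter whose bead is on top can be commuted to the end of the
  word, and as commutations go both ways this changes no level.
\<close>
lemma reduced_top:
  assumes "reduced w" "top (pile w) i = Some s"
  shows "\<exists>w'. reduced w' \<and> w \<rightarrow>\<^sub>R w' @ [(i, s)] \<and> levels w = levels (w' @ [(i, s)]) \<and>
           length w = Suc (length w') \<and> top (pile w') i \<noteq> Some (\<not> s)"
  using assms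
proof (induction arbitrary: i s rule: reduced.induct)
  case Nil
  then show ?case by (simp add: top_def)
next
  case (snoc w j t)
  note pw = pile_reduced_snoc[OF snoc.hyps(2)]
  show ?case
  proof (cases "j = i")
    case True
    then have "t = s" using snoc.prems pw by (simp add: top_push)
    then show ?thesis using snoc True by auto
  next
    case False
    then have E: "E i j" "top (pile w) i = Some s"
      using snoc.prems pw by (auto simp: top_push noncomm_def split: if_splits dest: E_sym)
    then obtain w' where w': "reduced w'" "w \<rightarrow>\<^sub>R w' @ [(i, s)]" "levels w = levels (w' @ [(i, s)])"
      "length w = Suc (length w')" "top (pile w') i \<noteq> Some (\<not> s)"
      using snoc.IH by blast
    have "pile w = push (i, s) (pile w')"
      using pile_equiv[OF reduces_imp_equiv[OF w'(2)]] pile_reduced_snoc[OF w'(5)] by simp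
    then have t': "top (pile w') j \<noteq> Some (\<not> t)"
      using snoc.hyps(2) E_not_noncomm[OF E(1)] by (simp add: top_push)
    have "w @ [(j, t)] \<rightarrow>\<^sub>R w' @ [(i, s), (j, t)]"
      using reduces_context[OF w'(2), of "[]" "[(j, t)]"] by simp
    also have "\<dots> \<rightarrow>\<^sub>R (w' @ [(j, t)]) @ [(i, s)]"
      using commute_snoc[OF E(1), of w'] by simp
    finally have red: "w @ [(j, t)] \<rightarrow>\<^sub>R (w' @ [(j, t)]) @ [(i, s)]" .
    have "raag_step E (w' @ [(i, s), (j, t)] @ []) (w' @ [(j, t), (i, s)] @ [])"
      "raag_step E (w' @ [(j, t), (i, s)] @ []) (w' @ [(i, s), (j, t)] @ [])"
      using E(1) E_sym by (blast intro: raag_step.commute)+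
    then have "levels (w' @ [(i, s), (j, t)]) = levels (w' @ [(j, t), (i, s)])"
      using levels_step by (metis append_Nil2 order_antisym)
    moreover have "levels (w @ [(j, t)]) = levels (w' @ [(i, s), (j, t)])"
      using w'(3) by (simp add: levels_append)
    ultimately have "levels (w @ [(j, t)]) = levels ((w' @ [(j, t)]) @ [(i, s)])" by simp
    moreover have "reduced (w' @ [(j, t)])"
      using w'(1) t' by (rule reduced.snoc)
    moreover have "top (pile (w' @ [(j, t)])) i \<noteq> Some (\<not> s)"
      unfolding pile_reduced_snoc[OF t'] using w'(5) E_not_noncomm[OF E(1)] by (simp add: top_push)
    ultimately show ?thesis using red w'(4) by (intro exI[of _ "w' @ [(j, t)]"]) auto
  qed
qed

lemma reduces_to_reduced: "\<exists>w'. reduced w' \<and> w \<rightarrow>\<^sub>R w'"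
proof (induction w rule: rev_induct)
  case Nil
  then show ?case using reduced.Nil by blast
next
  case (snoc x w)
  obtain i s where x: "x = (i, s)" by force
  obtain w' where w': "reduced w'" "w \<rightarrow>\<^sub>R w'" using snoc by blast
  then have red: "w @ [x] \<rightarrow>\<^sub>R w' @ [x]" using reduces_context[of w w' "[]"] by simp
  show ?case
  proof (cases "top (pile w') i = Some (\<not> s)")
    case True
    then obtain w'' where w'': "reduced w''" "w' \<rightarrow>\<^sub>R w'' @ [(i, \<not> s)]"
      using reduced_top[OF w'(1)] by blast
    have "w' @ [x] \<rightarrow>\<^sub>R w'' @ [(i, \<not> s), (i, \<not> \<not> s)]"
      using reduces_context[OF w''(2), of "[]" "[x]"] x by simp
    also have "\<dots> \<rightarrow>\<^sub>R w''"
      using raag_step.cancel[of E w'' i "\<not> s" "[]"] by auto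
    finally show ?thesis using red w''(1) by (meson rtranclp_trans)
  next
    case False
    then show ?thesis using red reduced.snoc[OF w'(1), of i s] x by blast
  qed
qed

text \<open>
  By induction, bringing the last letter of \<open>u\<close> to the end of \<open>w\<close> as
  well. The proof keeps track of the levels because these, too, are determined by the piling of a
  reduced word.
\<close>
lemma reduced_pile_eq:
  assumes "reduced u" "reduced w" "pile u = pile w"
  shows "(\<exists>m. u \<rightarrow>\<^sub>R m \<and> w \<rightarrow>\<^sub>R m) \<and> levels u = levels w"
  using assms
proof (induction arbitrary: w rule: reduced.induct)
  case Nil
  from \<open>reduced w\<close> have "w = []"
  proof cases
    case (snoc w' i s)
    then show ?thesis using Nil.prems(2) pile_reduced_snoc[of w' i s]
      by (auto simp: push_def fun_eq_iff split: if_splits)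
  qed
  then show ?case by auto
next
  case (snoc u i s)
  note pu = pile_reduced_snoc[OF snoc.hyps(2)]
  then have "top (pile w) i = Some s" using snoc.prems(2)[symmetric] by (simp add: top_push)
  then obtain w' where w': "reduced w'" "w \<rightarrow>\<^sub>R w' @ [(i, s)]" "levels w = levels (w' @ [(i, s)])"
    "top (pile w') i \<noteq> Some (\<not> s)"
    using reduced_top snoc.prems by blast
  have "pile w = push (i, s) (pile w')"
    using pile_equiv[OF reduces_imp_equiv[OF w'(2)]] pile_reduced_snoc[OF w'(4)] by simp
  then have "pile u = pile w'" using snoc.prems(2) pu by (metis pop_push)
  then obtain m where m: "u \<rightarrow>\<^sub>R m" "w' \<rightarrow>\<^sub>R m" "levels u = levels w'"
    using snoc.IH[OF w'(1)] by blast
  then have "u @ [(i, s)] \<rightarrow>\<^sub>R m @ [(i, s)]" "w' @ [(i, s)] \<rightarrow>\<^sub>R m @ [(i, s)]"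
    using reduces_context[of _ m "[]" "[(i, s)]"] by simp_all
  then show ?case using w' m by (auto intro: rtranclp_trans)
qed

text \<open>
  Both words reduce to reduced words, and these have the same piling. In contrast to equality in
  the group, a common reduct can be followed inside a subcomplex, where inserting a cancelling
  pair may be impossible.
\<close>
theorem confluence:
  assumes "u \<sim>\<^sub>R w" shows "\<exists>m. u \<rightarrow>\<^sub>R m \<and> w \<rightarrow>\<^sub>R m"
proof -
  obtain u' w' where r: "reduced u'" "u \<rightarrow>\<^sub>R u'" "reduced w'" "w \<rightarrow>\<^sub>R w'"
    using reduces_to_reduced by meson
  then have "u' \<sim>\<^sub>R w'"
    using assms by (meson equivclp_sym equivclp_trans reduces_imp_equiv)
  then show ?thesis using reduced_pile_eq[OF r(1) r(3) pile_equiv] r by (meson rtranclp_trans)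
qed

text \<open>
  Reduced words minimise all levels at once, since the levels only drop under reduction.
\<close>
lemma levels_reduced_le:
  assumes "u \<sim>\<^sub>R w" "reduced w" shows "levels w \<le> levels u"
proof -
  obtain u' where r: "reduced u'" "u \<rightarrow>\<^sub>R u'" using reduces_to_reduced by meson
  then have "u' \<sim>\<^sub>R w"
    using assms by (meson equivclp_sym equivclp_trans reduces_imp_equiv)
  then show ?thesis using reduced_pile_eq[OF r(1) assms(2) pile_equiv] levels_reduces[OF r(2)] by simp
qed

lemma length_step: "raag_step E u v \<Longrightarrow> length v \<le> length u"
  by (induction rule: raag_step.induct) auto

lemma length_reduces: "u \<rightarrow>\<^sub>R v \<Longrightarrow> length v \<le> length u"
  by (induction rule: rtranclp_induct) (auto dest: length_step)

subsection \<open>The norm\<close>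

text \<open>
  The number of layers of the heap. The letters of one layer commute, so this is the number of
  clique words into which \<open>w\<close> falls.
\<close>
definition height :: "'e word \<Rightarrow> nat" where
  "height w = Max (range (levels w))"

lemma height_le_iff: "height w \<le> n \<longleftrightarrow> (\<forall>i. levels w i \<le> n)"
  by (auto simp: height_def)

lemma levels_le_height: "levels w i \<le> height w"
  using height_le_iff by blast

lemma height_mono: "levels u \<le> levels w \<Longrightarrow> height u \<le> height w"
  by (auto simp: height_le_iff le_fun_def intro: order_trans levels_le_height)

definition clique_norm :: "'e word set \<Rightarrow> nat" where
  "clique_norm g = (LEAST n. \<exists>w\<in>g. height w \<le> n)"

lemma clique_norm_le_iff:
  assumes "g \<in> carrier (raag E)"
  shows "clique_norm g \<le> n \<longleftrightarrow> (\<exists>w. g = word_class E w \<and> height w \<le> n)"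
proof
  obtain w0 where "g = word_class E w0" using assms by (rule raag_carrierE)
  then have "\<exists>n. \<exists>w\<in>g. height w \<le> n" using word_class_self by blast
  then have "\<exists>w\<in>g. height w \<le> clique_norm g"
    unfolding clique_norm_def by (rule LeastI_ex)
  then show "clique_norm g \<le> n \<Longrightarrow> \<exists>w. g = word_class E w \<and> height w \<le> n"
    using word_class_memD[OF assms] by (metis order_trans)
next
  assume "\<exists>w. g = word_class E w \<and> height w \<le> n"
  then have "\<exists>w\<in>g. height w \<le> n" by auto
  then show "clique_norm g \<le> n" unfolding clique_norm_def by (rule Least_le)
qed

lemma clique_norm_reduced:
  assumes "reduced w" shows "clique_norm (word_class E w) = height w"
proof (rule antisym)
  show "clique_norm (word_class E w) \<le> height w"
    by (auto simp: clique_norm_le_iff)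
  obtain u where "word_class E w = word_class E u" "height u \<le> clique_norm (word_class E w)"
    using clique_norm_le_iff[of "word_class E w" "clique_norm (word_class E w)"] by auto
  moreover from this have "levels w \<le> levels u"
    using levels_reduced_le[OF _ assms] by (auto simp: word_class_eq_iff equivclp_sym)
  ultimately show "height w \<le> clique_norm (word_class E w)"
    using height_mono order_trans by blast
qed

definition clique_word :: "'e word \<Rightarrow> bool" where
  "clique_word K \<longleftrightarrow> distinct (map fst K) \<and> (\<forall>x\<in>set K. \<forall>y\<in>set K. fst x \<noteq> fst y \<longrightarrow> E (fst x) (fst y))"

lemma clique_word_Nil [simp]: "clique_word []"
  by (simp add: clique_word_def)

lemma clique_word_single [simp]: "clique_word [x]"
  by (simp add: clique_word_def)

lemma clique_word_snoc:
  "clique_word (K @ [x]) \<longleftrightarrow> clique_word K \<and> (\<forall>y\<in>set K. E (fst y) (fst x))"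
  by (auto simp: clique_word_def dest: E_sym)

lemma levels_clique_word:
  assumes "clique_word K"
  shows "levels (w @ K) = (\<lambda>i. if i \<in> fst ` set K then level_of (levels w) i else levels w i)"
  using assms
proof (induction K rule: rev_induct)
  case (snoc x K)
  then have K: "clique_word K" "\<And>y. y \<in> set K \<Longrightarrow> E (fst y) (fst x)"
    by (auto simp: clique_word_snoc)
  then have "fst x \<notin> fst ` set K" by (metis E_irrefl imageE)
  then have "level_of (levels (w @ K)) (fst x) = level_of (levels w) (fst x)"
    unfolding snoc.IH[OF K(1)] using K(2)
    by (intro level_of_cong) (metis E_not_noncomm imageE)
  then show ?case
    unfolding append_assoc[symmetric] levels_snoc using snoc.IH[OF K(1)]
      \<open>level_of (levels (w @ K)) (fst x) = level_of (levels w) (fst x)\<close>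
    by (simp add: fun_eq_iff)
qed simp

lemma clique_norm_mult_clique:
  assumes "g \<in> carrier (raag E)" "clique_word K"
  shows "clique_norm (g \<cdot> word_class E K) \<le> Suc (clique_norm g)"
proof -
  obtain w where w: "g = word_class E w" "height w \<le> clique_norm g"
    using clique_norm_le_iff[OF assms(1)] by blast
  have "height (w @ K) \<le> Suc (clique_norm g)"
    using w(2) levels_le_height[of w]
    by (auto simp: height_le_iff levels_clique_word[OF assms(2)] level_of_le_iff le_SucI)
  then show ?thesis using w(1) by (auto simp: clique_norm_le_iff)
qed

lemma clique_norm_mult_word:
  assumes "g \<in> carrier (raag E)"
  shows "clique_norm (g \<cdot> word_class E w) \<le> clique_norm g + length w"
proof (induction w rule: rev_induct)
  case Nil
  then show ?case using assms by (simp add: raag_one[symmetric])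
next
  case (snoc x w)
  have "g \<cdot> word_class E (w @ [x]) = (g \<cdot> word_class E w) \<cdot> word_class E [x]"
    using assms by (simp add: RG.m_assoc)
  then show ?case
    using clique_norm_mult_clique[of "g \<cdot> word_class E w" "[x]"] snoc assms by simp
qed

lemma move_past:
  assumes "\<And>y. y \<in> set K \<Longrightarrow> E (fst y) (fst x)"
  shows "w @ K @ [x] \<sim>\<^sub>R w @ [x] @ K \<and> levels (w @ K @ [x]) = levels (w @ [x] @ K)"
  using assms
proof (induction K rule: rev_induct)
  case (snoc y K)
  have "E (fst y) (fst x)" using snoc.prems by simp
  then have step: "raag_step E ((w @ K) @ [y, x] @ []) ((w @ K) @ [x, y] @ [])"
    "raag_step E ((w @ K) @ [x, y] @ []) ((w @ K) @ [y, x] @ [])"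
    using raag_step.commute[of E "fst y" "fst x" "w @ K" "snd y" "snd x" "[]"]
      raag_step.commute[of E "fst x" "fst y" "w @ K" "snd x" "snd y" "[]"] E_sym by auto
  have IH: "w @ K @ [x] \<sim>\<^sub>R w @ [x] @ K" "levels (w @ K @ [x]) = levels (w @ [x] @ K)"
    using snoc by auto
  have "w @ (K @ [y]) @ [x] \<sim>\<^sub>R w @ K @ [x, y]"
    using r_into_equivclp[of "raag_step E", OF step(1)] by simp
  moreover have "w @ K @ [x, y] \<sim>\<^sub>R w @ [x] @ K @ [y]"
    using equiv_append[OF IH(1), of "[y]" "[y]"] by simp
  ultimately have "w @ (K @ [y]) @ [x] \<sim>\<^sub>R w @ [x] @ K @ [y]"
    by (rule equivclp_trans)
  moreover have "levels (w @ K @ [y, x]) = levels (w @ K @ [x, y])"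
    using levels_step[OF step(1)] levels_step[OF step(2)] by (simp add: order_antisym)
  moreover have "levels (w @ K @ [x, y]) = levels (w @ [x] @ K @ [y])"
    using levels_append[of "w @ K @ [x]" "[y]"] levels_append[of "w @ [x] @ K" "[y]"] IH(2) by simp
  ultimately show ?case by simp
qed simp

text \<open>
  The letters of the top layer of the heap can be moved to the end of the word, where they form a
  clique word. In the induction a new letter either joins the top layer, and then commutes with
  it, or comes to rest below, and then it passes under the whole of it.
\<close>
lemma peel_top_level:
  "height w \<le> Suc n \<Longrightarrow>
     \<exists>w' K. w \<sim>\<^sub>R w' @ K \<and> levels w = levels (w' @ K) \<and> height w' \<le> n \<and> clique_word K \<and>
            (\<forall>y\<in>set K. levels w (fst y) = Suc n)"
proof (induction w rule: rev_induct)
  case Nil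
  have "height [] \<le> n" by (simp add: height_le_iff)
  then show ?case by (intro exI[of _ "[]"]) simp
next
  case (snoc x w)
  have hw: "height w \<le> Suc n"
    using snoc.prems height_mono[OF levels_extend[of w "[x]"]] by simp
  then obtain w' K where w': "w \<sim>\<^sub>R w' @ K" "levels w = levels (w' @ K)" "height w' \<le> n"
      "clique_word K" "\<And>y. y \<in> set K \<Longrightarrow> levels w (fst y) = Suc n"
    using snoc.IH by blast
  have wx: "w @ [x] \<sim>\<^sub>R w' @ K @ [x]" "levels (w @ [x]) = levels (w' @ K @ [x])"
    using equiv_append[OF w'(1), of "[x]" "[x]"] w'(2) levels_append[of "w' @ K" "[x]"]
      levels_append[of w "[x]"] by simp_all
  have lx: "level_of (levels w) (fst x) \<le> Suc n"
    using snoc.prems by (auto simp: height_le_iff split: if_splits)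
  have comm: "E (fst y) (fst x)" if "y \<in> set K" for y
    using level_of_gt[of "fst y" "fst x" "levels w"] w'(5)[OF that] lx by (force simp: noncomm_def dest: E_sym)
  then have ne: "fst y \<noteq> fst x" if "y \<in> set K" for y
    using that by (metis E_irrefl)
  show ?case
  proof (cases "level_of (levels w) (fst x) = Suc n")
    case True
    then have "clique_word (K @ [x])" "\<forall>y\<in>set (K @ [x]). levels (w @ [x]) (fst y) = Suc n"
      using comm w'(4,5) ne by (auto simp: clique_word_snoc)
    then show ?thesis using wx w'(3) by blast
  next
    case False
    have "level_of (levels w') (fst x) = level_of (levels w) (fst x)"
      unfolding w'(2) levels_clique_word[OF w'(4)] using comm ne
      by (intro level_of_cong) (auto simp: noncomm_def dest: E_sym)
    then have "height (w' @ [x]) \<le> n"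
      using w'(3) lx False by (auto simp: height_le_iff)
    moreover have "w @ [x] \<sim>\<^sub>R (w' @ [x]) @ K" "levels (w @ [x]) = levels ((w' @ [x]) @ K)"
      using wx move_past[of K x w'] comm by (auto intro: equivclp_trans)
    moreover have "\<forall>y\<in>set K. levels (w @ [x]) (fst y) = Suc n"
      using w'(5) ne by auto
    ultimately show ?thesis using w'(4) by blast
  qed
qed

lemma clique_norm_Suc_decompose:
  assumes "g \<in> carrier (raag E)" "clique_norm g \<le> Suc n"
  obtains h K where "h \<in> carrier (raag E)" "clique_norm h \<le> n" "clique_word K"
    "g = h \<cdot> word_class E K"
proof -
  obtain w where w: "g = word_class E w" "height w \<le> Suc n"
    using assms by (auto simp: clique_norm_le_iff)
  from peel_top_level[OF w(2)] obtain w' K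
    where "w \<sim>\<^sub>R w' @ K" "height w' \<le> n" "clique_word K" by blast
  then show thesis
    using that[of "word_class E w'" K] w(1) clique_norm_le_iff[of "word_class E w'" n]
    by (auto simp: word_class_eq_iff)
qed

lemma levels_eq_0: "(\<forall>i. levels w i = 0) \<longleftrightarrow> w = []"
proof (cases w rule: rev_cases)
  case (snoc v x)
  have "levels w (fst x) \<noteq> 0" unfolding snoc by (simp add: level_of_def)
  then show ?thesis using snoc by auto
qed simp

lemma clique_norm_0_iff:
  assumes "g \<in> carrier (raag E)"
  shows "clique_norm g = 0 \<longleftrightarrow> g = \<one>\<^bsub>raag E\<^esub>"
proof -
  have "height w \<le> 0 \<longleftrightarrow> w = []" for w
    using levels_eq_0[of w] height_le_iff[of w 0] by simp
  then show ?thesis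
    using clique_norm_le_iff[OF assms, of 0] by (simp add: raag_one)
qed

text \<open>
  A letter at a level that is maximal among the generators not commuting with it has nothing
  resting on it, so its bead is still on top of its stack.
\<close>
lemma top_of_maximal_level:
  assumes "reduced w" "\<And>k. noncomm i k \<Longrightarrow> levels w k \<le> levels w i" "levels w i > 0"
  shows "\<exists>s. top (pile w) i = Some s"
  using assms
proof (induction rule: reduced.induct)
  case (snoc w j t)
  note pw = pile_reduced_snoc[OF snoc.hyps(2)]
  consider "j = i" | "noncomm i j" | "E i j" unfolding noncomm_def by blast
  then show ?case
  proof cases
    case 2
    then have "levels w i < level_of (levels w) j" using noncomm_sym by (intro level_of_gt) auto
    then show ?thesis using snoc.prems(1)[of j] 2 by (auto simp: noncomm_def)
  next
    case 3
    have "levels w k \<le> levels w i" if "noncomm i k" for k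
      using snoc.prems(1)[OF that] E_not_noncomm[OF 3] that by (auto split: if_splits)
    then show ?thesis using snoc E_not_noncomm[OF 3] pw by (simp add: top_push)
  next
    case 1
    then have "top (pile (w @ [(j, t)])) i = Some t" unfolding pw by (simp add: top_push)
    then show ?thesis by blast
  qed
qed simp

text \<open>
  There are no dead ends. In a reduced word take a letter of the top layer; its bead is on top of
  its stack, so repeating the letter causes no cancellation, and the repeated letter starts a new
  layer.
\<close>
lemma clique_norm_extend:
  assumes "g \<in> carrier (raag E)"
  shows "\<exists>x. clique_norm (g \<cdot> word_class E [x]) = Suc (clique_norm g)"
proof -
  obtain w where w: "reduced w" "g = word_class E w"
    using assms reduces_to_reduced by (metis raag_carrierE reduces_imp_equiv word_class_eq_iff)
  have "\<exists>i s. levels w i = height w \<and> top (pile w) i \<noteq> Some (\<not> s)"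
  proof (cases "w = []")
    case True
    then show ?thesis by (auto simp: height_def top_def)
  next
    case False
    have "height w \<in> range (levels w)" unfolding height_def by (rule Max_in) auto
    then obtain i where i: "levels w i = height w" by auto
    moreover have "height w > 0"
      using False levels_eq_0[of w] height_le_iff[of w 0] by (cases "height w") auto
    ultimately obtain s where "top (pile w) i = Some s"
      using top_of_maximal_level[OF w(1), of i] levels_le_height by auto
    then show ?thesis using i by auto
  qed
  then obtain i s where i: "levels w i = height w" "top (pile w) i \<noteq> Some (\<not> s)" by blast
  then have "reduced (w @ [(i, s)])" using w(1) by (intro reduced.snoc)
  moreover have "height (w @ [(i, s)]) = Suc (height w)"
  proof (rule antisym)
    show "height (w @ [(i, s)]) \<le> Suc (height w)"
      using levels_le_height[of w] by (auto simp: height_le_iff level_of_le_iff le_SucI)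
    show "Suc (height w) \<le> height (w @ [(i, s)])"
      using levels_le_height[of "w @ [(i, s)]" i] level_of_gt[of i i "levels w"] i(1) by simp
  qed
  ultimately have "clique_norm (g \<cdot> word_class E [(i, s)]) = Suc (clique_norm g)"
    using w by (simp add: clique_norm_reduced)
  then show ?thesis by blast
qed

lemma clique_word_length: "clique_word K \<Longrightarrow> length K \<le> CARD('e)"
  by (metis clique_word_def card_mono distinct_card finite length_map subset_UNIV)

text \<open>
  A layer has at most as many letters as there are generators.
\<close>
lemma short_representative:
  assumes "g \<in> carrier (raag E)"
  shows "\<exists>w. g = word_class E w \<and> length w \<le> CARD('e) * clique_norm g"
proof -
  have "clique_norm g \<le> n \<Longrightarrow> \<exists>w. g = word_class E w \<and> length w \<le> CARD('e) * n" for n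
    using assms
  proof (induction n arbitrary: g)
    case 0
    then show ?case by (auto simp: clique_norm_0_iff raag_one)
  next
    case (Suc n)
    then obtain h K where h: "h \<in> carrier (raag E)" "clique_norm h \<le> n" "clique_word K"
      "g = h \<cdot> word_class E K"
      using clique_norm_Suc_decompose by metis
    then obtain w where "h = word_class E w" "length w \<le> CARD('e) * n"
      using Suc.IH by blast
    then show ?case
      using h clique_word_length[OF h(3)] by (intro exI[of _ "w @ K"]) simp
  qed
  then show ?thesis by blast
qed

lemma finite_clique_ball: "finite {g \<in> carrier (raag E). clique_norm g \<le> n}"
proof (rule finite_subset)
  show "finite (word_class E ` {w. set w \<subseteq> UNIV \<and> length w \<le> CARD('e) * n})"
    by (intro finite_imageI finite_lists_length_le) simp
  show "{g \<in> carrier (raag E). clique_norm g \<le> n} \<subseteq>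
      word_class E ` {w. set w \<subseteq> UNIV \<and> length w \<le> CARD('e) * n}"
  proof
    fix g assume g: "g \<in> {g \<in> carrier (raag E). clique_norm g \<le> n}"
    then obtain w where w: "g = word_class E w" "length w \<le> CARD('e) * clique_norm g"
      using short_representative by blast
    have "CARD('e) * clique_norm g \<le> CARD('e) * n" using g by simp
    then have "length w \<le> CARD('e) * n" using w(2) by (rule order_trans[rotated])
    then show "g \<in> word_class E ` {w. set w \<subseteq> UNIV \<and> length w \<le> CARD('e) * n}"
      using w(1) by auto
  qed
qed

end

section \<open>Holonomy of local cocycles\<close>

text \<open>
  A \<open>G\<close>-valued cocycle defined for pairs of nearby points is the combinatorial form of a flat
  connection.  It has a parallel transport along paths, whose result depends only on the homotopy
  class.  This detects group elements in a fundamental group without constructing a covering space.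
\<close>
definition local_cocycle ::
    "('g, 'm) monoid_scheme \<Rightarrow> 'x::metric_space set \<Rightarrow> real \<Rightarrow> ('x \<Rightarrow> 'x \<Rightarrow> 'g) \<Rightarrow> bool" where
  "local_cocycle G X \<delta> \<tau> \<longleftrightarrow>
     (\<forall>x y. \<tau> x y \<in> carrier G) \<and>
     (\<forall>x\<in>X. \<forall>y\<in>X. \<forall>z\<in>X. dist x y < \<delta> \<longrightarrow> dist y z < \<delta> \<longrightarrow> dist x z < \<delta> \<longrightarrow>
        \<tau> x y \<otimes>\<^bsub>G\<^esub> \<tau> y z = \<tau> x z)"

text \<open>
  \<open>L\<close> is a parallel section along the path \<open>p\<close>.
\<close>
definition holonomy_along ::
    "('g, 'm) monoid_scheme \<Rightarrow> 'x::metric_space set \<Rightarrow> real \<Rightarrow> ('x \<Rightarrow> 'x \<Rightarrow> 'g) \<Rightarrow> (real \<Rightarrow> 'x) \<Rightarrow>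
      (real \<Rightarrow> 'g) \<Rightarrow> bool" where
  "holonomy_along G X \<delta> \<tau> p L \<longleftrightarrow>
     path p \<and> (\<forall>t\<in>{0..1}. p t \<in> X \<and> L t \<in> carrier G) \<and>
     (\<exists>\<epsilon>>0. \<forall>s\<in>{0..1}. \<forall>t\<in>{0..1}. \<bar>s - t\<bar> < \<epsilon> \<longrightarrow> L t = L s \<otimes>\<^bsub>G\<^esub> \<tau> (p s) (p t))"

lemma local_cocycle_refl:
  assumes "group G" "local_cocycle G X \<delta> \<tau>" "\<delta> > 0" "x \<in> X"
  shows "\<tau> x x = \<one>\<^bsub>G\<^esub>"
proof -
  interpret group G by fact
  have "\<tau> x x \<otimes>\<^bsub>G\<^esub> \<tau> x x = \<tau> x x" "\<tau> x x \<in> carrier G"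
    using assms by (auto simp: local_cocycle_def)
  then show ?thesis using l_cancel_one by blast
qed

text \<open>
  Cut the square of the homotopy into a grid so fine that the cocycle identity holds on every
  cell. The products of the cocycle along two consecutive rows then agree, since the vertical
  transitions cancel and are trivial at the fixed ends.
\<close>
theorem holonomy_homotopy_invariant:
  assumes "group G" and coc: "local_cocycle G X \<delta> \<tau>" and "\<delta> > 0"
    and hom: "homotopic_paths X p q"
    and p: "holonomy_along G X \<delta> \<tau> p L" and q: "holonomy_along G X \<delta> \<tau> q M"
    and start: "L 0 = M 0"
  shows "L 1 = M 1"
proof -
  interpret group G by fact
  have tau [simp]: "\<tau> x y \<in> carrier G" for x y
    using coc by (auto simp: local_cocycle_def)
  have tau_trans: "\<tau> x y \<otimes>\<^bsub>G\<^esub> \<tau> y z = \<tau> x z"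
    if "x \<in> X" "y \<in> X" "z \<in> X" "dist x y < \<delta>" "dist y z < \<delta>" "dist x z < \<delta>" for x y z
    using coc that by (auto simp: local_cocycle_def)
  obtain h where h: "continuous_on ({0..1} \<times> {0..1}) h" "h \<in> ({0..1} \<times> {0..1}) \<rightarrow> X"
      "\<And>x. x \<in> {0..1} \<Longrightarrow> h (0, x) = p x" "\<And>x. x \<in> {0..1} \<Longrightarrow> h (1, x) = q x"
      and ends: "\<And>t. t \<in> {0..1::real} \<Longrightarrow> h (t, 0) = p 0 \<and> h (t, 1) = p 1"
    using hom unfolding homotopic_paths by (auto simp: pathstart_def pathfinish_def)
  have "uniformly_continuous_on ({0..1} \<times> {0..1}) h"
    by (intro compact_uniformly_continuous h compact_Times) auto
  then obtain \<eta> where \<eta>: "\<eta> > 0" "\<And>u v. u \<in> {0..1} \<times> {0..1} \<Longrightarrow> v \<in> {0..1} \<times> {0..1} \<Longrightarrow>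
      dist u v < \<eta> \<Longrightarrow> dist (h u) (h v) < \<delta>"
    using \<open>\<delta> > 0\<close> unfolding uniformly_continuous_on_def by metis
  obtain \<epsilon>1 where \<epsilon>1: "\<epsilon>1 > 0" "\<And>s t. s \<in> {0..1} \<Longrightarrow> t \<in> {0..1} \<Longrightarrow> \<bar>s - t\<bar> < \<epsilon>1 \<Longrightarrow>
      L t = L s \<otimes>\<^bsub>G\<^esub> \<tau> (p s) (p t)"
    using p unfolding holonomy_along_def by metis
  obtain \<epsilon>2 where \<epsilon>2: "\<epsilon>2 > 0" "\<And>s t. s \<in> {0..1} \<Longrightarrow> t \<in> {0..1} \<Longrightarrow> \<bar>s - t\<bar> < \<epsilon>2 \<Longrightarrow>
      M t = M s \<otimes>\<^bsub>G\<^esub> \<tau> (q s) (q t)"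
    using q unfolding holonomy_along_def by metis
  have LM [simp]: "t \<in> {0..1} \<Longrightarrow> L t \<in> carrier G" "t \<in> {0..1} \<Longrightarrow> M t \<in> carrier G" for t
    using p q by (auto simp: holonomy_along_def)
  have "Min {\<epsilon>1, \<epsilon>2, \<eta> / 2} > 0" using \<epsilon>1 \<epsilon>2 \<eta> by auto
  then obtain n where n: "inverse (real (Suc n)) < Min {\<epsilon>1, \<epsilon>2, \<eta> / 2}"
    using reals_Archimedean by blast
  define N where "N = Suc n"
  have N: "N > 0" "1 / real N < \<epsilon>1" "1 / real N < \<epsilon>2" "1 / real N < \<eta> / 2"
    using n by (auto simp: N_def inverse_eq_divide)
  define x where "x j k = h (real j / N, real k / N)" for j k :: nat
  have unit: "real j / N \<in> {0..1}" if "j \<le> N" for j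
    using that N(1) by (auto simp: field_simps)
  have xX: "x j k \<in> X" if "j \<le> N" "k \<le> N" for j k
    using h(2) unit[OF that(1)] unit[OF that(2)] unfolding x_def by auto
  have close: "dist (x j k) (x j' k') < \<delta>"
    if "j \<le> N" "k \<le> N" "j' \<le> N" "k' \<le> N" "\<bar>real j - real j'\<bar> \<le> 1" "\<bar>real k - real k'\<bar> \<le> 1"
    for j k j' k'
  proof -
    have "dist (real j / N, real k / N) (real j' / N, real k' / N) \<le>
        dist (real j / N) (real j' / N) + dist (real k / N) (real k' / N)"
      unfolding dist_prod_def by (simp add: sqrt_sum_squares_le_sum)
    also have "\<dots> \<le> 1 / N + 1 / N"
      using that(5,6) unfolding dist_real_def diff_divide_distrib[symmetric] abs_divide
      by (intro add_mono) (simp_all add: divide_right_mono)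
    also have "\<dots> < \<eta>" using N(4) by simp
    finally show ?thesis
      unfolding x_def using unit that by (intro \<eta>(2)) auto
  qed
  \<comment> \<open>The product of the transitions along the first \<open>k\<close> edges of row \<open>j\<close> of the grid.\<close>
  define P where "P j k = rec_nat \<one>\<^bsub>G\<^esub> (\<lambda>k g. g \<otimes>\<^bsub>G\<^esub> \<tau> (x j k) (x j (Suc k))) k" for j k
  have P0 [simp]: "P j 0 = \<one>\<^bsub>G\<^esub>" and PS: "P j (Suc k) = P j k \<otimes>\<^bsub>G\<^esub> \<tau> (x j k) (x j (Suc k))" for j k
    by (simp_all add: P_def)
  have P [simp]: "P j k \<in> carrier G" for j k
    by (induction k) (auto simp: PS)
  have close1: "\<bar>real k / N - real (Suc k) / N\<bar> = 1 / N" for k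
    by (simp add: diff_divide_distrib[symmetric] abs_divide)
  have A: "L (real k / N) = L 0 \<otimes>\<^bsub>G\<^esub> P 0 k" if "k \<le> N" for k
    using that
  proof (induction k)
    case (Suc k)
    have "L (real (Suc k) / N) = L (real k / N) \<otimes>\<^bsub>G\<^esub> \<tau> (p (real k / N)) (p (real (Suc k) / N))"
      using Suc.prems unit N close1[of k] by (intro \<epsilon>1(2)) auto
    moreover have "p (real k / N) = x 0 k" "p (real (Suc k) / N) = x 0 (Suc k)"
      using h(3) unit Suc.prems by (simp_all add: x_def del: of_nat_Suc)
    ultimately show ?case using Suc by (simp add: PS m_assoc del: of_nat_Suc)
  qed simp
  have B: "M (real k / N) = M 0 \<otimes>\<^bsub>G\<^esub> P N k" if "k \<le> N" for k
    using that
  proof (induction k)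
    case (Suc k)
    have "M (real (Suc k) / N) = M (real k / N) \<otimes>\<^bsub>G\<^esub> \<tau> (q (real k / N)) (q (real (Suc k) / N))"
      using Suc.prems unit N close1[of k] by (intro \<epsilon>2(2)) auto
    moreover have "q (real k / N) = x N k" "q (real (Suc k) / N) = x N (Suc k)"
      using h(4) unit Suc.prems N(1) by (simp_all add: x_def del: of_nat_Suc)
    ultimately show ?case using Suc by (simp add: PS m_assoc del: of_nat_Suc)
  qed simp
  have x0: "x j 0 = p 0" "x j N = p 1" if "j \<le> N" for j
    using ends[OF unit[OF that]] N(1) by (simp_all add: x_def)
  have refl: "\<tau> z z = \<one>\<^bsub>G\<^esub>" if "z \<in> X" for z
    using local_cocycle_refl[OF \<open>group G\<close> coc \<open>\<delta> > 0\<close> that] .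
  \<comment> \<open>The vertical edge at \<open>k\<close> carries the product along row \<open>j\<close> to that along row \<open>j + 1\<close>.\<close>
  have C: "P j k \<otimes>\<^bsub>G\<^esub> \<tau> (x j k) (x (Suc j) k) = P (Suc j) k" if "j < N" "k \<le> N" for j k
    using that(2)
  proof (induction k)
    case 0
    then show ?case using x0[of j] x0[of "Suc j"] xX[of j 0] that(1) by (simp add: refl)
  next
    case (Suc k)
    have "P j (Suc k) \<otimes>\<^bsub>G\<^esub> \<tau> (x j (Suc k)) (x (Suc j) (Suc k)) = P j k \<otimes>\<^bsub>G\<^esub> \<tau> (x j k) (x (Suc j) (Suc k))"
      using Suc.prems that(1) by (simp add: PS m_assoc tau_trans xX close)
    also have "\<dots> = P j k \<otimes>\<^bsub>G\<^esub> (\<tau> (x j k) (x (Suc j) k) \<otimes>\<^bsub>G\<^esub> \<tau> (x (Suc j) k) (x (Suc j) (Suc k)))"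
      using Suc.prems that(1) by (simp add: tau_trans xX close)
    also have "\<dots> = P (Suc j) (Suc k)"
      using Suc by (simp add: PS m_assoc[symmetric])
    finally show ?case .
  qed
  have D: "P j N = P 0 N" if "j \<le> N" for j
    using that
  proof (induction j)
    case (Suc j)
    then have "P (Suc j) N = P j N \<otimes>\<^bsub>G\<^esub> \<tau> (p 1) (p 1)" using C[of j N] x0[of j] x0[of "Suc j"] by simp
    moreover have "p 1 \<in> X" using p by (simp add: holonomy_along_def)
    ultimately show ?case using Suc by (simp add: refl)
  qed simp
  show ?thesis using A[of N] B[of N] D[of N] start N(1) by simp
qed

text \<open>
  Near the midpoint a short step from one half to the other is split there; the path being
  uniformly continuous, the three points are within the range of the cocycle identity.
\<close>
lemma holonomy_along_join:
  assumes "group G" and coc: "local_cocycle G X \<delta> \<tau>" and \<delta>: "\<delta> > 0"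
    and p: "holonomy_along G X \<delta> \<tau> p L" and q: "holonomy_along G X \<delta> \<tau> q M"
    and pq: "pathfinish p = pathstart q" "L 1 = M 0"
  shows "holonomy_along G X \<delta> \<tau> (p +++ q) (\<lambda>t. if t \<le> 1 / 2 then L (2 * t) else M (2 * t - 1))"
    (is "holonomy_along _ _ _ _ _ ?K")
proof -
  interpret group G by fact
  have [simp]: "\<tau> x y \<in> carrier G" for x y
    using coc by (auto simp: local_cocycle_def)
  have tau_trans: "\<tau> x y \<otimes>\<^bsub>G\<^esub> \<tau> y z = \<tau> x z"
    if "x \<in> X" "y \<in> X" "z \<in> X" "dist x y < \<delta>" "dist y z < \<delta>" "dist x z < \<delta>" for x y z
    using coc that by (auto simp: local_cocycle_def)
  obtain \<epsilon>1 where \<epsilon>1: "\<epsilon>1 > 0" "\<And>s t. s \<in> {0..1} \<Longrightarrow> t \<in> {0..1} \<Longrightarrow> \<bar>s - t\<bar> < \<epsilon>1 \<Longrightarrow>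
      L t = L s \<otimes>\<^bsub>G\<^esub> \<tau> (p s) (p t)"
    using p unfolding holonomy_along_def by metis
  obtain \<epsilon>2 where \<epsilon>2: "\<epsilon>2 > 0" "\<And>s t. s \<in> {0..1} \<Longrightarrow> t \<in> {0..1} \<Longrightarrow> \<bar>s - t\<bar> < \<epsilon>2 \<Longrightarrow>
      M t = M s \<otimes>\<^bsub>G\<^esub> \<tau> (q s) (q t)"
    using q unfolding holonomy_along_def by metis
  have path: "path (p +++ q)" using p q pq by (simp add: holonomy_along_def)
  then have "uniformly_continuous_on {0..1} (p +++ q)"
    unfolding path_def by (intro compact_uniformly_continuous) auto
  then obtain \<eta> where \<eta>: "\<eta> > 0" "\<And>u v. u \<in> {0..1} \<Longrightarrow> v \<in> {0..1} \<Longrightarrow> \<bar>u - v\<bar> < \<eta> \<Longrightarrow>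
      dist ((p +++ q) u) ((p +++ q) v) < \<delta>"
    using \<delta> unfolding uniformly_continuous_on_def dist_real_def
    by (metis abs_minus_commute)
  have X: "t \<in> {0..1} \<Longrightarrow> p t \<in> X" "t \<in> {0..1} \<Longrightarrow> q t \<in> X"
    "t \<in> {0..1} \<Longrightarrow> L t \<in> carrier G" "t \<in> {0..1} \<Longrightarrow> M t \<in> carrier G" for t
    using p q by (auto simp: holonomy_along_def)
  have pq': "p 1 = q 0" using pq by (simp add: pathstart_def pathfinish_def)
  define \<epsilon> where "\<epsilon> = min (min \<epsilon>1 \<epsilon>2 / 2) \<eta>"
  have \<epsilon>: "\<epsilon> > 0" "2 * \<epsilon> \<le> \<epsilon>1" "2 * \<epsilon> \<le> \<epsilon>2" "\<epsilon> \<le> \<eta>"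
    using \<epsilon>1(1) \<epsilon>2(1) \<eta>(1) by (auto simp: \<epsilon>_def min_def)
  have X': "(p +++ q) t \<in> X" "?K t \<in> carrier G" if "t \<in> {0..1}" for t
    using X that by (auto simp: joinpaths_def)
  have first: "?K t = ?K s \<otimes>\<^bsub>G\<^esub> \<tau> ((p +++ q) s) ((p +++ q) t)"
    if "s \<in> {0..1/2}" "t \<in> {0..1/2}" "\<bar>s - t\<bar> < \<epsilon>" for s t
    using that \<epsilon>1(2)[of "2 * s" "2 * t"] \<epsilon>(2) by (simp add: joinpaths_def)
  have second: "?K t = ?K s \<otimes>\<^bsub>G\<^esub> \<tau> ((p +++ q) s) ((p +++ q) t)"
    if "s \<in> {1/2..1}" "t \<in> {1/2..1}" "\<bar>s - t\<bar> < \<epsilon>" for s t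
  proof -
    have "?K r = M (2 * r - 1) \<and> (p +++ q) r = q (2 * r - 1)" if "r \<in> {1/2..1}" for r
    proof (cases "r = 1/2")
      case True
      show ?thesis unfolding True using pq' pq(2) by (simp add: joinpaths_def)
    qed (use that in \<open>auto simp: joinpaths_def\<close>)
    then show ?thesis
      using that \<epsilon>2(2)[of "2 * s - 1" "2 * t - 1"] \<epsilon>(3) by simp
  qed
  have main: "?K t = ?K s \<otimes>\<^bsub>G\<^esub> \<tau> ((p +++ q) s) ((p +++ q) t)"
    if st: "s \<in> {0..1}" "t \<in> {0..1}" "\<bar>s - t\<bar> < \<epsilon>" for s t
  proof -
    have via: ?thesis if "?K (1/2) = ?K s \<otimes>\<^bsub>G\<^esub> \<tau> ((p +++ q) s) ((p +++ q) (1/2))"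
      "?K t = ?K (1/2) \<otimes>\<^bsub>G\<^esub> \<tau> ((p +++ q) (1/2)) ((p +++ q) t)" "\<bar>s - 1/2\<bar> < \<epsilon>" "\<bar>1/2 - t\<bar> < \<epsilon>"
    proof -
      have "?K t = ?K s \<otimes>\<^bsub>G\<^esub> (\<tau> ((p +++ q) s) ((p +++ q) (1/2)) \<otimes>\<^bsub>G\<^esub> \<tau> ((p +++ q) (1/2)) ((p +++ q) t))"
        unfolding that(2) unfolding that(1) using X'(2)[OF st(1)] by (simp add: m_assoc)
      moreover have half: "1/2 \<in> {0..1::real}" by simp
      have "\<tau> ((p +++ q) s) ((p +++ q) (1/2)) \<otimes>\<^bsub>G\<^esub> \<tau> ((p +++ q) (1/2)) ((p +++ q) t) =
          \<tau> ((p +++ q) s) ((p +++ q) t)"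
        by (intro tau_trans X'(1) \<eta>(2) st half order.strict_trans2[OF that(3) \<epsilon>(4)]
          order.strict_trans2[OF that(4) \<epsilon>(4)] order.strict_trans2[OF st(3) \<epsilon>(4)])
      ultimately show ?thesis by simp
    qed
    consider "s \<le> 1/2" "t \<le> 1/2" | "1/2 \<le> s" "1/2 \<le> t" | "s \<le> 1/2" "1/2 \<le> t" | "1/2 \<le> s" "t \<le> 1/2"
      by linarith
    then show ?thesis
    proof cases
      case 3
      then have m: "\<bar>s - 1/2\<bar> < \<epsilon>" "\<bar>1/2 - t\<bar> < \<epsilon>" using st by auto
      show ?thesis by (rule via[OF first[of s "1/2"] second[of "1/2" t]]) (use m 3 st in simp_all)
    next
      case 4
      then have m: "\<bar>s - 1/2\<bar> < \<epsilon>" "\<bar>1/2 - t\<bar> < \<epsilon>" using st by auto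
      show ?thesis by (rule via[OF second[of s "1/2"] first[of "1/2" t]]) (use m 4 st in simp_all)
    next
      case 1
      show ?thesis by (rule first) (use 1 st in simp_all)
    next
      case 2
      show ?thesis by (rule second) (use 2 st in simp_all)
    qed
  qed
  show ?thesis
    unfolding holonomy_along_def
    using main \<epsilon>(1) X' path by blast
qed

section \<open>The holonomy of the manifold of the group\<close>

subsection \<open>Monomials\<close>

context raag_graph
begin

definition gen :: "'e \<Rightarrow> 'e word set" where
  "gen i = word_class E [(i, True)]"

text \<open>
  An arbitrary order of the generators, in which the factors of monomials are multiplied.
\<close>
definition generators :: "'e list" where
  "generators = (SOME xs. set xs = UNIV \<and> distinct xs)"

lemma generators: "set generators = UNIV" "distinct generators"
proof -
  have "\<exists>xs::'e list. set xs = UNIV \<and> distinct xs"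
    using finite_distinct_list[of "UNIV :: 'e set"] by auto
  then have "set generators = UNIV \<and> distinct generators"
    unfolding generators_def by (rule someI_ex)
  then show "set generators = UNIV" "distinct generators" by auto
qed

definition monomial_on :: "'e list \<Rightarrow> ('e \<Rightarrow> int) \<Rightarrow> 'e word set" where
  "monomial_on xs c = foldr (\<lambda>i h. gen i [^]\<^bsub>raag E\<^esub> c i \<cdot> h) xs \<one>\<^bsub>raag E\<^esub>"

definition monomial :: "('e \<Rightarrow> int) \<Rightarrow> 'e word set" where
  "monomial c = monomial_on generators c"

definition clique :: "'e set \<Rightarrow> bool" where
  "clique K \<longleftrightarrow> (\<forall>i\<in>K. \<forall>j\<in>K. i \<noteq> j \<longrightarrow> E i j)"

lemma gen_carrier [simp]: "gen i \<in> carrier (raag E)"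
  by (simp add: gen_def)

lemma word_class_letter: "word_class E [(i, s)] = gen i [^]\<^bsub>raag E\<^esub> (if s then 1 else -1 :: int)"
proof (cases s)
  case False
  have "raag_step E ([] @ [(i, False), (i, \<not> False)] @ []) ([] @ [])" by (rule raag_step.cancel)
  then have "word_class E [(i, False)] \<cdot> gen i = \<one>\<^bsub>raag E\<^esub>"
    by (simp add: gen_def raag_one word_class_eq_iff r_into_equivclp)
  then have "inv\<^bsub>raag E\<^esub> (gen i) = word_class E [(i, False)]"
    by (intro RG.inv_equality) auto
  moreover have "gen i [^]\<^bsub>raag E\<^esub> (- 1 :: int) = inv\<^bsub>raag E\<^esub> (gen i)"
    using RG.int_pow_neg[of "gen i" 1] by simp
  ultimately show ?thesis using False by simp
qed (simp add: gen_def[symmetric])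

lemma monomial_on_carrier [simp]: "monomial_on xs c \<in> carrier (raag E)"
  by (induction xs) (auto simp: monomial_on_def)

lemma monomial_carrier [simp]: "monomial c \<in> carrier (raag E)"
  by (simp add: monomial_def)

lemma gen_commute: "E i j \<Longrightarrow> gen i \<cdot> gen j = gen j \<cdot> gen i"
  using raag_step.commute[of E i j "[]" True True "[]"]
  by (simp add: gen_def word_class_eq_iff r_into_equivclp)

lemma int_pow_commute_one:
  assumes "x \<in> carrier (raag E)" "y \<in> carrier (raag E)" "x \<cdot> y = y \<cdot> x"
  shows "x [^]\<^bsub>raag E\<^esub> (m::int) \<cdot> y = y \<cdot> x [^]\<^bsub>raag E\<^esub> m"
proof -
  have "inv\<^bsub>raag E\<^esub> y \<cdot> x \<cdot> y = x"
    using assms by (simp add: RG.m_assoc) (metis RG.inv_closed RG.l_inv RG.l_one RG.m_assoc)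
  have cancel: "y \<cdot> (inv\<^bsub>raag E\<^esub> y \<cdot> z) = z" if "z \<in> carrier (raag E)" for z
    using that assms(2) by (simp add: RG.m_assoc[symmetric])
  define \<phi> where "\<phi> z = inv\<^bsub>raag E\<^esub> y \<cdot> z \<cdot> y" for z
  have "\<phi> \<in> hom (raag E) (raag E)"
  proof (rule homI)
    fix a b assume ab: "a \<in> carrier (raag E)" "b \<in> carrier (raag E)"
    have "\<phi> a \<cdot> \<phi> b = inv\<^bsub>raag E\<^esub> y \<cdot> a \<cdot> (y \<cdot> inv\<^bsub>raag E\<^esub> y) \<cdot> b \<cdot> y"
      using ab assms(2) by (simp add: \<phi>_def RG.m_assoc cancel)
    then show "\<phi> (a \<cdot> b) = \<phi> a \<cdot> \<phi> b"
      using ab assms(2) by (simp add: \<phi>_def RG.m_assoc)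
  qed (use assms(2) in \<open>simp add: \<phi>_def\<close>)
  then interpret h: group_hom "raag E" "raag E" \<phi> by unfold_locales
  have "\<phi> (x [^]\<^bsub>raag E\<^esub> m) = x [^]\<^bsub>raag E\<^esub> m"
    using h.hom_int_pow[of x m] assms \<open>_ = x\<close> by (simp add: \<phi>_def)
  then have "x [^]\<^bsub>raag E\<^esub> m = inv\<^bsub>raag E\<^esub> y \<cdot> (x [^]\<^bsub>raag E\<^esub> m \<cdot> y)"
    using assms by (simp add: \<phi>_def RG.m_assoc)
  then show ?thesis
    using assms RG.inv_solve_left[of "x [^]\<^bsub>raag E\<^esub> m" y "x [^]\<^bsub>raag E\<^esub> m \<cdot> y"] by simp
qed

lemma gen_pow_commute:
  assumes "E i j \<or> i = j"
  shows "gen i [^]\<^bsub>raag E\<^esub> (m::int) \<cdot> gen j [^]\<^bsub>raag E\<^esub> (n::int) =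
         gen j [^]\<^bsub>raag E\<^esub> n \<cdot> gen i [^]\<^bsub>raag E\<^esub> m"
proof -
  have "gen j \<cdot> gen i = gen i \<cdot> gen j"
    using assms gen_commute by auto
  then have "gen j [^]\<^bsub>raag E\<^esub> n \<cdot> gen i = gen i \<cdot> gen j [^]\<^bsub>raag E\<^esub> n"
    by (intro int_pow_commute_one) auto
  then show ?thesis by (intro int_pow_commute_one) auto
qed

lemma monomial_on_commute:
  assumes "\<And>i. i \<in> set xs \<Longrightarrow> c i \<noteq> 0 \<Longrightarrow> m \<noteq> 0 \<Longrightarrow> E i j \<or> i = j"
  shows "monomial_on xs c \<cdot> gen j [^]\<^bsub>raag E\<^esub> (m::int) =
         gen j [^]\<^bsub>raag E\<^esub> m \<cdot> monomial_on xs c"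
  using assms
proof (induction xs)
  case (Cons i xs)
  have comm: "gen i [^]\<^bsub>raag E\<^esub> c i \<cdot> gen j [^]\<^bsub>raag E\<^esub> m =
      gen j [^]\<^bsub>raag E\<^esub> m \<cdot> gen i [^]\<^bsub>raag E\<^esub> c i"
    using Cons.prems[of i] gen_pow_commute[of i j "c i" m] by (cases "c i = 0 \<or> m = 0") auto
  have "monomial_on (i # xs) c \<cdot> gen j [^]\<^bsub>raag E\<^esub> m =
      gen i [^]\<^bsub>raag E\<^esub> c i \<cdot> (gen j [^]\<^bsub>raag E\<^esub> m \<cdot> monomial_on xs c)"
    using Cons by (simp add: monomial_on_def[of "i # xs"] monomial_on_def[of xs, symmetric] RG.m_assoc)
  also have "\<dots> = (gen i [^]\<^bsub>raag E\<^esub> c i \<cdot> gen j [^]\<^bsub>raag E\<^esub> m) \<cdot> monomial_on xs c"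
    by (simp add: RG.m_assoc)
  also have "\<dots> = gen j [^]\<^bsub>raag E\<^esub> m \<cdot> monomial_on (i # xs) c"
    unfolding comm by (simp add: monomial_on_def[of "i # xs"] monomial_on_def[of xs, symmetric] RG.m_assoc)
  finally show ?case .
qed (simp add: monomial_on_def)

text \<open>
  Monomials supported on a clique lie in a free abelian subgroup; this is where commutation enters
  the cocycle identity.
\<close>
lemma monomial_add:
  assumes "clique K" "\<And>i. c i \<noteq> 0 \<Longrightarrow> i \<in> K" "\<And>i. c' i \<noteq> 0 \<Longrightarrow> i \<in> K"
  shows "monomial c \<cdot> monomial c' = monomial (\<lambda>i. c i + c' i)"
proof -
  have "monomial_on xs c \<cdot> monomial_on xs c' = monomial_on xs (\<lambda>i. c i + c' i)" for xs
  proof (induction xs)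
    case (Cons i xs)
    let ?a = "gen i [^]\<^bsub>raag E\<^esub> c i" and ?b = "gen i [^]\<^bsub>raag E\<^esub> c' i"
    have comm: "monomial_on xs c \<cdot> ?b = ?b \<cdot> monomial_on xs c"
      using assms by (intro monomial_on_commute) (auto simp: clique_def)
    have unf: "monomial_on (i # xs) f = gen i [^]\<^bsub>raag E\<^esub> f i \<cdot> monomial_on xs f" for f
      by (simp add: monomial_on_def)
    have "monomial_on (i # xs) c \<cdot> monomial_on (i # xs) c' =
        ?a \<cdot> (monomial_on xs c \<cdot> ?b) \<cdot> monomial_on xs c'"
      by (simp add: unf RG.m_assoc)
    also have "\<dots> = (?a \<cdot> ?b) \<cdot> (monomial_on xs c \<cdot> monomial_on xs c')"
      unfolding comm by (simp add: RG.m_assoc)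
    finally show ?case unfolding Cons.IH by (simp add: unf RG.int_pow_mult)
  qed (simp add: monomial_on_def)
  then show ?thesis by (simp add: monomial_def)
qed

lemma monomial_zero [simp]: "monomial (\<lambda>_. 0) = \<one>\<^bsub>raag E\<^esub>"
proof -
  have "monomial_on xs (\<lambda>_. 0) = \<one>\<^bsub>raag E\<^esub>" for xs
    by (induction xs) (auto simp: monomial_on_def)
  then show ?thesis by (simp add: monomial_def)
qed

lemma monomial_single: "monomial (\<lambda>j. if j = i then n else 0) = gen i [^]\<^bsub>raag E\<^esub> n"
proof -
  have "distinct xs \<Longrightarrow> monomial_on xs (\<lambda>j. if j = i then n else 0) =
      (if i \<in> set xs then gen i [^]\<^bsub>raag E\<^esub> n else \<one>\<^bsub>raag E\<^esub>)" for xs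
    by (induction xs) (auto simp: monomial_on_def)
  from this[of generators] show ?thesis by (simp add: monomial_def generators)
qed

lemma monomial_clique_word:
  assumes "clique K" "\<And>i. c i \<noteq> 0 \<Longrightarrow> i \<in> K" "\<And>i. c i \<in> {-1, 0, 1}"
  shows "\<exists>w. clique_word w \<and> monomial c = word_class E w"
proof -
  have "distinct xs \<Longrightarrow> \<exists>w. clique_word w \<and> fst ` set w \<subseteq> set xs \<inter> K \<and> monomial_on xs c = word_class E w" for xs
  proof (induction xs)
    case Nil
    then show ?case by (intro exI[of _ "[]"]) (simp add: monomial_on_def raag_one)
  next
    case (Cons i xs)
    then obtain w where w: "clique_word w" "fst ` set w \<subseteq> set xs \<inter> K" "monomial_on xs c = word_class E w"
      by auto
    have unf: "monomial_on (i # xs) c = gen i [^]\<^bsub>raag E\<^esub> c i \<cdot> monomial_on xs c"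
      by (simp add: monomial_on_def)
    show ?case
    proof (cases "c i = 0")
      case True
      then show ?thesis using w by (intro exI[of _ w]) (auto simp: unf)
    next
      case False
      then have "i \<in> K" "c i = (if c i = 1 then 1 else -1)" using assms(2,3)[of i] by auto
      then have "monomial_on (i # xs) c = word_class E ((i, c i = 1) # w)"
        unfolding unf w(3) using word_class_letter[of i "c i = 1"] raag_mult[of "[(i, c i = 1)]" w] by simp
      moreover have "clique_word ((i, c i = 1) # w)"
        using w \<open>i \<in> K\<close> assms(1) Cons.prems by (auto simp: clique_word_def clique_def)
      ultimately show ?thesis
        using w \<open>i \<in> K\<close> by (intro exI[of _ "(i, c i = 1) # w"]) auto
    qed
  qed
  from this[of generators] show ?thesis by (auto simp: monomial_def generators)
qed

end

subsection \<open>Crossing the walls\<close>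

text \<open>
  The integer \<open>n\<close> with \<open>2 * n - 1 < x \<le> 2 * n + 1\<close>: the signed number of walls between \<open>0\<close> and \<open>x\<close> on the line that
  covers the circle, the walls being at the odd integers.
\<close>
definition winding_part :: "real \<Rightarrow> int" where
  "winding_part x = \<lceil>(x - 1) / 2\<rceil>"

lemma winding_part_bounds: "-1 < x - 2 * winding_part x" "x - 2 * winding_part x \<le> 1"
proof -
  define c where "c = \<lceil>(x - 1) / 2\<rceil>"
  have "of_int c - 1 < (x - 1) / 2" "(x - 1) / 2 \<le> of_int c"
    using ceiling_correct[of "(x - 1) / 2"] unfolding c_def by blast+
  then show "-1 < x - 2 * winding_part x" "x - 2 * winding_part x \<le> 1"
    unfolding winding_part_def c_def[symmetric] by simp_all
qed

lemma winding_part_eq: "\<bar>x\<bar> \<le> 1 \<Longrightarrow> winding_part x = (if x = -1 then -1 else 0)"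
  unfolding winding_part_def by (auto simp: ceiling_eq_iff)

text \<open>
  The coordinate of a point of the circle in the cube, in the interval from \<open>-1\<close>
  (excluded) to \<open>1\<close>.
\<close>
definition turn :: "complex \<Rightarrow> real" where
  "turn z = Arg z / pi"

lemma turn_bounds: "-1 < turn z" "turn z \<le> 1"
  using Arg_bounded[of z] by (auto simp: turn_def field_simps)

lemma cis_turn: "norm z = 1 \<Longrightarrow> cis (pi * turn z) = z"
  by (cases "z = 0") (simp_all add: turn_def cis_Arg sgn_div_norm)

lemma turn_cis: "turn (cis (pi * x)) = x - 2 * winding_part x"
proof -
  have "cis (pi * x) = cis (pi * (x - 2 * winding_part x) + 2 * pi * winding_part x)"
    by (simp add: algebra_simps)
  also have "\<dots> = cis (pi * (x - 2 * winding_part x))"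
    by (simp add: cis_mult[symmetric] del: cis_multiple_2pi) (simp add: cis_multiple_2pi)
  finally have "cis (pi * x) = cis (pi * (x - 2 * winding_part x))" .
  moreover have "Arg (cis (pi * (x - 2 * winding_part x))) = pi * (x - 2 * winding_part x)"
  proof (rule Arg_cis)
    have "pi * (-1) < pi * (x - 2 * winding_part x)" "pi * (x - 2 * winding_part x) \<le> pi * 1"
      using winding_part_bounds[of x]
      by (intro mult_strict_left_mono mult_left_mono; simp)+
    then show "pi * (x - 2 * winding_part x) \<in> {- pi<..pi}" by simp
  qed
  ultimately show ?thesis by (simp add: turn_def)
qed

text \<open>
  A chord shorter than \<open>1/2\<close> subtends an angle below \<open>pi / 4\<close>.
\<close>
lemma close_turns:
  assumes "norm z = 1" "norm w = 1" "dist z w < 1 / 2"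
  shows "\<bar>turn z - turn w\<bar> < 1 / 4 \<or> \<bar>turn z - turn w\<bar> > 7 / 4"
proof (rule ccontr)
  define u where "u = \<bar>turn z - turn w\<bar>"
  assume "\<not> ?thesis"
  then have u: "1 / 4 \<le> u" "u \<le> 7 / 4" by (auto simp: u_def)
  have c: "cos (pi * v) \<le> cos (pi / 4)" if "1 / 4 \<le> v" "v \<le> 1" for v
    using that by (intro cos_monotone_0_pi_le) (auto simp: field_simps)
  have "cos (pi * u) = cos (2 * pi - pi * u)"
    by (simp add: cos_diff)
  also have "2 * pi - pi * u = pi * (2 - u)" by (simp add: algebra_simps)
  finally have "cos (pi * u) \<le> cos (pi / 4)"
    using c[of u] c[of "2 - u"] u by (cases "u \<le> 1") auto
  moreover have "cos (pi / 4) \<le> 3 / 4"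
  proof -
    have "sqrt 2 \<le> sqrt ((3/2)\<^sup>2)" by (intro real_sqrt_le_mono) (simp add: power2_eq_square)
    then show ?thesis by (simp add: cos_45 real_sqrt_unique del: real_sqrt_le_iff)
  qed
  ultimately have cu: "cos (pi * u) \<le> 3 / 4" by linarith
  have "cos (pi * u) = cos (pi * turn z - pi * turn w)"
    unfolding u_def by (cases "turn z \<ge> turn w") (auto simp: algebra_simps abs_if cos_diff)
  moreover have "(dist z w)\<^sup>2 = 2 - 2 * cos (pi * turn z - pi * turn w)"
  proof -
    have "dist z w = norm (cis (pi * turn z) - cis (pi * turn w))"
      by (simp add: cis_turn assms dist_norm)
    also have "\<dots>\<^sup>2 = (cos (pi * turn z) - cos (pi * turn w))\<^sup>2 + (sin (pi * turn z) - sin (pi * turn w))\<^sup>2"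
      by (simp add: cmod_power2)
    also have "\<dots> = ((cos (pi * turn z))\<^sup>2 + (sin (pi * turn z))\<^sup>2) + ((cos (pi * turn w))\<^sup>2 + (sin (pi * turn w))\<^sup>2)
        - 2 * cos (pi * turn z - pi * turn w)"
      by (simp add: cos_diff power2_eq_square algebra_simps)
    finally show ?thesis by simp
  qed
  moreover have "(dist z w)\<^sup>2 < (1 / 2)\<^sup>2"
    using assms(3) by (intro power_strict_mono) auto
  ultimately show False using cu by (simp add: power2_eq_square)
qed

text \<open>
  The sign with which the short arc from \<open>z\<close> to \<open>w\<close> crosses the wall at
  \<open>-1\<close>.
\<close>
definition crossing :: "complex \<Rightarrow> complex \<Rightarrow> int" where
  "crossing z w = (if turn z - turn w > 1 then 1 else if turn w - turn z > 1 then -1 else 0)"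

lemma crossing_add:
  assumes "norm x = 1" "norm y = 1" "norm z = 1" "dist x y < 1 / 2" "dist y z < 1 / 2" "dist x z < 1 / 2"
  shows "crossing x y + crossing y z = crossing x z"
  using close_turns[OF assms(1,2,4)] close_turns[OF assms(2,3,5)] close_turns[OF assms(1,3,6)]
    turn_bounds[of x] turn_bounds[of y] turn_bounds[of z]
  unfolding crossing_def by (auto simp: abs_if split: if_splits)

lemma crossing_near_minus_one:
  assumes "norm x = 1" "norm y = 1" "dist x y < 1 / 2" "crossing x y \<noteq> 0"
  shows "\<bar>turn x\<bar> > 3 / 4" "\<bar>turn y\<bar> > 3 / 4"
  using close_turns[OF assms(1,2,3)] assms(4) turn_bounds[of x] turn_bounds[of y]
  unfolding crossing_def by (auto simp: abs_if split: if_splits)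

lemma crossing_cis:
  assumes "\<bar>x - y\<bar> < 1 / 4"
  shows "crossing (cis (pi * x)) (cis (pi * y)) = winding_part y - winding_part x"
proof -
  have "\<bar>real_of_int (winding_part y - winding_part x)\<bar> < 2"
    using winding_part_bounds[of x] winding_part_bounds[of y] assms
    unfolding of_int_diff abs_less_iff by linarith
  then have "winding_part y - winding_part x \<in> {-1, 0, 1}" by auto
  then consider "winding_part y = winding_part x - 1" | "winding_part y = winding_part x"
    | "winding_part y = winding_part x + 1" by auto
  then show ?thesis
    using assms by cases (auto simp: crossing_def turn_cis abs_if split: if_splits)
qed

context raag_graph
begin

abbreviation T_A :: "(complex ^ 'e) set" where
  "T_A \<equiv> raag_manifold E"

lemma T_A_norm: "z \<in> T_A \<Longrightarrow> norm (z $ i) = 1"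
  by (auto simp: raag_manifold_def glue_def)

text \<open>
  The bound \<open>3/2\<close> of the truncation keeps two non-commuting coordinates from being
  both close to a wall.
\<close>
lemma T_A_turns:
  assumes "z \<in> T_A" "\<bar>turn (z $ i)\<bar> > 3 / 4" "\<bar>turn (z $ j)\<bar> > 3 / 4" "i \<noteq> j"
  shows "E i j"
proof (rule ccontr)
  assume "\<not> E i j"
  obtain x where x: "x \<in> truncated_cube E" "z = glue x"
    using assms(1) by (auto simp: raag_manifold_def)
  have "\<bar>turn (z $ k)\<bar> = \<bar>x $ k\<bar>" for k
  proof -
    have "\<bar>x $ k\<bar> \<le> 1" using x(1) by (auto simp: truncated_cube_def)
    then show ?thesis using x(2) by (auto simp: glue_def turn_cis winding_part_eq)
  qed
  moreover have "\<bar>x $ i\<bar> + \<bar>x $ j\<bar> \<le> 3 / 2"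
    using x(1) assms(4) \<open>\<not> E i j\<close> by (auto simp: truncated_cube_def)
  ultimately show False using assms by auto
qed

text \<open>
  The product of the generators whose walls lie between two nearby points of
  \<open>T\<^sub>A\<close>.
\<close>
definition transition :: "complex ^ 'e \<Rightarrow> complex ^ 'e \<Rightarrow> 'e word set" where
  "transition z w = monomial (\<lambda>i. crossing (z $ i) (w $ i))"

text \<open>
  The crossing numbers of the coordinates are additive, and all walls involved are close to the
  middle point, so that their generators commute.
\<close>
lemma transition_cocycle: "local_cocycle (raag E) T_A (1 / 2) transition"
  unfolding local_cocycle_def
proof (intro conjI allI ballI impI)
  fix x y z assume T: "x \<in> T_A" "y \<in> T_A" "z \<in> T_A"
    and d: "dist x y < 1 / 2" "dist y z < 1 / 2" "dist x z < 1 / 2"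
  have d': "dist (x $ i) (y $ i) < 1 / 2" "dist (y $ i) (z $ i) < 1 / 2" "dist (x $ i) (z $ i) < 1 / 2" for i
    using d dist_vec_nth_le[of x i y] dist_vec_nth_le[of y i z] dist_vec_nth_le[of x i z] by linarith+
  define K where "K = {i. \<bar>turn (y $ i)\<bar> > 3 / 4}"
  have "clique K" unfolding clique_def K_def using T_A_turns[OF T(2)] by blast
  then have "transition x y \<cdot> transition y z =
      monomial (\<lambda>i. crossing (x $ i) (y $ i) + crossing (y $ i) (z $ i))"
    unfolding transition_def
  proof (rule monomial_add)
    show "i \<in> K" if "crossing (x $ i) (y $ i) \<noteq> 0" for i
      using crossing_near_minus_one(2)[OF _ _ d'(1) that] T_A_norm T by (simp add: K_def)
    show "i \<in> K" if "crossing (y $ i) (z $ i) \<noteq> 0" for i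
      using crossing_near_minus_one(1)[OF _ _ d'(2) that] T_A_norm T by (simp add: K_def)
  qed
  also have "\<dots> = transition x z"
    unfolding transition_def using T d' by (simp add: crossing_add T_A_norm)
  finally show "transition x y \<cdot> transition y z = transition x z" .
qed (simp add: transition_def)

abbreviation holonomy :: "(real \<Rightarrow> complex ^ 'e) \<Rightarrow> (real \<Rightarrow> 'e word set) \<Rightarrow> bool" where
  "holonomy \<equiv> holonomy_along (raag E) T_A (1 / 2) transition"

lemma continuous_on_glue: "continuous_on S glue"
  unfolding glue_def by (intro continuous_intros)

text \<open>
  A path that lifts to a path \<open>\<theta>\<close> in the cover of the torus, crossing only
  walls of commuting generators, has the holonomy read off from the cover.
\<close>
lemma holonomy_flat:
  assumes th: "continuous_on {0..1} \<theta>" and T: "\<And>t. t \<in> {0..1} \<Longrightarrow> glue (\<theta> t) \<in> T_A"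
    and K: "clique K" "\<And>t i. t \<in> {0..1} \<Longrightarrow> winding_part (\<theta> t $ i) \<noteq> 0 \<Longrightarrow> i \<in> K"
    and g: "g \<in> carrier (raag E)"
  shows "holonomy (glue \<circ> \<theta>) (\<lambda>t. g \<cdot> monomial (\<lambda>i. winding_part (\<theta> t $ i)))"
  unfolding holonomy_along_def
proof (intro conjI ballI)
  show "path (glue \<circ> \<theta>)" unfolding path_def
    by (intro continuous_on_compose th continuous_on_glue)
  have "uniformly_continuous_on {0..1} \<theta>"
    using th by (intro compact_uniformly_continuous) auto
  then obtain \<eta> where \<eta>: "\<eta> > 0" "\<And>s t. s \<in> {0..1} \<Longrightarrow> t \<in> {0..1} \<Longrightarrow> \<bar>s - t\<bar> < \<eta> \<Longrightarrow>
      dist (\<theta> s) (\<theta> t) < 1 / 4"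
    unfolding uniformly_continuous_on_def dist_real_def
    by (metis abs_minus_commute zero_less_divide_1_iff zero_less_numeral)
  have "g \<cdot> monomial (\<lambda>i. winding_part (\<theta> t $ i)) =
      g \<cdot> monomial (\<lambda>i. winding_part (\<theta> s $ i)) \<cdot> transition ((glue \<circ> \<theta>) s) ((glue \<circ> \<theta>) t)"
    if st: "s \<in> {0..1}" "t \<in> {0..1}" "\<bar>s - t\<bar> < \<eta>" for s t
  proof -
    have "\<bar>\<theta> s $ i - \<theta> t $ i\<bar> < 1 / 4" for i
      using \<eta>(2)[OF st] dist_vec_nth_le[of "\<theta> s" i "\<theta> t"] by (simp add: dist_real_def)
    then have "transition ((glue \<circ> \<theta>) s) ((glue \<circ> \<theta>) t) =
        monomial (\<lambda>i. winding_part (\<theta> t $ i) - winding_part (\<theta> s $ i))"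
      by (simp add: transition_def glue_def crossing_cis)
    moreover have "monomial (\<lambda>i. winding_part (\<theta> s $ i)) \<cdot>
          monomial (\<lambda>i. winding_part (\<theta> t $ i) - winding_part (\<theta> s $ i)) =
        monomial (\<lambda>i. winding_part (\<theta> s $ i) + (winding_part (\<theta> t $ i) - winding_part (\<theta> s $ i)))"
      using K st by (intro monomial_add[OF K(1)]) (auto, metis)
    ultimately show ?thesis using g by (simp add: RG.m_assoc)
  qed
  then show "\<exists>\<epsilon>>0. \<forall>s\<in>{0..1}. \<forall>t\<in>{0..1}. \<bar>s - t\<bar> < \<epsilon> \<longrightarrow>
      g \<cdot> monomial (\<lambda>i. winding_part (\<theta> t $ i)) =
      g \<cdot> monomial (\<lambda>i. winding_part (\<theta> s $ i)) \<cdot> transition ((glue \<circ> \<theta>) s) ((glue \<circ> \<theta>) t)"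
    using \<eta>(1) by blast
qed (use T g in auto)

definition dir :: "'e \<times> bool \<Rightarrow> real ^ 'e" where
  "dir x = axis (fst x) (if snd x then 1 else -1)"

lemma dir_nth: "dir x $ k = (if k = fst x then (if snd x then 1 else -1) else 0)"
  by (simp add: dir_def axis_def)

definition letter_loop :: "'e \<times> bool \<Rightarrow> real \<Rightarrow> complex ^ 'e" where
  "letter_loop x = (if snd x then generator_loop (fst x) else reversepath (generator_loop (fst x)))"

lemma word_loop_Cons: "word_loop (x # w) = letter_loop x +++ word_loop w"
  by (cases x) (simp add: letter_loop_def)

lemma cis_pi_2: "cis (pi * 2) = 1" "cis (- (pi * 2)) = 1"
  using cis_multiple_2pi[of 1] cis_multiple_2pi[of "-1"] by (simp_all add: mult.commute)

lemma letter_loop_eq: "letter_loop x = glue \<circ> (\<lambda>t. (2 * t) *\<^sub>R dir x)"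
proof -
  have "cis (2 * pi * (1 - t)) = cis (- (2 * pi * t))" for t
    by (simp add: algebra_simps cis_divide[symmetric] cis_inverse divide_inverse cis_pi_2)
  then show ?thesis
    by (auto simp: letter_loop_def generator_loop_def reversepath_def glue_def dir_nth fun_eq_iff
        vec_eq_iff mult.commute mult.left_commute)
qed

lemma letter_loop_in_T_A: "t \<in> {0..1} \<Longrightarrow> letter_loop x t \<in> T_A"
proof -
  assume t: "t \<in> {0..1}"
  define y where "y = (if t \<le> 1 / 2 then (2 * t) *\<^sub>R dir x else (2 * t - 2) *\<^sub>R dir x)"
  have "y \<in> truncated_cube E"
    using t by (auto simp: truncated_cube_def y_def dir_nth)
  moreover have "cis (pi * (2 * t - 2)) = cis (pi * (2 * t))"
    "cis (pi * (2 - 2 * t)) = cis (- (pi * (2 * t)))"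
    by (simp_all add: algebra_simps cis_divide[symmetric] cis_inverse divide_inverse cis_mult[symmetric] cis_pi_2)
  then have "glue y = letter_loop x t"
    by (auto simp: letter_loop_eq y_def glue_def dir_nth vec_eq_iff)
  ultimately show ?thesis unfolding raag_manifold_def by (metis image_eqI)
qed

lemma path_letter_loop [simp]: "path (letter_loop x)"
  unfolding letter_loop_eq path_def by (intro continuous_on_compose continuous_on_glue continuous_intros)

lemma letter_loop_ends [simp]: "pathstart (letter_loop x) = 1" "pathfinish (letter_loop x) = 1"
  by (auto simp: letter_loop_def generator_loop_def pathstart_def pathfinish_def reversepath_def vec_eq_iff)

lemma pathstart_word_loop [simp]: "pathstart (word_loop (w :: 'e word)) = 1"
  by (cases w) (auto simp: word_loop_Cons pathstart_def[of "\<lambda>_. 1"] simp del: word_loop.simps(2))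

lemma pathfinish_word_loop [simp]: "pathfinish (word_loop (w :: 'e word)) = 1"
  by (induction w) (auto simp: word_loop_Cons pathfinish_def[of "\<lambda>_. 1"] simp del: word_loop.simps(2))

lemma path_word_loop [simp]: "path (word_loop (w :: 'e word))"
  by (induction w) (auto simp: word_loop_Cons path_def[of "\<lambda>_. 1"] simp del: word_loop.simps(2))

lemma winding_part_double_dir:
  assumes "t \<in> {0..1}"
  shows "winding_part (((2 * t) *\<^sub>R dir x) $ i) \<noteq> 0 \<Longrightarrow> i = fst x"
  by (auto simp: dir_nth winding_part_eq split: if_splits)

lemma holonomy_word_loop:
  assumes "g \<in> carrier (raag E)"
  shows "\<exists>L. holonomy (word_loop w) L \<and> L 0 = g \<and> L 1 = g \<cdot> word_class E w"
  using assms
proof (induction w arbitrary: g)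
  case Nil
  have one: "word_loop [] = glue \<circ> (\<lambda>_. 0)" by (auto simp: glue_def vec_eq_iff)
  have "0 \<in> truncated_cube E" by (simp add: truncated_cube_def)
  then have "holonomy (word_loop []) (\<lambda>t. g \<cdot> monomial (\<lambda>i. winding_part ((0 :: real ^ 'e) $ i)))"
    unfolding one by (intro holonomy_flat[where K = "{}"] Nil)
      (auto simp: raag_manifold_def clique_def winding_part_eq)
  then show ?case using Nil
    by (intro exI[of _ "\<lambda>t. g \<cdot> monomial (\<lambda>i. winding_part ((0 :: real ^ 'e) $ i))"])
      (simp add: winding_part_eq raag_one[symmetric])
next
  case (Cons x w)
  define L where "L t = g \<cdot> monomial (\<lambda>i. winding_part (((2 * t) *\<^sub>R dir x) $ i))" for t
  have "holonomy (letter_loop x) L"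
    unfolding L_def letter_loop_eq
    using letter_loop_in_T_A[of _ x] winding_part_double_dir[of _ x]
    by (intro holonomy_flat[where K = "{fst x}"] Cons.prems continuous_intros)
      (auto simp: clique_def letter_loop_eq)
  moreover have "L 0 = g" using Cons.prems by (simp add: L_def winding_part_eq)
  moreover have L1: "L 1 = g \<cdot> word_class E [x]"
  proof -
    have "winding_part 2 = 1" "winding_part (-2) = -1" by (simp_all add: winding_part_def ceiling_eq_iff)
    then have "(\<lambda>i. winding_part (((2 * 1) *\<^sub>R dir x) $ i)) =
        (\<lambda>j. if j = fst x then (if snd x then 1 else -1) else 0)"
      by (auto simp: fun_eq_iff dir_nth winding_part_eq)
    then show ?thesis
      unfolding L_def by (simp add: monomial_single word_class_letter[of "fst x" "snd x", simplified])
  qed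
  moreover obtain M where "holonomy (word_loop w) M" "M 0 = g \<cdot> word_class E [x]"
      "M 1 = g \<cdot> word_class E [x] \<cdot> word_class E w"
    using Cons.IH[of "g \<cdot> word_class E [x]"] Cons.prems by auto
  ultimately have "holonomy (letter_loop x +++ word_loop w)
      (\<lambda>t. if t \<le> 1 / 2 then L (2 * t) else M (2 * t - 1))"
    by (intro holonomy_along_join group_raag transition_cocycle) auto
  then show ?case
    using \<open>L 0 = g\<close> \<open>M 1 = _\<close> Cons.prems
    by (intro exI[of _ "\<lambda>t. if t \<le> 1 / 2 then L (2 * t) else M (2 * t - 1)"])
      (simp add: word_loop_Cons RG.m_assoc del: word_loop.simps)
qed

lemma truncated_cube_convexity:
  assumes "\<And>i. \<bar>y $ i\<bar> \<le> \<bar>x $ i\<bar>" "x \<in> truncated_cube E"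
  shows "y \<in> truncated_cube E"
  unfolding truncated_cube_def
proof (intro CollectI conjI allI impI)
  show "\<bar>y $ i\<bar> \<le> 1" for i
    using assms(1)[of i] assms(2) by (auto simp: truncated_cube_def intro: order_trans)
  show "\<bar>y $ i\<bar> + \<bar>y $ j\<bar> \<le> 3 / 2" if "i \<noteq> j \<and> \<not> E i j" for i j
  proof -
    have "\<bar>x $ i\<bar> + \<bar>x $ j\<bar> \<le> 3 / 2" using that assms(2) unfolding truncated_cube_def by blast
    then show ?thesis using assms(1)[of i] assms(1)[of j] by linarith
  qed
qed

lemma truncated_cube_scale: "x \<in> truncated_cube E \<Longrightarrow> \<bar>c\<bar> \<le> 1 \<Longrightarrow> c *\<^sub>R x \<in> truncated_cube E"
  by (rule truncated_cube_convexity) (auto simp: abs_mult mult_left_le_one_le)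

text \<open>
  The image of the segment from the centre of the cube to \<open>x\<close>, which joins the base
  point to a point of the copy.
\<close>
definition spoke :: "real ^ 'e \<Rightarrow> real \<Rightarrow> complex ^ 'e" where
  "spoke x = glue \<circ> linepath 0 x"

lemma spoke_ends [simp]: "pathstart (spoke x) = 1" "pathfinish (spoke x) = glue x"
  by (auto simp: spoke_def pathstart_def pathfinish_def linepath_def glue_def vec_eq_iff)

lemma path_spoke [simp]: "path (spoke x)"
  unfolding spoke_def path_def by (intro continuous_on_compose continuous_on_glue continuous_intros)

text \<open>
  The holonomy along a spoke. It is trivial except on the facets \<open>x $ i = -1\<close>,
  because \<open>turn\<close> puts the wall on the side of the facet \<open>x $ i = 1\<close>:
  both facets have the same image, and a spoke that ends at the former has just crossed.
\<close>
definition boundary_shift :: "real ^ 'e \<Rightarrow> 'e word set" where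
  "boundary_shift x = monomial (\<lambda>i. if x $ i = -1 then -1 else 0)"

lemma clique_unit_coords: "x \<in> truncated_cube E \<Longrightarrow> clique {i. \<bar>x $ i\<bar> = 1}"
proof -
  assume x: "x \<in> truncated_cube E"
  have "E i j" if "\<bar>x $ i\<bar> = 1" "\<bar>x $ j\<bar> = 1" "i \<noteq> j" for i j
  proof (rule ccontr)
    assume "\<not> E i j"
    then have "\<bar>x $ i\<bar> + \<bar>x $ j\<bar> \<le> 3 / 2" using x that(3) unfolding truncated_cube_def by blast
    then show False using that by simp
  qed
  then show ?thesis by (auto simp: clique_def)
qed

theorem holonomy_word_loop_spoke:
  assumes "x \<in> truncated_cube E"
  shows "\<exists>L. holonomy (word_loop w +++ spoke x) L \<and> L 0 = \<one>\<^bsub>raag E\<^esub> \<and>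
             L 1 = word_class E w \<cdot> boundary_shift x"
proof -
  obtain L where L: "holonomy (word_loop w) L" "L 0 = \<one>\<^bsub>raag E\<^esub>" "L 1 = word_class E w"
    using holonomy_word_loop[of "\<one>\<^bsub>raag E\<^esub>" w] by auto
  define M where "M t = word_class E w \<cdot> monomial (\<lambda>i. winding_part (linepath 0 x t $ i))" for t
  have lp: "linepath 0 x t = t *\<^sub>R x" for t by (simp add: linepath_def)
  have x1: "\<bar>x $ i\<bar> \<le> 1" for i using assms by (auto simp: truncated_cube_def)
  have tx: "\<bar>t * x $ i\<bar> \<le> \<bar>x $ i\<bar>" if "t \<in> {0..1}" for t i
    using that by (auto simp: abs_mult mult_left_le_one_le)
  have "holonomy (spoke x) M"
    unfolding M_def spoke_def
  proof (rule holonomy_flat[OF _ _ clique_unit_coords[OF assms]])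
    fix t i assume "t \<in> {0..1::real}" "winding_part (linepath 0 x t $ i) \<noteq> 0"
    then show "i \<in> {i. \<bar>x $ i\<bar> = 1}"
      using tx[of t i] x1[of i] by (auto simp: lp winding_part_eq split: if_splits)
  qed (auto intro!: continuous_intros truncated_cube_scale assms simp: raag_manifold_def lp)
  moreover have "M 0 = L 1" "M 1 = word_class E w \<cdot> boundary_shift x"
    using x1 by (simp_all add: M_def lp winding_part_eq L(3) boundary_shift_def)
  ultimately show ?thesis
    using L holonomy_along_join[OF group_raag transition_cocycle _ L(1), of "spoke x" M]
    by (intro exI[of _ "\<lambda>t. if t \<le> 1 / 2 then L (2 * t) else M (2 * t - 1)"]) simp
qed

text \<open>
  Homotopic paths have equal holonomy, so the homotopy class of a path into a copy determines the
  element of the copy, up to the shift on the boundary.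
\<close>
theorem homotopic_word_loop_spoke_imp:
  assumes "x \<in> truncated_cube E" "y \<in> truncated_cube E"
    and "homotopic_paths T_A (word_loop u +++ spoke x) (word_loop w +++ spoke y)"
  shows "word_class E u \<cdot> boundary_shift x = word_class E w \<cdot> boundary_shift y"
proof -
  obtain L M where L: "holonomy (word_loop u +++ spoke x) L" "L 0 = \<one>\<^bsub>raag E\<^esub>"
      "L 1 = word_class E u \<cdot> boundary_shift x"
    and M: "holonomy (word_loop w +++ spoke y) M" "M 0 = \<one>\<^bsub>raag E\<^esub>"
      "M 1 = word_class E w \<cdot> boundary_shift y"
    using holonomy_word_loop_spoke assms(1,2) by meson
  show ?thesis
    using holonomy_homotopy_invariant[OF group_raag transition_cocycle _ assms(3) L(1) M(1)] L M by simp
qed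

text \<open>
  A word is recovered, up to its class, from the homotopy class of its loop: no relations besides
  those of the group hold between the loops of the generators.
\<close>
theorem homotopic_word_loops_imp_equiv:
  assumes "homotopic_paths T_A (word_loop u) (word_loop w)"
  shows "u \<sim>\<^sub>R w"
proof -
  obtain L M where L: "holonomy (word_loop u) L" "L 0 = \<one>\<^bsub>raag E\<^esub>" "L 1 = word_class E u"
    and M: "holonomy (word_loop w) M" "M 0 = \<one>\<^bsub>raag E\<^esub>" "M 1 = word_class E w"
    using holonomy_word_loop[of "\<one>\<^bsub>raag E\<^esub>" u] holonomy_word_loop[of "\<one>\<^bsub>raag E\<^esub>" w] by auto
  show ?thesis
    using holonomy_homotopy_invariant[OF group_raag transition_cocycle _ assms L(1) M(1)] L M
    by (simp add: word_class_eq_iff)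
qed

end

section \<open>Copies of the truncated cube in the universal cover\<close>

subsection \<open>Homotopies of paths\<close>

lemma path_image_two_legs:
  assumes "convex C" "a \<in> C" "b \<in> C" "c \<in> C"
  shows "path_image (linepath a b +++ linepath b c) \<subseteq> C"
  using assms by (intro subset_path_image_join) (simp_all add: closed_segment_subset)

text \<open>
  The source of nearly all explicit homotopies below: compose with a map from a convex set, in
  which paths with the same ends are homotopic.
\<close>
lemma homotopic_images_of_convex:
  fixes C :: "'a::real_normed_vector set" and h :: "'a \<Rightarrow> 'b::topological_space"
  assumes "convex C" "continuous_on C h" "h ` C \<subseteq> X" "path p" "path q" "path_image p \<subseteq> C" "path_image q \<subseteq> C"
    "pathstart p = pathstart q" "pathfinish p = pathfinish q"
  shows "homotopic_paths X (h \<circ> p) (h \<circ> q)"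
proof (rule homotopic_paths_continuous_image)
  show "homotopic_paths C p q"
    using assms by (intro homotopic_paths_linear) (auto simp: closed_segment_subset path_image_def image_subset_iff)
qed (use assms in auto)

text \<open>
  The case of the map \<open>p\<close> on the unit interval. It yields the groupoid laws for paths
  in an arbitrary topological space.
\<close>
lemma homotopic_reparametrizations:
  fixes p :: "real \<Rightarrow> 'a::topological_space"
  assumes "path p" "path_image p \<subseteq> S" "path q" "path r" "path_image q \<subseteq> {0..1}" "path_image r \<subseteq> {0..1}"
    "pathstart q = pathstart r" "pathfinish q = pathfinish r"
  shows "homotopic_paths S (p \<circ> q) (p \<circ> r)"
  using assms by (intro homotopic_images_of_convex[of "{0..1}"]) (auto simp: path_def path_image_def)

lemma linepath_unit_image: "u \<in> {0..1} \<Longrightarrow> v \<in> {0..1} \<Longrightarrow> path_image (linepath u v) \<subseteq> {0..1::real}"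
  by (simp add: closed_segment_subset)

lemma homotopic_paths_right_unit:
  fixes p :: "real \<Rightarrow> 'a::topological_space"
  assumes "path p" "path_image p \<subseteq> S"
  shows "homotopic_paths S (p +++ (\<lambda>_. pathfinish p)) p"
proof -
  have "homotopic_paths S (p \<circ> (linepath 0 1 +++ linepath 1 1)) (p \<circ> linepath 0 1)"
    using assms by (intro homotopic_reparametrizations subset_path_image_join linepath_unit_image) auto
  moreover have "p \<circ> linepath 0 1 = p" "p \<circ> linepath 1 1 = (\<lambda>_. pathfinish p)"
    by (auto simp: linepath_def pathfinish_def)
  ultimately show ?thesis by (simp add: path_compose_join)
qed

lemma homotopic_paths_left_unit:
  fixes p :: "real \<Rightarrow> 'a::topological_space"
  assumes "path p" "path_image p \<subseteq> S"
  shows "homotopic_paths S ((\<lambda>_. pathstart p) +++ p) p"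
proof -
  have "homotopic_paths S (p \<circ> (linepath 0 0 +++ linepath 0 1)) (p \<circ> linepath 0 1)"
    using assms by (intro homotopic_reparametrizations subset_path_image_join linepath_unit_image) auto
  moreover have "p \<circ> linepath 0 1 = p" "p \<circ> linepath 0 0 = (\<lambda>_. pathstart p)"
    by (auto simp: linepath_def pathstart_def)
  ultimately show ?thesis by (simp add: path_compose_join)
qed

lemma homotopic_paths_right_inverse:
  fixes p :: "real \<Rightarrow> 'a::topological_space"
  assumes "path p" "path_image p \<subseteq> S"
  shows "homotopic_paths S (p +++ reversepath p) (\<lambda>_. pathstart p)"
proof -
  have "homotopic_paths S (p \<circ> (linepath 0 1 +++ linepath 1 0)) (p \<circ> linepath 0 0)"
    using assms by (intro homotopic_reparametrizations subset_path_image_join linepath_unit_image) auto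
  moreover have "p \<circ> linepath 0 1 = p" "p \<circ> linepath 1 0 = reversepath p" "p \<circ> linepath 0 0 = (\<lambda>_. pathstart p)"
    by (auto simp: linepath_def pathstart_def reversepath_def)
  ultimately show ?thesis by (simp add: path_compose_join)
qed

lemma homotopic_paths_cancel_middle:
  fixes p :: "real \<Rightarrow> 'a::topological_space"
  assumes "path p" "path q" "path r" "path_image p \<subseteq> S" "path_image q \<subseteq> S" "path_image r \<subseteq> S"
    and "pathfinish p = pathstart q" "pathstart r = pathstart q"
  shows "homotopic_paths S ((p +++ q) +++ (reversepath q +++ r)) (p +++ r)"
proof -
  let ?c = "\<lambda>_::real. pathstart q"
  have [simp]: "path ?c" "path_image ?c \<subseteq> S" "pathstart ?c = pathstart q" "pathfinish ?c = pathstart q"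
    using assms(5) by (auto simp: path_def path_image_def pathstart_def pathfinish_def)
  have "homotopic_paths S ((p +++ q) +++ (reversepath q +++ r)) (p +++ (q +++ (reversepath q +++ r)))"
    using assms by (intro homotopic_paths_sym[OF homotopic_paths_assoc])
      (auto simp: path_image_join)
  also have "homotopic_paths S \<dots> (p +++ ((q +++ reversepath q) +++ r))"
    using assms by (intro homotopic_paths_join homotopic_paths_assoc) auto
  also have "homotopic_paths S \<dots> (p +++ (?c +++ r))"
    using assms by (intro homotopic_paths_join homotopic_paths_right_inverse) auto
  also have "homotopic_paths S \<dots> (p +++ r)"
    using assms homotopic_paths_left_unit[of r S] by (intro homotopic_paths_join) auto
  finally show ?thesis .
qed

lemma path_class_eq_iff:
  assumes "path p" "path_image p \<subseteq> X"
  shows "path_class X p = path_class X q \<longleftrightarrow> homotopic_paths X p q"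
proof
  assume "path_class X p = path_class X q"
  then have "p \<in> path_class X q" using assms by (auto simp: path_class_def)
  then show "homotopic_paths X p q" by (auto simp: path_class_def homotopic_paths_sym)
next
  assume "homotopic_paths X p q"
  then show "path_class X p = path_class X q"
    by (auto simp: path_class_def intro: homotopic_paths_trans homotopic_paths_sym)
qed

subsection \<open>Deck transformations\<close>

context raag_graph
begin

lemma glue_homotopy:
  assumes "convex C" "glue ` C \<subseteq> X" "path p" "path q" "path_image p \<subseteq> C" "path_image q \<subseteq> C"
    "pathstart p = pathstart q" "pathfinish p = pathfinish q"
  shows "homotopic_paths X (glue \<circ> p) (glue \<circ> q)"
  using assms continuous_on_glue by (intro homotopic_images_of_convex[of C]) auto

abbreviation Salvetti :: "(complex ^ 'e) set" where
  "Salvetti \<equiv> points (salvetti E)"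

lemma Salvetti_subset_T_A: "Salvetti \<subseteq> T_A"
proof
  fix z assume z: "z \<in> Salvetti"
  define x where "x = (\<chi> i. turn (z $ i))"
  have n: "norm (z $ i) = 1" for i using z by (simp add: salvetti_def)
  have "z = glue x"
    using cis_turn[OF n] by (simp add: x_def glue_def vec_eq_iff)
  moreover have "x \<in> truncated_cube E"
    unfolding truncated_cube_def
  proof (intro CollectI conjI allI impI)
    show b: "\<bar>x $ i\<bar> \<le> 1" for i
      using turn_bounds[of "z $ i"] by (simp add: x_def)
    fix i j assume ij: "i \<noteq> j \<and> \<not> E i j"
    then have "z $ i = 1 \<or> z $ j = 1" using z by (auto simp: salvetti_def)
    moreover have "turn 1 = 0" by (simp add: turn_def)
    ultimately have "x $ i = 0 \<or> x $ j = 0" by (auto simp: x_def)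
    then show "\<bar>x $ i\<bar> + \<bar>x $ j\<bar> \<le> 3 / 2" using b[of i] b[of j] by auto
  qed
  ultimately show "z \<in> T_A" by (auto simp: raag_manifold_def)
qed

lemma glue_flat_in_Salvetti:
  assumes "clique K" "\<And>i. x $ i \<noteq> 0 \<Longrightarrow> i \<in> K"
  shows "glue x \<in> Salvetti"
proof -
  have "E i j" if "i \<noteq> j" "cis (pi * x $ i) \<noteq> 1" "cis (pi * x $ j) \<noteq> 1" for i j
    using that assms by (metis clique_def cis_zero mult_zero_right)
  then show ?thesis by (simp add: salvetti_def glue_def)
qed

lemma glue_even_shift:
  assumes "\<And>k. a $ k / 2 \<in> \<int>"
  shows "glue (a + x) = glue x"
proof -
  have "cis (pi * a $ k) = 1" for k
    using cis_multiple_2pi[OF assms[of k]] by simp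
  then show ?thesis by (simp add: glue_def vec_eq_iff distrib_left cis_mult[symmetric])
qed

lemma letter_loop_linepath:
  assumes "\<And>k. a $ k / 2 \<in> \<int>"
  shows "letter_loop x = glue \<circ> linepath a (a + 2 *\<^sub>R dir x)"
proof
  fix t
  have "linepath a (a + 2 *\<^sub>R dir x) t = a + (2 * t) *\<^sub>R dir x"
    by (simp add: linepath_def algebra_simps)
  then show "letter_loop x t = (glue \<circ> linepath a (a + 2 *\<^sub>R dir x)) t"
    by (simp add: letter_loop_eq glue_even_shift[OF assms])
qed

lemma letter_loop_image: "path_image (letter_loop x) \<subseteq> Salvetti"
  unfolding letter_loop_eq path_image_def
  by (auto intro!: glue_flat_in_Salvetti[where K = "{fst x}"] simp: clique_def dir_nth split: if_splits)

lemma word_loop_image: "path_image (word_loop w) \<subseteq> Salvetti"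
proof (induction w)
  case Nil
  have "(1 :: complex ^ 'e) \<in> Salvetti" by (simp add: salvetti_def)
  then show ?case by (auto simp: path_image_def)
next
  case (Cons x w)
  then show ?case
    using letter_loop_image[of x] by (auto simp: word_loop_Cons path_image_join simp del: word_loop.simps)
qed

lemma letter_loop_inverse: "letter_loop (i, \<not> s) = reversepath (letter_loop (i, s))"
  by (auto simp: letter_loop_def)

text \<open>
  The plane spanned by two commuting directions maps to the Salvetti complex, and both sides are
  the image of a path in this plane along two edges of a square.
\<close>
lemma letter_loops_commute:
  assumes "E (fst x) (fst y)"
  shows "homotopic_paths Salvetti (letter_loop x +++ letter_loop y) (letter_loop y +++ letter_loop x)"
proof -
  define C where "C = {v :: real ^ 'e. \<forall>k. v $ k \<noteq> 0 \<longrightarrow> k \<in> {fst x, fst y}}"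
  have C: "convex C" unfolding C_def convex_def by force
  have dirC: "dir x \<in> C" "dir y \<in> C" "0 \<in> C" by (auto simp: C_def dir_nth)
  have addC: "u \<in> C \<Longrightarrow> v \<in> C \<Longrightarrow> u + 2 *\<^sub>R v \<in> C" for u v
    unfolding C_def by (auto, metis add_cancel_left_left mult_zero_right)
  have even: "(2 *\<^sub>R dir x) $ k / 2 \<in> \<int>" for x k by (simp add: dir_nth)
  have loop: "letter_loop x +++ letter_loop y =
      glue \<circ> (linepath 0 (2 *\<^sub>R dir x) +++ linepath (2 *\<^sub>R dir x) (2 *\<^sub>R dir x + 2 *\<^sub>R dir y))" for x y
    unfolding path_compose_join
    using letter_loop_linepath[of 0 x] letter_loop_linepath[OF even, of y x] by simp
  show ?thesis
    unfolding loop
  proof (rule glue_homotopy[OF C])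
    show "glue ` C \<subseteq> Salvetti"
      using assms E_sym by (auto intro!: glue_flat_in_Salvetti[where K = "{fst x, fst y}"] simp: C_def clique_def)
    have "2 *\<^sub>R dir x \<in> C" "2 *\<^sub>R dir y \<in> C" "2 *\<^sub>R dir x + 2 *\<^sub>R dir y \<in> C" "2 *\<^sub>R dir y + 2 *\<^sub>R dir x \<in> C"
      using addC[OF dirC(3) dirC(1)] addC[OF dirC(3) dirC(2)] addC dirC by auto
    then show "path_image (linepath 0 (2 *\<^sub>R dir x) +++ linepath (2 *\<^sub>R dir x) (2 *\<^sub>R dir x + 2 *\<^sub>R dir y)) \<subseteq> C"
      "path_image (linepath 0 (2 *\<^sub>R dir y) +++ linepath (2 *\<^sub>R dir y) (2 *\<^sub>R dir y + 2 *\<^sub>R dir x)) \<subseteq> C"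
      using dirC(3) C by (simp_all add: path_image_two_legs)
  qed (auto simp: add.commute)
qed

lemma word_loop_append:
  assumes "Salvetti \<subseteq> X"
  shows "homotopic_paths X (word_loop (u @ w)) (word_loop u +++ word_loop w)"
proof -
  have im: "path_image (word_loop (v :: 'e word)) \<subseteq> X" "path_image (letter_loop x) \<subseteq> X" for v x
    using word_loop_image letter_loop_image assms by blast+
  show ?thesis
  proof (induction u)
    case Nil
    have "(\<lambda>_. 1) = linepath (pathstart (word_loop w)) (pathstart (word_loop w))"
      by (auto simp: linepath_def scaleR_left_distrib[symmetric])
    then show ?case
      using homotopic_paths_sym[OF homotopic_paths_lid[of "word_loop w" X]] im by simp
  next
    case (Cons x u)
    have "homotopic_paths X (letter_loop x +++ word_loop (u @ w)) (letter_loop x +++ (word_loop u +++ word_loop w))"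
      using Cons im by (intro homotopic_paths_join) auto
    also have "homotopic_paths X \<dots> ((letter_loop x +++ word_loop u) +++ word_loop w)"
      using im by (intro homotopic_paths_assoc) auto
    finally show ?case by (simp add: word_loop_Cons del: word_loop.simps)
  qed
qed

lemma word_loop_single:
  "homotopic_paths Salvetti (word_loop [x]) (letter_loop x)"
proof -
  have "(\<lambda>_. 1) = linepath (pathfinish (letter_loop x)) (pathfinish (letter_loop x))"
    by (auto simp: linepath_def scaleR_left_distrib[symmetric])
  then show ?thesis
    using homotopic_paths_rid[of "letter_loop x" Salvetti] letter_loop_image[of x]
    by (simp add: word_loop_Cons del: word_loop.simps(2))
qed

lemma word_loop_pair:
  "homotopic_paths Salvetti (word_loop [x, y]) (letter_loop x +++ letter_loop y)"
  using homotopic_paths_join[OF homotopic_paths_refl[THEN iffD2] word_loop_single[of y], of "letter_loop x"]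
    letter_loop_image[of x]
  by (simp add: word_loop_Cons[of x] del: word_loop.simps(2))

lemma word_loop_step: "raag_step E u w \<Longrightarrow> homotopic_paths Salvetti (word_loop u) (word_loop w)"
proof -
  have mid: "homotopic_paths Salvetti (word_loop (a @ m @ b)) (word_loop (a @ m' @ b))"
    if "homotopic_paths Salvetti (word_loop m) (word_loop m')" for a b m m'
  proof -
    have *: "homotopic_paths Salvetti (word_loop (a @ m @ b)) (word_loop a +++ (word_loop m +++ word_loop b))" for m
      using homotopic_paths_trans[OF word_loop_append homotopic_paths_join[OF homotopic_paths_refl[THEN iffD2] word_loop_append]]
        word_loop_image by auto
    have "homotopic_paths Salvetti (word_loop a +++ (word_loop m +++ word_loop b)) (word_loop a +++ (word_loop m' +++ word_loop b))"
      using that word_loop_image by (intro homotopic_paths_join) auto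
    then show ?thesis
      using * homotopic_paths_sym homotopic_paths_trans by blast
  qed
  assume "raag_step E u w"
  then show ?thesis
  proof cases
    case (cancel a i s b)
    have "homotopic_paths Salvetti (letter_loop (i, s) +++ letter_loop (i, \<not> s)) (linepath 1 1)"
      using homotopic_paths_rinv[of "letter_loop (i, s)" Salvetti] letter_loop_image[of "(i, s)"]
      by (simp add: letter_loop_inverse)
    moreover have "linepath 1 1 = (word_loop [] :: real \<Rightarrow> complex ^ 'e)"
      by (auto simp: linepath_def scaleR_left_distrib[symmetric])
    ultimately have "homotopic_paths Salvetti (word_loop [(i, s), (i, \<not> s)]) (word_loop [])"
      using homotopic_paths_trans[OF word_loop_pair] by metis
    from mid[OF this, of a b] show ?thesis using cancel by simp
  next
    case (commute i j a s t b)
    have "homotopic_paths Salvetti (word_loop [(i, s), (j, t)]) (word_loop [(j, t), (i, s)])"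
      using homotopic_paths_trans[OF homotopic_paths_trans[OF word_loop_pair letter_loops_commute] homotopic_paths_sym[OF word_loop_pair]]
        commute by (metis fst_conv)
    from mid[OF this, of a b] show ?thesis using commute by simp
  qed
qed

lemma word_loop_equiv:
  assumes "u \<sim>\<^sub>R w" "Salvetti \<subseteq> X"
  shows "homotopic_paths X (word_loop u) (word_loop w)"
proof -
  have "homotopic_paths Salvetti (word_loop u) (word_loop w)"
    using assms(1)
  proof (induction rule: equivclp_induct)
    case (step y z)
    then show ?case using word_loop_step homotopic_paths_sym homotopic_paths_trans by blast
  qed (simp add: word_loop_image)
  then show ?thesis using assms(2) homotopic_paths_subset by blast
qed

text \<open>
  Any word of the group element may be used to compute the deck transformation, because the
  relations hold up to homotopy already in the Salvetti complex.
\<close>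
lemma deck_path_class:
  assumes "Salvetti \<subseteq> X" "path p" "path_image p \<subseteq> X" "pathstart p = 1"
  shows "deck X (word_class E w) (path_class X p) = path_class X (word_loop w +++ p)"
proof (rule Set.set_eqI, rule iffI)
  fix r assume "r \<in> path_class X (word_loop w +++ p)"
  then show "r \<in> deck X (word_class E w) (path_class X p)"
    using assms unfolding deck_def path_class_def
    by (intro CollectI bexI[of _ w] bexI[of _ p]) auto
next
  fix r assume "r \<in> deck X (word_class E w) (path_class X p)"
  then obtain w' p' where "w \<sim>\<^sub>R w'" "homotopic_paths X p p'" "homotopic_paths X (word_loop w' +++ p') r"
    by (auto simp: deck_def path_class_def mem_word_class)
  moreover from this have "homotopic_paths X (word_loop w +++ p) (word_loop w' +++ p')"
    using assms by (intro homotopic_paths_join word_loop_equiv) auto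
  ultimately show "r \<in> path_class X (word_loop w +++ p)"
    unfolding path_class_def using homotopic_paths_trans by blast
qed

subsection \<open>Copies of the truncated cube\<close>

lemma glue_T_A: "x \<in> truncated_cube E \<Longrightarrow> glue x \<in> T_A"
  by (simp add: raag_manifold_def)

lemma spoke_image: "x \<in> truncated_cube E \<Longrightarrow> path_image (spoke x) \<subseteq> T_A"
  by (auto simp: spoke_def path_image_def linepath_def intro!: glue_T_A truncated_cube_scale)

lemma word_loop_image_T_A: "path_image (word_loop w) \<subseteq> T_A"
  using word_loop_image Salvetti_subset_T_A by blast

lemma cell_copy_eq:
  assumes "x \<in> truncated_cube E"
  shows "cell_copy E (word_class E w) x = path_class T_A (word_loop w +++ spoke x)"
  unfolding cell_copy_def spoke_def[symmetric]
  using assms by (intro deck_path_class Salvetti_subset_T_A spoke_image) auto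

lemma cell_copy_eq_iff:
  assumes "x \<in> truncated_cube E" "y \<in> truncated_cube E"
  shows "cell_copy E (word_class E u) x = cell_copy E (word_class E w) y \<longleftrightarrow>
         homotopic_paths T_A (word_loop u +++ spoke x) (word_loop w +++ spoke y)"
  unfolding cell_copy_eq[OF assms(1)] cell_copy_eq[OF assms(2)]
  using assms word_loop_image_T_A spoke_image by (intro path_class_eq_iff) (auto simp: path_image_join)

lemma convex_truncated_cube: "convex (truncated_cube E)"
proof -
  have c: "convex {x :: real ^ 'e. \<bar>x $ i\<bar> \<le> 1}" for i
    unfolding convex_def
  proof (intro ballI allI impI CollectI)
    fix x y :: "real ^ 'e" and u v :: real
    assume a: "x \<in> {x. \<bar>x $ i\<bar> \<le> 1}" "y \<in> {x. \<bar>x $ i\<bar> \<le> 1}" "0 \<le> u" "0 \<le> v" "u + v = 1"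
    have "\<bar>u * x $ i + v * y $ i\<bar> \<le> u * \<bar>x $ i\<bar> + v * \<bar>y $ i\<bar>"
      using a by (auto intro!: order_trans[OF abs_triangle_ineq] simp: abs_mult)
    also have "\<dots> \<le> 1" using a by (intro convex_bound_le) auto
    finally show "\<bar>(u *\<^sub>R x + v *\<^sub>R y) $ i\<bar> \<le> 1" by simp
  qed
  have d: "convex {x :: real ^ 'e. \<bar>x $ i\<bar> + \<bar>x $ j\<bar> \<le> 3 / 2}" for i j
    unfolding convex_def
  proof (intro ballI allI impI CollectI)
    fix x y :: "real ^ 'e" and u v :: real
    assume a: "x \<in> {x. \<bar>x $ i\<bar> + \<bar>x $ j\<bar> \<le> 3 / 2}" "y \<in> {x. \<bar>x $ i\<bar> + \<bar>x $ j\<bar> \<le> 3 / 2}"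
      "0 \<le> u" "0 \<le> v" "u + v = 1"
    have "\<bar>u * x $ k + v * y $ k\<bar> \<le> u * \<bar>x $ k\<bar> + v * \<bar>y $ k\<bar>" for k
      using a by (auto intro!: order_trans[OF abs_triangle_ineq] simp: abs_mult)
    from this[of i] this[of j]
    have "\<bar>u * x $ i + v * y $ i\<bar> + \<bar>u * x $ j + v * y $ j\<bar> \<le>
        u * (\<bar>x $ i\<bar> + \<bar>x $ j\<bar>) + v * (\<bar>y $ i\<bar> + \<bar>y $ j\<bar>)"
      by (simp add: algebra_simps)
    also have "\<dots> \<le> 3 / 2" using a by (intro convex_bound_le) auto
    finally show "\<bar>(u *\<^sub>R x + v *\<^sub>R y) $ i\<bar> + \<bar>(u *\<^sub>R x + v *\<^sub>R y) $ j\<bar> \<le> 3 / 2" by simp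
  qed
  have "truncated_cube E = (\<Inter>i. {x. \<bar>x $ i\<bar> \<le> 1}) \<inter>
      (\<Inter>(i, j)\<in>{(i, j). i \<noteq> j \<and> \<not> E i j}. {x. \<bar>x $ i\<bar> + \<bar>x $ j\<bar> \<le> 3 / 2})"
    by (auto simp: truncated_cube_def)
  also have "convex \<dots>" using c d by (intro convex_Int convex_INT) auto
  finally show ?thesis .
qed

lemma dir_in_truncated_cube: "\<bar>c\<bar> \<le> 1 \<Longrightarrow> c *\<^sub>R dir x \<in> truncated_cube E"
  by (auto simp: truncated_cube_def dir_nth)

text \<open>
  The non-ideal facet \<open>y\<close> of the copy of \<open>w\<close> is the opposite facet of
  the copy of \<open>w @ [y]\<close>. The loop of the letter \<open>y\<close> goes from the centre
  of the cube to the facet \<open>y\<close> and on from the opposite facet to the centre; followed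
  by the spoke to \<open>x - 2 *\<^sub>R dir y\<close> it backtracks and leaves a path homotopic
  to the spoke to \<open>x\<close>.
\<close>
lemma cell_copy_flip:
  assumes x: "x \<in> truncated_cube E" and y: "x $ fst y = (if snd y then 1 else -1)"
  shows "x - 2 *\<^sub>R dir y \<in> truncated_cube E"
    "cell_copy E (word_class E w) x = cell_copy E (word_class E (w @ [y])) (x - 2 *\<^sub>R dir y)"
proof -
  define x' where "x' = x - 2 *\<^sub>R dir y"
  show x': "x - 2 *\<^sub>R dir y \<in> truncated_cube E"
    by (rule truncated_cube_convexity[OF _ x]) (use y in \<open>auto simp: dir_nth\<close>)
  have x'T: "x' \<in> truncated_cube E" using x' by (simp add: x'_def)
  let ?d = "dir y"
  have d: "?d \<in> truncated_cube E" "- ?d \<in> truncated_cube E" "0 \<in> truncated_cube E"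
    using dir_in_truncated_cube[of 1 y] dir_in_truncated_cube[of "-1" y] dir_in_truncated_cube[of 0 y] by auto
  have even: "(2 *\<^sub>R ?d) $ k / 2 \<in> \<int>" for k by (simp add: dir_nth)
  have shift: "glue \<circ> linepath (2 *\<^sub>R ?d + a) (2 *\<^sub>R ?d + b) = glue \<circ> linepath a b" for a b
  proof
    fix t
    have "linepath (2 *\<^sub>R ?d + a) (2 *\<^sub>R ?d + b) t = 2 *\<^sub>R ?d + linepath a b t"
      by (simp add: linepath_def algebra_simps)
    then show "(glue \<circ> linepath (2 *\<^sub>R ?d + a) (2 *\<^sub>R ?d + b)) t = (glue \<circ> linepath a b) t"
      by (simp only: o_apply glue_even_shift[OF even])
  qed
  \<comment> \<open>The two halves of the loop of the letter, and the way from the opposite facet to the point.\<close>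
  define A where "A = glue \<circ> linepath 0 ?d"
  define B where "B = glue \<circ> linepath (- ?d) 0"
  define C where "C = glue \<circ> linepath (- ?d) x'"
  have "2 *\<^sub>R ?d + - ?d = ?d" by (simp add: scaleR_2)
  then have shift': "glue \<circ> linepath ?d (2 *\<^sub>R ?d) = B" "glue \<circ> linepath ?d x = C"
    unfolding B_def C_def x'_def using shift[of "- ?d" 0] shift[of "- ?d" "x - 2 *\<^sub>R ?d"] by simp_all
  have seg: "path_image (linepath a b) \<subseteq> truncated_cube E" if "a \<in> truncated_cube E" "b \<in> truncated_cube E" for a b
    using that closed_segment_subset[OF _ _ convex_truncated_cube] by auto
  have gT: "glue ` truncated_cube E \<subseteq> T_A" by (simp add: raag_manifold_def)
  have glue_seg: "path (glue \<circ> linepath a b)"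
    "path_image (glue \<circ> linepath a b) \<subseteq> T_A" if "a \<in> truncated_cube E" "b \<in> truncated_cube E" for a b
    using seg[OF that] gT
    by (auto simp: path_image_compose intro!: path_continuous_image continuous_on_glue)
  have ABC: "path A" "path B" "path C" "path_image A \<subseteq> T_A" "path_image B \<subseteq> T_A" "path_image C \<subseteq> T_A"
    using glue_seg d x'T unfolding A_def B_def C_def by auto
  have mdd: "glue (- ?d) = glue ?d"
    using glue_even_shift[OF even, of "- ?d"] by (simp add: scaleR_2)
  have AB: "pathfinish A = pathstart B" "pathstart C = pathstart B"
    using mdd by (simp_all add: A_def B_def C_def pathstart_compose pathfinish_compose)
  have 1: "homotopic_paths T_A (spoke x) (A +++ C)"
  proof -
    have "homotopic_paths T_A (spoke x) (glue \<circ> (linepath 0 ?d +++ linepath ?d x))"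
      unfolding spoke_def using d x seg
      by (intro glue_homotopy[OF convex_truncated_cube gT]) (auto simp: path_image_join)
    then show ?thesis by (simp only: path_compose_join shift'(2) A_def)
  qed
  have 2: "homotopic_paths T_A (letter_loop y) (A +++ B)"
  proof -
    have "homotopic_paths T_A (glue \<circ> linepath 0 (2 *\<^sub>R ?d)) (glue \<circ> (linepath 0 ?d +++ linepath ?d (2 *\<^sub>R ?d)))"
    proof (rule glue_homotopy[of "range (\<lambda>c. c *\<^sub>R ?d)"])
      show cv: "convex (range (\<lambda>c. c *\<^sub>R ?d))"
        by (intro convex_linear_image convex_UNIV bounded_linear.linear bounded_linear_scaleR_left)
      have "glue (c *\<^sub>R ?d) \<in> Salvetti" for c
        by (intro glue_flat_in_Salvetti[where K = "{fst y}"]) (auto simp: clique_def dir_nth split: if_splits)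
      then show "glue ` range (\<lambda>c. c *\<^sub>R ?d) \<subseteq> T_A" using Salvetti_subset_T_A by auto
      have "c *\<^sub>R ?d \<in> range (\<lambda>c. c *\<^sub>R ?d)" for c by (rule rangeI)
      from this[of 0] this[of 1] this[of 2]
      have "0 \<in> range (\<lambda>c. c *\<^sub>R ?d)" "?d \<in> range (\<lambda>c. c *\<^sub>R ?d)" "2 *\<^sub>R ?d \<in> range (\<lambda>c. c *\<^sub>R ?d)"
        by simp_all
      then show "path_image (linepath 0 (2 *\<^sub>R ?d)) \<subseteq> range (\<lambda>c. c *\<^sub>R ?d)"
        "path_image (linepath 0 ?d +++ linepath ?d (2 *\<^sub>R ?d)) \<subseteq> range (\<lambda>c. c *\<^sub>R ?d)"
        using cv path_image_two_legs[OF cv] by (simp_all add: closed_segment_subset)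
    qed auto
    then show ?thesis using letter_loop_linepath[of 0 y] by (simp add: path_compose_join shift'(1) A_def)
  qed
  have 3: "homotopic_paths T_A (spoke x') (reversepath B +++ C)"
  proof -
    have "homotopic_paths T_A (spoke x') (glue \<circ> (linepath 0 (- ?d) +++ linepath (- ?d) x'))"
      unfolding spoke_def using d x'T seg
      by (intro glue_homotopy[OF convex_truncated_cube gT]) (auto simp: path_image_join)
    moreover have "reversepath B = glue \<circ> linepath 0 (- ?d)"
      by (auto simp: B_def reversepath_def linepath_def)
    ultimately show ?thesis by (simp only: path_compose_join C_def)
  qed
  have 4: "homotopic_paths T_A (letter_loop y +++ spoke x') (spoke x)"
  proof -
    have "homotopic_paths T_A (letter_loop y +++ spoke x') ((A +++ B) +++ (reversepath B +++ C))"
      by (intro homotopic_paths_join 2 3) simp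
    also have "homotopic_paths T_A \<dots> (A +++ C)"
      using ABC AB by (intro homotopic_paths_cancel_middle) auto
    also have "homotopic_paths T_A \<dots> (spoke x)" using 1 by (rule homotopic_paths_sym)
    finally show ?thesis .
  qed
  have lT: "path_image (letter_loop y) \<subseteq> T_A" using letter_loop_image Salvetti_subset_T_A by blast
  have "homotopic_paths T_A (word_loop (w @ [y]) +++ spoke x') ((word_loop w +++ word_loop [y]) +++ spoke x')"
    using x'T spoke_image word_loop_append[OF Salvetti_subset_T_A]
    by (intro homotopic_paths_join) auto
  also have "homotopic_paths T_A \<dots> ((word_loop w +++ letter_loop y) +++ spoke x')"
    using x'T spoke_image word_loop_image_T_A homotopic_paths_subset[OF word_loop_single Salvetti_subset_T_A]
    by (intro homotopic_paths_join) auto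
  also have "homotopic_paths T_A \<dots> (word_loop w +++ (letter_loop y +++ spoke x'))"
    using x'T spoke_image word_loop_image_T_A lT
    by (intro homotopic_paths_sym[OF homotopic_paths_assoc]) auto
  also have "homotopic_paths T_A \<dots> (word_loop w +++ spoke x)"
    using word_loop_image_T_A 4 by (intro homotopic_paths_join) auto
  finally show "cell_copy E (word_class E w) x = cell_copy E (word_class E (w @ [y])) (x - 2 *\<^sub>R dir y)"
    unfolding x'_def[symmetric] using cell_copy_eq_iff[OF x'T x] homotopic_paths_sym by metis
qed

section \<open>Tiles and group elements\<close>

text \<open>
  Copies overlap only along non-ideal facets: the end points of the spokes have equal images in
  the torus, and the holonomies determine the group elements.
\<close>
lemma cell_copy_eqD:
  assumes "g \<in> carrier (raag E)" "h \<in> carrier (raag E)" "x \<in> truncated_cube E" "y \<in> truncated_cube E"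
    and eq: "cell_copy E g x = cell_copy E h y"
  shows "g \<cdot> boundary_shift x = h \<cdot> boundary_shift y"
    "y $ i = x $ i \<or> \<bar>x $ i\<bar> = 1 \<and> y $ i = - x $ i"
proof -
  obtain u w where uw: "g = word_class E u" "h = word_class E w"
    using assms(1,2) by (metis raag_carrierE)
  then have hom: "homotopic_paths T_A (word_loop u +++ spoke x) (word_loop w +++ spoke y)"
    using eq cell_copy_eq_iff assms(3,4) by blast
  then show "g \<cdot> boundary_shift x = h \<cdot> boundary_shift y"
    using homotopic_word_loop_spoke_imp[OF assms(3,4)] uw by simp
  have "glue x = glue y" using homotopic_paths_imp_pathfinish[OF hom] by simp
  then have "cis (pi * x $ i) = cis (pi * y $ i)" by (auto simp: glue_def vec_eq_iff)
  then have "x $ i - 2 * winding_part (x $ i) = y $ i - 2 * winding_part (y $ i)"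
    using turn_cis by metis
  moreover have "\<bar>x $ i\<bar> \<le> 1" "\<bar>y $ i\<bar> \<le> 1" using assms(3,4) by (auto simp: truncated_cube_def)
  ultimately show "y $ i = x $ i \<or> \<bar>x $ i\<bar> = 1 \<and> y $ i = - x $ i"
    by (auto simp: winding_part_eq split: if_splits)
qed

lemma boundary_shift_interior: "(\<And>i. x $ i \<noteq> -1) \<Longrightarrow> boundary_shift x = \<one>\<^bsub>raag E\<^esub>"
  by (simp add: boundary_shift_def)

lemma boundary_shift_carrier [simp]: "boundary_shift x \<in> carrier (raag E)"
  by (simp add: boundary_shift_def)

lemma cell_copy_interior_unique:
  assumes "g \<in> carrier (raag E)" "h \<in> carrier (raag E)" "x \<in> truncated_cube E" "y \<in> truncated_cube E"
    and "cell_copy E g x = cell_copy E h y" "\<And>i. \<bar>x $ i\<bar> < 1"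
  shows "g = h"
proof -
  have "y $ i = x $ i" for i
    using cell_copy_eqD(2)[OF assms(1-5), of i] assms(6)[of i] by auto
  moreover have "x $ i \<noteq> - 1" for i using assms(6)[of i] by auto
  ultimately show ?thesis
    using cell_copy_eqD(1)[OF assms(1-5)] assms(1,2) by (simp add: boundary_shift_interior)
qed

lemma cell_copy_flips:
  assumes "clique_word K" "x \<in> truncated_cube E" "\<And>y. y \<in> set K \<Longrightarrow> x $ fst y = (if snd y then 1 else -1)"
  shows "\<exists>x'\<in>truncated_cube E. cell_copy E (word_class E w) x = cell_copy E (word_class E (w @ K)) x'"
  using assms
proof (induction K arbitrary: x w)
  case (Cons y K)
  note flip = cell_copy_flip(1)[of x y] cell_copy_flip(2)[of x y w]
  have "clique_word K" using Cons.prems(1) by (simp add: clique_word_def)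
  moreover have "x - 2 *\<^sub>R dir y \<in> truncated_cube E" using flip Cons.prems by simp
  moreover have "(x - 2 *\<^sub>R dir y) $ fst z = (if snd z then 1 else -1)" if "z \<in> set K" for z
  proof -
    have "fst z \<noteq> fst y" using Cons.prems(1) that by (force simp: clique_word_def)
    then show ?thesis using Cons.prems(3)[of z] that by (simp add: dir_nth)
  qed
  ultimately obtain x' where x': "x' \<in> truncated_cube E"
      "cell_copy E (word_class E (w @ [y])) (x - 2 *\<^sub>R dir y) = cell_copy E (word_class E ((w @ [y]) @ K)) x'"
    using Cons.IH by blast
  have "cell_copy E (word_class E w) x = cell_copy E (word_class E (w @ [y])) (x - 2 *\<^sub>R dir y)"
    using flip(2) Cons.prems by simp
  then show ?case using x' by (intro bexI[of _ x']) simp_all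
qed auto

text \<open>
  A common point lies on some facets of the first copy, whose generators commute; the two elements
  differ by the product of those facets that have to be crossed. Conversely the corner of the cube
  in the direction of a clique word is carried to the second copy by crossing the facets one after
  the other.
\<close>
lemma copies_meet_iff:
  assumes "g \<in> carrier (raag E)" "h \<in> carrier (raag E)"
  shows "copy E g \<inter> copy E h \<noteq> {} \<longleftrightarrow> (\<exists>K. clique_word K \<and> h = g \<cdot> word_class E K)"
proof
  assume "copy E g \<inter> copy E h \<noteq> {}"
  then obtain x y where xy: "x \<in> truncated_cube E" "y \<in> truncated_cube E" "cell_copy E g x = cell_copy E h y"
    by auto
  note eq = cell_copy_eqD[OF assms xy]
  define K where "K = {i. \<bar>x $ i\<bar> = 1}"
  \<comment> \<open>The exponents of the quotient of the two boundary shifts.\<close>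
  define c where "c i = (if x $ i = -1 then -1 else 0) - (if y $ i = -1 then -1 else 0 :: int)" for i
  have K: "clique K" unfolding K_def using xy(1) by (rule clique_unit_coords)
  have y: "\<bar>y $ i\<bar> = 1 \<Longrightarrow> i \<in> K" for i using eq(2)[of i] by (auto simp: K_def)
  have yK: "y $ i = -1 \<Longrightarrow> i \<in> K" "x $ i = -1 \<Longrightarrow> i \<in> K" for i
    using y[of i] by (auto simp: K_def)
  have cK: "c i \<noteq> 0 \<Longrightarrow> i \<in> K" for i
    using yK[of i] by (auto simp: c_def split: if_splits)
  have "monomial c \<cdot> boundary_shift y = boundary_shift x"
    unfolding boundary_shift_def
    by (subst monomial_add[OF K]) (use cK yK in \<open>auto simp: c_def split: if_splits\<close>)
  then have "(g \<cdot> monomial c) \<cdot> boundary_shift y = h \<cdot> boundary_shift y"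
    using eq(1) assms by (simp add: RG.m_assoc)
  then have "h = g \<cdot> monomial c"
    using assms by (simp add: RG.right_cancel)
  moreover obtain w where "clique_word w" "monomial c = word_class E w"
  proof -
    have "c i \<in> {-1, 0, 1}" for i by (simp add: c_def)
    then show ?thesis using monomial_clique_word[OF K cK] that by blast
  qed
  ultimately show "\<exists>K. clique_word K \<and> h = g \<cdot> word_class E K" by auto
next
  assume "\<exists>K. clique_word K \<and> h = g \<cdot> word_class E K"
  then obtain K where K: "clique_word K" "h = g \<cdot> word_class E K" by blast
  obtain w where w: "g = word_class E w" using assms(1) by (rule raag_carrierE)
  define x :: "real ^ 'e" where
    "x = (\<chi> k. if (k, True) \<in> set K then 1 else if (k, False) \<in> set K then -1 else 0)"
  have xT: "x \<in> truncated_cube E"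
    unfolding truncated_cube_def
  proof (intro CollectI conjI allI impI)
    fix i j assume ij: "i \<noteq> j \<and> \<not> E i j"
    have "x $ i = 0 \<or> x $ j = 0"
    proof (rule ccontr)
      assume "\<not> ?thesis"
      then obtain s t where "(i, s) \<in> set K" "(j, t) \<in> set K" by (auto simp: x_def split: if_splits)
      then show False using K(1) ij by (force simp: clique_word_def)
    qed
    moreover have "\<bar>x $ i\<bar> \<le> 1" "\<bar>x $ j\<bar> \<le> 1" by (simp_all add: x_def)
    ultimately show "\<bar>x $ i\<bar> + \<bar>x $ j\<bar> \<le> 3 / 2" by auto
  qed (simp add: x_def)
  have "x $ fst y = (if snd y then 1 else -1)" if "y \<in> set K" for y
  proof -
    have "(fst y, True) \<notin> set K" if "\<not> snd y"
    proof
      assume "(fst y, True) \<in> set K"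
      then have "(fst y, True) = y"
        using \<open>y \<in> set K\<close> K(1) by (metis clique_word_def distinct_map fst_conv inj_onD)
      then show False using that by (metis snd_conv)
    qed
    then show ?thesis using that by (cases y; cases "snd y") (auto simp: x_def)
  qed
  from cell_copy_flips[OF K(1) xT this, of w] show "copy E g \<inter> copy E h \<noteq> {}"
    using xT K(2) w by auto
qed

text \<open>
  Adding all copies that meet a ball multiplies by all clique words, that is, adds one layer.
\<close>
lemma cell_ball_eq: "cell_ball E n = \<Union> {copy E g | g. g \<in> carrier (raag E) \<and> clique_norm g \<le> n}"
proof (induction n)
  case 0
  have "g \<in> carrier (raag E) \<and> clique_norm g \<le> 0 \<longleftrightarrow> g = \<one>\<^bsub>raag E\<^esub>" for g
    unfolding le_zero_eq by (metis clique_norm_0_iff RG.one_closed)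
  then have "{copy E g | g. g \<in> carrier (raag E) \<and> clique_norm g \<le> 0} = {copy E \<one>\<^bsub>raag E\<^esub>}"
    by (simp only: singleton_conv) blast
  then show ?case by (simp only: cell_ball.simps ccpo_Sup_singleton)
next
  case (Suc n)
  have "copy E g \<inter> cell_ball E n \<noteq> {} \<longleftrightarrow> clique_norm g \<le> Suc n" if g: "g \<in> carrier (raag E)" for g
  proof
    assume "copy E g \<inter> cell_ball E n \<noteq> {}"
    then obtain h where h: "h \<in> carrier (raag E)" "clique_norm h \<le> n" "copy E h \<inter> copy E g \<noteq> {}"
      unfolding Suc.IH by blast
    then obtain K where "clique_word K" "g = h \<cdot> word_class E K"
      using copies_meet_iff g by blast
    then show "clique_norm g \<le> Suc n" using clique_norm_mult_clique[OF h(1)] h(2) by fastforce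
  next
    assume "clique_norm g \<le> Suc n"
    then obtain h K where h: "h \<in> carrier (raag E)" "clique_norm h \<le> n" "clique_word K"
        "g = h \<cdot> word_class E K"
      using clique_norm_Suc_decompose[OF g] by metis
    then have "copy E h \<inter> copy E g \<noteq> {}" using copies_meet_iff[OF h(1) g] by blast
    then show "copy E g \<inter> cell_ball E n \<noteq> {}" unfolding Suc.IH using h by blast
  qed
  then have "cell_ball E (Suc n) = cell_ball E n \<union>
      \<Union> {copy E g | g. g \<in> carrier (raag E) \<and> clique_norm g \<le> Suc n}"
    by (simp cong: conj_cong)
  moreover have "cell_ball E n \<subseteq> \<Union> {copy E g | g. g \<in> carrier (raag E) \<and> clique_norm g \<le> Suc n}"
    unfolding Suc.IH by fastforce
  ultimately show ?case by (simp only: Un_absorb1)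
qed

text \<open>
  An interior point lies on one copy only.
\<close>
lemma interior_in_ball_iff:
  assumes "g \<in> carrier (raag E)" "x \<in> truncated_cube E" "\<And>i. \<bar>x $ i\<bar> < 1"
  shows "cell_copy E g x \<in> cell_ball E n \<longleftrightarrow> clique_norm g \<le> n"
proof
  assume "cell_copy E g x \<in> cell_ball E n"
  then obtain h y where h: "h \<in> carrier (raag E)" "clique_norm h \<le> n" "y \<in> truncated_cube E"
      "cell_copy E g x = cell_copy E h y"
    unfolding cell_ball_eq by blast
  then have "g = h" using cell_copy_interior_unique[OF assms(1) h(1) assms(2) h(3,4)] assms(3) by blast
  then show "clique_norm g \<le> n" using h by simp
next
  assume "clique_norm g \<le> n"
  then show "cell_copy E g x \<in> cell_ball E n" unfolding cell_ball_eq using assms(1,2) by blast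
qed

lemma zero_in_truncated_cube [simp]: "0 \<in> truncated_cube E"
  using dir_in_truncated_cube[of 0] by simp

lemma copy_subset_ball_iff:
  assumes "g \<in> carrier (raag E)"
  shows "copy E g \<subseteq> cell_ball E n \<longleftrightarrow> clique_norm g \<le> n"
proof
  assume "copy E g \<subseteq> cell_ball E n"
  then have "cell_copy E g 0 \<in> cell_ball E n" using zero_in_truncated_cube by blast
  then show "clique_norm g \<le> n" using interior_in_ball_iff[OF assms, of 0] by simp
next
  assume "clique_norm g \<le> n"
  then show "copy E g \<subseteq> cell_ball E n" unfolding cell_ball_eq using assms by blast
qed

text \<open>
  Continuity of \<open>cell_copy\<close> along a radius, for the topology of the universal cover:
  the class of a path moves continuously when the path is shortened along its last segment. This
  is enough to approximate a point of a facet by interior points of the copy on its other side.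
\<close>
lemma cell_copy_limit:
  assumes U: "openin (universal_cover_topology T_A 1) U"
    and x: "x \<in> truncated_cube E" and xU: "cell_copy E (word_class E w) x \<in> U"
  shows "\<exists>c0<1. \<forall>c. c0 < c \<and> c < 1 \<longrightarrow> cell_copy E (word_class E w) (c *\<^sub>R x) \<in> U"
proof -
  have "generate_topology_on {{path_class T_A (p +++ q) | q.
           path q \<and> path_image q \<subseteq> T_A \<inter> V \<and> pathstart q = pathfinish p} | p V.
        path p \<and> path_image p \<subseteq> T_A \<and> pathstart p = 1 \<and> open V} U"
    using U unfolding universal_cover_topology_def openin_topology_generated_by_iff .
  then show ?thesis
    using xU
  proof induction
    case (Int a b)
    then obtain c1 c2 where "c1 < 1" "\<forall>c. c1 < c \<and> c < 1 \<longrightarrow> cell_copy E (word_class E w) (c *\<^sub>R x) \<in> a"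
      "c2 < 1" "\<forall>c. c2 < c \<and> c < 1 \<longrightarrow> cell_copy E (word_class E w) (c *\<^sub>R x) \<in> b"
      by (metis IntD1 IntD2)
    then show ?case by (intro exI[of _ "max c1 c2"]) auto
  next
    case (UN K)
    then obtain k where k: "k \<in> K" "cell_copy E (word_class E w) x \<in> k" by blast
    then obtain c0 where "c0 < 1" "\<forall>c. c0 < c \<and> c < 1 \<longrightarrow> cell_copy E (word_class E w) (c *\<^sub>R x) \<in> k"
      using UN.IH by blast
    then show ?case using k(1) by blast
  next
    case (Basis s)
    then obtain p V where p: "path p" "path_image p \<subseteq> T_A" "pathstart p = 1" "open V"
      and s: "s = {path_class T_A (p +++ q) | q.
           path q \<and> path_image q \<subseteq> T_A \<inter> V \<and> pathstart q = pathfinish p}" by auto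
    then obtain q where q: "path q" "path_image q \<subseteq> T_A \<inter> V" "pathstart q = pathfinish p"
      "cell_copy E (word_class E w) x = path_class T_A (p +++ q)"
      using Basis.prems by auto
    have im: "path_image (word_loop w +++ spoke x) \<subseteq> T_A"
      using word_loop_image_T_A spoke_image[OF x] by (auto simp: path_image_join)
    have pq: "homotopic_paths T_A (word_loop w +++ spoke x) (p +++ q)"
      using q(4) unfolding cell_copy_eq[OF x] by (subst (asm) path_class_eq_iff) (use im in auto)
    then have "glue x = pathfinish q" using homotopic_paths_imp_pathfinish by fastforce
    then have "glue x \<in> V" using q(2) by auto
    define f where "f c = glue (c *\<^sub>R x)" for c
    have "continuous_on UNIV f"
      unfolding f_def glue_def by (intro continuous_intros)
    then have "open (f -` V)" using p(4) by (simp add: open_vimage)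
    moreover have "1 \<in> f -` V" using \<open>glue x \<in> V\<close> by (simp add: f_def)
    ultimately obtain e where e: "e > 0" "ball 1 e \<subseteq> f -` V" by (meson open_contains_ball)
    show ?case
    proof (intro exI[of _ "max 0 (1 - e)"] conjI allI impI)
      show "max 0 (1 - e) < 1" using e by auto
      fix c assume c: "max 0 (1 - e) < c \<and> c < 1"
      then have cT: "c *\<^sub>R x \<in> truncated_cube E" using x by (intro truncated_cube_scale) auto
      define r where "r = glue \<circ> linepath x (c *\<^sub>R x)"
      have lin: "linepath x (c *\<^sub>R x) t = (1 - t * (1 - c)) *\<^sub>R x" for t
        by (simp add: linepath_def algebra_simps)
      have rV: "path_image r \<subseteq> V"
      proof -
        have "1 - t * (1 - c) \<in> ball 1 e" if "t \<in> {0..1}" for t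
        proof -
          define u where "u = t * (1 - c)"
          have "u \<le> 1 * (1 - c)" using that c unfolding u_def by (intro mult_right_mono) auto
          moreover have "0 \<le> u" unfolding u_def using that c by (intro mult_nonneg_nonneg) auto
          moreover have "1 - c < e" using c by simp
          ultimately show ?thesis unfolding u_def[symmetric] by (simp add: dist_real_def)
        qed
        then have "f (1 - t * (1 - c)) \<in> V" if "t \<in> {0..1}" for t using e(2) that by blast
        moreover have "r t = f (1 - t * (1 - c))" for t by (simp add: r_def lin f_def)
        ultimately show ?thesis unfolding path_image_def by (simp add: image_subset_iff)
      qed
      have rT: "path_image r \<subseteq> T_A"
        using closed_segment_subset[OF x cT convex_truncated_cube]
        by (auto simp: r_def path_image_compose intro!: glue_T_A)
      have r: "path r" "pathstart r = glue x"
        by (auto simp: r_def pathstart_compose intro!: path_continuous_image continuous_on_glue)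
      have "homotopic_paths T_A (spoke (c *\<^sub>R x)) (glue \<circ> (linepath 0 x +++ linepath x (c *\<^sub>R x)))"
        unfolding spoke_def using x cT
        by (intro glue_homotopy[OF convex_truncated_cube] path_image_two_legs convex_truncated_cube)
          (auto intro!: glue_T_A simp: closed_segment_subset convex_truncated_cube)
      then have sp: "homotopic_paths T_A (spoke (c *\<^sub>R x)) (spoke x +++ r)"
        by (simp add: spoke_def r_def path_compose_join)
      have "homotopic_paths T_A (word_loop w +++ spoke (c *\<^sub>R x)) (word_loop w +++ (spoke x +++ r))"
        using sp word_loop_image_T_A by (intro homotopic_paths_join) auto
      also have "homotopic_paths T_A \<dots> ((word_loop w +++ spoke x) +++ r)"
        using word_loop_image_T_A spoke_image[OF x] rT r by (intro homotopic_paths_assoc) auto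
      also have "homotopic_paths T_A \<dots> ((p +++ q) +++ r)"
        using pq r rT by (intro homotopic_paths_join[OF pq]) auto
      also have "homotopic_paths T_A \<dots> (p +++ (q +++ r))"
        using p q r rT \<open>glue x = pathfinish q\<close> by (intro homotopic_paths_sym[OF homotopic_paths_assoc]) auto
      finally have "homotopic_paths T_A (word_loop w +++ spoke (c *\<^sub>R x)) (p +++ (q +++ r))" .
      then have "cell_copy E (word_class E w) (c *\<^sub>R x) = path_class T_A (p +++ (q +++ r))"
        unfolding cell_copy_eq[OF cT] by (subst path_class_eq_iff)
          (use word_loop_image_T_A spoke_image[OF cT] in \<open>auto simp: path_image_join\<close>)
      moreover have "path (q +++ r)" "pathstart (q +++ r) = pathfinish p" "path_image (q +++ r) \<subseteq> T_A \<inter> V"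
        using q r \<open>glue x = pathfinish q\<close> rT rV by (auto simp: path_image_join)
      ultimately show "cell_copy E (word_class E w) (c *\<^sub>R x) \<in> s" unfolding s by blast
    qed
  qed simp
qed

lemma cell_copy_in_topspace:
  assumes "x \<in> truncated_cube E"
  shows "cell_copy E (word_class E w) x \<in> topspace (universal_cover_topology T_A 1)"
proof -
  let ?p = "word_loop w +++ spoke x" and ?q = "\<lambda>_::real. glue x"
  have p: "path ?p" "path_image ?p \<subseteq> T_A" "pathstart ?p = 1"
    using word_loop_image_T_A spoke_image[OF assms] by (auto simp: path_image_join)
  have "homotopic_paths T_A (?p +++ ?q) ?p"
    using homotopic_paths_right_unit[OF p(1,2)] by simp
  then have "cell_copy E (word_class E w) x = path_class T_A (?p +++ ?q)"
    unfolding cell_copy_eq[OF assms] using p(1,2) path_class_eq_iff homotopic_paths_sym by blast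
  moreover have "path ?q" "path_image ?q \<subseteq> T_A \<inter> UNIV" "pathstart ?q = pathfinish ?p"
    using glue_T_A[OF assms] by (auto simp: path_def path_image_def pathstart_def[of ?q])
  ultimately show ?thesis
    unfolding universal_cover_topology_def topology_generated_by_topspace
    using p open_UNIV by blast
qed

definition facet :: "'e \<times> bool \<Rightarrow> (real ^ 'e) set" where
  "facet y = {x \<in> truncated_cube E. x $ fst y = (if snd y then 1 else -1)}"

text \<open>
  The facet \<open>y\<close> separates the copy of \<open>g\<close>, inside the ball, from the
  copy of \<open>g * y\<close>, outside. Points of the facet are limits of interior points of the
  outer copy, so they are in the frontier.
\<close>
lemma outer_facet_in_sphere:
  assumes g: "g \<in> carrier (raag E)" "clique_norm g \<le> n"
    and gy: "clique_norm (g \<cdot> word_class E [y]) > n"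
  shows "cell_copy E g ` facet y \<subseteq> cell_sphere E n"
proof
  fix z assume "z \<in> cell_copy E g ` facet y"
  then obtain x where x: "x \<in> truncated_cube E" "x $ fst y = (if snd y then 1 else -1)" "z = cell_copy E g x"
    by (auto simp: facet_def)
  obtain w where w: "g = word_class E w" using g(1) by (rule raag_carrierE)
  define x' where "x' = x - 2 *\<^sub>R dir y"
  have x': "x' \<in> truncated_cube E" "z = cell_copy E (word_class E (w @ [y])) x'"
    using cell_copy_flip(1)[OF x(1,2)] cell_copy_flip(2)[OF x(1,2), of w] x(3) w by (auto simp: x'_def)
  let ?U = "universal_cover_topology T_A 1"
  have far: "cell_copy E (word_class E (w @ [y])) (c *\<^sub>R x') \<notin> cell_ball E n" if c: "0 < c" "c < 1" for c
  proof -
    have x1: "\<bar>x' $ i\<bar> \<le> 1" for i using x'(1) by (auto simp: truncated_cube_def)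
    have "\<bar>(c *\<^sub>R x') $ i\<bar> < 1" for i
    proof -
      have "c * \<bar>x' $ i\<bar> \<le> c" using c x1[of i] by (intro mult_left_le) auto
      moreover have "\<bar>(c *\<^sub>R x') $ i\<bar> = c * \<bar>x' $ i\<bar>" using c by (simp add: abs_mult)
      ultimately show ?thesis using c by linarith
    qed
    then show ?thesis
      using gy w interior_in_ball_iff[of "word_class E (w @ [y])" "c *\<^sub>R x'" n] c x'(1)
      by (auto simp: truncated_cube_scale)
  qed
  have "z \<in> cell_ball E n" unfolding cell_ball_eq using x g by blast
  have "z \<in> topspace ?U" using x cell_copy_in_topspace w by simp
  then have "z \<in> ?U closure_of cell_ball E n"
    using \<open>z \<in> cell_ball E n\<close> by (auto simp: in_closure_of)
  moreover have "z \<notin> ?U interior_of cell_ball E n"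
  proof
    assume "z \<in> ?U interior_of cell_ball E n"
    then obtain V where V: "openin ?U V" "z \<in> V" "V \<subseteq> cell_ball E n"
      by (auto simp: interior_of_def)
    then obtain c0 where c0: "c0 < 1" "\<forall>c. c0 < c \<and> c < 1 \<longrightarrow> cell_copy E (word_class E (w @ [y])) (c *\<^sub>R x') \<in> V"
      using cell_copy_limit[OF V(1) x'(1)] x'(2) by blast
    obtain c where "max 0 c0 < c" "c < 1" using c0(1) dense[of "max 0 c0" 1] by auto
    then show False using c0 far[of c] V(3) by auto
  qed
  ultimately show "z \<in> cell_sphere E n"
    by (simp add: cell_sphere_def frontier_of_def)
qed

lemma dir_in_facet: "dir y \<in> facet y"
  using dir_in_truncated_cube[of 1 y] by (simp add: facet_def dir_nth)

lemma facet_in_nonideal_facets: "facet y \<in> nonideal_facets E"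
  by (auto simp: facet_def nonideal_facets_def)

text \<open>
  The tile of \<open>g\<close> contains an outer facet, whose centre \<open>dir y\<close> belongs
  to no copies but those of \<open>g\<close> and of the neighbour across the facet. The neighbour
  has clique norm \<open>n + 2\<close>, so if the centre is on the copy of \<open>h\<close>, then
  \<open>h = g\<close>.
\<close>
lemma tile_inj:
  assumes g: "g \<in> carrier (raag E)" "clique_norm g = Suc n"
    and h: "h \<in> carrier (raag E)" "clique_norm h = Suc n"
    and eq: "tile E n g = tile E n h"
  shows "g = h"
proof -
  obtain y where y: "clique_norm (g \<cdot> word_class E [y]) = Suc (Suc n)"
    using clique_norm_extend[OF g(1)] g(2) by auto
  have "cell_copy E g ` facet y \<subseteq> cell_sphere E (Suc n)"
    using outer_facet_in_sphere[OF g(1)] g(2) y by simp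
  then have "cell_copy E g ` facet y \<subseteq> tile E n g"
    unfolding tile_def using facet_in_nonideal_facets by blast
  then have "cell_copy E g (dir y) \<in> tile E n h" using dir_in_facet eq by blast
  then obtain q where q: "q \<in> truncated_cube E" "cell_copy E g (dir y) = cell_copy E h q"
    unfolding tile_def nonideal_facets_def by auto
  have d: "dir y \<in> truncated_cube E" using dir_in_truncated_cube[of 1 y] by simp
  note D = cell_copy_eqD[OF g(1) h(1) d q]
  have "q $ i = 0" if "i \<noteq> fst y" for i using D(2)[of i] that by (simp add: dir_nth)
  moreover have "q $ fst y = dir y $ fst y \<or> q $ fst y = - dir y $ fst y" using D(2)[of "fst y"] by blast
  ultimately have "(\<forall>i. q $ i = dir y $ i) \<or> (\<forall>i. q $ i = - dir y $ i)"
    by (metis dir_nth minus_zero)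
  then have "q = dir y \<or> q = - dir y"
    by (simp add: vec_eq_iff)
  then show ?thesis
  proof
    assume "q = dir y"
    then show ?thesis using D(1) g(1) h(1) by (simp add: RG.right_cancel)
  next
    assume q': "q = - dir y"
    obtain w where w: "g = word_class E w" using g(1) by (rule raag_carrierE)
    have "cell_copy E g (dir y) = cell_copy E (g \<cdot> word_class E [y]) (- dir y)"
      using cell_copy_flip(2)[OF d, of y w] w by (simp add: dir_nth scaleR_2)
    then have eq': "cell_copy E (g \<cdot> word_class E [y]) (- dir y) = cell_copy E h (- dir y)"
      using q(2) unfolding q' by (rule trans[OF sym])
    have gy: "g \<cdot> word_class E [y] \<in> carrier (raag E)"
      using g(1) word_class_carrier by (rule RG.m_closed)
    have "- dir y \<in> truncated_cube E" using q(1) unfolding q' .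
    then have "(g \<cdot> word_class E [y]) \<cdot> boundary_shift (- dir y) =
        h \<cdot> boundary_shift (- dir y)"
      using cell_copy_eqD(1)[OF gy h(1) _ _ eq'] by blast
    then have "g \<cdot> word_class E [y] = h"
      using RG.right_cancel[OF boundary_shift_carrier gy h(1)] by blast
    then show ?thesis using y h(2) by (metis n_not_Suc_n)
  qed
qed

text \<open>
  A tile is labelled by membership of its element in \<open>V\<close>, and the tile determines its
  element, so the non-ideal tiles can be counted by their elements.
\<close>
theorem card_non_ideal_tiles:
  assumes "V \<subseteq> carrier (raag E)"
  shows "finite (non_ideal_tiles (tiling E V n))"
    "card (non_ideal_tiles (tiling E V n)) = card {g \<in> V. clique_norm g = Suc n}"
proof -
  have eq: "non_ideal_tiles (tiling E V n) = tile E n ` {g \<in> V. clique_norm g = Suc n}"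
  proof (rule Set.set_eqI)
    fix T
    have ideal: "(Non_ideal, T) \<notin> {(Ideal, cell_copy E g ` F) | g F. P g F}" for P by simp
    have nonideal: "(Non_ideal, T) \<in> {(if g \<in> V then Non_ideal else Ideal, tile E n g) | g. P g} \<longleftrightarrow>
        (\<exists>g. g \<in> V \<and> T = tile E n g \<and> P g)" for P
      by (auto split: if_splits)
    have new: "g \<in> carrier (raag E) \<and> copy E g \<subseteq> cell_ball E (Suc n) \<and> \<not> copy E g \<subseteq> cell_ball E n \<longleftrightarrow>
        clique_norm g = Suc n" if "g \<in> V" for g
    proof -
      have g: "g \<in> carrier (raag E)" using that assms by blast
      show ?thesis unfolding copy_subset_ball_iff[OF g] using g by (metis le_Suc_eq not_less_eq_eq order_refl)
    qed
    have split: "x \<in> A \<union> B \<longleftrightarrow> Q" if "x \<notin> A" "x \<in> B \<longleftrightarrow> Q" for x :: "tile_label \<times> (real \<Rightarrow> complex ^ 'e) set set" and A B Q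
      using that by blast
    have mem: "T \<in> non_ideal_tiles R \<longleftrightarrow> (Non_ideal, T) \<in> R" for R
      by (simp add: non_ideal_tiles_def)
    have "T \<in> non_ideal_tiles (tiling E V n) \<longleftrightarrow>
        (\<exists>g. g \<in> V \<and> T = tile E n g \<and> g \<in> carrier (raag E) \<and>
             copy E g \<subseteq> cell_ball E (Suc n) \<and> \<not> copy E g \<subseteq> cell_ball E n)"
      unfolding mem tiling_def by (rule split[OF ideal nonideal])
    also have "\<dots> \<longleftrightarrow> (\<exists>g. g \<in> V \<and> T = tile E n g \<and> clique_norm g = Suc n)"
      by (rule ex_cong1, rule conj_cong, rule refl, rule conj_cong, rule refl, erule new)
    finally show "T \<in> non_ideal_tiles (tiling E V n) \<longleftrightarrow> T \<in> tile E n ` {g \<in> V. clique_norm g = Suc n}"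
      by auto
  qed
  have fin: "finite {g \<in> V. clique_norm g = Suc n}"
    using assms by (intro finite_subset[OF _ finite_clique_ball[of "Suc n"]]) auto
  then show "finite (non_ideal_tiles (tiling E V n))" by (simp add: eq)
  have "inj_on (tile E n) {g \<in> V. clique_norm g = Suc n}"
    using assms by (intro inj_onI tile_inj) auto
  then show "card (non_ideal_tiles (tiling E V n)) = card {g \<in> V. clique_norm g = Suc n}"
    by (simp add: eq card_image)
qed

end

section \<open>Comparison of growth functions\<close>

abbreviation list_prod :: "('g, 'm) monoid_scheme \<Rightarrow> 'g list \<Rightarrow> 'g" where
  "list_prod G ws \<equiv> foldr (mult G) ws (one G)"

context group
begin

lemma list_prod_closed [simp]: "set ws \<subseteq> carrier G \<Longrightarrow> list_prod G ws \<in> carrier G"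
  by (induction ws) auto

lemma list_prod_append:
  "set us \<subseteq> carrier G \<Longrightarrow> set ws \<subseteq> carrier G \<Longrightarrow> list_prod G (us @ ws) = list_prod G us \<otimes> list_prod G ws"
  by (induction us) (auto simp: m_assoc)

lemma generate_imp_list_prod:
  assumes "x \<in> generate G S" "S \<subseteq> carrier G"
  shows "\<exists>ws. set ws \<subseteq> S \<union> m_inv G ` S \<and> list_prod G ws = x"
  using assms(1)
proof induction
  case one
  show ?case by (intro exI[of _ "[]"]) simp
next
  case (incl h)
  then show ?case using assms(2) by (intro exI[of _ "[h]"]) auto
next
  case (inv h)
  then show ?case using assms(2) by (intro exI[of _ "[inv h]"]) auto
next
  case (eng h1 h2)
  then obtain u w where "set u \<subseteq> S \<union> m_inv G ` S" "list_prod G u = h1"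
    "set w \<subseteq> S \<union> m_inv G ` S" "list_prod G w = h2" by blast
  moreover from this have "set u \<subseteq> carrier G" "set w \<subseteq> carrier G" using assms(2) by auto
  ultimately show ?case by (intro exI[of _ "u @ w"]) (auto simp: list_prod_append simp del: foldr_append)
qed

lemma list_prod_generate: "set ws \<subseteq> S \<Longrightarrow> list_prod G ws \<in> generate G S"
  by (induction ws) (auto intro: generate.one generate.eng generate.incl)

context
  fixes S assumes S: "finite_generating_set G S"
begin

lemma S_props: "finite S" "S \<subseteq> carrier G" "generate G S = carrier G"
  using S by (auto simp: finite_generating_set_def)

lemma S_letters: "S \<union> m_inv G ` S \<subseteq> carrier G"
  using S_props by auto

lemma word_norm_witness:
  assumes "x \<in> carrier G"
  shows "\<exists>ws. length ws = word_norm G S x \<and> set ws \<subseteq> S \<union> m_inv G ` S \<and> list_prod G ws = x"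
proof -
  obtain ws where "set ws \<subseteq> S \<union> m_inv G ` S" "list_prod G ws = x"
    using generate_imp_list_prod[of x S] assms S_props by auto
  then have "\<exists>n. \<exists>ws. length ws = n \<and> set ws \<subseteq> S \<union> m_inv G ` S \<and> list_prod G ws = x" by blast
  then show ?thesis unfolding word_norm_def by (rule LeastI_ex)
qed

lemma word_norm_le:
  assumes "set ws \<subseteq> S \<union> m_inv G ` S" shows "word_norm G S (list_prod G ws) \<le> length ws"
  unfolding word_norm_def by (rule Least_le) (use assms in blast)

lemma word_norm_mult:
  assumes "x \<in> carrier G" "y \<in> carrier G"
  shows "word_norm G S (x \<otimes> y) \<le> word_norm G S x + word_norm G S y"
proof -
  obtain u w where "length u = word_norm G S x" "set u \<subseteq> S \<union> m_inv G ` S" "list_prod G u = x"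
    "length w = word_norm G S y" "set w \<subseteq> S \<union> m_inv G ` S" "list_prod G w = y"
    using word_norm_witness assms by meson
  moreover from this have "list_prod G (u @ w) = x \<otimes> y"
    using S_letters by (subst list_prod_append) auto
  ultimately show ?thesis using word_norm_le[of "u @ w"] by simp
qed

lemma finite_word_ball: "finite {x \<in> carrier G. word_norm G S x \<le> n}"
proof (rule finite_subset)
  show "{x \<in> carrier G. word_norm G S x \<le> n} \<subseteq>
      list_prod G ` {ws. set ws \<subseteq> S \<union> m_inv G ` S \<and> length ws \<le> n}"
    using word_norm_witness by fastforce
  show "finite (list_prod G ` {ws. set ws \<subseteq> S \<union> m_inv G ` S \<and> length ws \<le> n})"
    using S_props by (intro finite_imageI finite_lists_length_le) auto
qed

lemma word_norm_list_prod_bound: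
  assumes "finite T" "T \<subseteq> carrier G"
  shows "\<exists>C. \<forall>ts. set ts \<subseteq> T \<longrightarrow> word_norm G S (list_prod G ts) \<le> C * length ts"
proof -
  define C where "C = Max (insert 0 (word_norm G S ` T))"
  have C: "word_norm G S t \<le> C" if "t \<in> T" for t
    unfolding C_def using that assms(1) by (intro Max_ge) auto
  have "set ts \<subseteq> T \<Longrightarrow> word_norm G S (list_prod G ts) \<le> C * length ts" for ts
  proof (induction ts)
    case Nil
    then show ?case using word_norm_le[of "[]"] by simp
  next
    case (Cons t ts)
    then have "word_norm G S (t \<otimes> list_prod G ts) \<le> word_norm G S t + word_norm G S (list_prod G ts)"
      using assms(2) by (intro word_norm_mult list_prod_closed) auto
    then show ?case using Cons C[of t] by simp
  qed
  then show ?thesis by blast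
qed

lemma sum_growth_function:
  "(\<Sum>k\<le>n. growth_function G S k) = card {x \<in> carrier G. word_norm G S x \<le> n}"
proof -
  have "(\<Sum>k\<le>n. growth_function G S k) = card (\<Union>k\<le>n. {x \<in> carrier G. word_norm G S x = k})"
    unfolding growth_function_def
    by (intro card_UN_disjoint[symmetric])
      (auto intro: finite_subset[OF _ finite_word_ball])
  also have "(\<Union>k\<le>n. {x \<in> carrier G. word_norm G S x = k}) = {x \<in> carrier G. word_norm G S x \<le> n}"
    by auto
  finally show ?thesis .
qed

end

text \<open>
  The counting argument of the Milnor--Schwarz lemma. \<open>V\<close> stands for a set of orbit
  points with a size \<open>N\<close>, the map \<open>\<phi>\<close> for the embedding of the
  group as an orbit, and \<open>\<psi>\<close> for a coarse inverse. Injectivity and the Lipschitz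
  bound for \<open>\<phi>\<close> bound the balls of the group by those of \<open>V\<close>; for
  the converse, \<open>\<psi>\<close> has short values and fibres of bounded size. The shift from
  \<open>n\<close> to \<open>Suc n\<close> leaves the points of size \<open>0\<close> uncounted,
  which costs an additive constant.
\<close>
lemma growth_equivalent_orbit:
  fixes N :: "'v \<Rightarrow> nat"
  assumes S: "finite_generating_set G S"
    and fin: "\<And>n. finite {v \<in> V. N v \<le> n}" and center: "card {v \<in> V. N v = 0} \<le> 1"
    and \<phi>: "inj_on \<phi> (carrier G)" "\<phi> ` carrier G \<subseteq> V"
    and \<phi>_bound: "\<And>T. finite T \<Longrightarrow> T \<subseteq> carrier G \<Longrightarrow>
      \<exists>C. \<forall>ts. set ts \<subseteq> T \<longrightarrow> N (\<phi> (list_prod G ts)) \<le> C * length ts"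
    and T: "finite T" "T \<subseteq> carrier G"
    and \<psi>: "\<And>v. v \<in> V \<Longrightarrow> \<exists>ts. set ts \<subseteq> T \<and> \<psi> v = list_prod G ts \<and> length ts \<le> C * N v + C"
    and fibres: "\<And>x. finite {v \<in> V. \<psi> v = x} \<and> card {v \<in> V. \<psi> v = x} \<le> D"
  shows "growth_equivalent (\<lambda>n. card {v \<in> V. N v = Suc n}) (growth_function G S)"
proof -
  define ball where "ball n = {v \<in> V. N v \<le> n}" for n
  have ball: "finite (ball n)" for n using fin by (simp add: ball_def)
  have sumV: "(\<Sum>k\<le>n. card {v \<in> V. N v = Suc k}) + card {v \<in> V. N v = 0} = card (ball (Suc n))" for n
  proof -
    have "(\<Sum>k\<le>n. card {v \<in> V. N v = Suc k}) = card (\<Union>k\<le>n. {v \<in> V. N v = Suc k})"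
      by (intro card_UN_disjoint[symmetric]) (auto intro: finite_subset[OF _ fin])
    also have "\<dots> + card {v \<in> V. N v = 0} = card ((\<Union>k\<le>n. {v \<in> V. N v = Suc k}) \<union> {v \<in> V. N v = 0})"
      by (intro card_Un_disjoint[symmetric]) (auto intro: finite_subset[OF _ fin])
    also have "(\<Union>k\<le>n. {v \<in> V. N v = Suc k}) \<union> {v \<in> V. N v = 0} = ball (Suc n)"
    proof (rule Set.set_eqI)
      fix v
      show "v \<in> (\<Union>k\<le>n. {v \<in> V. N v = Suc k}) \<union> {v \<in> V. N v = 0} \<longleftrightarrow> v \<in> ball (Suc n)"
        by (cases "N v") (auto simp: ball_def)
    qed
    finally show ?thesis .
  qed
  have letters: "finite (S \<union> m_inv G ` S)" "S \<union> m_inv G ` S \<subseteq> carrier G"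
    using S_props[OF S] by auto
  obtain C1 where C1: "\<And>ts. set ts \<subseteq> S \<union> m_inv G ` S \<Longrightarrow> N (\<phi> (list_prod G ts)) \<le> C1 * length ts"
    using \<phi>_bound[OF letters] by blast
  have upper: "card {x \<in> carrier G. word_norm G S x \<le> n} \<le> card (ball (C1 * n))" for n
  proof (rule card_inj_on_le)
    show "\<phi> ` {x \<in> carrier G. word_norm G S x \<le> n} \<subseteq> ball (C1 * n)"
    proof
      fix v assume "v \<in> \<phi> ` {x \<in> carrier G. word_norm G S x \<le> n}"
      then obtain x where x: "x \<in> carrier G" "word_norm G S x \<le> n" "v = \<phi> x" by auto
      then obtain ts where ts: "length ts = word_norm G S x" "set ts \<subseteq> S \<union> m_inv G ` S" "list_prod G ts = x"
        using word_norm_witness[OF S] by blast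
      have "N v \<le> C1 * length ts" using C1[OF ts(2)] ts(3) x(3) by simp
      also have "\<dots> \<le> C1 * n" using ts(1) x(2) by simp
      finally show "v \<in> ball (C1 * n)" using x \<phi>(2) by (auto simp: ball_def)
    qed
  qed (use \<phi>(1) ball in \<open>auto intro: inj_on_subset\<close>)
  obtain C2 where C2: "\<And>ts. set ts \<subseteq> T \<Longrightarrow> word_norm G S (list_prod G ts) \<le> C2 * length ts"
    using word_norm_list_prod_bound[OF S T] by blast
  have lower: "card (ball n) \<le> D * card {x \<in> carrier G. word_norm G S x \<le> C2 * (C * n + C)}" for n
  proof -
    let ?B = "{x \<in> carrier G. word_norm G S x \<le> C2 * (C * n + C)}"
    have "ball n \<subseteq> (\<Union>x\<in>?B. {v \<in> V. \<psi> v = x})"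
    proof
      fix v assume v: "v \<in> ball n"
      then obtain ts where ts: "set ts \<subseteq> T" "\<psi> v = list_prod G ts" "length ts \<le> C * N v + C"
        using \<psi>[of v] by (auto simp: ball_def)
      have "C * N v \<le> C * n" using v by (simp add: ball_def)
      then have "length ts \<le> C * n + C" using ts(3) by linarith
      then have "C2 * length ts \<le> C2 * (C * n + C)" by (rule mult_le_mono2)
      then have "\<psi> v \<in> ?B" using C2[OF ts(1)] ts(1,2) T(2) by (auto intro: order_trans)
      then show "v \<in> (\<Union>x\<in>?B. {v \<in> V. \<psi> v = x})" using v by (auto simp: ball_def)
    qed
    then have "card (ball n) \<le> card (\<Union>x\<in>?B. {v \<in> V. \<psi> v = x})"
      using finite_word_ball[OF S] fibres by (intro card_mono) auto
    also have "\<dots> \<le> (\<Sum>x\<in>?B. card {v \<in> V. \<psi> v = x})"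
      using finite_word_ball[OF S] by (rule card_UN_le)
    also have "\<dots> \<le> (\<Sum>x\<in>?B. D)" using fibres by (intro sum_mono) auto
    finally show ?thesis by (simp add: mult.commute)
  qed
  have mono: "card {x \<in> carrier G. word_norm G S x \<le> m} \<le> card {x \<in> carrier G. word_norm G S x \<le> n}"
    if "m \<le> n" for m n
    using that finite_word_ball[OF S] by (intro card_mono) auto
  have mono': "card (ball m) \<le> card (ball n)" if "m \<le> n" for m n
    using that ball by (intro card_mono) (auto simp: ball_def)
  show ?thesis
    unfolding growth_equivalent_def growth_dominated_def
  proof
    let ?C = "D + 2 * C2 * C"
    show "\<exists>C. \<forall>n. (\<Sum>k\<le>n. card {v \<in> V. N v = Suc k}) \<le> C * (\<Sum>k\<le>C * n + C. growth_function G S k) + C"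
    proof (intro exI[of _ ?C] allI)
      fix n
      have "(\<Sum>k\<le>n. card {v \<in> V. N v = Suc k}) \<le> card (ball (Suc n))" using sumV[of n] by simp
      also have "\<dots> \<le> D * card {x \<in> carrier G. word_norm G S x \<le> C2 * (C * Suc n + C)}" by (rule lower)
      also have "\<dots> \<le> ?C * card {x \<in> carrier G. word_norm G S x \<le> ?C * n + ?C}"
        by (intro mult_le_mono mono) (simp_all add: algebra_simps)
      also have "\<dots> \<le> ?C * (\<Sum>k\<le>?C * n + ?C. growth_function G S k) + ?C"
        by (simp only: sum_growth_function[OF S])
      finally show "(\<Sum>k\<le>n. card {v \<in> V. N v = Suc k}) \<le> ?C * (\<Sum>k\<le>?C * n + ?C. growth_function G S k) + ?C" .
    qed
    show "\<exists>C. \<forall>n. (\<Sum>k\<le>n. growth_function G S k) \<le> C * (\<Sum>k\<le>C * n + C. card {v \<in> V. N v = Suc k}) + C"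
    proof (intro exI[of _ "Suc C1"] allI)
      fix n
      have "(\<Sum>k\<le>n. growth_function G S k) \<le> card (ball (C1 * n))"
        using upper[of n] by (simp add: sum_growth_function[OF S])
      also have "\<dots> \<le> card (ball (Suc (Suc C1 * n + Suc C1)))" by (intro mono') simp
      also have "\<dots> \<le> (\<Sum>k\<le>Suc C1 * n + Suc C1. card {v \<in> V. N v = Suc k}) + 1"
        using sumV[of "Suc C1 * n + Suc C1"] center by linarith
      also have "\<dots> \<le> Suc C1 * (\<Sum>k\<le>Suc C1 * n + Suc C1. card {v \<in> V. N v = Suc k}) + Suc C1"
        by (intro add_mono) simp_all
      finally show "(\<Sum>k\<le>n. growth_function G S k) \<le>
          Suc C1 * (\<Sum>k\<le>Suc C1 * n + Suc C1. card {v \<in> V. N v = Suc k}) + Suc C1" .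
    qed
  qed
qed

end

section \<open>Isometries of cubes\<close>

lemma cube_dist_sq: "(cube_dist n x y)\<^sup>2 = (\<Sum>i<n. (x i - y i)\<^sup>2)"
  by (simp add: cube_dist_def L2_set_def sum_nonneg)

lemma unit_cube_bounds: "x \<in> unit_cube n \<Longrightarrow> 0 \<le> x i \<and> x i \<le> 1"
  by (cases "i < n") (auto simp: unit_cube_def)

lemma unit_cube_outside: "x \<in> unit_cube n \<Longrightarrow> i \<ge> n \<Longrightarrow> x i = 0"
  by (simp add: unit_cube_def)

lemma unit_cube_ext:
  assumes "x \<in> unit_cube n" "y \<in> unit_cube n" "\<And>i. i < n \<Longrightarrow> x i = y i"
  shows "x = y"
  using assms by (auto simp: unit_cube_def fun_eq_iff) (metis not_le)

lemma sum_sq_le_dim: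
  assumes "x \<in> unit_cube n" "y \<in> unit_cube n"
  shows "(\<Sum>i<n. (x i - y i)\<^sup>2) \<le> n"
proof -
  have "(x i - y i)\<^sup>2 \<le> 1" for i
    using unit_cube_bounds[OF assms(1), of i] unit_cube_bounds[OF assms(2), of i]
    by (auto simp: abs_square_le_1 abs_le_iff)
  then show ?thesis using sum_bounded_above[of "{..<n}" "\<lambda>i. (x i - y i)\<^sup>2" 1] by simp
qed

text \<open>
  The diameter of the cube is attained only by pairs of opposite corners. So isometries map
  corners to corners.
\<close>
lemma sum_sq_eq_dim:
  assumes "x \<in> unit_cube n" "y \<in> unit_cube n" "(\<Sum>i<n. (x i - y i)\<^sup>2) = n" "i < n"
  shows "x i \<in> {0, 1}" "y i = 1 - x i"
proof -
  have le: "(x j - y j)\<^sup>2 \<le> 1" for j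
    using unit_cube_bounds[OF assms(1), of j] unit_cube_bounds[OF assms(2), of j]
    by (auto simp: abs_square_le_1 abs_le_iff)
  have "(\<Sum>j<n. 1 - (x j - y j)\<^sup>2) = 0" using assms(3) by (simp add: sum_subtractf)
  then have "1 - (x i - y i)\<^sup>2 = 0"
    using le assms(4) by (subst (asm) sum_nonneg_eq_0_iff) auto
  then have "x i - y i = 1 \<or> x i - y i = -1" by (simp add: power2_eq_1_iff)
  then show "x i \<in> {0, 1}" "y i = 1 - x i"
    using unit_cube_bounds[OF assms(1), of i] unit_cube_bounds[OF assms(2), of i] by auto
qed

definition ones :: "nat \<Rightarrow> nat \<Rightarrow> real" where
  "ones n i = (if i < n then 1 else 0)"

definition unit_point :: "nat \<Rightarrow> nat \<Rightarrow> real" where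
  "unit_point i j = (if j = i then 1 else 0)"

text \<open>
  Comparing the diameters gives equal dimensions. The images of the origin and of the unit points
  are corners that differ in one coordinate, which defines the permutation and the reflections. A
  coordinate of an arbitrary point is then recovered from its distances to the origin and to a
  unit point.
\<close>
theorem cube_isometry_signed_permutation:
  assumes h: "cube_isometry m (unit_cube m) n (unit_cube n) h"
  shows "m = n \<and> (\<exists>\<sigma> r. bij_betw \<sigma> {..<n} {..<n} \<and>
           (\<forall>x\<in>unit_cube n. \<forall>i<n. h x (\<sigma> i) = (if r i then 1 - x i else x i)))"
proof -
  have bij: "bij_betw h (unit_cube m) (unit_cube n)" using h by (simp add: cube_isometry_def)
  have hU: "h x \<in> unit_cube n" if "x \<in> unit_cube m" for x
    using bij that by (auto simp: bij_betw_def)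
  have sq: "(\<Sum>i<n. (h x i - h y i)\<^sup>2) = (\<Sum>i<m. (x i - y i)\<^sup>2)"
    if "x \<in> unit_cube m" "y \<in> unit_cube m" for x y
    unfolding cube_dist_sq[symmetric] using h that by (simp add: cube_isometry_def)
  have z: "(\<lambda>_. 0) \<in> unit_cube k" "ones k \<in> unit_cube k" for k by (auto simp: unit_cube_def ones_def)
  have d: "(\<Sum>i<k. (0 - ones k i)\<^sup>2) = k" for k by (simp add: ones_def)
  have "real m = (\<Sum>i<m. (0 - ones m i)\<^sup>2)" by (rule d[symmetric])
  also have "\<dots> = (\<Sum>i<n. (h (\<lambda>_. 0) i - h (ones m) i)\<^sup>2)"
    by (rule sq[OF z(1) z(2), symmetric])
  also have "\<dots> \<le> n" by (intro sum_sq_le_dim hU z)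
  finally have "real m \<le> n" .
  moreover have "real n \<le> m"
  proof -
    have "(\<lambda>_. 0) \<in> h ` unit_cube m" "ones n \<in> h ` unit_cube m"
      using bij z[of n] by (simp_all add: bij_betw_def)
    then obtain x y where xy: "x \<in> unit_cube m" "y \<in> unit_cube m" "h x = (\<lambda>_. 0)" "h y = ones n"
      by (elim imageE) auto
    show ?thesis using sum_sq_le_dim[OF xy(1,2)] unfolding sq[OF xy(1,2), symmetric] xy(3,4) d .
  qed
  ultimately have mn: "m = n" by simp
  note hU = hU[unfolded mn] and sq = sq[unfolded mn] and bij = bij[unfolded mn]
  \<comment> \<open>The image of the origin; its coordinates equal to \<open>1\<close> are the reflected ones.\<close>
  define a where "a = h (\<lambda>_. 0)"
  have aU: "a \<in> unit_cube n" using hU z by (simp add: a_def)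
  have a01: "a j \<in> {0, 1}" if "j < n" for j
    using sum_sq_eq_dim(1)[OF hU[OF z(1)] hU[OF z(2)] _ that] unfolding sq[OF z(1) z(2)] d a_def by blast
  have e: "unit_point i \<in> unit_cube n" if "i < n" for i
    using that by (auto simp: unit_cube_def unit_point_def)
  have e01: "h (unit_point i) j \<in> {0, 1}" if "i < n" "j < n" for i j
  proof -
    have o: "(\<lambda>j. ones n j - unit_point i j) \<in> unit_cube n"
      using that by (auto simp: unit_cube_def unit_point_def ones_def)
    have "(\<Sum>k<n. (unit_point i k - (ones n k - unit_point i k))\<^sup>2) = (\<Sum>k<n. 1)"
      by (intro sum.cong) (auto simp: unit_point_def ones_def)
    then have "(\<Sum>k<n. (unit_point i k - (ones n k - unit_point i k))\<^sup>2) = n" by simp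
    then show ?thesis
      using sum_sq_eq_dim(1)[OF hU[OF e[OF that(1)]] hU[OF o] _ that(2)]
      unfolding sq[OF e[OF that(1)] o] by blast
  qed
  have ex: "\<exists>j<n. h (unit_point i) j = 1 - a j \<and> (\<forall>k<n. k \<noteq> j \<longrightarrow> h (unit_point i) k = a k)" if i: "i < n" for i
  proof -
    let ?D = "{j \<in> {..<n}. h (unit_point i) j \<noteq> a j}"
    have "(\<Sum>j<n. (h (unit_point i) j - a j)\<^sup>2) = (\<Sum>j<n. (unit_point i j - 0)\<^sup>2)"
      unfolding a_def using sq[OF e[OF i] z(1)] by simp
    also have "\<dots> = 1" using i by (simp add: unit_point_def if_distrib[of "\<lambda>x. x\<^sup>2"] sum.delta cong: if_cong)
    also have "(\<Sum>j<n. (h (unit_point i) j - a j)\<^sup>2) = (\<Sum>j<n. if h (unit_point i) j \<noteq> a j then 1 else 0)"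
      using e01[OF i] a01 by (intro sum.cong) fastforce+
    also have "\<dots> = card ?D" by (simp add: sum.If_cases Int_def)
    finally have "card ?D = 1" by simp
    then obtain j where j: "?D = {j}" by (meson card_1_singletonE)
    then have "j < n" "h (unit_point i) j \<noteq> a j" by auto
    then have "h (unit_point i) j = 1 - a j" using e01[OF i, of j] a01[of j] by auto
    then show ?thesis using j \<open>j < n\<close> by blast
  qed
  then obtain \<sigma> where \<sigma>: "\<And>i. i < n \<Longrightarrow> \<sigma> i < n" "\<And>i. i < n \<Longrightarrow> h (unit_point i) (\<sigma> i) = 1 - a (\<sigma> i)"
    "\<And>i k. i < n \<Longrightarrow> k < n \<Longrightarrow> k \<noteq> \<sigma> i \<Longrightarrow> h (unit_point i) k = a k"
    by metis
  have "inj_on \<sigma> {..<n}"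
  proof (rule inj_onI)
    fix i i' assume i: "i \<in> {..<n}" "i' \<in> {..<n}" "\<sigma> i = \<sigma> i'"
    have "h (unit_point i) = h (unit_point i')"
    proof (rule unit_cube_ext[OF hU hU])
      show "h (unit_point i) k = h (unit_point i') k" if "k < n" for k
        using \<sigma>(2,3)[of i] \<sigma>(2,3)[of i'] i that by (cases "k = \<sigma> i") auto
    qed (use e i in auto)
    then have "unit_point i = unit_point i'"
      using bij e i by (auto simp: bij_betw_def dest: inj_onD)
    then have "unit_point i i = unit_point i' i" by simp
    then show "i = i'" by (simp add: unit_point_def split: if_splits)
  qed
  moreover have "\<sigma> ` {..<n} \<subseteq> {..<n}" using \<sigma>(1) by auto
  ultimately have "bij_betw \<sigma> {..<n} {..<n}"
    unfolding bij_betw_def using endo_inj_surj[of "{..<n}" \<sigma>] by simp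
  moreover have "h x (\<sigma> i) = (if a (\<sigma> i) = 1 then 1 - x i else x i)" if x: "x \<in> unit_cube n" and i: "i < n" for x i
  proof -
    let ?j = "\<sigma> i"
    have j: "?j < n" using \<sigma>(1) i by simp
    have split: "(\<Sum>k<n. F k) = F p + (\<Sum>k\<in>{..<n} - {p}. F k)" if "p < n" for p and F :: "nat \<Rightarrow> real"
      using that by (intro sum.remove) auto
    have "(\<Sum>k\<in>{..<n} - {?j}. (h x k - h (unit_point i) k)\<^sup>2) = (\<Sum>k\<in>{..<n} - {?j}. (h x k - a k)\<^sup>2)"
      using \<sigma>(3)[OF i] by (intro sum.cong) auto
    then have 1: "(\<Sum>k<n. (h x k - h (unit_point i) k)\<^sup>2) - (h x ?j - h (unit_point i) ?j)\<^sup>2 =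
        (\<Sum>k<n. (h x k - a k)\<^sup>2) - (h x ?j - a ?j)\<^sup>2"
      using split[OF j, of "\<lambda>k. (h x k - h (unit_point i) k)\<^sup>2"] split[OF j, of "\<lambda>k. (h x k - a k)\<^sup>2"] by simp
    have "(\<Sum>k\<in>{..<n} - {i}. (x k - unit_point i k)\<^sup>2) = (\<Sum>k\<in>{..<n} - {i}. (x k - 0)\<^sup>2)"
      by (intro sum.cong) (auto simp: unit_point_def)
    then have 2: "(\<Sum>k<n. (x k - unit_point i k)\<^sup>2) - (x i - 1)\<^sup>2 = (\<Sum>k<n. (x k - 0)\<^sup>2) - (x i)\<^sup>2"
      using split[OF i, of "\<lambda>k. (x k - unit_point i k)\<^sup>2"] split[OF i, of "\<lambda>k. (x k - 0)\<^sup>2"]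
      by (simp add: unit_point_def)
    have "(\<Sum>k<n. (h x k - a k)\<^sup>2) = (\<Sum>k<n. (x k - 0)\<^sup>2)"
      unfolding a_def using sq[OF x z(1)] by simp
    moreover have "(\<Sum>k<n. (h x k - h (unit_point i) k)\<^sup>2) = (\<Sum>k<n. (x k - unit_point i k)\<^sup>2)"
      using sq[OF x e[OF i]] .
    ultimately have "(h x ?j - (1 - a ?j))\<^sup>2 - (h x ?j - a ?j)\<^sup>2 = (x i - 1)\<^sup>2 - (x i)\<^sup>2"
      using 1 2 \<sigma>(2)[OF i] by simp
    then show ?thesis
      using a01[OF j] by (auto simp: power2_eq_square algebra_simps)
  qed
  ultimately have "\<exists>\<sigma> r. bij_betw \<sigma> {..<n} {..<n} \<and>
           (\<forall>x\<in>unit_cube n. \<forall>i<n. h x (\<sigma> i) = (if r i then 1 - x i else x i))"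
    by (intro exI[of _ \<sigma>] exI[of _ "\<lambda>i. a (\<sigma> i) = 1"]) auto
  then show ?thesis using mn by blast
qed

section \<open>Developing the cubes of a special complex\<close>

text \<open>
  The universal cover of the torus, scaled so that a cube of the Salvetti complex has side length
  \<open>1\<close>; for \<open>glue\<close> the side length is \<open>2\<close>.
\<close>
definition torus_point :: "real ^ 'e \<Rightarrow> complex ^ 'e::finite" where
  "torus_point \<theta> = (\<chi> e. cis (2 * pi * \<theta> $ e))"

lemma cis_2pi_eq_iff: "cis (2 * pi * a) = cis (2 * pi * b) \<longleftrightarrow> a - b \<in> \<int>"
proof
  assume "cis (2 * pi * a) = cis (2 * pi * b)"
  then have "cis (2 * pi * a - 2 * pi * b) = 1" by (simp add: cis_divide[symmetric])
  then have "cos (2 * pi * a - 2 * pi * b) = 1" by (metis cis.sel(1) one_complex.sel(1))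
  then obtain n where "2 * pi * a - 2 * pi * b = real_of_int n * 2 * pi" using cos_one_2pi_int by metis
  then have "2 * pi * (a - b) = 2 * pi * real_of_int n" by (simp add: algebra_simps)
  then show "a - b \<in> \<int>" by simp
next
  assume "a - b \<in> \<int>"
  then have "cis (2 * pi * (a - b)) = 1" by (rule cis_multiple_2pi)
  then have "cis (2 * pi * a) / cis (2 * pi * b) = 1" by (simp add: cis_divide algebra_simps)
  then show "cis (2 * pi * a) = cis (2 * pi * b)" by simp
qed

lemma torus_point_eq_iff: "torus_point \<theta> = torus_point \<eta> \<longleftrightarrow> (\<forall>e. \<theta> $ e - \<eta> $ e \<in> \<int>)"
  by (simp add: torus_point_def vec_eq_iff cis_2pi_eq_iff)

lemma torus_point_0 [simp]: "torus_point 0 = 1"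
  by (simp add: torus_point_def vec_eq_iff)

lemma torus_point_eq_1_iff: "torus_point \<theta> = 1 \<longleftrightarrow> (\<forall>e. \<theta> $ e \<in> \<int>)"
  using torus_point_eq_iff[of \<theta> 0] by simp

lemma abs_Ints_less_1: "(x :: real) \<in> \<int> \<Longrightarrow> \<bar>x\<bar> < 1 \<Longrightarrow> x = 0"
  by (metis Ints_nonzero_abs_less1)

lemma continuous_on_torus_point: "continuous_on S torus_point"
  unfolding torus_point_def by (intro continuous_intros)

locale special_complex = raag_graph E
  for E :: "'e::finite \<Rightarrow> 'e \<Rightarrow> bool" +
  fixes Y :: "('y::topological_space, 'c) cubed_space" and f :: "'y \<Rightarrow> complex ^ 'e"
  assumes special: "special_cube_complex E Y f"
begin

abbreviation "dm \<equiv> cell_dim Y"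
abbreviation "ch \<equiv> chart Y"
abbreviation "cub c \<equiv> unit_cube (cell_dim Y c)"

lemma complex_Y: "cube_complex Y"
  and npc_Y: "nonpositively_curved Y"
  and local_iso: "local_isometry Y (salvetti E) f"
  using special by (auto simp: special_cube_complex_def)

text \<open>
  The local isometry makes direction \<open>i\<close> of the cube \<open>c\<close> parallel to the
  generator \<open>l i\<close>, traversed forwards or backwards according to the sign \<open>s
  i\<close>.
\<close>
definition is_labelling :: "'c \<Rightarrow> (nat \<Rightarrow> 'e) \<Rightarrow> (nat \<Rightarrow> real) \<Rightarrow> bool" where
  "is_labelling c l s \<longleftrightarrow> inj_on l {..<dm c} \<and> (\<forall>i. s i \<in> {1, -1}) \<and>
     (\<forall>i<dm c. \<forall>j<dm c. i \<noteq> j \<longrightarrow> E (l i) (l j)) \<and>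
     (\<forall>x\<in>cub c. (\<forall>i<dm c. f (ch c x) $ l i = cis (2 * pi * (s i * x i))) \<and>
                  (\<forall>e. e \<notin> l ` {..<dm c} \<longrightarrow> f (ch c x) $ e = 1))"

lemma ex_labelling:
  assumes "c \<in> cells Y" shows "\<exists>l s. is_labelling c l s"
proof -
  obtain xs h where xs: "xs \<in> cells (salvetti E)"
      and h: "cube_isometry (dm c) (cub c) (cell_dim (salvetti E) xs) (unit_cube (cell_dim (salvetti E) xs)) h"
      and f: "\<And>x. x \<in> cub c \<Longrightarrow> f (ch c x) = chart (salvetti E) xs (h x)"
    using local_iso assms unfolding local_isometry_def combinatorial_map_def by metis
  have xs': "distinct xs" "\<And>i j. i \<in> set xs \<Longrightarrow> j \<in> set xs \<Longrightarrow> i \<noteq> j \<Longrightarrow> E i j"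
    and len: "cell_dim (salvetti E) xs = length xs"
    using xs by (auto simp: salvetti_def)
  define n where "n = length xs"
  obtain \<sigma> r where mn: "dm c = n" and \<sigma>: "bij_betw \<sigma> {..<n} {..<n}"
      and hx: "\<And>x i. x \<in> unit_cube n \<Longrightarrow> i < n \<Longrightarrow> h x (\<sigma> i) = (if r i then 1 - x i else x i)"
    using cube_isometry_signed_permutation[OF h] len unfolding n_def by metis
  have \<sigma>n: "i < n \<Longrightarrow> \<sigma> i < n" for i using \<sigma> by (auto simp: bij_betw_def)
  define l where "l i = xs ! \<sigma> i" for i
  define s where "s i = (if r i then -1 else 1 :: real)" for i
  have inj: "inj_on l {..<n}"
  proof (rule inj_onI)
    fix i j assume ij: "i \<in> {..<n}" "j \<in> {..<n}" "l i = l j"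
    then have "\<sigma> i = \<sigma> j"
      using xs'(1) \<sigma>n by (auto simp: l_def n_def nth_eq_iff_index_eq)
    then show "i = j" using \<sigma> ij by (auto simp: bij_betw_def dest: inj_onD)
  qed
  have ran: "l ` {..<n} = set xs"
  proof -
    have "l ` {..<n} = (!) xs ` (\<sigma> ` {..<n})" by (auto simp: l_def)
    also have "\<dots> = set xs" using \<sigma> by (auto simp: bij_betw_def n_def set_conv_nth)
    finally show ?thesis .
  qed
  have ch: "chart (salvetti E) xs y $ e = (\<Prod>k | k < n \<and> xs ! k = e. cis (2 * pi * y k))" for y e
    by (simp add: salvetti_def n_def)
  have at_label: "f (ch c x) $ l i = cis (2 * pi * (s i * x i))" if "x \<in> cub c" "i < n" for x i
  proof -
    have "{k. k < n \<and> xs ! k = l i} = {\<sigma> i}"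
      using xs'(1) \<sigma>n[OF that(2)] by (auto simp: l_def n_def nth_eq_iff_index_eq)
    then have "f (ch c x) $ l i = cis (2 * pi * h x (\<sigma> i))" using f[OF that(1)] ch by simp
    also have "\<dots> = cis (2 * pi * (s i * x i))"
      using hx[of x i] that mn by (auto simp: s_def cis_2pi_eq_iff)
    finally show ?thesis .
  qed
  have off_label: "f (ch c x) $ e = 1" if "x \<in> cub c" "e \<notin> l ` {..<n}" for x e
  proof -
    have none: "{k. k < n \<and> xs ! k = e} = {}" using that(2) ran by (auto simp: n_def)
    show ?thesis unfolding f[OF that(1)] ch none by simp
  qed
  have commuting: "E (l i) (l j)" if "i < n" "j < n" "i \<noteq> j" for i j
  proof (rule xs'(2))
    show "l i \<in> set xs" "l j \<in> set xs" using ran that by auto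
    show "l i \<noteq> l j" using inj that by (auto dest: inj_onD)
  qed
  have "s i \<in> {1, -1}" for i by (simp add: s_def)
  then have "is_labelling c l s"
    unfolding is_labelling_def using inj at_label off_label commuting
    by (simp only: mn) blast
  then show ?thesis by blast
qed

definition lab :: "'c \<Rightarrow> nat \<Rightarrow> 'e" where
  "lab c = (SOME l. \<exists>s. is_labelling c l s)"

definition sg :: "'c \<Rightarrow> nat \<Rightarrow> real" where
  "sg c = (SOME s. is_labelling c (lab c) s)"

lemma labelling: "c \<in> cells Y \<Longrightarrow> is_labelling c (lab c) (sg c)"
proof -
  assume "c \<in> cells Y"
  then have "\<exists>s. is_labelling c (lab c) s"
    unfolding lab_def by (intro someI_ex[of "\<lambda>l. \<exists>s. is_labelling c l s"] ex_labelling)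
  then show ?thesis unfolding sg_def by (rule someI_ex)
qed

lemma lab_inj_on: "c \<in> cells Y \<Longrightarrow> inj_on (lab c) {..<dm c}"
  using labelling[of c] unfolding is_labelling_def by blast

lemma lab_inj: "c \<in> cells Y \<Longrightarrow> i < dm c \<Longrightarrow> j < dm c \<Longrightarrow> lab c i = lab c j \<longleftrightarrow> i = j"
  using inj_on_eq_iff[OF lab_inj_on] by simp

lemma lab_E: "c \<in> cells Y \<Longrightarrow> i < dm c \<Longrightarrow> j < dm c \<Longrightarrow> i \<noteq> j \<Longrightarrow> E (lab c i) (lab c j)"
  using labelling[of c] unfolding is_labelling_def by blast

lemma sg_cases: "c \<in> cells Y \<Longrightarrow> sg c i = 1 \<or> sg c i = -1"
  using labelling[of c] unfolding is_labelling_def by blast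

lemma sg_sq [simp]: "c \<in> cells Y \<Longrightarrow> sg c i * (sg c i * x) = x"
  using sg_cases[of c i] by auto

text \<open>
  The coordinates of a point of the cube \<open>c\<close>, arranged by generators: a lift of the
  composite of the chart and \<open>f\<close> to the cover of the torus.
\<close>
definition dev :: "'c \<Rightarrow> (nat \<Rightarrow> real) \<Rightarrow> real ^ 'e" where
  "dev c x = (\<chi> e. \<Sum>i | i < dm c \<and> lab c i = e. sg c i * x i)"

lemma dev_lab:
  assumes "c \<in> cells Y" "i < dm c" shows "dev c x $ lab c i = sg c i * x i"
proof -
  have "{k. k < dm c \<and> lab c k = lab c i} = {i}" using lab_inj assms by auto
  then show ?thesis by (simp add: dev_def)
qed

lemma dev_other: "e \<notin> lab c ` {..<dm c} \<Longrightarrow> dev c x $ e = 0"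
  by (auto simp: dev_def intro!: sum.neutral)

lemma vec_eq_lab:
  assumes "\<And>i. i < dm c \<Longrightarrow> \<theta> $ lab c i = \<eta> $ lab c i"
    "\<And>e. e \<notin> lab c ` {..<dm c} \<Longrightarrow> \<theta> $ e = \<eta> $ e"
  shows "\<theta> = \<eta>"
  unfolding vec_eq_iff
proof
  show "\<theta> $ e = \<eta> $ e" for e
    using assms by (cases "e \<in> lab c ` {..<dm c}") auto
qed

lemma f_chart:
  assumes "c \<in> cells Y" "x \<in> cub c" shows "f (ch c x) = torus_point (dev c x)"
  using labelling[OF assms(1)] assms
  by (intro vec_eq_lab[of c]) (auto simp: is_labelling_def torus_point_def dev_lab dev_other)

lemma dev_inj:
  assumes "c \<in> cells Y" "x \<in> cub c" "y \<in> cub c" "dev c x = dev c y" shows "x = y"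
proof (rule unit_cube_ext[OF assms(2,3)])
  fix i assume "i < dm c"
  then have "sg c i * x i = sg c i * y i" using dev_lab[OF assms(1)] assms(4) by metis
  then show "x i = y i" using sg_cases[OF assms(1), of i] by auto
qed

lemma chart_in_points: "c \<in> cells Y \<Longrightarrow> x \<in> cub c \<Longrightarrow> ch c x \<in> points Y"
  using complex_Y by (auto simp: cube_complex_def)

lemma pointsE:
  assumes "y \<in> points Y" obtains c x where "c \<in> cells Y" "x \<in> cub c" "y = ch c x"
  using assms complex_Y by (auto simp: cube_complex_def)

lemma support_face_subset: "support_face n x \<subseteq> unit_cube n"
  by (auto simp: support_face_def)

lemma support_face_self: "x \<in> unit_cube n \<Longrightarrow> x \<in> support_face n x"
  by (auto simp: support_face_def)

lemma support_face_segment: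
  assumes "x \<in> unit_cube n" "z \<in> support_face n x" "t \<in> {0..1}"
  shows "(\<lambda>i. x i + t * (z i - x i)) \<in> support_face n x"
proof -
  have z: "z \<in> unit_cube n" using assms(2) support_face_subset by blast
  have "0 \<le> (1 - t) * x i + t * z i" "(1 - t) * x i + t * z i \<le> 1" for i
    using unit_cube_bounds[OF assms(1), of i] unit_cube_bounds[OF z, of i] assms(3)
    by (auto intro!: add_nonneg_nonneg mult_nonneg_nonneg convex_bound_le)
  then have b: "0 \<le> x i + t * (z i - x i)" "x i + t * (z i - x i) \<le> 1" for i
    by (simp_all add: algebra_simps)
  moreover have "x i + t * (z i - x i) = 0" if "i \<ge> n" for i
    using unit_cube_outside[OF assms(1) that] unit_cube_outside[OF z that] by simp
  ultimately have "(\<lambda>i. x i + t * (z i - x i)) \<in> unit_cube n"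
    unfolding unit_cube_def by blast
  moreover have "x i + t * (z i - x i) = x i" if "i < n" "x i \<in> {0, 1}" for i
  proof -
    have "z i = x i" using assms(2) that unfolding support_face_def by blast
    then show ?thesis by simp
  qed
  ultimately show ?thesis
    unfolding support_face_def by blast
qed

lemma cube_dist_coordinate: "i < n \<Longrightarrow> \<bar>x i - y i\<bar> \<le> cube_dist n x y"
  unfolding cube_dist_def using member_le_L2_set[of "{..<n}" i "\<lambda>i. \<bar>x i - y i\<bar>"]
  by (simp add: L2_set_def)

text \<open>
  The identifications between cubes preserve developments up to translation. On the segment from
  \<open>x\<close> to \<open>z\<close> the two developments have the same image in the torus, so
  their difference is integral, and being continuous it is constant.
\<close>
theorem transport:
  assumes c: "c \<in> cells Y" "c' \<in> cells Y" and x: "x \<in> cub c" "x' \<in> cub c'" "ch c x = ch c' x'"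
    and z: "z \<in> support_face (dm c) x"
  shows "\<exists>z'\<in>support_face (dm c') x'. ch c z = ch c' z' \<and> dev c' z' - dev c' x' = dev c z - dev c x"
proof -
  have "\<forall>c\<in>cells Y. \<forall>c'\<in>cells Y. \<forall>x\<in>cub c. \<forall>x'\<in>cub c'. ch c x = ch c' x' \<longrightarrow>
      (\<exists>h. cube_isometry (dm c) (support_face (dm c) x) (dm c') (support_face (dm c') x') h \<and>
           (\<forall>z\<in>support_face (dm c) x. ch c z = ch c' (h z)))"
    using complex_Y unfolding cube_complex_def by (elim conjE)
  from this[rule_format, OF c x]
  obtain h where iso: "cube_isometry (dm c) (support_face (dm c) x) (dm c') (support_face (dm c') x') h"
      and hch: "\<And>z. z \<in> support_face (dm c) x \<Longrightarrow> ch c z = ch c' (h z)"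
    by blast
  have hF: "h y \<in> support_face (dm c') x'" if "y \<in> support_face (dm c) x" for y
    using iso that by (auto simp: cube_isometry_def bij_betw_def)
  have fl: "torus_point (dev c y) = torus_point (dev c' (h y))" if "y \<in> support_face (dm c) x" for y
    using f_chart[OF c(1), of y] f_chart[OF c(2), of "h y"] hch[OF that] hF[OF that] that support_face_subset
    by (metis subsetD)
  have xx: "x \<in> support_face (dm c) x" using x(1) by (rule support_face_self)
  \<comment> \<open>A gluing isometry, too, takes \<open>x\<close> to \<open>x'\<close>: coordinates in which \<open>x'\<close> is on the boundary are the same on
    its whole face, and the others agree modulo integers and lie strictly between \<open>0\<close> and \<open>1\<close> for \<open>x'\<close>.\<close>
  have hx: "h x = x'"
  proof (rule unit_cube_ext)
    show hxU: "h x \<in> cub c'" using hF[OF xx] support_face_subset by blast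
    fix j assume j: "j < dm c'"
    show "h x j = x' j"
    proof (cases "x' j \<in> {0, 1}")
      case True
      then show ?thesis using hF[OF xx] j by (auto simp: support_face_def)
    next
      case False
      then have b: "0 < x' j" "x' j < 1" using unit_cube_bounds[OF x(2), of j] by auto
      have "torus_point (dev c' (h x)) = torus_point (dev c' x')"
        using f_chart[OF c(2) hxU] f_chart[OF c(2) x(2)] hch[OF xx] x(3) by simp
      then have "dev c' (h x) $ lab c' j - dev c' x' $ lab c' j \<in> \<int>"
        by (simp add: torus_point_eq_iff)
      then have "sg c' j * h x j - sg c' j * x' j \<in> \<int>" by (simp add: dev_lab[OF c(2) j])
      then have "h x j - x' j \<in> \<int>"
        using sg_cases[OF c(2), of j] by (auto simp: minus_in_Ints_iff[of "h x j - x' j", symmetric])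
      moreover have "\<bar>h x j - x' j\<bar> < 1" using b unit_cube_bounds[OF hxU, of j] by auto
      ultimately show ?thesis using abs_Ints_less_1 by fastforce
    qed
  qed (rule x(2))
  define u where "u t = (\<lambda>i. x i + t * (z i - x i))" for t
  have uF: "u t \<in> support_face (dm c) x" if "t \<in> {0..1}" for t
    unfolding u_def using support_face_segment[OF x(1) z that] .
  have ends: "u 0 = x" "u 1 = z" by (auto simp: u_def)
  define L where "L = cube_dist (dm c) z x"
  have ud: "cube_dist (dm c) (u t) (u s) = L * \<bar>t - s\<bar>" for s t
  proof -
    have "cube_dist (dm c) (u t) (u s) = L2_set (\<lambda>i. (t - s) * (z i - x i)) {..<dm c}"
      unfolding cube_dist_def u_def by (intro L2_set_cong refl) (simp add: algebra_simps)
    also have "\<dots> = \<bar>t - s\<bar> * L"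
      unfolding L_def cube_dist_def L2_set_def
      by (simp add: power_mult_distrib sum_distrib_left[symmetric] real_sqrt_mult)
    finally show ?thesis by (simp add: mult.commute)
  qed
  have L0: "L \<ge> 0" unfolding L_def cube_dist_def by (rule L2_set_nonneg)
  have cont: "continuous_on {0..1} (\<lambda>t. dev c' (h (u t)) $ e - dev c (u t) $ e)" for e
  proof (rule continuous_on_diff)
    show "continuous_on {0..1} (\<lambda>t. dev c (u t) $ e)"
      unfolding dev_def u_def by (simp add: continuous_intros)
    show "continuous_on {0..1} (\<lambda>t. dev c' (h (u t)) $ e)"
    proof (cases "e \<in> lab c' ` {..<dm c'}")
      case True
      then obtain j where j: "j < dm c'" "e = lab c' j" by auto
      have "L-lipschitz_on {0..1} (\<lambda>t. h (u t) j)"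
      proof (rule lipschitz_onI[OF _ L0])
        fix t s :: real assume st: "t \<in> {0..1}" "s \<in> {0..1}"
        have "\<bar>h (u t) j - h (u s) j\<bar> \<le> cube_dist (dm c') (h (u t)) (h (u s))"
          using j(1) by (rule cube_dist_coordinate)
        also have "\<dots> = cube_dist (dm c) (u t) (u s)"
          using iso uF st by (simp add: cube_isometry_def)
        finally show "dist (h (u t) j) (h (u s) j) \<le> L * dist t s"
          by (simp add: ud dist_real_def)
      qed
      then have "continuous_on {0..1} (\<lambda>t. h (u t) j)" by (rule lipschitz_on_continuous_on)
      then show ?thesis unfolding j(2) dev_lab[OF c(2) j(1)] by (intro continuous_intros)
    qed (simp add: dev_other)
  qed
  have int: "dev c' (h (u t)) $ e - dev c (u t) $ e \<in> \<int>" if "t \<in> {0..1}" for t e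
    using fl[OF uF[OF that]] by (auto simp: torus_point_eq_iff) (metis Ints_minus minus_diff_eq)
  have const: "dev c' (h (u 1)) $ e - dev c (u 1) $ e = dev c' (h (u 0)) $ e - dev c (u 0) $ e" for e
  proof -
    have "(\<lambda>t. dev c' (h (u t)) $ e - dev c (u t) $ e) constant_on {0..1::real}"
    proof (rule continuous_discrete_range_constant[OF _ cont])
      fix t :: real assume t: "t \<in> {0..1}"
      show "\<exists>d>0. \<forall>y. y \<in> {0..1} \<and> dev c' (h (u y)) $ e - dev c (u y) $ e \<noteq> dev c' (h (u t)) $ e - dev c (u t) $ e \<longrightarrow>
        d \<le> norm (dev c' (h (u y)) $ e - dev c (u y) $ e - (dev c' (h (u t)) $ e - dev c (u t) $ e))"
      proof (intro exI[of _ 1] conjI allI impI)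
        fix y :: real
        assume y: "y \<in> {0..1} \<and> dev c' (h (u y)) $ e - dev c (u y) $ e \<noteq> dev c' (h (u t)) $ e - dev c (u t) $ e"
        then have "dev c' (h (u y)) $ e - dev c (u y) $ e - (dev c' (h (u t)) $ e - dev c (u t) $ e) \<in> \<int>"
          using t by (intro Ints_diff[OF int int]) auto
        then show "1 \<le> norm (dev c' (h (u y)) $ e - dev c (u y) $ e - (dev c' (h (u t)) $ e - dev c (u t) $ e))"
          using y abs_Ints_less_1 by fastforce
      qed simp
    qed simp
    then show ?thesis unfolding constant_on_def by force
  qed
  show ?thesis
  proof (intro bexI[of _ "h z"] conjI)
    show "dev c' (h z) - dev c' x' = dev c z - dev c x"
      using const hx unfolding ends vec_eq_iff by (simp add: algebra_simps)
  qed (use hch[OF z] hF[OF z] in auto)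
qed

section \<open>Stars of vertices\<close>

lemma corners_subset: "a \<in> corners n \<Longrightarrow> a \<in> unit_cube n"
  by (simp add: corners_def)

lemma corner_cases: "a \<in> corners n \<Longrightarrow> a i = 0 \<or> a i = 1"
  by (cases "i < n") (auto simp: corners_def unit_cube_def)

lemma dev_diff_lab:
  "c \<in> cells Y \<Longrightarrow> i < dm c \<Longrightarrow> (dev c x - dev c a) $ lab c i = sg c i * (x i - a i)"
  by (simp add: dev_lab right_diff_distrib)

lemma dev_diff_other: "e \<notin> lab c ` {..<dm c} \<Longrightarrow> (dev c x - dev c a) $ e = 0"
  by (simp add: dev_other)

lemma dev_corner_Ints:
  assumes "c \<in> cells Y" "a \<in> corners (dm c)" shows "dev c a $ e \<in> \<int>"
proof (cases "e \<in> lab c ` {..<dm c}")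
  case True
  then obtain i where "i < dm c" "e = lab c i" by auto
  then show ?thesis
    using dev_lab[OF assms(1), of i a] sg_cases[OF assms(1), of i] corner_cases[OF assms(2), of i] by auto
qed (simp add: dev_other)

lemma f_chart_eq_1_iff:
  assumes "c \<in> cells Y" "x \<in> cub c" shows "f (ch c x) = 1 \<longleftrightarrow> x \<in> corners (dm c)"
proof
  assume "f (ch c x) = 1"
  then have i: "dev c x $ e \<in> \<int>" for e using f_chart[OF assms] by (simp add: torus_point_eq_1_iff)
  have "x i \<in> {0, 1}" if "i < dm c" for i
  proof -
    have "x i \<in> \<int>"
      using i[of "lab c i"] dev_lab[OF assms(1) that, of x] sg_cases[OF assms(1), of i] by (auto simp: minus_in_Ints_iff)
    then obtain k where "x i = of_int k" by (rule Ints_cases)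
    then show ?thesis using unit_cube_bounds[OF assms(2), of i] by auto
  qed
  then show "x \<in> corners (dm c)" using assms(2) by (simp add: corners_def)
next
  assume "x \<in> corners (dm c)"
  then show "f (ch c x) = 1"
    using f_chart[OF assms] dev_corner_Ints[OF assms(1)] by (simp add: torus_point_eq_1_iff)
qed

lemma torus_point_dev_diff:
  assumes "c \<in> cells Y" "a \<in> corners (dm c)" "x \<in> cub c"
  shows "f (ch c x) = torus_point (dev c x - dev c a)"
  using f_chart[OF assms(1,3)] dev_corner_Ints[OF assms(1,2)] by (simp add: torus_point_eq_iff)

subsection \<open>Half edges and their letters\<close>

text \<open>
  The letter read on leaving the corner \<open>a\<close> in direction \<open>i\<close>; the
  coordinate increases if \<open>a i = 0\<close> and decreases if \<open>a i = 1\<close>.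
\<close>
definition half_letter :: "'c \<Rightarrow> (nat \<Rightarrow> real) \<Rightarrow> nat \<Rightarrow> 'e \<times> bool" where
  "half_letter c a i = (lab c i, sg c i * (1 - 2 * a i) > 0)"

definition half_loop :: "'e \<times> bool \<Rightarrow> (complex ^ 'e) set" where
  "half_loop x = (\<lambda>t. torus_point (t *\<^sub>R dir x)) ` {0<..<1/2}"

lemma half_loop_inj: assumes "half_loop x = half_loop y" shows "x = y"
proof -
  have "torus_point ((1/4) *\<^sub>R dir x) \<in> half_loop x"
    unfolding half_loop_def by (intro imageI) simp
  then have "torus_point ((1/4) *\<^sub>R dir x) \<in> half_loop y" unfolding assms .
  then obtain t where t: "0 < t" "t < 1/2" "torus_point ((1/4) *\<^sub>R dir x) = torus_point (t *\<^sub>R dir y)"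
    by (auto simp: half_loop_def)
  then have "1/4 * dir x $ e - t * dir y $ e \<in> \<int>" for e
    by (simp add: torus_point_eq_iff)
  from this[of "fst x"] have k: "1/4 * (if snd x then 1 else -1) - t * dir y $ fst x \<in> \<int>" (is "?k \<in> _")
    by (simp add: dir_nth)
  have "\<bar>?k\<bar> < 1" using t by (simp add: dir_nth abs_if)
  then have "?k = 0" using abs_Ints_less_1[OF k] by blast
  then show ?thesis using t by (auto simp: dir_nth prod_eq_iff split: if_splits)
qed

lemma half_edge_image:
  assumes c: "c \<in> cells Y" and a: "a \<in> corners (dm c)" and i: "i < dm c"
  shows "f ` half_edge Y c a i = half_loop (half_letter c a i)"
proof -
  have "f (ch c (a(i := \<bar>a i - t\<bar>))) = torus_point (t *\<^sub>R dir (half_letter c a i))" if t: "t \<in> {0<..<1/2}" for t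
  proof -
    let ?x = "a(i := \<bar>a i - t\<bar>)"
    have x: "?x \<in> cub c" using corner_cases[OF a, of i] corners_subset[OF a] t i by (auto simp: unit_cube_def)
    have "dev c ?x - dev c a = t *\<^sub>R dir (half_letter c a i)"
    proof (rule vec_eq_lab)
      fix j assume j: "j < dm c"
      show "(dev c ?x - dev c a) $ lab c j = (t *\<^sub>R dir (half_letter c a i)) $ lab c j"
        unfolding dev_diff_lab[OF c j]
        using lab_inj[OF c j i] corner_cases[OF a, of i] sg_cases[OF c, of i] t
        by (auto simp: dir_nth half_letter_def)
    next
      fix e assume e: "e \<notin> lab c ` {..<dm c}"
      then show "(dev c ?x - dev c a) $ e = (t *\<^sub>R dir (half_letter c a i)) $ e"
        unfolding dev_diff_other[OF e] using i by (auto simp: dir_nth half_letter_def)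
    qed
    then show ?thesis using torus_point_dev_diff[OF c a x] by simp
  qed
  then show ?thesis unfolding half_edge_def half_loop_def image_image by (intro image_cong) auto
qed

lemma vertex_cornersD:
  assumes "(c, a) \<in> vertex_corners Y v"
  shows "c \<in> cells Y" "a \<in> corners (dm c)" "ch c a = v" "v \<in> vertices Y"
  using assms by (auto simp: vertex_corners_def vertices_def)

lemma vertex_cornersI:
  "c \<in> cells Y \<Longrightarrow> a \<in> corners (dm c) \<Longrightarrow> (c, a) \<in> vertex_corners Y (ch c a)"
  by (auto simp: vertex_corners_def)

lemma half_edges_subset_link:
  assumes "(c, a) \<in> vertex_corners Y v" "J \<subseteq> {..<dm c}"
  shows "half_edge Y c a ` J \<subseteq> link_vertices Y v" "half_edge Y c a ` J \<in> link_simplices Y v"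
proof -
  show "half_edge Y c a ` J \<in> link_simplices Y v"
    unfolding link_simplices_def using assms by blast
  then show "half_edge Y c a ` J \<subseteq> link_vertices Y v" unfolding link_vertices_def by blast
qed

text \<open>
  The half edges spanning the smallest face that contains both \<open>a\<close> and
  \<open>x\<close> can be read off from the relative development, independently of the cube.
\<close>
lemma half_letters_support:
  assumes "c \<in> cells Y" "a \<in> corners (dm c)" "x \<in> cub c"
  shows "half_letter c a ` {i. i < dm c \<and> x i \<noteq> a i} =
         {(e, (dev c x - dev c a) $ e > 0) | e. (dev c x - dev c a) $ e \<noteq> 0}"
proof -
  have pos: "sg c i * (1 - 2 * a i) > 0 \<longleftrightarrow> sg c i * (x i - a i) > 0" if "x i \<noteq> a i" for i
    using corner_cases[OF assms(2), of i] unit_cube_bounds[OF assms(3), of i] sg_cases[OF assms(1), of i] that by auto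
  show ?thesis
  proof (intro Set.set_eqI iffI)
    fix p assume "p \<in> half_letter c a ` {i. i < dm c \<and> x i \<noteq> a i}"
    then obtain i where i: "i < dm c" "x i \<noteq> a i" "p = half_letter c a i" by auto
    then have "(dev c x - dev c a) $ lab c i \<noteq> 0" "p = (lab c i, (dev c x - dev c a) $ lab c i > 0)"
      unfolding dev_diff_lab[OF assms(1) i(1)] half_letter_def i(3)
      using pos[OF i(2)] sg_cases[OF assms(1), of i] by auto
    then show "p \<in> {(e, (dev c x - dev c a) $ e > 0) | e. (dev c x - dev c a) $ e \<noteq> 0}" by blast
  next
    fix p assume "p \<in> {(e, (dev c x - dev c a) $ e > 0) | e. (dev c x - dev c a) $ e \<noteq> 0}"
    then obtain e where e: "p = (e, (dev c x - dev c a) $ e > 0)" "(dev c x - dev c a) $ e \<noteq> 0" by blast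
    then obtain i where i: "i < dm c" "e = lab c i" using dev_diff_other[of e c x a] by blast
    then have "x i \<noteq> a i" using e(2) dev_diff_lab[OF assms(1) i(1), of x a] by auto
    moreover from this have "p = half_letter c a i"
      unfolding e(1) i(2) dev_diff_lab[OF assms(1) i(1)] half_letter_def using pos by simp
    ultimately show "p \<in> half_letter c a ` {i. i < dm c \<and> x i \<noteq> a i}" using i(1) by blast
  qed
qed

lemma npc_vertex: "v \<in> vertices Y \<Longrightarrow> simplicial_link Y v"
  using npc_Y by (simp add: nonpositively_curved_def)

lemma local_iso_vertex:
  assumes "v \<in> vertices Y"
  shows "inj_on ((`) f) (link_vertices Y v)"
    "\<And>\<Sigma>. \<Sigma> \<subseteq> link_vertices Y v \<Longrightarrow> (`) f ` \<Sigma> \<in> link_simplices (salvetti E) (f v) \<Longrightarrow> \<Sigma> \<in> link_simplices Y v"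
  using local_iso assms unfolding local_isometry_def by blast+

lemma half_edge_set_image:
  assumes "c \<in> cells Y" "a \<in> corners (dm c)" "J \<subseteq> {..<dm c}"
  shows "(`) f ` half_edge Y c a ` J = half_loop ` half_letter c a ` J"
  unfolding image_image using assms by (intro image_cong refl half_edge_image) auto

text \<open>
  Points near a vertex are determined by their development relative to it. The relative
  development determines the letters of the half edges at the corner that point towards
  \<open>x\<close>; since \<open>f\<close> is injective on the link it determines these half
  edges, and since the link is simplicial the corner block that they span.
\<close>
theorem star_point_unique:
  assumes ca: "(c, a) \<in> vertex_corners Y v" and ca': "(c', a') \<in> vertex_corners Y v"
    and x: "x \<in> cub c" and x': "x' \<in> cub c'"
    and eq: "dev c x - dev c a = dev c' x' - dev c' a'"
  shows "ch c x = ch c' x'"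
proof -
  note D = vertex_cornersD[OF ca] and D' = vertex_cornersD[OF ca']
  define J where "J = {i. i < dm c \<and> x i \<noteq> a i}"
  define J' where "J' = {i. i < dm c' \<and> x' i \<noteq> a' i}"
  have JJ: "J \<subseteq> {..<dm c}" "J' \<subseteq> {..<dm c'}" by (auto simp: J_def J'_def)
  have "half_letter c a ` J = half_letter c' a' ` J'"
    unfolding J_def J'_def half_letters_support[OF D(1,2) x] half_letters_support[OF D'(1,2) x'] eq ..
  then have "(`) f ` half_edge Y c a ` J = (`) f ` half_edge Y c' a' ` J'"
    using half_edge_set_image[OF D(1,2) JJ(1)] half_edge_set_image[OF D'(1,2) JJ(2)] by simp
  then have he: "half_edge Y c a ` J = half_edge Y c' a' ` J'"
    by (rule inj_on_image_eq_iff[OF local_iso_vertex(1)[OF D(4)] half_edges_subset_link(1)[OF ca JJ(1)]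
        half_edges_subset_link(1)[OF ca' JJ(2)], THEN iffD1])
  have links: "\<forall>(c, x)\<in>vertex_corners Y v. \<forall>(c', x')\<in>vertex_corners Y v.
        \<forall>J \<subseteq> {..<cell_dim Y c}. \<forall>J' \<subseteq> {..<cell_dim Y c'}.
          half_edge Y c x ` J = half_edge Y c' x' ` J' \<longrightarrow>
          corner_block Y c x J = corner_block Y c' x' J'"
    using npc_vertex[OF D(4)] unfolding simplicial_link_def by (elim conjE)
  note links' = bspec[OF bspec[OF links ca, unfolded prod.case] ca', unfolded prod.case]
  have block: "corner_block Y c a J = corner_block Y c' a' J'"
    by (rule links'[rule_format, OF JJ he])
  \<comment> \<open>A corner block contains only points at distance less than \<open>1/2\<close> from the corner in each coordinate, so
    \<open>x\<close> is contracted towards the corner first; it lies in the support face of the contracted point.\<close>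
  define m where "m = (\<lambda>i. a i + (x i - a i) / 3)"
  have a01: "a i = 0 \<or> a i = 1" for i using corner_cases[OF D(2)] .
  have x01: "0 \<le> x i" "x i \<le> 1" for i using unit_cube_bounds[OF x, of i] by auto
  have mU: "m \<in> cub c"
    unfolding unit_cube_def
  proof (intro CollectI conjI allI impI)
    fix i
    show "0 \<le> m i" "m i \<le> 1" using a01[of i] x01[of i] by (auto simp: m_def field_simps)
    show "m i = 0" if "dm c \<le> i"
      using unit_cube_outside[OF x that] unit_cube_outside[OF corners_subset[OF D(2)] that] by (simp add: m_def)
  qed
  have third: "\<bar>m i - a i\<bar> = \<bar>x i - a i\<bar> / 3" for i by (simp add: m_def)
  have "ch c m \<in> corner_block Y c a J"
    unfolding corner_block_def
  proof (intro imageI CollectI conjI allI impI mU)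
    fix i assume "i < dm c"
    have "\<bar>x i - a i\<bar> \<le> 1" using a01[of i] x01[of i] by auto
    then show "if i \<in> J then 0 < \<bar>m i - a i\<bar> \<and> \<bar>m i - a i\<bar> < 1 / 2 else m i = a i"
      unfolding third using \<open>i < dm c\<close> by (auto simp: J_def m_def)
  qed
  then have "ch c m \<in> corner_block Y c' a' J'" using block by simp
  then obtain m' where m': "m' \<in> cub c'" "ch c m = ch c' m'"
    and m'b: "\<And>i. i < dm c' \<Longrightarrow> if i \<in> J' then 0 < \<bar>m' i - a' i\<bar> \<and> \<bar>m' i - a' i\<bar> < 1 / 2 else m' i = a' i"
    unfolding corner_block_def by blast
  have dm: "dev c m - dev c a = (1/3) *\<^sub>R (dev c x - dev c a)"
  proof (rule vec_eq_lab)
    fix i assume i: "i < dm c"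
    show "(dev c m - dev c a) $ lab c i = ((1/3) *\<^sub>R (dev c x - dev c a)) $ lab c i"
      unfolding vector_scaleR_component dev_diff_lab[OF D(1) i] by (simp add: m_def)
  next
    fix e assume e: "e \<notin> lab c ` {..<dm c}"
    show "(dev c m - dev c a) $ e = ((1/3) *\<^sub>R (dev c x - dev c a)) $ e"
      unfolding vector_scaleR_component dev_diff_other[OF e] by simp
  qed
  have small: "\<bar>(dev c x - dev c a) $ e\<bar> \<le> 1" for e
  proof (cases "e \<in> lab c ` {..<dm c}")
    case True
    then obtain i where i: "i < dm c" "e = lab c i" by auto
    have "\<bar>x i - a i\<bar> \<le> 1" using a01[of i] x01[of i] by auto
    then show ?thesis unfolding i(2) dev_diff_lab[OF D(1) i(1)] using sg_cases[OF D(1), of i] by (auto simp: abs_mult)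
  qed (simp add: dev_other)
  have small': "\<bar>(dev c' m' - dev c' a') $ e\<bar> < 1 / 2" for e
  proof (cases "e \<in> lab c' ` {..<dm c'}")
    case True
    then obtain i where i: "i < dm c'" "e = lab c' i" by auto
    have "\<bar>m' i - a' i\<bar> < 1 / 2" using m'b[OF i(1)] by (auto split: if_splits)
    then show ?thesis unfolding i(2) dev_diff_lab[OF D'(1) i(1)] using sg_cases[OF D'(1), of i] by (auto simp: abs_mult)
  qed (simp add: dev_other)
  have "torus_point (dev c m - dev c a) = torus_point (dev c' m' - dev c' a')"
    using torus_point_dev_diff[OF D(1,2) mU] torus_point_dev_diff[OF D'(1,2) m'(1)] m'(2) by simp
  then have "(dev c m - dev c a) $ e - (dev c' m' - dev c' a') $ e \<in> \<int>" for e
    by (simp only: torus_point_eq_iff)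
  moreover have "\<bar>(dev c m - dev c a) $ e - (dev c' m' - dev c' a') $ e\<bar> < 1" for e
    using small[of e] small'[of e] unfolding dm vector_scaleR_component real_scaleR_def by linarith
  ultimately have mm: "dev c m - dev c a = dev c' m' - dev c' a'"
    unfolding vec_eq_iff using abs_Ints_less_1 by (metis eq_iff_diff_eq_0)
  have "x \<in> support_face (dm c) m"
    unfolding support_face_def
  proof (intro CollectI conjI allI impI x)
    fix i assume "i < dm c" "m i \<in> {0, 1}"
    then show "x i = m i" using a01[of i] x01[of i] by (auto simp: m_def field_simps)
  qed
  then obtain z' where z': "z' \<in> support_face (dm c') m'" "ch c x = ch c' z'"
    "dev c' z' - dev c' m' = dev c x - dev c m"
    using transport[OF D(1) D'(1) mU m'(1,2)] by blast
  have "dev c' z' = dev c' x'"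
    using z'(3) mm eq by (metis (no_types, lifting) add_diff_cancel_left' add_diff_eq diff_add_cancel)
  then have "z' = x'"
    using dev_inj[OF D'(1) _ x'] z'(1) support_face_subset by blast
  then show ?thesis using z'(2) by simp
qed

subsection \<open>Star charts\<close>

definition Box :: "real ^ 'e \<Rightarrow> (real ^ 'e) set" where
  "Box \<sigma> = {\<theta>. \<forall>e. \<theta> $ e \<in> closed_segment 0 (\<sigma> $ e)}"

lemma Box_eq_INT: "Box \<sigma> = (\<Inter>e. (\<lambda>\<theta>. \<theta> $ e) -` closed_segment 0 (\<sigma> $ e))"
  by (auto simp: Box_def)

lemma closed_Box: "closed (Box \<sigma>)"
  unfolding Box_eq_INT
  by (intro closed_INT ballI closed_vimage) (auto intro!: continuous_intros)

lemma convex_Box: "convex (Box \<sigma>)"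
  unfolding Box_eq_INT
  by (intro convex_INT ballI convex_linear_vimage) (auto intro: bounded_linear.linear bounded_linear_vec_nth)

lemma zero_in_Box [simp]: "0 \<in> Box \<sigma>"
  by (simp add: Box_def)

text \<open>
  The development, relative to the corner \<open>a\<close>, of the opposite corner; it spans the
  box that the cube \<open>c\<close> occupies when \<open>a\<close> is put at the origin.
\<close>
definition spread :: "'c \<Rightarrow> (nat \<Rightarrow> real) \<Rightarrow> real ^ 'e" where
  "spread c a = dev c (\<lambda>i. 1 - 2 * a i)"

text \<open>
  The inverse of the development relative to the corner \<open>a\<close>.
\<close>
definition undev :: "'c \<Rightarrow> (nat \<Rightarrow> real) \<Rightarrow> real ^ 'e \<Rightarrow> nat \<Rightarrow> real" where
  "undev c a \<theta> = (\<lambda>i. if i < dm c then a i + sg c i * \<theta> $ lab c i else 0)"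

lemma closed_segment_0: "x \<in> closed_segment 0 (y :: real) \<longleftrightarrow> (\<exists>s\<in>{0..1}. x = s * y)"
  by (auto simp: closed_segment_def)

lemma dev_diff_in_Box:
  assumes "c \<in> cells Y" "a \<in> corners (dm c)" "x \<in> cub c"
  shows "dev c x - dev c a \<in> Box (spread c a)"
  unfolding Box_def
proof (intro CollectI allI)
  fix e
  show "(dev c x - dev c a) $ e \<in> closed_segment 0 (spread c a $ e)"
  proof (cases "e \<in> lab c ` {..<dm c}")
    case True
    then obtain i where i: "i < dm c" "e = lab c i" by auto
    show ?thesis
      unfolding i(2) dev_diff_lab[OF assms(1) i(1)] spread_def dev_lab[OF assms(1) i(1)] closed_segment_0
      using corner_cases[OF assms(2), of i] unit_cube_bounds[OF assms(3), of i]
      by (intro bexI[of _ "\<bar>x i - a i\<bar>"]) (auto simp: abs_if)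
  qed (simp add: dev_other spread_def)
qed

lemma undev:
  assumes "c \<in> cells Y" "a \<in> corners (dm c)" "\<theta> \<in> Box (spread c a)"
  shows "undev c a \<theta> \<in> cub c" "dev c (undev c a \<theta>) - dev c a = \<theta>"
proof -
  have s: "\<exists>s\<in>{0..1}. \<theta> $ lab c i = s * (sg c i * (1 - 2 * a i))" if "i < dm c" for i
  proof -
    have "\<theta> $ lab c i \<in> closed_segment 0 (spread c a $ lab c i)" using assms(3) by (simp add: Box_def)
    then show ?thesis unfolding spread_def dev_lab[OF assms(1) that] closed_segment_0 .
  qed
  have "0 \<le> a i + sg c i * \<theta> $ lab c i \<and> a i + sg c i * \<theta> $ lab c i \<le> 1" if "i < dm c" for i
    using s[OF that] corner_cases[OF assms(2), of i] sg_cases[OF assms(1), of i] by auto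
  then show "undev c a \<theta> \<in> cub c" by (simp add: unit_cube_def undev_def)
  show "dev c (undev c a \<theta>) - dev c a = \<theta>"
  proof (rule vec_eq_lab)
    fix i assume i: "i < dm c"
    show "(dev c (undev c a \<theta>) - dev c a) $ lab c i = \<theta> $ lab c i"
      unfolding dev_diff_lab[OF assms(1) i] using i assms(1) by (simp add: undev_def)
  next
    fix e assume e: "e \<notin> lab c ` {..<dm c}"
    have "\<theta> $ e \<in> closed_segment 0 (spread c a $ e)" using assms(3) by (simp add: Box_def)
    then show "(dev c (undev c a \<theta>) - dev c a) $ e = \<theta> $ e"
      unfolding dev_diff_other[OF e] using e by (simp add: spread_def dev_other)
  qed
qed

text \<open>
  The closed star of a vertex, laid out in the cover of the torus as a union of boxes around the
  origin.
\<close>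
definition star :: "'y \<Rightarrow> (real ^ 'e) set" where
  "star v = (\<Union>(c, a)\<in>vertex_corners Y v. Box (spread c a))"

text \<open>
  The map from the star to the complex, well defined because a point is determined by its relative
  development.
\<close>
definition star_chart :: "'y \<Rightarrow> real ^ 'e \<Rightarrow> 'y" where
  "star_chart v \<theta> = (SOME y. \<exists>c a. (c, a) \<in> vertex_corners Y v \<and> \<theta> \<in> Box (spread c a) \<and> y = ch c (undev c a \<theta>))"

lemma star_chart_eq_undev:
  assumes "(c, a) \<in> vertex_corners Y v" "\<theta> \<in> Box (spread c a)"
  shows "star_chart v \<theta> = ch c (undev c a \<theta>)"
  unfolding star_chart_def
proof (rule some_equality)
  show "\<exists>c' a'. (c', a') \<in> vertex_corners Y v \<and> \<theta> \<in> Box (spread c' a') \<and> ch c (undev c a \<theta>) = ch c' (undev c' a' \<theta>)"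
    using assms by blast
  fix y assume "\<exists>c a. (c, a) \<in> vertex_corners Y v \<and> \<theta> \<in> Box (spread c a) \<and> y = ch c (undev c a \<theta>)"
  then obtain c' a' where ca': "(c', a') \<in> vertex_corners Y v" "\<theta> \<in> Box (spread c' a')" "y = ch c' (undev c' a' \<theta>)"
    by blast
  note u = undev[OF vertex_cornersD(1,2)[OF assms(1)] assms(2)] and u' = undev[OF vertex_cornersD(1,2)[OF ca'(1)] ca'(2)]
  show "y = ch c (undev c a \<theta>)"
    unfolding ca'(3) by (rule star_point_unique[OF ca'(1) assms(1) u'(1) u(1)]) (simp add: u(2) u'(2))
qed

lemma star_chart_dev:
  assumes "(c, a) \<in> vertex_corners Y v" "x \<in> cub c"
  shows "star_chart v (dev c x - dev c a) = ch c x" "dev c x - dev c a \<in> Box (spread c a)" "dev c x - dev c a \<in> star v"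
proof -
  note D = vertex_cornersD[OF assms(1)]
  show B: "dev c x - dev c a \<in> Box (spread c a)" using dev_diff_in_Box D assms(2) by blast
  then show "dev c x - dev c a \<in> star v" unfolding star_def using assms(1) by blast
  have "dev c (undev c a (dev c x - dev c a)) = dev c x" using undev(2)[OF D(1,2) B] by simp
  then show "star_chart v (dev c x - dev c a) = ch c x"
    using dev_inj[OF D(1) undev(1)[OF D(1,2) B] assms(2)] star_chart_eq_undev[OF assms(1) B] by simp
qed

lemma starE:
  assumes "\<theta> \<in> star v"
  obtains c a x where "(c, a) \<in> vertex_corners Y v" "x \<in> cub c" "\<theta> = dev c x - dev c a" "star_chart v \<theta> = ch c x"
    "\<theta> \<in> Box (spread c a)"
proof -
  obtain c a where ca: "(c, a) \<in> vertex_corners Y v" "\<theta> \<in> Box (spread c a)"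
    using assms by (auto simp: star_def)
  note u = undev[OF vertex_cornersD(1,2)[OF ca(1)] ca(2)]
  show thesis using that[OF ca(1) u(1)] u(2) star_chart_eq_undev[OF ca] ca(2) by simp
qed

lemma star_chart_in_points: "\<theta> \<in> star v \<Longrightarrow> star_chart v \<theta> \<in> points Y"
  using chart_in_points vertex_cornersD(1) by (metis starE)

lemma f_star_chart: "\<theta> \<in> star v \<Longrightarrow> f (star_chart v \<theta>) = torus_point \<theta>"
  using torus_point_dev_diff vertex_cornersD(1,2) by (metis starE)

lemma zero_in_star: "v \<in> vertices Y \<Longrightarrow> 0 \<in> star v \<and> star_chart v 0 = v"
proof -
  assume "v \<in> vertices Y"
  then obtain c a where ca: "(c, a) \<in> vertex_corners Y v"
    by (auto simp: vertices_def vertex_corners_def)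
  note D = vertex_cornersD[OF ca]
  show ?thesis using star_chart_dev[OF ca corners_subset[OF D(2)]] D(3) by simp
qed

lemma Box_subset_star: "(c, a) \<in> vertex_corners Y v \<Longrightarrow> Box (spread c a) \<subseteq> star v"
  unfolding star_def by blast

lemma change_corner:
  assumes "(c, a) \<in> vertex_corners Y v" "b \<in> corners (dm c)" "\<theta> \<in> Box (spread c a)"
  shows "\<theta> - (dev c b - dev c a) \<in> Box (spread c b)"
    "star_chart (ch c b) (\<theta> - (dev c b - dev c a)) = star_chart v \<theta>"
proof -
  note D = vertex_cornersD[OF assms(1)]
  note u = undev[OF D(1,2) assms(3)]
  have e: "\<theta> - (dev c b - dev c a) = dev c (undev c a \<theta>) - dev c b" using u(2) by (simp add: algebra_simps)
  note L = star_chart_dev[OF vertex_cornersI[OF D(1) assms(2)] u(1)]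
  show "\<theta> - (dev c b - dev c a) \<in> Box (spread c b)" unfolding e by (rule L(2))
  show "star_chart (ch c b) (\<theta> - (dev c b - dev c a)) = star_chart v \<theta>"
    unfolding e L(1) star_chart_eq_undev[OF assms(1,3)] ..
qed

text \<open>
  If a point of a cube at \<open>v\<close> lies in the open star of \<open>w\<close>, then
  \<open>w\<close> is a corner of this cube, and the two charts differ by a translation.
\<close>
lemma star_chart_transport:
  assumes "(c, a) \<in> vertex_corners Y v" "\<theta> \<in> Box (spread c a)"
    and "\<theta>' \<in> star w" "\<And>e. \<bar>\<theta>' $ e\<bar> < 1" and eq: "star_chart v \<theta> = star_chart w \<theta>'"
  shows "\<exists>b\<in>corners (dm c). ch c b = w \<and> dev c b - dev c a = \<theta> - \<theta>'"
proof -
  note D = vertex_cornersD[OF assms(1)]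
  note u = undev[OF D(1,2) assms(2)]
  obtain c' a' x' where x': "(c', a') \<in> vertex_corners Y w" "x' \<in> cub c'" "\<theta>' = dev c' x' - dev c' a'"
      "star_chart w \<theta>' = ch c' x'"
    using assms(3) by (rule starE)
  note D' = vertex_cornersD[OF x'(1)]
  have "a' \<in> support_face (dm c') x'"
    unfolding support_face_def
  proof (intro CollectI conjI allI impI corners_subset D'(2))
    fix i assume i: "i < dm c'" "x' i \<in> {0, 1}"
    have "\<bar>sg c' i * (x' i - a' i)\<bar> < 1"
      using assms(4)[of "lab c' i"] unfolding x'(3) dev_diff_lab[OF D'(1) i(1)] .
    then have "\<bar>x' i - a' i\<bar> < 1" using sg_cases[OF D'(1), of i] by (auto simp: abs_mult)
    then show "a' i = x' i" using i(2) corner_cases[OF D'(2), of i] by auto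
  qed
  moreover have "ch c' x' = ch c (undev c a \<theta>)"
    using eq x'(4) star_chart_eq_undev[OF assms(1,2)] by simp
  ultimately obtain b where b: "b \<in> support_face (dm c) (undev c a \<theta>)" "ch c' a' = ch c b"
      "dev c b - dev c (undev c a \<theta>) = dev c' a' - dev c' x'"
    using transport[OF D'(1) D(1) x'(2) u(1)] by blast
  have bU: "b \<in> cub c" using b(1) support_face_subset by blast
  have "f (ch c b) = 1"
    using b(2) f_chart_eq_1_iff[OF D'(1) corners_subset[OF D'(2)]] D'(2) by simp
  then have "b \<in> corners (dm c)" using f_chart_eq_1_iff[OF D(1) bU] by simp
  moreover have "dev c b - dev c a = \<theta> - \<theta>'"
  proof -
    have "dev c b - dev c a = (dev c b - dev c (undev c a \<theta>)) + (dev c (undev c a \<theta>) - dev c a)" by simp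
    also have "\<dots> = \<theta> - \<theta>'" unfolding b(3) u(2) x'(3) by simp
    finally show ?thesis .
  qed
  moreover have "ch c b = w" using b(2) D'(3) by simp
  ultimately show ?thesis by blast
qed

subsection \<open>Topology of the stars\<close>

lemma openin_points_iff:
  assumes "U \<subseteq> points Y"
  shows "openin (top_of_set (points Y)) U \<longleftrightarrow>
         (\<forall>c\<in>cells Y. openin (top_of_set (cub c)) {x \<in> cub c. ch c x \<in> U})"
proof -
  have "\<forall>U \<subseteq> points Y. openin (top_of_set (points Y)) U \<longleftrightarrow>
         (\<forall>c\<in>cells Y. openin (top_of_set (cub c)) {x \<in> cub c. ch c x \<in> U})"
    using complex_Y unfolding cube_complex_def by (elim conjE)
  then show ?thesis using assms by blast
qed

lemma continuous_on_dev: "continuous_on S (dev c)"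
proof -
  have "continuous_on S (\<lambda>x. x i)" for i :: nat and S :: "(nat \<Rightarrow> real) set"
    by (rule continuous_on_subset[OF continuous_on_product_coordinates]) simp
  then show ?thesis unfolding dev_def by (intro continuous_intros)
qed

lemma continuous_on_chart:
  assumes "c \<in> cells Y" shows "continuous_on (cub c) (ch c)"
proof (subst continuous_on_open_gen)
  show "ch c \<in> cub c \<rightarrow> points Y" using chart_in_points[OF assms] by blast
  show "\<forall>U. openin (top_of_set (points Y)) U \<longrightarrow> openin (top_of_set (cub c)) (cub c \<inter> ch c -` U)"
  proof (intro allI impI)
    fix U assume U: "openin (top_of_set (points Y)) U"
    then have "U \<subseteq> points Y" by (rule openin_imp_subset)
    from openin_points_iff[OF this] U assms
    have "openin (top_of_set (cub c)) {x \<in> cub c. ch c x \<in> U}" by blast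
    moreover have "{x \<in> cub c. ch c x \<in> U} = cub c \<inter> ch c -` U" by blast
    ultimately show "openin (top_of_set (cub c)) (cub c \<inter> ch c -` U)" by simp
  qed
qed

lemma continuous_on_f: "continuous_on (points Y) f"
proof (subst continuous_on_open_gen[where T = UNIV])
  show "f \<in> points Y \<rightarrow> UNIV" by blast
  show "\<forall>U. openin (top_of_set UNIV) U \<longrightarrow> openin (top_of_set (points Y)) (points Y \<inter> f -` U)"
  proof (intro allI impI)
    fix U :: "(complex ^ 'e) set" assume U: "openin (top_of_set UNIV) U"
    have "openin (top_of_set (cub c)) {x \<in> cub c. ch c x \<in> points Y \<inter> f -` U}" if c: "c \<in> cells Y" for c
    proof -
      have "continuous_on (cub c) (\<lambda>x. torus_point (dev c x))"
        by (rule continuous_on_compose2[OF continuous_on_torus_point[of UNIV] continuous_on_dev]) blast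
      moreover have "open U" using U by simp
      ultimately have "openin (top_of_set (cub c)) (cub c \<inter> (\<lambda>x. torus_point (dev c x)) -` U)"
        by (rule continuous_openin_preimage_gen)
      moreover have "{x \<in> cub c. ch c x \<in> points Y \<inter> f -` U} = cub c \<inter> (\<lambda>x. torus_point (dev c x)) -` U"
        using chart_in_points[OF c] f_chart[OF c] by auto
      ultimately show ?thesis by simp
    qed
    then show "openin (top_of_set (points Y)) (points Y \<inter> f -` U)"
      using openin_points_iff[of "points Y \<inter> f -` U"] by blast
  qed
qed

lemma continuous_on_undev: "continuous_on S (undev c a)"
proof (rule continuous_on_coordinatewise_then_product)
  fix i
  show "continuous_on S (\<lambda>\<theta>. undev c a \<theta> i)"
    unfolding undev_def by (cases "i < dm c") (auto intro!: continuous_intros)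
qed

lemma continuous_on_star_chart_Box:
  assumes "(c, a) \<in> vertex_corners Y v"
  shows "continuous_on (Box (spread c a)) (star_chart v)"
proof -
  note D = vertex_cornersD[OF assms]
  have "continuous_on (Box (spread c a)) (\<lambda>\<theta>. ch c (undev c a \<theta>))"
    by (rule continuous_on_compose2[OF continuous_on_chart[OF D(1)] continuous_on_undev])
      (use undev(1)[OF D(1,2)] in blast)
  then show ?thesis
    by (rule continuous_on_eq) (simp add: star_chart_eq_undev[OF assms])
qed

lemma finite_sign_vectors: "finite {\<sigma> :: real ^ 'e. \<forall>e. \<sigma> $ e \<in> {-1, 0, 1}}"
proof (rule finite_subset)
  show "{\<sigma> :: real ^ 'e. \<forall>e. \<sigma> $ e \<in> {-1, 0, 1}} \<subseteq> vec_lambda ` (UNIV \<rightarrow>\<^sub>E {-1, 0, 1})"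
  proof
    fix \<sigma> :: "real ^ 'e" assume "\<sigma> \<in> {\<sigma>. \<forall>e. \<sigma> $ e \<in> {-1, 0, 1}}"
    then have "vec_nth \<sigma> \<in> UNIV \<rightarrow>\<^sub>E {-1, 0, 1}" by (auto simp: PiE_def)
    moreover have "\<sigma> = vec_lambda (vec_nth \<sigma>)" by simp
    ultimately show "\<sigma> \<in> vec_lambda ` (UNIV \<rightarrow>\<^sub>E {-1, 0, 1})" by (metis image_eqI)
  qed
  show "finite (vec_lambda ` (UNIV \<rightarrow>\<^sub>E {-1, 0, 1 :: real}) :: (real ^ 'e) set)"
    by (intro finite_imageI finite_PiE) auto
qed

lemma spread_signs:
  assumes "c \<in> cells Y" "a \<in> corners (dm c)"
  shows "spread c a $ e \<in> {-1, 0, 1}"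
proof (cases "e \<in> lab c ` {..<dm c}")
  case True
  then obtain i where i: "i < dm c" "e = lab c i" by auto
  show ?thesis
    unfolding i(2) spread_def dev_lab[OF assms(1) i(1)]
    using corner_cases[OF assms(2), of i] sg_cases[OF assms(1), of i] by auto
qed (simp add: spread_def dev_other)

text \<open>
  A vertex may have infinitely many cubes, but these occupy only finitely many closed boxes, so
  the pieces can be pasted.
\<close>
lemma continuous_on_star_chart: "continuous_on (star v) (star_chart v)"
proof -
  define \<Sigma> where "\<Sigma> = (\<lambda>(c, a). spread c a) ` vertex_corners Y v"
  have "\<Sigma> \<subseteq> {\<sigma>. \<forall>e. \<sigma> $ e \<in> {-1, 0, 1}}"
    unfolding \<Sigma>_def using spread_signs vertex_cornersD(1,2) by fast
  then have "finite \<Sigma>" using finite_sign_vectors finite_subset by blast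
  then have "continuous_on (\<Union>\<sigma>\<in>\<Sigma>. Box \<sigma>) (star_chart v)"
  proof (rule continuous_on_closed_Union)
    show "closed (Box \<sigma>)" for \<sigma> by (rule closed_Box)
    fix \<sigma> assume "\<sigma> \<in> \<Sigma>"
    then show "continuous_on (Box \<sigma>) (star_chart v)"
      unfolding \<Sigma>_def using continuous_on_star_chart_Box by auto
  qed
  moreover have "(\<Union>\<sigma>\<in>\<Sigma>. Box \<sigma>) = star v"
    unfolding \<Sigma>_def star_def by auto
  ultimately show ?thesis by simp
qed

lemma zero_corner: "(\<lambda>_. 0) \<in> corners n"
  by (auto simp: corners_def unit_cube_def)

lemma locate_corner:
  assumes "c \<in> cells Y" "x \<in> cub c" "\<theta> \<in> star v" "\<And>e. \<bar>\<theta> $ e\<bar> < 1" "ch c x = star_chart v \<theta>"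
  shows "\<exists>b\<in>corners (dm c). ch c b = v \<and> dev c x - dev c b = \<theta>"
proof -
  define z where "z = (\<lambda>_::nat. 0::real)"
  have oc: "(c, z) \<in> vertex_corners Y (ch c z)"
    unfolding z_def using assms(1) zero_corner by (rule vertex_cornersI)
  note L = star_chart_dev[OF oc assms(2)]
  have "star_chart (ch c z) (dev c x - dev c z) = star_chart v \<theta>" using L(1) assms(5) by simp
  then obtain b where "b \<in> corners (dm c)" "ch c b = v" "dev c b - dev c z = dev c x - dev c z - \<theta>"
    using star_chart_transport[OF oc L(2) assms(3,4)] by blast
  moreover from this(3) have "dev c x - dev c b = \<theta>" by (simp add: algebra_simps)
  ultimately show ?thesis by blast
qed

text \<open>
  In every cube the preimage of the image is again given by an open condition on the development
  relative to a corner, because every cube that contains a point of the open star has its centre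
  among the corners.
\<close>
lemma star_chart_open:
  assumes "open U" "\<And>\<theta> e. \<theta> \<in> U \<Longrightarrow> \<bar>\<theta> $ e\<bar> < 1"
  shows "openin (top_of_set (points Y)) (star_chart v ` (U \<inter> star v))"
proof (subst openin_points_iff)
  show "star_chart v ` (U \<inter> star v) \<subseteq> points Y" using star_chart_in_points by blast
  show "\<forall>c\<in>cells Y. openin (top_of_set (cub c)) {x \<in> cub c. ch c x \<in> star_chart v ` (U \<inter> star v)}"
  proof
    fix c assume c: "c \<in> cells Y"
    show "openin (top_of_set (cub c)) {x \<in> cub c. ch c x \<in> star_chart v ` (U \<inter> star v)}"
    proof (subst openin_subopen, intro ballI)
      fix x assume "x \<in> {x \<in> cub c. ch c x \<in> star_chart v ` (U \<inter> star v)}"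
      then obtain \<theta> where x: "x \<in> cub c" and \<theta>: "\<theta> \<in> U" "\<theta> \<in> star v" "ch c x = star_chart v \<theta>" by blast
      obtain b where b: "b \<in> corners (dm c)" "ch c b = v" "dev c x - dev c b = \<theta>"
        using locate_corner[OF c x \<theta>(2) _ \<theta>(3)] assms(2)[OF \<theta>(1)] by blast
      have cb: "(c, b) \<in> vertex_corners Y v" using vertex_cornersI[OF c b(1)] b(2) by simp
      let ?T = "cub c \<inter> (\<lambda>x. dev c x - dev c b) -` U"
      have "openin (top_of_set (cub c)) ?T"
        by (intro continuous_openin_preimage_gen assms(1) continuous_on_diff continuous_on_dev continuous_on_const)
      moreover have "x \<in> ?T" using x b(3) \<theta>(1) by simp
      moreover have "?T \<subseteq> {x \<in> cub c. ch c x \<in> star_chart v ` (U \<inter> star v)}"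
      proof
        fix x' assume x': "x' \<in> ?T"
        then have "ch c x' = star_chart v (dev c x' - dev c b)" "dev c x' - dev c b \<in> U \<inter> star v"
          using star_chart_dev[OF cb, of x'] by auto
        then show "x' \<in> {x \<in> cub c. ch c x \<in> star_chart v ` (U \<inter> star v)}" using x' by blast
      qed
      ultimately show "\<exists>T. openin (top_of_set (cub c)) T \<and> x \<in> T \<and>
          T \<subseteq> {x \<in> cub c. ch c x \<in> star_chart v ` (U \<inter> star v)}" by blast
    qed
  qed
qed

text \<open>
  Take a corner of the cube nearest to the point.
\<close>
lemma star_cover:
  assumes "y \<in> points Y"
  shows "\<exists>v\<in>vertices Y. \<exists>\<theta>\<in>star v. star_chart v \<theta> = y \<and> (\<forall>e. \<bar>\<theta> $ e\<bar> \<le> 1 / 2)"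
proof -
  obtain c x where cx: "c \<in> cells Y" "x \<in> cub c" "y = ch c x" using assms by (rule pointsE)
  define a where "a = (\<lambda>i. if i < dm c \<and> x i > 1 / 2 then 1 else 0 :: real)"
  have a: "a \<in> corners (dm c)" by (auto simp: a_def corners_def unit_cube_def)
  have ca: "(c, a) \<in> vertex_corners Y (ch c a)" using cx(1) a by (rule vertex_cornersI)
  note L = star_chart_dev[OF ca cx(2)]
  have "\<bar>(dev c x - dev c a) $ e\<bar> \<le> 1 / 2" for e
  proof (cases "e \<in> lab c ` {..<dm c}")
    case True
    then obtain i where i: "i < dm c" "e = lab c i" by auto
    have "\<bar>x i - a i\<bar> \<le> 1 / 2" using unit_cube_bounds[OF cx(2), of i] i(1) by (auto simp: a_def)
    then show ?thesis
      unfolding i(2) dev_diff_lab[OF cx(1) i(1)] using sg_cases[OF cx(1), of i] by (auto simp: abs_mult)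
  qed (simp add: dev_other)
  then show ?thesis
    using L(1,3) cx(3) vertex_cornersD(4)[OF ca] by blast
qed

lemma integral_star_point:
  assumes "\<theta> \<in> star v" "v \<in> vertices Y" "star_chart v \<theta> \<in> vertices Y" "\<And>e. \<bar>\<theta> $ e\<bar> < 1"
  shows "\<theta> = 0" "star_chart v \<theta> = v"
proof -
  have "f w = 1" if "w \<in> vertices Y" for w
    using that f_chart_eq_1_iff corners_subset by (auto simp: vertices_def)
  then have "torus_point \<theta> = 1" using f_star_chart[OF assms(1)] assms(3) by simp
  then have "\<theta> $ e = 0" for e
    using abs_Ints_less_1[OF _ assms(4)] by (simp add: torus_point_eq_1_iff)
  then show "\<theta> = 0" by (simp add: vec_eq_iff)
  then show "star_chart v \<theta> = v" using zero_in_star[OF assms(2)] by simp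
qed

lemma f_eq_1_iff_vertex:
  assumes "y \<in> points Y" shows "f y = 1 \<longleftrightarrow> y \<in> vertices Y"
proof
  assume "f y = 1"
  obtain c x where cx: "c \<in> cells Y" "x \<in> cub c" "y = ch c x" using assms by (rule pointsE)
  then show "y \<in> vertices Y"
    using f_chart_eq_1_iff[OF cx(1,2)] \<open>f y = 1\<close> by (auto simp: vertices_def)
next
  assume "y \<in> vertices Y"
  then show "f y = 1" using f_chart_eq_1_iff corners_subset by (auto simp: vertices_def)
qed

lemma open_max_ball: "open {\<theta> :: real ^ 'e. \<forall>e. \<bar>\<theta> $ e - \<theta>0 $ e\<bar> < r}"
proof -
  have "{\<theta> :: real ^ 'e. \<forall>e. \<bar>\<theta> $ e - \<theta>0 $ e\<bar> < r} = (\<Inter>e. {\<theta>. \<bar>\<theta> $ e - \<theta>0 $ e\<bar> < r})" by auto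
  also have "open \<dots>"
    by (intro open_INT ballI open_Collect_less continuous_intros) auto
  finally show ?thesis .
qed

lemma vertices_subset_points: "vertices Y \<subseteq> points Y"
  using chart_in_points corners_subset by (auto simp: vertices_def)

text \<open>
  The open stars cover the complex, and each contains a single vertex.
\<close>
lemma finite_vertices:
  assumes "compact (points Y)" shows "finite (vertices Y)"
proof -
  \<comment> \<open>Any radius above \<open>1/2\<close>, to cover the complex, and at most \<open>1\<close>, to avoid further vertices.\<close>
  define U where "U = {\<theta> :: real ^ 'e. \<forall>e. \<bar>\<theta> $ e - 0 $ e\<bar> < 3 / 4}"
  have U: "open U" unfolding U_def by (rule open_max_ball)
  have U1: "\<bar>\<theta> $ e\<bar> < 1" if "\<theta> \<in> U" for \<theta> e
  proof -
    have "\<bar>\<theta> $ e - 0 $ e\<bar> < 3 / 4" using that unfolding U_def by blast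
    then show ?thesis by simp
  qed
  define nb where "nb v = star_chart v ` (U \<inter> star v)" for v
  have compact: "\<forall>C. (\<forall>c\<in>C. openin (top_of_set (points Y)) c) \<and> points Y \<subseteq> \<Union> C \<longrightarrow>
      (\<exists>D\<subseteq>C. finite D \<and> points Y \<subseteq> \<Union> D)"
    using assms unfolding compact_eq_openin_cover .
  have opens: "\<forall>c\<in>nb ` vertices Y. openin (top_of_set (points Y)) c"
    unfolding nb_def using star_chart_open[OF U U1] by blast
  have covers: "points Y \<subseteq> \<Union> (nb ` vertices Y)"
  proof
    fix y assume "y \<in> points Y"
    then obtain v \<theta> where v: "v \<in> vertices Y" "\<theta> \<in> star v" "star_chart v \<theta> = y" "\<And>e. \<bar>\<theta> $ e\<bar> \<le> 1 / 2"
      using star_cover by blast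
    have "\<bar>\<theta> $ e - 0 $ e\<bar> < 3 / 4" for e using v(4)[of e] by simp
    then have "\<theta> \<in> U" unfolding U_def by blast
    then show "y \<in> \<Union> (nb ` vertices Y)" unfolding nb_def using v by blast
  qed
  obtain D where D: "D \<subseteq> nb ` vertices Y" "finite D" "points Y \<subseteq> \<Union> D"
    using compact[THEN spec, THEN mp, OF conjI[OF opens covers]] by (elim exE conjE)
  obtain V0 where V0: "V0 \<subseteq> vertices Y" "finite V0" "D = nb ` V0"
    using finite_subset_image[OF D(2,1)] by blast
  have "vertices Y \<subseteq> V0"
  proof
    fix w assume w: "w \<in> vertices Y"
    then obtain v where v: "v \<in> V0" "w \<in> nb v" using D(3) V0(3) vertices_subset_points by blast
    then obtain \<theta> where \<theta>: "\<theta> \<in> U" "\<theta> \<in> star v" "w = star_chart v \<theta>" unfolding nb_def by blast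
    have "star_chart v \<theta> = v"
      using integral_star_point(2)[OF \<theta>(2)] v(1) V0(1) w \<theta>(3) U1[OF \<theta>(1)] by blast
    then show "w \<in> V0" using v(1) \<theta>(3) by simp
  qed
  then show ?thesis using V0(2) finite_subset by blast
qed

lemma f_in_Salvetti: "y \<in> points Y \<Longrightarrow> f y \<in> Salvetti"
proof -
  assume "y \<in> points Y"
  then obtain c x where cx: "c \<in> cells Y" "x \<in> cub c" "y = ch c x" by (rule pointsE)
  have "E i j" if "i \<noteq> j" "f y $ i \<noteq> 1" "f y $ j \<noteq> 1" for i j
  proof -
    have "e \<in> lab c ` {..<dm c}" if "f y $ e \<noteq> 1" for e
    proof (rule ccontr)
      assume "e \<notin> lab c ` {..<dm c}"
      then have "f y $ e = 1" unfolding cx(3) f_chart[OF cx(1,2)] by (simp add: torus_point_def dev_other)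
      then show False using that by simp
    qed
    then obtain p q where "p < dm c" "i = lab c p" "q < dm c" "j = lab c q" using \<open>f y $ i \<noteq> 1\<close> \<open>f y $ j \<noteq> 1\<close> by blast
    then show ?thesis using lab_E[OF cx(1), of p q] \<open>i \<noteq> j\<close> by blast
  qed
  moreover have "norm (f y $ i) = 1" for i
    unfolding cx(3) f_chart[OF cx(1,2)] by (simp add: torus_point_def)
  ultimately show "f y \<in> Salvetti" unfolding salvetti_def by simp
qed

subsection \<open>Completing squares\<close>

lemma corner_flip:
  assumes "c \<in> cells Y" "a \<in> corners (dm c)" "i < dm c"
  shows "a(i := 1 - a i) \<in> corners (dm c)" "dev c (a(i := 1 - a i)) - dev c a = dir (half_letter c a i)"
proof -
  show "a(i := 1 - a i) \<in> corners (dm c)"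
    using assms by (auto simp: corners_def unit_cube_def)
  show "dev c (a(i := 1 - a i)) - dev c a = dir (half_letter c a i)"
  proof (rule vec_eq_lab)
    fix j assume j: "j < dm c"
    show "(dev c (a(i := 1 - a i)) - dev c a) $ lab c j = dir (half_letter c a i) $ lab c j"
      unfolding dev_diff_lab[OF assms(1) j]
      using lab_inj[OF assms(1) j assms(3)] corner_cases[OF assms(2), of i] sg_cases[OF assms(1), of i]
      by (auto simp: dir_nth half_letter_def)
  next
    fix e assume e: "e \<notin> lab c ` {..<dm c}"
    then show "(dev c (a(i := 1 - a i)) - dev c a) $ e = dir (half_letter c a i) $ e"
      unfolding dev_diff_other[OF e] using assms(3) by (auto simp: dir_nth half_letter_def)
  qed
qed

lemma dir_in_Box_iff:
  assumes "c \<in> cells Y" "a \<in> corners (dm c)"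
  shows "dir x \<in> Box (spread c a) \<longleftrightarrow> (\<exists>i<dm c. half_letter c a i = x)"
proof
  assume "dir x \<in> Box (spread c a)"
  then have b: "dir x $ fst x \<in> closed_segment 0 (spread c a $ fst x)" unfolding Box_def by blast
  have "fst x \<in> lab c ` {..<dm c}"
  proof (rule ccontr)
    assume "fst x \<notin> lab c ` {..<dm c}"
    then show False using b by (simp add: spread_def dev_other dir_nth split: if_splits)
  qed
  then obtain i where i: "i < dm c" "fst x = lab c i" by auto
  obtain s where s: "0 \<le> s" "s \<le> 1" "dir x $ fst x = s * (sg c i * (1 - 2 * a i))"
    using b unfolding i(2) spread_def dev_lab[OF assms(1) i(1)] closed_segment_0 by auto
  then have "half_letter c a i = x"
    using corner_cases[OF assms(2), of i] sg_cases[OF assms(1), of i] i(2)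
    by (auto simp: half_letter_def prod_eq_iff dir_nth split: if_splits)
  then show "\<exists>i<dm c. half_letter c a i = x" using i(1) by blast
next
  assume "\<exists>i<dm c. half_letter c a i = x"
  then obtain i where i: "i < dm c" "half_letter c a i = x" by blast
  show "dir x \<in> Box (spread c a)"
    using dev_diff_in_Box[OF assms corners_subset[OF corner_flip(1)[OF assms i(1)]]]
      corner_flip(2)[OF assms i(1)] i(2) by simp
qed

lemma salvetti_half_edge:
  assumes "distinct xs" "k < length xs" "\<And>j. a j \<in> {0, 1}"
  shows "half_edge (salvetti E) xs a k = half_loop (xs ! k, a k = 0)"
proof -
  have "chart (salvetti E) xs (a(k := \<bar>a k - t\<bar>)) = torus_point (t *\<^sub>R dir (xs ! k, a k = 0))" (is "?l = ?r")
    if t: "t \<in> {0<..<1/2}" for t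
    unfolding vec_eq_iff
  proof
    fix i
    have l: "?l $ i = (\<Prod>j | j < length xs \<and> xs ! j = i. cis (2 * pi * (a(k := \<bar>a k - t\<bar>)) j))"
      by (simp add: salvetti_def)
    show "?l $ i = ?r $ i"
    proof (cases "i = xs ! k")
      case True
      then have one: "{j. j < length xs \<and> xs ! j = i} = {k}"
        using assms(1,2) by (auto simp: nth_eq_iff_index_eq)
      have "?l $ i = cis (2 * pi * \<bar>a k - t\<bar>)" unfolding l one by simp
      also have "\<dots> = cis (2 * pi * (if a k = 0 then t else - t))"
        unfolding cis_2pi_eq_iff using assms(3)[of k] t by auto
      finally show ?thesis using True by (simp add: torus_point_def dir_nth)
    next
      case False
      have "cis (2 * pi * (a(k := \<bar>a k - t\<bar>)) j) = 1" if "j < length xs" "xs ! j = i" for j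
      proof -
        have "j \<noteq> k" using that False by blast
        then show ?thesis using assms(3)[of j] cis_multiple_2pi[of 1] by auto
      qed
      then have "?l $ i = 1" unfolding l by (intro prod.neutral) blast
      then show ?thesis using False by (simp add: torus_point_def dir_nth)
    qed
  qed
  then show ?thesis unfolding half_edge_def half_loop_def by (intro image_cong) auto
qed

lemma salvetti_square_link:
  assumes "E (fst x) (fst y)"
  shows "{half_loop x, half_loop y} \<in> link_simplices (salvetti E) 1"
proof -
  define a where "a = (\<lambda>k::nat. if (k = 0 \<and> \<not> snd x) \<or> (k = 1 \<and> \<not> snd y) then 1 else 0 :: real)"
  let ?xs = "[fst x, fst y]"
  have ne: "fst x \<noteq> fst y" using assms by auto
  have a01: "a j \<in> {0, 1}" for j by (simp add: a_def)
  have h: "half_edge (salvetti E) ?xs a 0 = half_loop x" "half_edge (salvetti E) ?xs a 1 = half_loop y"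
  proof -
    have "(fst x, a 0 = 0) = x" "(fst y, a 1 = 0) = y" by (auto simp: a_def prod_eq_iff)
    then show "half_edge (salvetti E) ?xs a 0 = half_loop x" "half_edge (salvetti E) ?xs a 1 = half_loop y"
      using salvetti_half_edge[of ?xs 0 a, OF _ _ a01] salvetti_half_edge[of ?xs 1 a, OF _ _ a01] ne
      by simp_all
  qed
  have "?xs \<in> cells (salvetti E)" using assms E_sym ne by (auto simp: salvetti_def)
  moreover have dim: "cell_dim (salvetti E) ?xs = 2" by (simp add: salvetti_def)
  moreover have "a \<in> corners 2" by (auto simp: corners_def unit_cube_def a_def)
  moreover have "chart (salvetti E) ?xs a = 1"
  proof -
    have "cis (2 * pi * a k) = 1" for k using cis_multiple_2pi[of 1] by (simp add: a_def)
    then show ?thesis by (simp add: salvetti_def vec_eq_iff)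
  qed
  ultimately have "(?xs, a) \<in> vertex_corners (salvetti E) 1" by (simp add: vertex_corners_def)
  moreover have "{..<2::nat} = {0, 1}" by auto
  then have "half_edge (salvetti E) ?xs a ` {..<2} = {half_loop x, half_loop y}" using h by simp
  ultimately show ?thesis
    unfolding link_simplices_def using dim by (intro CollectI exI[of _ ?xs] exI[of _ a] exI[of _ "{..<2}"]) auto
qed

text \<open>
  Two edges at \<open>w\<close> with commuting letters are mapped to edges of a square of the
  Salvetti complex; the image of the link being a full subcomplex, they span a cube at
  \<open>w\<close> already.
\<close>
theorem square_completion:
  assumes "dir x \<in> star w" "dir y \<in> star w" "E (fst x) (fst y)"
  shows "\<exists>c a. (c, a) \<in> vertex_corners Y w \<and> dir x \<in> Box (spread c a) \<and> dir y \<in> Box (spread c a)"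
proof -
  obtain c1 a1 where 1: "(c1, a1) \<in> vertex_corners Y w" "dir x \<in> Box (spread c1 a1)"
    using assms(1) by (rule starE)
  obtain c2 a2 where 2: "(c2, a2) \<in> vertex_corners Y w" "dir y \<in> Box (spread c2 a2)"
    using assms(2) by (rule starE)
  note D1 = vertex_cornersD[OF 1(1)] and D2 = vertex_cornersD[OF 2(1)]
  obtain i where i: "i < dm c1" "half_letter c1 a1 i = x" using dir_in_Box_iff[OF D1(1,2)] 1(2) by blast
  obtain j where j: "j < dm c2" "half_letter c2 a2 j = y" using dir_in_Box_iff[OF D2(1,2)] 2(2) by blast
  let ?S = "{half_edge Y c1 a1 i, half_edge Y c2 a2 j}"
  have sub: "?S \<subseteq> link_vertices Y w"
    using half_edges_subset_link(1)[OF 1(1), of "{i}"] half_edges_subset_link(1)[OF 2(1), of "{j}"] i(1) j(1) by simp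
  have fw: "f w = 1" using f_eq_1_iff_vertex vertices_subset_points D1(4) by blast
  have im: "(`) f ` ?S = {half_loop x, half_loop y}"
    using half_edge_image[OF D1(1,2) i(1)] half_edge_image[OF D2(1,2) j(1)] i(2) j(2) by simp
  have "?S \<in> link_simplices Y w"
    by (rule local_iso_vertex(2)[OF D1(4) sub]) (use im fw salvetti_square_link[OF assms(3)] in simp)
  then obtain c a J where ca: "(c, a) \<in> vertex_corners Y w" "J \<subseteq> {..<dm c}" "?S = half_edge Y c a ` J"
    unfolding link_simplices_def by blast
  note D = vertex_cornersD[OF ca(1)]
  have "half_loop ` half_letter c a ` J = {half_loop x, half_loop y}"
    using half_edge_set_image[OF D(1,2) ca(2)] ca(3) im by simp
  then have "half_loop x \<in> half_loop ` half_letter c a ` J" "half_loop y \<in> half_loop ` half_letter c a ` J"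
    by simp_all
  then have "x \<in> half_letter c a ` J" "y \<in> half_letter c a ` J" using half_loop_inj by blast+
  then show ?thesis
    using dir_in_Box_iff[OF D(1,2)] ca(1,2) by blast
qed

section \<open>Edge paths\<close>

subsection \<open>Words spelled by edge paths\<close>

abbreviation homot :: "(real \<Rightarrow> 'y) \<Rightarrow> (real \<Rightarrow> 'y) \<Rightarrow> bool" (infix "\<simeq>" 50) where
  "p \<simeq> q \<equiv> homotopic_paths (points Y) p q"

definition inv_letter :: "'e \<times> bool \<Rightarrow> 'e \<times> bool" where
  "inv_letter x = (fst x, \<not> snd x)"

lemma dir_inv_letter: "dir (inv_letter x) = - dir x"
  by (simp add: inv_letter_def vec_eq_iff dir_nth)

text \<open>
  The edge at \<open>v\<close> with the letter \<open>x\<close>, which exists exactly if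
  \<open>dir x \<in> star v\<close>, and its end point. As the letter determines the edge, an edge
  path is given by its initial vertex and a word.
\<close>
definition tgt :: "'y \<Rightarrow> 'e \<times> bool \<Rightarrow> 'y" where
  "tgt v x = star_chart v (dir x)"

definition edge :: "'y \<Rightarrow> 'e \<times> bool \<Rightarrow> real \<Rightarrow> 'y" where
  "edge v x = star_chart v \<circ> linepath 0 (dir x)"

fun endv :: "'y \<Rightarrow> 'e word \<Rightarrow> 'y" where
  "endv v [] = v"
| "endv v (x # w) = endv (tgt v x) w"

fun spelled :: "'y \<Rightarrow> 'e word \<Rightarrow> bool" where
  "spelled v [] \<longleftrightarrow> v \<in> vertices Y"
| "spelled v (x # w) \<longleftrightarrow> v \<in> vertices Y \<and> dir x \<in> star v \<and> spelled (tgt v x) w"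

fun epath :: "'y \<Rightarrow> 'e word \<Rightarrow> real \<Rightarrow> 'y" where
  "epath v [] = (\<lambda>_. v)"
| "epath v (x # w) = edge v x +++ epath (tgt v x) w"

lemma cone_path:
  assumes "(c, a) \<in> vertex_corners Y v" "path p" "path_image p \<subseteq> Box (spread c a)"
  shows "path (star_chart v \<circ> p)" "path_image (star_chart v \<circ> p) \<subseteq> points Y"
proof -
  have "continuous_on (path_image p) (star_chart v)"
    using continuous_on_star_chart_Box[OF assms(1)] assms(3) continuous_on_subset by blast
  then show "path (star_chart v \<circ> p)" using assms(2) by (intro path_continuous_image)
  show "path_image (star_chart v \<circ> p) \<subseteq> points Y"
    unfolding path_image_compose using assms(3) Box_subset_star[OF assms(1)] star_chart_in_points by blast
qed

text \<open>
  A cube seen from one of its corners is convex, so paths in it with the same ends are homotopic.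
\<close>
lemma cone_homotopy:
  assumes "(c, a) \<in> vertex_corners Y v" "path p" "path q"
    "path_image p \<subseteq> Box (spread c a)" "path_image q \<subseteq> Box (spread c a)"
    "pathstart p = pathstart q" "pathfinish p = pathfinish q"
  shows "star_chart v \<circ> p \<simeq> star_chart v \<circ> q"
proof (rule homotopic_images_of_convex[OF convex_Box[of "spread c a"] continuous_on_star_chart_Box[OF assms(1)]])
  show "star_chart v ` Box (spread c a) \<subseteq> points Y"
    using Box_subset_star[OF assms(1)] star_chart_in_points by blast
qed (use assms in auto)

text \<open>
  A segment in a cube may be described from any corner of the cube.
\<close>
lemma cone_recenter:
  assumes ca: "(c, a) \<in> vertex_corners Y v" and b: "b \<in> corners (dm c)"
    and "\<theta> \<in> Box (spread c a)" "\<eta> \<in> Box (spread c a)" and t: "t \<in> {0..1}"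
  shows "(star_chart (ch c b) \<circ> linepath (\<theta> - (dev c b - dev c a)) (\<eta> - (dev c b - dev c a))) t =
         (star_chart v \<circ> linepath \<theta> \<eta>) t"
proof -
  have "linepath \<theta> \<eta> t \<in> closed_segment \<theta> \<eta>" using t by (rule linepath_in_path)
  then have in_box: "linepath \<theta> \<eta> t \<in> Box (spread c a)"
    using assms(3,4) closed_segment_subset[OF _ _ convex_Box] by blast
  have "linepath (\<theta> - (dev c b - dev c a)) (\<eta> - (dev c b - dev c a)) t = linepath \<theta> \<eta> t - (dev c b - dev c a)"
    by (simp add: linepath_def algebra_simps)
  then show ?thesis using change_corner(2)[OF ca b in_box] by simp
qed

lemma Box_seg: "\<theta> \<in> Box \<sigma> \<Longrightarrow> \<eta> \<in> Box \<sigma> \<Longrightarrow> path_image (linepath \<theta> \<eta>) \<subseteq> Box \<sigma>"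
  by (simp add: closed_segment_subset convex_Box)

lemma corner_of_integral_point:
  assumes ca: "(c, a) \<in> vertex_corners Y v" and B: "\<theta> \<in> Box (spread c a)" and int: "\<And>e. \<theta> $ e \<in> \<int>"
  shows "\<exists>b\<in>corners (dm c). dev c b - dev c a = \<theta> \<and> ch c b = star_chart v \<theta>"
proof -
  note D = vertex_cornersD[OF ca] and u = undev[OF vertex_cornersD(1,2)[OF ca] B]
  have "f (ch c (undev c a \<theta>)) = 1"
    using f_star_chart[of \<theta> v] Box_subset_star[OF ca] B int star_chart_eq_undev[OF ca B]
    by (auto simp: torus_point_eq_1_iff)
  then have "undev c a \<theta> \<in> corners (dm c)" using f_chart_eq_1_iff[OF D(1) u(1)] by simp
  then show ?thesis using u(2) star_chart_eq_undev[OF ca B] by (intro bexI[of _ "undev c a \<theta>"]) simp_all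
qed

lemma dir_Ints: "dir x $ e \<in> \<int>"
  by (simp add: dir_nth)

lemma dir_corner:
  assumes "dir x \<in> Box (spread c a)" "(c, a) \<in> vertex_corners Y v"
  shows "\<exists>b\<in>corners (dm c). dev c b - dev c a = dir x \<and> ch c b = tgt v x"
  unfolding tgt_def by (rule corner_of_integral_point[OF assms(2,1) dir_Ints])

lemma tgt_vertex: "dir x \<in> star v \<Longrightarrow> tgt v x \<in> vertices Y"
  using dir_corner vertex_cornersD(1) by (metis starE vertex_cornersD(4) vertex_cornersI)

lemma edge_path:
  assumes "v \<in> vertices Y" "dir x \<in> star v"
  shows "path (edge v x)" "path_image (edge v x) \<subseteq> points Y" "pathstart (edge v x) = v" "pathfinish (edge v x) = tgt v x"
proof -
  obtain c a where ca: "(c, a) \<in> vertex_corners Y v" "dir x \<in> Box (spread c a)"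
    using assms(2) by (rule starE)
  show "path (edge v x)" "path_image (edge v x) \<subseteq> points Y"
    unfolding edge_def using cone_path[OF ca(1) path_linepath Box_seg[OF zero_in_Box ca(2)]] by blast+
  show "pathstart (edge v x) = v" "pathfinish (edge v x) = tgt v x"
    using zero_in_star[OF assms(1)] by (simp_all add: edge_def tgt_def pathstart_compose pathfinish_compose)
qed

lemma spelled_vertex: "spelled v w \<Longrightarrow> v \<in> vertices Y"
  by (cases w) auto

lemma spelled_end: "spelled v w \<Longrightarrow> endv v w \<in> vertices Y"
  by (induction w arbitrary: v) auto

lemma spelled_append: "spelled v (u @ w) \<longleftrightarrow> spelled v u \<and> spelled (endv v u) w"
  by (induction u arbitrary: v) (auto dest: spelled_vertex)

lemma endv_append: "endv v (u @ w) = endv (endv v u) w"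
  by (induction u arbitrary: v) auto

lemma epath_props:
  "spelled v w \<Longrightarrow> path (epath v w) \<and> path_image (epath v w) \<subseteq> points Y \<and>
     pathstart (epath v w) = v \<and> pathfinish (epath v w) = endv v w"
proof (induction w arbitrary: v)
  case Nil
  then show ?case using vertices_subset_points
    by (auto simp: path_def path_image_def pathstart_def pathfinish_def)
next
  case (Cons x w)
  then have v: "v \<in> vertices Y" "dir x \<in> star v" "spelled (tgt v x) w" by simp_all
  note e = edge_path[OF v(1,2)] and IH = Cons.IH[OF v(3)]
  show ?case using e IH by (simp add: subset_path_image_join)
qed

lemma epath [simp]:
  assumes "spelled v w"
  shows "path (epath v w)" "path_image (epath v w) \<subseteq> points Y"
    "pathstart (epath v w) = v" "pathfinish (epath v w) = endv v w"
  using epath_props[OF assms] by auto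

lemma f_edge:
  assumes "dir x \<in> star v" "t \<in> {0..1}" shows "f (edge v x t) = letter_loop x t"
proof -
  obtain c a where ca: "(c, a) \<in> vertex_corners Y v" "dir x \<in> Box (spread c a)"
    using assms(1) by (rule starE)
  have "linepath 0 (dir x) t \<in> closed_segment 0 (dir x)" using assms(2) by (rule linepath_in_path)
  then have "linepath 0 (dir x) t \<in> star v"
    using closed_segment_subset[OF zero_in_Box ca(2) convex_Box] Box_subset_star[OF ca(1)] by blast
  then have "f (edge v x t) = torus_point (linepath 0 (dir x) t)"
    unfolding edge_def o_apply by (rule f_star_chart)
  also have "\<dots> = letter_loop x t"
    by (simp add: letter_loop_eq glue_def torus_point_def linepath_def vec_eq_iff mult_ac)
  finally show ?thesis .
qed

lemma f_epath: "spelled v w \<Longrightarrow> t \<in> {0..1} \<Longrightarrow> f (epath v w t) = word_loop w t"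
proof (induction w arbitrary: v t)
  case Nil
  then show ?case using f_eq_1_iff_vertex vertices_subset_points by auto
next
  case (Cons x w)
  then have v: "dir x \<in> star v" "spelled (tgt v x) w" by simp_all
  show ?case
  proof (cases "t \<le> 1 / 2")
    case True
    then show ?thesis
      using f_edge[OF v(1), of "2 * t"] Cons.prems(2)
      by (simp add: word_loop_Cons joinpaths_def del: word_loop.simps)
  next
    case False
    then show ?thesis
      using Cons.IH[OF v(2), of "2 * t - 1"] Cons.prems(2)
      by (simp add: word_loop_Cons joinpaths_def del: word_loop.simps)
  qed
qed

lemma epath_append:
  "spelled v (u @ w) \<Longrightarrow> epath v (u @ w) \<simeq> epath v u +++ epath (endv v u) w"
proof (induction u arbitrary: v)
  case Nil
  then show ?case
    using homotopic_paths_sym[OF homotopic_paths_left_unit[of "epath v w" "points Y"]] by simp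
next
  case (Cons x u)
  then have v: "v \<in> vertices Y" "dir x \<in> star v" "spelled (tgt v x) (u @ w)" by simp_all
  then have s: "spelled (tgt v x) u" "spelled (endv (tgt v x) u) w" by (simp_all add: spelled_append)
  note e = edge_path[OF v(1,2)]
  have "edge v x +++ epath (tgt v x) (u @ w) \<simeq> edge v x +++ (epath (tgt v x) u +++ epath (endv (tgt v x) u) w)"
    using e v(3) Cons.IH[OF v(3)] by (intro homotopic_paths_join) auto
  also have "edge v x +++ (epath (tgt v x) u +++ epath (endv (tgt v x) u) w) \<simeq>
      (edge v x +++ epath (tgt v x) u) +++ epath (endv (tgt v x) u) w"
    using e s by (intro homotopic_paths_assoc) auto
  finally show ?case by simp
qed

text \<open>
  The edge seen from its other end.
\<close>
lemma inverse_edge: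
  assumes v: "v \<in> vertices Y" and x: "dir x \<in> star v"
  shows "dir (inv_letter x) \<in> star (tgt v x)" "tgt (tgt v x) (inv_letter x) = v"
    "edge (tgt v x) (inv_letter x) \<simeq> reversepath (edge v x)"
proof -
  obtain c a where ca: "(c, a) \<in> vertex_corners Y v" "dir x \<in> Box (spread c a)"
    using x by (rule starE)
  obtain b where b: "b \<in> corners (dm c)" "dev c b - dev c a = dir x" "ch c b = tgt v x"
    using dir_corner[OF ca(2,1)] by blast
  note D = vertex_cornersD[OF ca(1)]
  have cb: "(c, b) \<in> vertex_corners Y (tgt v x)" using vertex_cornersI[OF D(1) b(1)] b(3) by simp
  have 0: "- dir x \<in> Box (spread c b)" "star_chart (tgt v x) (- dir x) = v"
    using change_corner[OF ca(1) b(1) zero_in_Box] b(2,3) zero_in_star[OF v] by simp_all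
  show s: "dir (inv_letter x) \<in> star (tgt v x)"
    unfolding dir_inv_letter using Box_subset_star[OF cb] 0(1) by blast
  show "tgt (tgt v x) (inv_letter x) = v"
    unfolding tgt_def[of "tgt v x"] dir_inv_letter by (rule 0(2))
  have "edge (tgt v x) (inv_letter x) t = reversepath (edge v x) t" if t: "t \<in> {0..1}" for t
  proof -
    have "(star_chart (tgt v x) \<circ> linepath (dir x - dir x) (0 - dir x)) t = (star_chart v \<circ> linepath (dir x) 0) t"
      using cone_recenter[OF ca(1) b(1) ca(2) zero_in_Box t] unfolding b(2,3) .
    moreover have "linepath (dir x) 0 t = linepath 0 (dir x) (1 - t)" by (simp add: linepath_def)
    ultimately show ?thesis by (simp add: edge_def reversepath_def dir_inv_letter)
  qed
  then show "edge (tgt v x) (inv_letter x) \<simeq> reversepath (edge v x)"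
    using edge_path[OF tgt_vertex[OF x] s] by (intro homotopic_paths_eq) auto
qed

text \<open>
  At the corner between the edges \<open>x\<close> and \<open>y\<close> of an edge path the
  inverse of \<open>x\<close> and \<open>y\<close> span a cube, in which the path can go round the
  square the other way.
\<close>
lemma square:
  assumes v: "v \<in> vertices Y" and x: "dir x \<in> star v" and y: "dir y \<in> star (tgt v x)" and E: "E (fst x) (fst y)"
  shows "dir y \<in> star v" "dir x \<in> star (tgt v y)" "tgt (tgt v y) x = tgt (tgt v x) y"
    "edge v x +++ edge (tgt v x) y \<simeq> edge v y +++ edge (tgt v y) x"
proof -
  \<comment> \<open>The square is completed at the middle vertex \<open>q\<close> of the path.\<close>
  define q where "q = tgt v x"
  note I = inverse_edge[OF v x, folded q_def]
  let ?\<alpha> = "- dir x" and ?\<beta> = "dir y"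
  have "E (fst (inv_letter x)) (fst y)" using E by (simp add: inv_letter_def)
  then obtain c a where ca: "(c, a) \<in> vertex_corners Y q" "?\<alpha> \<in> Box (spread c a)" "?\<beta> \<in> Box (spread c a)"
    using square_completion[OF I(1)] y unfolding q_def[symmetric] dir_inv_letter by blast
  note D = vertex_cornersD[OF ca(1)]
  have "fst x \<noteq> fst y" using E by auto
  have \<alpha>\<beta>: "?\<alpha> + ?\<beta> \<in> Box (spread c a)"
    unfolding Box_def
  proof (intro CollectI allI)
    fix e
    have "(?\<alpha> + ?\<beta>) $ e = ?\<alpha> $ e \<or> (?\<alpha> + ?\<beta>) $ e = ?\<beta> $ e"
      using \<open>fst x \<noteq> fst y\<close> by (simp add: dir_nth)
    moreover have "?\<alpha> $ e \<in> closed_segment 0 (spread c a $ e)" "?\<beta> $ e \<in> closed_segment 0 (spread c a $ e)"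
      using ca(2,3) unfolding Box_def by blast+
    ultimately show "(?\<alpha> + ?\<beta>) $ e \<in> closed_segment 0 (spread c a $ e)" by metis
  qed
  have "?\<alpha> $ e \<in> \<int>" "(?\<alpha> + ?\<beta>) $ e \<in> \<int>" for e by (simp_all add: dir_nth)
  then obtain b b2 where b: "b \<in> corners (dm c)" "dev c b - dev c a = ?\<alpha>" "ch c b = star_chart q ?\<alpha>"
      and b2: "b2 \<in> corners (dm c)" "dev c b2 - dev c a = ?\<alpha> + ?\<beta>" "ch c b2 = star_chart q (?\<alpha> + ?\<beta>)"
    using corner_of_integral_point[OF ca(1,2)] corner_of_integral_point[OF ca(1) \<alpha>\<beta>] by metis
  have bv: "ch c b = v" using I(2) b(3) unfolding tgt_def[of q] dir_inv_letter by simp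
  have cb: "(c, b) \<in> vertex_corners Y v" using vertex_cornersI[OF D(1) b(1)] bv by simp
  have at_v: "?\<beta> \<in> Box (spread c b)" "star_chart v ?\<beta> = star_chart q (?\<alpha> + ?\<beta>)"
    using change_corner[OF ca(1) b(1) \<alpha>\<beta>] unfolding b(2) bv by simp_all
  then show yv: "dir y \<in> star v" using Box_subset_star[OF cb] by blast
  define s where "s = tgt v y"
  have s: "s = ch c b2" unfolding s_def tgt_def at_v(2) b2(3) ..
  have cb2: "(c, b2) \<in> vertex_corners Y s" using vertex_cornersI[OF D(1) b2(1)] s by simp
  have at_s: "dir x \<in> Box (spread c b2)" "star_chart s (dir x) = star_chart q ?\<beta>"
    using change_corner[OF ca(1) b2(1) ca(3)] unfolding b2(2) s by simp_all
  then show xs: "dir x \<in> star (tgt v y)" using Box_subset_star[OF cb2] unfolding s_def by blast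
  show "tgt (tgt v y) x = tgt (tgt v x) y"
    unfolding s_def[symmetric] q_def[symmetric] tgt_def[of s] tgt_def[of q] by (rule at_s(2))
  have q: "q \<in> vertices Y" using D(4) .
  have yq: "dir y \<in> star q" using y unfolding q_def .
  have sv: "s \<in> vertices Y" unfolding s_def using tgt_vertex[OF yv] .
  note ex = edge_path[OF v x] and ey = edge_path[OF q yq] and ey' = edge_path[OF v yv]
    and ex' = edge_path[OF sv xs[folded s_def]]
  have seg1: "edge v x t = (star_chart q \<circ> linepath ?\<alpha> 0) t" if "t \<in> {0..1}" for t
    using cone_recenter[OF ca(1) b(1) ca(2) zero_in_Box that] unfolding b(2) bv edge_def by simp
  have seg2: "edge v y t = (star_chart q \<circ> linepath ?\<alpha> (?\<alpha> + ?\<beta>)) t" if "t \<in> {0..1}" for t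
    using cone_recenter[OF ca(1) b(1) ca(2) \<alpha>\<beta> that] unfolding b(2) bv edge_def by simp
  have seg3: "edge s x t = (star_chart q \<circ> linepath (?\<alpha> + ?\<beta>) ?\<beta>) t" if "t \<in> {0..1}" for t
    using cone_recenter[OF ca(1) b2(1) \<alpha>\<beta> ca(3) that] unfolding b2(2) s[symmetric] edge_def by simp
  have "edge v x +++ edge q y \<simeq> (star_chart q \<circ> linepath ?\<alpha> 0) +++ (star_chart q \<circ> linepath 0 ?\<beta>)"
    using seg1 ex ey
    by (intro homotopic_paths_join homotopic_paths_eq) (auto simp: q_def edge_def[of "tgt v x"])
  also have "(star_chart q \<circ> linepath ?\<alpha> 0) +++ (star_chart q \<circ> linepath 0 ?\<beta>) = star_chart q \<circ> (linepath ?\<alpha> 0 +++ linepath 0 ?\<beta>)"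
    by (simp add: path_compose_join)
  also have "star_chart q \<circ> (linepath ?\<alpha> 0 +++ linepath 0 ?\<beta>) \<simeq> star_chart q \<circ> (linepath ?\<alpha> (?\<alpha> + ?\<beta>) +++ linepath (?\<alpha> + ?\<beta>) ?\<beta>)"
    using ca(2,3) \<alpha>\<beta> by (intro cone_homotopy[OF ca(1)] path_image_two_legs convex_Box) auto
  also have "star_chart q \<circ> (linepath ?\<alpha> (?\<alpha> + ?\<beta>) +++ linepath (?\<alpha> + ?\<beta>) ?\<beta>) =
      (star_chart q \<circ> linepath ?\<alpha> (?\<alpha> + ?\<beta>)) +++ (star_chart q \<circ> linepath (?\<alpha> + ?\<beta>) ?\<beta>)"
    by (simp add: path_compose_join)
  finally have 1: "edge v x +++ edge q y \<simeq> (star_chart q \<circ> linepath ?\<alpha> (?\<alpha> + ?\<beta>)) +++ (star_chart q \<circ> linepath (?\<alpha> + ?\<beta>) ?\<beta>)" .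
  have 2: "edge v y +++ edge s x \<simeq> (star_chart q \<circ> linepath ?\<alpha> (?\<alpha> + ?\<beta>)) +++ (star_chart q \<circ> linepath (?\<alpha> + ?\<beta>) ?\<beta>)"
  proof (rule homotopic_paths_join)
    show "edge v y \<simeq> star_chart q \<circ> linepath ?\<alpha> (?\<alpha> + ?\<beta>)" using ey' seg2 by (intro homotopic_paths_eq)
    show "edge s x \<simeq> star_chart q \<circ> linepath (?\<alpha> + ?\<beta>) ?\<beta>" using ex' seg3 by (intro homotopic_paths_eq)
    show "pathfinish (edge v y) = pathstart (edge s x)" using ey'(4) ex'(3) by (simp add: s_def)
  qed
  show "edge v x +++ edge (tgt v x) y \<simeq> edge v y +++ edge (tgt v y) x"
    using homotopic_paths_trans[OF 1 homotopic_paths_sym[OF 2]] unfolding q_def s_def .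
qed

lemma epath_pair:
  assumes "spelled v [x, y]"
  shows "epath v [x, y] \<simeq> edge v x +++ edge (tgt v x) y"
proof -
  have s: "v \<in> vertices Y" "dir x \<in> star v" "tgt v x \<in> vertices Y" "dir y \<in> star (tgt v x)"
    using assms tgt_vertex by auto
  note e = edge_path[OF s(1,2)] and e' = edge_path[OF s(3,4)]
  have "edge (tgt v x) y +++ (\<lambda>_. tgt (tgt v x) y) \<simeq> edge (tgt v x) y"
    using homotopic_paths_right_unit[OF e'(1,2)] e'(4) by simp
  then show ?thesis using e e' by (auto intro!: homotopic_paths_join)
qed

text \<open>
  This is the convexity of the universal cover of the complex in that of the Salvetti complex: an
  edge path remains one when its word is reduced. The steps of the converse kind, which insert a
  cancelling pair, may leave the complex.
\<close>
theorem spelled_step: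
  assumes "raag_step E u w" "spelled v u"
  shows "spelled v w" "endv v w = endv v u" "epath v u \<simeq> epath v w"
proof -
  have mid: "spelled v (p @ m' @ r) \<and> endv v (p @ m' @ r) = endv v (p @ m @ r) \<and> epath v (p @ m @ r) \<simeq> epath v (p @ m' @ r)"
    if s: "spelled v (p @ m @ r)" and m: "\<And>q. spelled q m \<Longrightarrow> spelled q m' \<and> endv q m' = endv q m \<and> epath q m \<simeq> epath q m'"
    for p m m' r
  proof -
    let ?q = "endv v p"
    have s1: "spelled v p" "spelled ?q m" "spelled (endv ?q m) r" "spelled ?q (m @ r)" using s by (simp_all add: spelled_append)
    have m': "spelled ?q m'" "endv ?q m' = endv ?q m" "epath ?q m \<simeq> epath ?q m'" using m[OF s1(2)] by auto
    have s2: "spelled v (p @ m' @ r)" "spelled ?q (m' @ r)" using s1 m' by (simp_all add: spelled_append)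
    have "epath ?q (m @ r) \<simeq> epath ?q m +++ epath (endv ?q m) r" using s1 by (intro epath_append) (simp add: spelled_append)
    also have "epath ?q m +++ epath (endv ?q m) r \<simeq> epath ?q m' +++ epath (endv ?q m') r"
      using m' s1 by (intro homotopic_paths_join) auto
    also have "epath ?q m' +++ epath (endv ?q m') r \<simeq> epath ?q (m' @ r)"
      using s2 by (intro homotopic_paths_sym[OF epath_append])
    finally have h: "epath ?q (m @ r) \<simeq> epath ?q (m' @ r)" .
    have "epath v (p @ (m @ r)) \<simeq> epath v p +++ epath ?q (m @ r)" using s by (intro epath_append)
    also have "epath v p +++ epath ?q (m @ r) \<simeq> epath v p +++ epath ?q (m' @ r)"
      using h s1 by (intro homotopic_paths_join) auto
    also have "epath v p +++ epath ?q (m' @ r) \<simeq> epath v (p @ (m' @ r))"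
      using s2 by (intro homotopic_paths_sym[OF epath_append])
    finally show ?thesis using s2(1) m'(2) by (simp add: endv_append)
  qed
  have "spelled v w \<and> endv v w = endv v u \<and> epath v u \<simeq> epath v w"
    using assms(1)
  proof cases
    case (cancel p i s r)
    have "spelled q [] \<and> endv q [] = endv q [(i, s), (i, \<not> s)] \<and> epath q [(i, s), (i, \<not> s)] \<simeq> epath q []"
      if q: "spelled q [(i, s), (i, \<not> s)]" for q
    proof -
      have v: "q \<in> vertices Y" "dir (i, s) \<in> star q" using q by auto
      note I = inverse_edge[OF v, unfolded inv_letter_def fst_conv snd_conv] and e = edge_path[OF v]
      have "epath q [(i, s), (i, \<not> s)] \<simeq> edge q (i, s) +++ edge (tgt q (i, s)) (i, \<not> s)"
        by (rule epath_pair[OF q])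
      also have "edge q (i, s) +++ edge (tgt q (i, s)) (i, \<not> s) \<simeq> edge q (i, s) +++ reversepath (edge q (i, s))"
        using e I(3) edge_path[OF tgt_vertex[OF v(2)] I(1)] by (intro homotopic_paths_join) auto
      also have "edge q (i, s) +++ reversepath (edge q (i, s)) \<simeq> (\<lambda>_. pathstart (edge q (i, s)))"
        using e by (intro homotopic_paths_right_inverse)
      finally show ?thesis using e(3) v(1) I(2) by simp
    qed
    from mid[of p "[(i, s), (i, \<not> s)]" r "[]", OF _ this] show ?thesis using assms(2) cancel by simp
  next
    case (commute i j p s t r)
    have "spelled q [(j, t), (i, s)] \<and> endv q [(j, t), (i, s)] = endv q [(i, s), (j, t)] \<and>
        epath q [(i, s), (j, t)] \<simeq> epath q [(j, t), (i, s)]"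
      if q: "spelled q [(i, s), (j, t)]" for q
    proof -
      have v: "q \<in> vertices Y" "dir (i, s) \<in> star q" "dir (j, t) \<in> star (tgt q (i, s))" using q by auto
      note S = square[OF v, unfolded fst_conv, OF commute(3)]
      have s: "spelled q [(j, t), (i, s)]"
        using v S tgt_vertex by auto
      have "epath q [(i, s), (j, t)] \<simeq> edge q (i, s) +++ edge (tgt q (i, s)) (j, t)" by (rule epath_pair[OF q])
      also have "edge q (i, s) +++ edge (tgt q (i, s)) (j, t) \<simeq> edge q (j, t) +++ edge (tgt q (j, t)) (i, s)" by (rule S(4))
      also have "edge q (j, t) +++ edge (tgt q (j, t)) (i, s) \<simeq> epath q [(j, t), (i, s)]"
        by (rule homotopic_paths_sym[OF epath_pair[OF s]])
      finally show ?thesis using s S(3) by simp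
    qed
    from mid[of p "[(i, s), (j, t)]" r "[(j, t), (i, s)]", OF _ this] show ?thesis using assms(2) commute by simp
  qed
  then show "spelled v w" "endv v w = endv v u" "epath v u \<simeq> epath v w" by auto
qed

corollary spelled_reduces:
  "u \<rightarrow>\<^sub>R w \<Longrightarrow> spelled v u \<Longrightarrow> spelled v w \<and> endv v w = endv v u \<and> epath v u \<simeq> epath v w"
proof (induction rule: rtranclp_induct)
  case (step y z)
  then show ?case using spelled_step[of y z v] by (metis homotopic_paths_trans)
qed simp

text \<open>
  Both words are compared with a common reduct, which is spelled by an edge path of the complex as
  well.
\<close>
corollary spelled_equiv:
  assumes "u \<sim>\<^sub>R w" "spelled v u" "spelled v w"
  shows "endv v u = endv v w" "epath v u \<simeq> epath v w"
proof -
  obtain m where "u \<rightarrow>\<^sub>R m" "w \<rightarrow>\<^sub>R m" using confluence[OF assms(1)] by blast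
  then have "endv v m = endv v u \<and> epath v u \<simeq> epath v m" "endv v m = endv v w \<and> epath v w \<simeq> epath v m"
    using spelled_reduces assms(2,3) by blast+
  then show "endv v u = endv v w" "epath v u \<simeq> epath v w"
    by (auto intro: homotopic_paths_trans homotopic_paths_sym)
qed

lemma spelled_inverse:
  "spelled v w \<Longrightarrow> spelled (endv v w) (inv_word w) \<and> endv (endv v w) (inv_word w) = v"
proof (induction w arbitrary: v)
  case (Cons x w)
  obtain i s where x: "x = (i, s)" by force
  have v: "v \<in> vertices Y" "dir x \<in> star v" "spelled (tgt v x) w" using Cons.prems by auto
  have "spelled (tgt v x) [(i, \<not> s)] \<and> endv (tgt v x) [(i, \<not> s)] = v"
    using inverse_edge(1,2)[OF v(1,2)] v(1) tgt_vertex[OF v(2)] by (simp add: inv_letter_def x)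
  then show ?case
    using Cons.IH[OF v(3)] v(1) by (simp add: x inv_word_Cons spelled_append endv_append)
qed simp

subsection \<open>Diagonals of cubes\<close>

text \<open>
  Straight segments between corners of a cube are homotopic to edge paths, by changing the
  coordinates one at a time.
\<close>
lemma corner_path:
  assumes "(c, a) \<in> vertex_corners Y v" "b \<in> corners (dm c)"
  shows "\<exists>w. spelled v w \<and> endv v w = ch c b \<and> epath v w \<simeq> star_chart v \<circ> linepath 0 (dev c b - dev c a)"
  using assms
proof (induction "card {i. i < dm c \<and> a i \<noteq> b i}" arbitrary: a v)
  case 0
  note D = vertex_cornersD[OF 0(2)]
  have "a i = b i" if "i < dm c" for i using 0(1) that by auto
  then have ab: "a = b" by (rule unit_cube_ext[OF corners_subset[OF D(2)] corners_subset[OF 0(3)]])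
  have s: "spelled v []" using D(4) by simp
  have e: "star_chart v \<circ> linepath 0 (dev c b - dev c a) = epath v []"
    unfolding ab using zero_in_star[OF D(4)] by (simp add: fun_eq_iff linepath_def)
  have "epath v [] \<simeq> star_chart v \<circ> linepath 0 (dev c b - dev c a)"
    unfolding e using epath_props[OF s] by auto
  moreover have "endv v [] = ch c b" using D(3) ab by simp
  ultimately show ?case using s by blast
next
  case (Suc n)
  note D = vertex_cornersD[OF Suc.prems(1)]
  have "{i. i < dm c \<and> a i \<noteq> b i} \<noteq> {}" using Suc.hyps(2) by force
  then obtain i where i: "i < dm c" "a i \<noteq> b i" by blast
  define a1 where "a1 = a(i := 1 - a i)"
  define x where "x = half_letter c a i"
  have a1: "a1 \<in> corners (dm c)" "dev c a1 - dev c a = dir x"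
    unfolding a1_def x_def using corner_flip[OF D(1,2) i(1)] by auto
  have "a1 i = b i" using corner_cases[OF D(2), of i] corner_cases[OF Suc.prems(2), of i] i(2) by (auto simp: a1_def)
  then have "{j. j < dm c \<and> a1 j \<noteq> b j} = {j. j < dm c \<and> a j \<noteq> b j} - {i}"
    by (auto simp: a1_def split: if_splits)
  then have n: "n = card {j. j < dm c \<and> a1 j \<noteq> b j}" using Suc.hyps(2) i by simp
  have xB: "dir x \<in> Box (spread c a)" using dir_in_Box_iff[OF D(1,2)] i(1) x_def by blast
  have xs: "dir x \<in> star v" using Box_subset_star[OF Suc.prems(1)] xB by blast
  have tv: "tgt v x = ch c a1"
    using star_chart_dev(1)[OF Suc.prems(1) corners_subset[OF a1(1)]] a1(2) by (simp add: tgt_def)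
  have ca1: "(c, a1) \<in> vertex_corners Y (tgt v x)" using vertex_cornersI[OF D(1) a1(1)] tv by simp
  obtain w where w: "spelled (tgt v x) w" "endv (tgt v x) w = ch c b"
      "epath (tgt v x) w \<simeq> star_chart (tgt v x) \<circ> linepath 0 (dev c b - dev c a1)"
    using Suc.hyps(1)[OF n ca1 Suc.prems(2)] by blast
  let ?d = "dev c b - dev c a"
  have dB: "?d \<in> Box (spread c a)" using dev_diff_in_Box[OF D(1,2) corners_subset[OF Suc.prems(2)]] .
  have e: "dir x - dir x = 0" "?d - dir x = dev c b - dev c a1" using a1(2) by (simp_all add: algebra_simps)
  have leg: "(star_chart (tgt v x) \<circ> linepath 0 (dev c b - dev c a1)) t = (star_chart v \<circ> linepath (dir x) ?d) t" if "t \<in> {0..1}" for t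
    using cone_recenter[OF Suc.prems(1) a1(1) xB dB that] unfolding a1(2) tv e .
  have "epath (tgt v x) w \<simeq> star_chart v \<circ> linepath (dir x) ?d"
  proof (rule homotopic_paths_trans[OF w(3)])
    show "star_chart (tgt v x) \<circ> linepath 0 (dev c b - dev c a1) \<simeq> star_chart v \<circ> linepath (dir x) ?d"
      using homotopic_paths_imp_path[OF w(3)] homotopic_paths_imp_subset[OF w(3)] leg
      by (intro homotopic_paths_eq) auto
  qed
  then have "epath v (x # w) \<simeq> edge v x +++ (star_chart v \<circ> linepath (dir x) ?d)"
    using edge_path[OF D(4) xs] w(1) by (auto intro!: homotopic_paths_join)
  also have "edge v x +++ (star_chart v \<circ> linepath (dir x) ?d) = star_chart v \<circ> (linepath 0 (dir x) +++ linepath (dir x) ?d)"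
    by (simp add: edge_def path_compose_join)
  also have "star_chart v \<circ> (linepath 0 (dir x) +++ linepath (dir x) ?d) \<simeq> star_chart v \<circ> linepath 0 ?d"
    using xB dB by (intro cone_homotopy[OF Suc.prems(1)] path_image_two_legs convex_Box Box_seg) auto
  finally have "epath v (x # w) \<simeq> star_chart v \<circ> linepath 0 ?d" .
  moreover have "spelled v (x # w)" using D(4) xs w(1) by simp
  ultimately show ?case using w(2) by (intro exI[of _ "x # w"]) simp
qed

subsection \<open>Deforming paths to edge paths\<close>

text \<open>
  A star is starlike about the origin, and hence simply connected.
\<close>
lemma star_contractible_homotopy:
  assumes "v \<in> vertices Y" "path p" "path q" "path_image p \<subseteq> star v" "path_image q \<subseteq> star v"
    "pathstart p = pathstart q" "pathfinish p = pathfinish q"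
  shows "star_chart v \<circ> p \<simeq> star_chart v \<circ> q"
proof (rule homotopic_paths_continuous_image[OF _ continuous_on_star_chart])
  have "starlike (star v)"
    unfolding starlike_def
  proof (intro bexI[of _ 0] ballI)
    show "0 \<in> star v" using zero_in_star[OF assms(1)] by blast
    fix \<theta> assume "\<theta> \<in> star v"
    then obtain c a where "(c, a) \<in> vertex_corners Y v" "\<theta> \<in> Box (spread c a)" by (rule starE)
    then show "closed_segment 0 \<theta> \<subseteq> star v"
      using closed_segment_subset[OF zero_in_Box _ convex_Box] Box_subset_star by blast
  qed
  then have "simply_connected (star v)" by (rule starlike_imp_simply_connected)
  note this[unfolded simply_connected_eq_homotopic_paths, THEN conjunct2, rule_format]
  from this[of p q] show "homotopic_paths (star v) p q"
    using assms(2-) by simp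
  show "star_chart v \<in> star v \<rightarrow> points Y" using star_chart_in_points by blast
qed

definition chord :: "'y \<Rightarrow> real ^ 'e \<Rightarrow> real \<Rightarrow> 'y" where
  "chord v \<theta> = star_chart v \<circ> linepath 0 \<theta>"

lemma star_segment: "\<theta> \<in> star v \<Longrightarrow> path_image (linepath 0 \<theta>) \<subseteq> star v"
proof -
  assume "\<theta> \<in> star v"
  then obtain c a where ca: "(c, a) \<in> vertex_corners Y v" "\<theta> \<in> Box (spread c a)" by (rule starE)
  then show ?thesis using Box_seg[OF zero_in_Box ca(2)] Box_subset_star[OF ca(1)] by blast
qed

lemma chord_path:
  assumes "v \<in> vertices Y" "\<theta> \<in> star v"
  shows "path (chord v \<theta>)" "path_image (chord v \<theta>) \<subseteq> points Y"
    "pathstart (chord v \<theta>) = v" "pathfinish (chord v \<theta>) = star_chart v \<theta>"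
proof -
  note S = star_segment[OF assms(2)]
  show "path (chord v \<theta>)" unfolding chord_def
    by (rule path_continuous_image[OF path_linepath continuous_on_subset[OF continuous_on_star_chart S]])
  show "path_image (chord v \<theta>) \<subseteq> points Y"
    unfolding chord_def path_image_compose using S star_chart_in_points by blast
  show "pathstart (chord v \<theta>) = v" "pathfinish (chord v \<theta>) = star_chart v \<theta>"
    using zero_in_star[OF assms(1)] by (simp_all add: chord_def pathstart_compose pathfinish_compose)
qed

text \<open>
  A point that is joined to two vertices by chords of their stars lies in a common cube of the two
  vertices, in which the detour over the point is homotopic to a diagonal.
\<close>
lemma change_star:
  assumes u: "u \<in> vertices Y" "\<theta> \<in> star u" and v: "v \<in> vertices Y" "\<eta> \<in> star v" "\<And>e. \<bar>\<eta> $ e\<bar> < 1"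
    and eq: "star_chart u \<theta> = star_chart v \<eta>"
  shows "\<exists>w. spelled u w \<and> endv u w = v \<and> chord u \<theta> +++ reversepath (chord v \<eta>) \<simeq> epath u w"
proof -
  obtain c a where ca: "(c, a) \<in> vertex_corners Y u" "\<theta> \<in> Box (spread c a)" using u(2) by (rule starE)
  obtain b where b: "b \<in> corners (dm c)" "ch c b = v" "dev c b - dev c a = \<theta> - \<eta>"
    using star_chart_transport[OF ca v(2,3) eq] by blast
  obtain w where w: "spelled u w" "endv u w = ch c b" "epath u w \<simeq> star_chart u \<circ> linepath 0 (dev c b - dev c a)"
    using corner_path[OF ca(1) b(1)] by blast
  have dB: "\<theta> - \<eta> \<in> Box (spread c a)"
    using dev_diff_in_Box[OF vertex_cornersD(1,2)[OF ca(1)] corners_subset[OF b(1)]] b(3) by simp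
  have "reversepath (chord v \<eta>) t = (star_chart u \<circ> linepath \<theta> (\<theta> - \<eta>)) t" if t: "t \<in> {0..1}" for t
  proof -
    have "(star_chart v \<circ> linepath (\<theta> - (\<theta> - \<eta>)) ((\<theta> - \<eta>) - (\<theta> - \<eta>))) t = (star_chart u \<circ> linepath \<theta> (\<theta> - \<eta>)) t"
      using cone_recenter[OF ca(1) b(1) ca(2) dB t] unfolding b(2,3) .
    moreover have "linepath \<eta> 0 t = linepath 0 \<eta> (1 - t)" by (simp add: linepath_def)
    ultimately show ?thesis by (simp add: chord_def reversepath_def)
  qed
  then have "reversepath (chord v \<eta>) \<simeq> star_chart u \<circ> linepath \<theta> (\<theta> - \<eta>)"
    using chord_path[OF v(1,2)] by (intro homotopic_paths_eq) auto
  then have "chord u \<theta> +++ reversepath (chord v \<eta>) \<simeq> chord u \<theta> +++ (star_chart u \<circ> linepath \<theta> (\<theta> - \<eta>))"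
    using chord_path[OF u] chord_path[OF v(1,2)] eq by (intro homotopic_paths_join) auto
  also have "chord u \<theta> +++ (star_chart u \<circ> linepath \<theta> (\<theta> - \<eta>)) = star_chart u \<circ> (linepath 0 \<theta> +++ linepath \<theta> (\<theta> - \<eta>))"
    by (simp add: chord_def path_compose_join)
  also have "star_chart u \<circ> (linepath 0 \<theta> +++ linepath \<theta> (\<theta> - \<eta>)) \<simeq> star_chart u \<circ> linepath 0 (\<theta> - \<eta>)"
    using ca(2) dB by (intro cone_homotopy[OF ca(1)] path_image_two_legs convex_Box Box_seg) auto
  also have "star_chart u \<circ> linepath 0 (\<theta> - \<eta>) \<simeq> epath u w"
    using w(3) unfolding b(3) by (rule homotopic_paths_sym)
  finally show ?thesis using w(1,2) b(2) by blast
qed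

text \<open>
  Short pieces of a path lie in one open star and lift continuously to its chart.
\<close>
lemma local_lift:
  assumes p: "path p" "path_image p \<subseteq> points Y" and t0: "t0 \<in> {0..1}"
  shows "\<exists>v\<in>vertices Y. \<exists>\<epsilon>>0. \<exists>\<theta>. continuous_on {t \<in> {0..1}. \<bar>t - t0\<bar> < \<epsilon>} \<theta> \<and>
           (\<forall>t\<in>{0..1}. \<bar>t - t0\<bar> < \<epsilon> \<longrightarrow> \<theta> t \<in> star v \<and> star_chart v (\<theta> t) = p t \<and> (\<forall>e. \<bar>\<theta> t $ e\<bar> < 1))"
proof -
  have pt: "p t \<in> points Y" if "t \<in> {0..1}" for t using p(2) that by (auto simp: path_image_def)
  obtain v \<theta>0 where v: "v \<in> vertices Y" "\<theta>0 \<in> star v" "star_chart v \<theta>0 = p t0" "\<And>e. \<bar>\<theta>0 $ e\<bar> \<le> 1 / 2"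
    using star_cover[OF pt[OF t0]] by blast
  \<comment> \<open>Within \<open>1/4\<close> of \<open>\<theta>0\<close> the coordinates stay below \<open>1\<close>, and they are continuous functions of the image under \<open>f\<close>,
    since they differ from those of \<open>\<theta>0\<close> by angles of less than \<open>pi / 2\<close>.\<close>
  define U where "U = {\<theta> :: real ^ 'e. \<forall>e. \<bar>\<theta> $ e - \<theta>0 $ e\<bar> < 1 / 4}"
  have U: "open U" unfolding U_def by (rule open_max_ball)
  have near: "\<bar>\<theta> $ e - \<theta>0 $ e\<bar> < 1 / 4" if "\<theta> \<in> U" for \<theta> e using that unfolding U_def by blast
  have U1: "\<bar>\<theta> $ e\<bar> < 1" if "\<theta> \<in> U" for \<theta> e using near[OF that, of e] v(4)[of e] by linarith
  have "\<theta>0 \<in> U" by (simp add: U_def)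
  let ?N = "star_chart v ` (U \<inter> star v)"
  have "openin (top_of_set (points Y)) ?N" using star_chart_open[OF U U1] by blast
  then have "openin (top_of_set {0..1}) ({0..1} \<inter> p -` ?N)"
    using p by (intro continuous_openin_preimage[of _ _ "points Y"]) (auto simp: path_def path_image_def)
  moreover have "t0 \<in> {0..1} \<inter> p -` ?N" using t0 v(2,3) \<open>\<theta>0 \<in> U\<close> by (auto intro!: image_eqI[of _ _ \<theta>0])
  ultimately obtain \<epsilon> where \<epsilon>: "\<epsilon> > 0" "ball t0 \<epsilon> \<inter> {0..1} \<subseteq> {0..1} \<inter> p -` ?N"
    unfolding openin_contains_ball by blast
  have "\<exists>\<theta>. \<theta> \<in> U \<and> \<theta> \<in> star v \<and> star_chart v \<theta> = p t" if "t \<in> {0..1}" "\<bar>t - t0\<bar> < \<epsilon>" for t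
  proof -
    have "t \<in> ball t0 \<epsilon> \<inter> {0..1}" using that by (simp add: dist_real_def abs_minus_commute)
    then have "p t \<in> ?N" using \<epsilon>(2) by blast
    then show ?thesis by force
  qed
  then obtain \<theta> where \<theta>: "\<And>t. t \<in> {0..1} \<Longrightarrow> \<bar>t - t0\<bar> < \<epsilon> \<Longrightarrow> \<theta> t \<in> U \<and> \<theta> t \<in> star v \<and> star_chart v (\<theta> t) = p t"
    by metis
  let ?S = "{t \<in> {0..1}. \<bar>t - t0\<bar> < \<epsilon>}"
  define g where "g t e = \<theta>0 $ e + arcsin (Im (f (p t) $ e * cis (- (2 * pi * \<theta>0 $ e)))) / (2 * pi)" for t e
  have g: "\<theta> t $ e = g t e" if "t \<in> ?S" for t e
  proof -
    have t: "t \<in> {0..1}" "\<bar>t - t0\<bar> < \<epsilon>" using that by auto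
    note T = \<theta>[OF t]
    define d where "d = \<theta> t $ e - \<theta>0 $ e"
    have "\<bar>d\<bar> < 1 / 4" unfolding d_def using near T by blast
    then have "2 * pi * \<bar>d\<bar> \<le> 2 * pi * (1 / 4)" by (intro mult_left_mono) auto
    then have "\<bar>2 * pi * d\<bar> \<le> pi / 2" by (simp add: abs_mult)
    then have d': "- (pi / 2) \<le> 2 * pi * d" "2 * pi * d \<le> pi / 2" by linarith+
    have "f (p t) = torus_point (\<theta> t)" using f_star_chart T by metis
    then have "f (p t) $ e * cis (- (2 * pi * \<theta>0 $ e)) = cis (2 * pi * d)"
      by (simp add: torus_point_def cis_mult d_def algebra_simps)
    then have "arcsin (Im (f (p t) $ e * cis (- (2 * pi * \<theta>0 $ e)))) = 2 * pi * d"
      using arcsin_sin[OF d'] by simp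
    then show ?thesis by (simp add: g_def d_def)
  qed
  have "continuous_on ?S (\<lambda>t. f (p t))"
    using p by (intro continuous_on_compose2[OF continuous_on_f])
      (auto simp: path_def path_image_def intro: continuous_on_subset)
  moreover have "\<forall>t\<in>?S. - 1 \<le> Im (f (p t) $ e * cis (- (2 * pi * \<theta>0 $ e))) \<and>
      Im (f (p t) $ e * cis (- (2 * pi * \<theta>0 $ e))) \<le> 1" for e
  proof
    fix t assume "t \<in> ?S"
    then have "norm (f (p t) $ e * cis (- (2 * pi * \<theta>0 $ e))) = 1"
      using f_in_Salvetti[OF pt, of t] by (simp add: norm_mult salvetti_def)
    then have "\<bar>Im (f (p t) $ e * cis (- (2 * pi * \<theta>0 $ e)))\<bar> \<le> 1" using abs_Im_le_cmod by metis
    then show "- 1 \<le> Im (f (p t) $ e * cis (- (2 * pi * \<theta>0 $ e))) \<and> Im (f (p t) $ e * cis (- (2 * pi * \<theta>0 $ e))) \<le> 1"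
      by linarith
  qed
  ultimately have "continuous_on ?S (\<lambda>t. g t e)" for e
    unfolding g_def by (intro continuous_intros) auto
  then have "continuous_on ?S (\<lambda>t. \<chi> e. g t e)" by (intro continuous_intros)
  then have "continuous_on ?S \<theta>"
    by (rule continuous_on_eq) (simp add: vec_eq_iff g)
  then show ?thesis
    using v(1) \<epsilon>(1) \<theta> U1 by blast
qed

text \<open>
  Up to the time \<open>t\<close> the path is homotopic to an edge path followed by a chord inside
  an open star. This property spreads along the path by connectedness of the interval.
\<close>
definition tracked :: "(real \<Rightarrow> 'y) \<Rightarrow> real \<Rightarrow> bool" where
  "tracked p t \<longleftrightarrow> (\<exists>w \<theta>. spelled (p 0) w \<and> \<theta> \<in> star (endv (p 0) w) \<and> star_chart (endv (p 0) w) \<theta> = p t \<and>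
     (\<forall>e. \<bar>\<theta> $ e\<bar> < 1) \<and> (p \<circ> linepath 0 t) \<simeq> epath (p 0) w +++ chord (endv (p 0) w) \<theta>)"

lemma subpath_concat:
  assumes "path p" "path_image p \<subseteq> points Y" "s \<in> {0..1}" "t \<in> {0..1}"
  shows "(p \<circ> linepath 0 s) +++ (p \<circ> linepath s t) \<simeq> (p \<circ> linepath 0 t)"
proof -
  have "p \<circ> (linepath 0 s +++ linepath s t) \<simeq> p \<circ> linepath 0 t"
    using assms by (intro homotopic_reparametrizations subset_path_image_join linepath_unit_image) auto
  then show ?thesis by (simp add: path_compose_join)
qed

text \<open>
  Within one star the path from \<open>p s\<close> to \<open>p t\<close> is homotopic to a detour
  over the centre of the star; the first half of the detour is merged with the chord at \<open>p
  s\<close> into an edge path.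
\<close>
lemma tracked_step:
  assumes p: "path p" "path_image p \<subseteq> points Y" and v: "v \<in> vertices Y"
    and \<theta>: "continuous_on {t \<in> {0..1}. \<bar>t - t0\<bar> < \<epsilon>} \<theta>"
      "\<And>t. t \<in> {0..1} \<Longrightarrow> \<bar>t - t0\<bar> < \<epsilon> \<Longrightarrow> \<theta> t \<in> star v \<and> star_chart v (\<theta> t) = p t \<and> (\<forall>e. \<bar>\<theta> t $ e\<bar> < 1)"
    and s: "s \<in> {0..1}" "\<bar>s - t0\<bar> < \<epsilon>" and t: "t \<in> {0..1}" "\<bar>t - t0\<bar> < \<epsilon>" and "tracked p s"
  shows "tracked p t"
proof -
  obtain w \<eta> where w: "spelled (p 0) w" "\<eta> \<in> star (endv (p 0) w)" "star_chart (endv (p 0) w) \<eta> = p s"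
      "\<And>e. \<bar>\<eta> $ e\<bar> < 1" "(p \<circ> linepath 0 s) \<simeq> epath (p 0) w +++ chord (endv (p 0) w) \<eta>"
    using \<open>tracked p s\<close> unfolding tracked_def by blast
  define u where "u = endv (p 0) w"
  have uv: "u \<in> vertices Y" unfolding u_def using w(1) by (rule spelled_end)
  note S = \<theta>(2)[OF s] and T = \<theta>(2)[OF t]
  have Ss: "\<theta> s \<in> star v" "star_chart v (\<theta> s) = p s" "\<And>e. \<bar>\<theta> s $ e\<bar> < 1" using S by auto
  have Tt: "\<theta> t \<in> star v" "star_chart v (\<theta> t) = p t" "\<And>e. \<bar>\<theta> t $ e\<bar> < 1" using T by auto
  obtain w1 where w1: "spelled u w1" "endv u w1 = v" "chord u \<eta> +++ reversepath (chord v (\<theta> s)) \<simeq> epath u w1"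
    using change_star[OF uv w(2)[folded u_def] v Ss(1,3)] w(3) Ss(2) unfolding u_def by auto
  let ?I = "{t \<in> {0..1}. \<bar>t - t0\<bar> < \<epsilon>}"
  have "convex ?I"
  proof -
    have "?I = {0..1} \<inter> ball t0 \<epsilon>" by (auto simp: dist_real_def abs_minus_commute)
    then show ?thesis by (simp add: convex_Int)
  qed
  then have seg: "path_image (linepath s t) \<subseteq> ?I"
    using s t by (simp add: closed_segment_subset)
  then have lin: "linepath s t r \<in> ?I" if "r \<in> {0..1}" for r
    using that unfolding path_image_def by blast
  have pathth: "path (\<theta> \<circ> linepath s t)"
    by (rule path_continuous_image[OF path_linepath continuous_on_subset[OF \<theta>(1) seg]])
  have imth: "path_image (\<theta> \<circ> linepath s t) \<subseteq> star v"
    unfolding path_image_def using lin \<theta>(2) by auto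
  note cs = chord_path[OF v Ss(1)] and ct = chord_path[OF v Tt(1)] and cu = chord_path[OF uv w(2)[folded u_def]]
  have "(p \<circ> linepath s t) \<simeq> star_chart v \<circ> (\<theta> \<circ> linepath s t)"
  proof (rule homotopic_paths_eq)
    show "path ((p \<circ> linepath s t))" 
      by (rule path_continuous_image[OF path_linepath continuous_on_subset[OF _ linepath_unit_image[OF s(1) t(1)]]])
        (use p(1) in \<open>simp add: path_def\<close>)
    show "path_image ((p \<circ> linepath s t)) \<subseteq> points Y"
      unfolding path_image_compose using linepath_unit_image[OF s(1) t(1)] p(2) by (auto simp: path_image_def)
    fix r :: real assume "r \<in> {0..1}"
    then have "linepath s t r \<in> ?I" by (rule lin)
    then have "star_chart v (\<theta> (linepath s t r)) = p (linepath s t r)" using \<theta>(2) by blast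
    then show "(p \<circ> linepath s t) r = (star_chart v \<circ> (\<theta> \<circ> linepath s t)) r" by simp
  qed
  also have "star_chart v \<circ> (\<theta> \<circ> linepath s t) \<simeq> star_chart v \<circ> (linepath (\<theta> s) 0 +++ linepath 0 (\<theta> t))"
  proof (rule star_contractible_homotopy[OF v pathth])
    have "path_image (linepath (\<theta> s) 0) \<subseteq> star v" using star_segment[OF Ss(1)] by (simp add: closed_segment_commute)
    then show "path_image (linepath (\<theta> s) 0 +++ linepath 0 (\<theta> t)) \<subseteq> star v"
      using star_segment[OF Tt(1)] by (rule subset_path_image_join)
  qed (use imth in \<open>auto simp: pathstart_compose pathfinish_compose\<close>)
  also have "star_chart v \<circ> (linepath (\<theta> s) 0 +++ linepath 0 (\<theta> t)) = reversepath (chord v (\<theta> s)) +++ chord v (\<theta> t)"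
  proof -
    have "star_chart v \<circ> linepath (\<theta> s) 0 = reversepath (chord v (\<theta> s))"
      by (auto simp: chord_def reversepath_def linepath_def)
    then show ?thesis by (simp add: path_compose_join chord_def)
  qed
  finally have st: "(p \<circ> linepath s t) \<simeq> reversepath (chord v (\<theta> s)) +++ chord v (\<theta> t)" .
  have ew: "path (epath (p 0) w)" "path_image (epath (p 0) w) \<subseteq> points Y" "pathfinish (epath (p 0) w) = u"
    using w(1) by (auto simp: u_def)
  have meet: "star_chart u \<eta> = star_chart v (\<theta> s)" using w(3) Ss(2) by (simp add: u_def)
  have "(p \<circ> linepath 0 t) \<simeq> (p \<circ> linepath 0 s) +++ (p \<circ> linepath s t)"
    using subpath_concat[OF p s(1) t(1)] by (rule homotopic_paths_sym)
  also have "(p \<circ> linepath 0 s) +++ (p \<circ> linepath s t) \<simeq>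
      (epath (p 0) w +++ chord u \<eta>) +++ (reversepath (chord v (\<theta> s)) +++ chord v (\<theta> t))"
    using w(5) st unfolding u_def by (intro homotopic_paths_join) (auto simp: pathstart_compose pathfinish_compose)
  also have "(epath (p 0) w +++ chord u \<eta>) +++ (reversepath (chord v (\<theta> s)) +++ chord v (\<theta> t)) \<simeq>
      epath (p 0) w +++ (chord u \<eta> +++ (reversepath (chord v (\<theta> s)) +++ chord v (\<theta> t)))"
    using ew cu cs ct meet by (intro homotopic_paths_sym[OF homotopic_paths_assoc]) (auto simp: subset_path_image_join)
  also have "epath (p 0) w +++ (chord u \<eta> +++ (reversepath (chord v (\<theta> s)) +++ chord v (\<theta> t))) \<simeq>
      epath (p 0) w +++ ((chord u \<eta> +++ reversepath (chord v (\<theta> s))) +++ chord v (\<theta> t))"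
    using ew cu cs ct meet by (intro homotopic_paths_join homotopic_paths_assoc) auto
  also have "epath (p 0) w +++ ((chord u \<eta> +++ reversepath (chord v (\<theta> s))) +++ chord v (\<theta> t)) \<simeq>
      epath (p 0) w +++ (epath u w1 +++ chord v (\<theta> t))"
    using ew cu cs ct w1 by (intro homotopic_paths_join) auto
  also have "epath (p 0) w +++ (epath u w1 +++ chord v (\<theta> t)) \<simeq> (epath (p 0) w +++ epath u w1) +++ chord v (\<theta> t)"
    using ew ct w1 by (intro homotopic_paths_assoc) auto
  also have "(epath (p 0) w +++ epath u w1) +++ chord v (\<theta> t) \<simeq> epath (p 0) (w @ w1) +++ chord v (\<theta> t)"
  proof (intro homotopic_paths_join)
    show "epath (p 0) w +++ epath u w1 \<simeq> epath (p 0) (w @ w1)"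
      unfolding u_def by (rule homotopic_paths_sym[OF epath_append]) (use w(1) w1(1) in \<open>simp add: spelled_append u_def\<close>)
  qed (use ew ct w1 in auto)
  finally have "(p \<circ> linepath 0 t) \<simeq> epath (p 0) (w @ w1) +++ chord v (\<theta> t)" .
  moreover have "spelled (p 0) (w @ w1)" "endv (p 0) (w @ w1) = v"
    using w(1) w1 by (simp_all add: spelled_append endv_append u_def)
  ultimately show ?thesis
    unfolding tracked_def using Tt by (intro exI[of _ "w @ w1"] exI[of _ "\<theta> t"]) auto
qed

text \<open>
  At the end of the path the chord is trivial, since a vertex is the only vertex in its open star.
\<close>
theorem path_homotopic_epath:
  assumes p: "path p" "path_image p \<subseteq> points Y" and start: "p 0 \<in> vertices Y" and finish: "p 1 \<in> vertices Y"
  shows "\<exists>w. spelled (p 0) w \<and> endv (p 0) w = p 1 \<and> p \<simeq> epath (p 0) w"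
proof -
  have "tracked p 0"
  proof -
    have s: "spelled (p 0) []" using start by simp
    have z: "0 \<in> star (p 0)" "star_chart (p 0) 0 = p 0" using zero_in_star[OF start] by auto
    have c: "chord (p 0) 0 = (\<lambda>_. p 0)" using z(2) by (simp add: chord_def fun_eq_iff linepath_def)
    have "(p \<circ> linepath 0 0) = (\<lambda>_. p 0)" by (auto simp: linepath_def)
    moreover have "epath (p 0) [] +++ chord (p 0) 0 = (\<lambda>_. p 0)" unfolding c by (simp add: joinpaths_def)
    moreover have "(\<lambda>_. p 0) \<simeq> (\<lambda>_. p 0)" using epath_props[OF s] by auto
    ultimately have "(p \<circ> linepath 0 0) \<simeq> epath (p 0) [] +++ chord (p 0) 0" by simp
    then show ?thesis unfolding tracked_def using s z by (intro exI[of _ "[]"] exI[of _ 0]) simp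
  qed
  note tracked_start = this
  have locally_constant: "\<exists>T. openin (top_of_set {0..1}) T \<and> t0 \<in> T \<and> (\<forall>x\<in>T. \<forall>y\<in>T. tracked p x \<longrightarrow> tracked p y)"
    if t0: "t0 \<in> {0..1}" for t0 :: real
  proof -
    obtain v \<epsilon> \<theta> where v: "v \<in> vertices Y" "\<epsilon> > 0" "continuous_on {t \<in> {0..1}. \<bar>t - t0\<bar> < \<epsilon>} \<theta>"
        "\<And>t. t \<in> {0..1} \<Longrightarrow> \<bar>t - t0\<bar> < \<epsilon> \<Longrightarrow> \<theta> t \<in> star v \<and> star_chart v (\<theta> t) = p t \<and> (\<forall>e. \<bar>\<theta> t $ e\<bar> < 1)"
      using local_lift[OF p t0] by blast
    let ?T = "{0..1} \<inter> ball t0 \<epsilon>"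
    have "tracked p t" if st: "s \<in> ?T" "t \<in> ?T" and tr: "tracked p s" for s t
      by (rule tracked_step[OF p v(1,3,4) _ _ _ _ tr]) (use st in \<open>auto simp: dist_real_def abs_minus_commute\<close>)
    moreover have "openin (top_of_set {0..1}) ?T" by (intro openin_open_Int) simp
    moreover have "t0 \<in> ?T" using t0 v(2) by simp
    ultimately show "\<exists>T. openin (top_of_set {0..1}) T \<and> t0 \<in> T \<and> (\<forall>x\<in>T. \<forall>y\<in>T. tracked p x \<longrightarrow> tracked p y)"
      by blast
  qed
  have "connected {0..1::real}" "0 \<in> {0..1::real}" "1 \<in> {0..1::real}" by simp_all
  from connected_induction_simple[OF this tracked_start locally_constant] have "tracked p 1" .
  then obtain w \<theta> where w: "spelled (p 0) w" "\<theta> \<in> star (endv (p 0) w)" "star_chart (endv (p 0) w) \<theta> = p 1"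
     "\<And>e. \<bar>\<theta> $ e\<bar> < 1" "(p \<circ> linepath 0 1) \<simeq> epath (p 0) w +++ chord (endv (p 0) w) \<theta>"
    unfolding tracked_def by blast
  let ?u = "endv (p 0) w"
  have u: "?u \<in> vertices Y" using w(1) by (rule spelled_end)
  have z: "\<theta> = 0" "?u = p 1"
    using integral_star_point[OF w(2) u _ w(4)] w(3) finish by auto
  have c: "chord ?u \<theta> = (\<lambda>_. pathfinish (epath (p 0) w))"
    using zero_in_star[OF u] w(1) unfolding z(1) by (simp add: chord_def fun_eq_iff linepath_def)
  have "p \<simeq> epath (p 0) w +++ (\<lambda>_. pathfinish (epath (p 0) w))" 
    using w(5) unfolding c by (simp add: fun_eq_iff linepath_def o_def)
  also have "epath (p 0) w +++ (\<lambda>_. pathfinish (epath (p 0) w)) \<simeq> epath (p 0) w"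
    using w(1) by (intro homotopic_paths_right_unit) auto
  finally show ?thesis using w(1) z(2) by blast
qed

end

section \<open>Fundamental groups and their growth\<close>

subsection \<open>The fundamental group\<close>

lemma fundamental_group_mult:
  assumes "path p" "path_image p \<subseteq> X" "path q" "path_image q \<subseteq> X" "pathfinish p = pathstart q"
  shows "path_class X p \<otimes>\<^bsub>fundamental_group X x0\<^esub> path_class X q = path_class X (p +++ q)"
proof -
  have "homotopic_paths X (p +++ q) r \<longleftrightarrow>
      (\<exists>p'\<in>path_class X p. \<exists>q'\<in>path_class X q. homotopic_paths X (p' +++ q') r)" for r
  proof
    assume "homotopic_paths X (p +++ q) r"
    moreover have "p \<in> path_class X p" "q \<in> path_class X q" using assms by (auto simp: path_class_def)
    ultimately show "\<exists>p'\<in>path_class X p. \<exists>q'\<in>path_class X q. homotopic_paths X (p' +++ q') r" by blast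
  next
    assume "\<exists>p'\<in>path_class X p. \<exists>q'\<in>path_class X q. homotopic_paths X (p' +++ q') r"
    then obtain p' q' where "homotopic_paths X p p'" "homotopic_paths X q q'" "homotopic_paths X (p' +++ q') r"
      by (auto simp: path_class_def)
    then show "homotopic_paths X (p +++ q) r"
      using homotopic_paths_join[of X p p' q q'] assms(5) homotopic_paths_trans by blast
  qed
  then show ?thesis by (simp add: fundamental_group_def path_class_def[of X "p +++ q"])
qed

lemma fundamental_group_carrierE:
  assumes "a \<in> carrier (fundamental_group X x0)"
  obtains p where "path p" "path_image p \<subseteq> X" "pathstart p = x0" "pathfinish p = x0" "a = path_class X p"
  using assms by (auto simp: fundamental_group_def)

lemma fundamental_group_carrierI:
  "path p \<Longrightarrow> path_image p \<subseteq> X \<Longrightarrow> pathstart p = x0 \<Longrightarrow> pathfinish p = x0 \<Longrightarrow>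
     path_class X p \<in> carrier (fundamental_group X x0)"
  by (auto simp: fundamental_group_def)

lemma fundamental_group_one: "\<one>\<^bsub>fundamental_group X x0\<^esub> = path_class X (\<lambda>_. x0)"
  by (simp add: fundamental_group_def)

lemma constant_loop:
  assumes "x0 \<in> X"
  shows "path (\<lambda>_::real. x0)" "path_image (\<lambda>_::real. x0) \<subseteq> X" "pathstart (\<lambda>_::real. x0) = x0" "pathfinish (\<lambda>_::real. x0) = x0"
  using assms by (auto simp: path_def path_image_def pathstart_def pathfinish_def)

lemma group_fundamental_group:
  assumes "x0 \<in> X" shows "group (fundamental_group X x0)"
proof (rule groupI)
  let ?G = "fundamental_group X x0"
  note const = constant_loop[OF assms]
  show "\<one>\<^bsub>?G\<^esub> \<in> carrier ?G"
    unfolding fundamental_group_one using const by (rule fundamental_group_carrierI)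
  fix a b assume "a \<in> carrier ?G" "b \<in> carrier ?G"
  then obtain p q where p: "path p" "path_image p \<subseteq> X" "pathstart p = x0" "pathfinish p = x0" "a = path_class X p"
    and q: "path q" "path_image q \<subseteq> X" "pathstart q = x0" "pathfinish q = x0" "b = path_class X q"
    by (metis fundamental_group_carrierE)
  have ab: "a \<otimes>\<^bsub>?G\<^esub> b = path_class X (p +++ q)"
    using p q by (simp add: fundamental_group_mult)
  show "a \<otimes>\<^bsub>?G\<^esub> b \<in> carrier ?G"
    unfolding ab using p q by (intro fundamental_group_carrierI) (auto simp: subset_path_image_join)
  have "\<one>\<^bsub>?G\<^esub> \<otimes>\<^bsub>?G\<^esub> a = path_class X ((\<lambda>_. x0) +++ p)"
    unfolding fundamental_group_one using p const by (simp add: fundamental_group_mult)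
  also have "\<dots> = path_class X p"
    using homotopic_paths_left_unit[OF p(1,2)] p const
    by (subst path_class_eq_iff) (auto simp: subset_path_image_join)
  finally show "\<one>\<^bsub>?G\<^esub> \<otimes>\<^bsub>?G\<^esub> a = a" using p by simp
  have "path_class X (reversepath p) \<otimes>\<^bsub>?G\<^esub> a = path_class X (reversepath p +++ p)"
    using p by (simp add: fundamental_group_mult)
  also have "\<dots> = path_class X (\<lambda>_. x0)"
    using homotopic_paths_right_inverse[of "reversepath p" X] p
    by (subst path_class_eq_iff) (auto simp: subset_path_image_join)
  finally show "\<exists>y\<in>carrier ?G. y \<otimes>\<^bsub>?G\<^esub> a = \<one>\<^bsub>?G\<^esub>"
    unfolding fundamental_group_one using p
    by (intro bexI[of _ "path_class X (reversepath p)"] fundamental_group_carrierI) auto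
  fix c assume "c \<in> carrier ?G"
  then obtain r where r: "path r" "path_image r \<subseteq> X" "pathstart r = x0" "pathfinish r = x0" "c = path_class X r"
    by (metis fundamental_group_carrierE)
  have "a \<otimes>\<^bsub>?G\<^esub> b \<otimes>\<^bsub>?G\<^esub> c = path_class X ((p +++ q) +++ r)"
    unfolding ab using p q r by (simp add: fundamental_group_mult subset_path_image_join)
  also have "\<dots> = path_class X (p +++ (q +++ r))"
    using p q r homotopic_paths_sym[OF homotopic_paths_assoc[of p X q r]]
    by (subst path_class_eq_iff) (auto simp: subset_path_image_join)
  also have "\<dots> = a \<otimes>\<^bsub>?G\<^esub> (b \<otimes>\<^bsub>?G\<^esub> c)"
    using p q r by (simp add: fundamental_group_mult subset_path_image_join)
  finally show "a \<otimes>\<^bsub>?G\<^esub> b \<otimes>\<^bsub>?G\<^esub> c = a \<otimes>\<^bsub>?G\<^esub> (b \<otimes>\<^bsub>?G\<^esub> c)" .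
qed

subsection \<open>Growth of the Artin group\<close>

context raag_graph
begin

lemma clique_norm_word_class: "clique_norm (word_class E w) \<le> length w"
  using clique_norm_mult_word[of "\<one>\<^bsub>raag E\<^esub>" w] clique_norm_0_iff[of "\<one>\<^bsub>raag E\<^esub>"] by simp

lemma center_le_1: "V \<subseteq> carrier (raag E) \<Longrightarrow> card {g \<in> V. clique_norm g = 0} \<le> 1"
proof -
  assume "V \<subseteq> carrier (raag E)"
  then have "{g \<in> V. clique_norm g = 0} \<subseteq> {\<one>\<^bsub>raag E\<^esub>}" using clique_norm_0_iff by blast
  then show ?thesis using card_mono[of "{\<one>\<^bsub>raag E\<^esub>}"] by simp
qed

lemma finite_ball_subset: "V \<subseteq> carrier (raag E) \<Longrightarrow> finite {g \<in> V. clique_norm g \<le> n}"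
  by (rule finite_subset[OF _ finite_clique_ball[of n]]) blast

lemma list_prod_words:
  "list_prod (raag E) (map (word_class E) ws) = word_class E (concat ws)"
  by (induction ws) (simp_all add: raag_one)

lemma word_class_letters: "word_class E w = list_prod (raag E) (map (\<lambda>x. word_class E [x]) w)"
proof -
  have "map (\<lambda>x. word_class E [x]) w = map (word_class E) (map (\<lambda>x. [x]) w)" by simp
  then show ?thesis by (simp only: list_prod_words concat_map_singleton) simp
qed

text \<open>
  The group is compared with itself: the clique norm and the word norm of the letters bound each
  other up to factors, and hence so do the clique norm and every other word norm.
\<close>
lemma growth_raag: "is_growth_of (\<lambda>n. card {g \<in> carrier (raag E). clique_norm g = Suc n}) (raag E)"
  unfolding is_growth_of_def
proof
  define T where "T = range (\<lambda>x. word_class E [x])"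
  have T: "finite T" "T \<subseteq> carrier (raag E)" by (auto simp: T_def)
  have rep: "\<exists>ts. set ts \<subseteq> T \<and> g = list_prod (raag E) ts \<and> length ts \<le> CARD('e) * clique_norm g + CARD('e)"
    if g: "g \<in> carrier (raag E)" for g
  proof -
    obtain w where w: "g = word_class E w" "length w \<le> CARD('e) * clique_norm g"
      using short_representative[OF g] by blast
    then show ?thesis
      using word_class_letters[of w] by (intro exI[of _ "map (\<lambda>x. word_class E [x]) w"]) (auto simp: T_def)
  qed
  show "\<exists>S. finite_generating_set (raag E) S"
  proof (intro exI[of _ T])
    have "carrier (raag E) \<subseteq> generate (raag E) T"
      using rep RG.list_prod_generate[of _ T] by blast
    moreover have "generate (raag E) T \<subseteq> carrier (raag E)" using RG.generate_incl[OF T(2)] .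
    ultimately show "finite_generating_set (raag E) T" using T by (simp add: finite_generating_set_def)
  qed
  show "\<forall>S. finite_generating_set (raag E) S \<longrightarrow>
      growth_equivalent (\<lambda>n. card {g \<in> carrier (raag E). clique_norm g = Suc n}) (growth_function (raag E) S)"
  proof (intro allI impI)
    fix S assume S: "finite_generating_set (raag E) S"
    have bound: "\<exists>C. \<forall>ts. set ts \<subseteq> T' \<longrightarrow> clique_norm (id (list_prod (raag E) ts)) \<le> C * length ts"
      if T': "finite T'" "T' \<subseteq> carrier (raag E)" for T'
    proof -
      have "\<exists>w. t = word_class E w" if t: "t \<in> T'" for t
      proof -
        have "t \<in> carrier (raag E)" using t T'(2) by blast
        then obtain w where "t = word_class E w" by (rule raag_carrierE)
        then show ?thesis by blast
      qed
      then obtain wd where wd: "\<And>t. t \<in> T' \<Longrightarrow> t = word_class E (wd t)" by metis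
      define C where "C = Max (insert 0 ((length \<circ> wd) ` T'))"
      have C: "length (wd t) \<le> C" if "t \<in> T'" for t
        unfolding C_def using that T'(1) by (intro Max_ge) auto
      have "clique_norm (list_prod (raag E) ts) \<le> C * length ts" if ts: "set ts \<subseteq> T'" for ts
      proof -
        have "map (word_class E) (map wd ts) = ts" using ts wd by (auto intro!: map_idI)
        then have "list_prod (raag E) ts = word_class E (concat (map wd ts))" using list_prod_words[of "map wd ts"] by simp
        moreover have "length (concat (map wd ts)) \<le> C * length ts"
          using ts C by (induction ts) (auto intro: add_mono)
        ultimately show ?thesis using clique_norm_word_class[of "concat (map wd ts)"] by simp
      qed
      then show ?thesis by auto
    qed
    show "growth_equivalent (\<lambda>n. card {g \<in> carrier (raag E). clique_norm g = Suc n}) (growth_function (raag E) S)"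
    proof (rule RG.growth_equivalent_orbit[where V = "carrier (raag E)" and N = clique_norm and \<phi> = id
          and \<psi> = id and T = T and C = "CARD('e)" and D = 1])
      show "finite {v \<in> carrier (raag E). id v = x} \<and> card {v \<in> carrier (raag E). id v = x} \<le> 1" for x
      proof -
        have "{v \<in> carrier (raag E). id v = x} \<subseteq> {x}" by auto
        then show ?thesis using card_mono[of "{x}"] finite_subset by fastforce
      qed
      show "\<exists>ts. set ts \<subseteq> T \<and> id g = list_prod (raag E) ts \<and> length ts \<le> CARD('e) * clique_norm g + CARD('e)"
        if "g \<in> carrier (raag E)" for g
        using rep[OF that] by simp
    qed (use S T bound finite_clique_ball center_le_1 in simp_all)
  qed
qed

end

subsection \<open>Loops and words\<close>

context special_complex
begin

context
  fixes y0 assumes compact: "compact (points Y)" and y0: "y0 \<in> vertices Y"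
begin

definition loop_word :: "'e word \<Rightarrow> bool" where
  "loop_word w \<longleftrightarrow> spelled y0 w \<and> endv y0 w = y0"

definition loop_class :: "'e word \<Rightarrow> (real \<Rightarrow> 'y) set" where
  "loop_class w = path_class (points Y) (epath y0 w)"

abbreviation "\<pi> \<equiv> fundamental_group (points Y) y0"

lemma y0_point: "y0 \<in> points Y"
  using y0 vertices_subset_points by blast

interpretation P: group \<pi>
  by (rule group_fundamental_group[OF y0_point])

lemma loop_class_carrier: "loop_word w \<Longrightarrow> loop_class w \<in> carrier \<pi>"
  unfolding loop_class_def loop_word_def by (intro fundamental_group_carrierI) auto

lemma loop_word_append: "loop_word u \<Longrightarrow> loop_word w \<Longrightarrow> loop_word (u @ w)"
  by (simp add: loop_word_def spelled_append endv_append)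

lemma loop_class_append:
  assumes "loop_word u" "loop_word w"
  shows "loop_class (u @ w) = loop_class u \<otimes>\<^bsub>\<pi>\<^esub> loop_class w"
proof -
  note u = assms(1)[unfolded loop_word_def] and w = assms(2)[unfolded loop_word_def]
  have uw: "spelled y0 (u @ w)" using loop_word_append[OF assms] by (simp add: loop_word_def)
  have "epath y0 (u @ w) \<simeq> epath y0 u +++ epath y0 w" using epath_append[OF uw] u by simp
  then have "loop_class (u @ w) = path_class (points Y) (epath y0 u +++ epath y0 w)"
    unfolding loop_class_def using uw by (subst path_class_eq_iff) auto
  also have "\<dots> = loop_class u \<otimes>\<^bsub>\<pi>\<^esub> loop_class w"
    unfolding loop_class_def using u w by (simp add: fundamental_group_mult)
  finally show ?thesis .
qed

lemma loop_class_Nil: "loop_class [] = \<one>\<^bsub>\<pi>\<^esub>"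
  by (simp add: loop_class_def fundamental_group_one)

lemma f_epath_homotopic:
  assumes "spelled v w" shows "homotopic_paths Salvetti (f \<circ> epath v w) (word_loop w)"
  by (rule homotopic_paths_sym, rule homotopic_paths_eq)
    (use f_epath[OF assms] word_loop_image in auto)

lemma f_homotopic: "p \<simeq> q \<Longrightarrow> homotopic_paths Salvetti (f \<circ> p) (f \<circ> q)"
  by (rule homotopic_paths_continuous_image[OF _ continuous_on_f]) (use f_in_Salvetti in auto)

text \<open>
  Homotopies are mapped to \<open>T\<^sub>A\<close>, where the holonomy recovers the word.
\<close>
lemma epaths_homotopic_imp_equiv:
  assumes "spelled v u" "spelled v w" "epath v u \<simeq> epath v w" shows "u \<sim>\<^sub>R w"
proof -
  have "homotopic_paths Salvetti (word_loop u) (f \<circ> epath v u)"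
    using f_epath_homotopic[OF assms(1)] by (rule homotopic_paths_sym)
  also have "homotopic_paths Salvetti (f \<circ> epath v u) (f \<circ> epath v w)" using assms(3) by (rule f_homotopic)
  also have "homotopic_paths Salvetti (f \<circ> epath v w) (word_loop w)" by (rule f_epath_homotopic[OF assms(2)])
  finally show ?thesis
    using homotopic_word_loops_imp_equiv homotopic_paths_subset[OF _ Salvetti_subset_T_A] by blast
qed

text \<open>
  The fundamental group embeds in the Artin group.
\<close>
lemma loop_class_eq_iff:
  assumes "loop_word u" "loop_word w"
  shows "loop_class u = loop_class w \<longleftrightarrow> u \<sim>\<^sub>R w"
proof -
  note u = assms(1)[unfolded loop_word_def] and w = assms(2)[unfolded loop_word_def]
  have "loop_class u = loop_class w \<longleftrightarrow> epath y0 u \<simeq> epath y0 w"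
    unfolding loop_class_def using u by (intro path_class_eq_iff) auto
  then show ?thesis using u w epaths_homotopic_imp_equiv spelled_equiv(2) by blast
qed

lemma loop_class_surj:
  assumes "a \<in> carrier \<pi>" shows "\<exists>w. loop_word w \<and> a = loop_class w"
proof -
  obtain p where p: "path p" "path_image p \<subseteq> points Y" "pathstart p = y0" "pathfinish p = y0" "a = path_class (points Y) p"
    using assms by (rule fundamental_group_carrierE)
  have p01: "p 0 = y0" "p 1 = y0" using p(3,4) by (simp_all add: pathstart_def pathfinish_def)
  obtain w where w: "spelled (p 0) w" "endv (p 0) w = p 1" "p \<simeq> epath (p 0) w"
    using path_homotopic_epath[OF p(1,2)] p01 y0 by auto
  have "a = loop_class w"
    unfolding p(5) loop_class_def using w(3) p01 p(1,2) by (subst path_class_eq_iff) auto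
  then show ?thesis using w p01 by (auto simp: loop_word_def)
qed

subsection \<open>The embedded universal cover\<close>

abbreviation "V \<equiv> special_elements E Y f y0"

text \<open>
  The vertices of the embedded universal cover are the ends of lifted edge paths.
\<close>
lemma special_elements_eq: "V = {word_class E w | w. spelled y0 w}"
proof -
  have deck: "deck Salvetti (word_class E w) (path_class Salvetti (\<lambda>_. 1)) = path_class Salvetti (word_loop w)" for w
  proof -
    have one: "(1 :: complex ^ 'e) \<in> Salvetti" by (simp add: salvetti_def)
    note c = constant_loop[OF one]
    have "deck Salvetti (word_class E w) (path_class Salvetti (\<lambda>_. 1)) = path_class Salvetti (word_loop w +++ (\<lambda>_. 1))"
      using c by (intro deck_path_class) auto
    also have "\<dots> = path_class Salvetti (word_loop w)"
      using homotopic_paths_right_unit[of "word_loop w" Salvetti] word_loop_image c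
      by (subst path_class_eq_iff) (auto simp: subset_path_image_join)
    finally show ?thesis .
  qed
  have lift: "lift_map Salvetti f (path_class (points Y) p) = path_class Salvetti (f \<circ> p)"
    if p: "path p" "path_image p \<subseteq> points Y" for p
  proof (rule Set.set_eqI, rule iffI)
    fix r assume "r \<in> lift_map Salvetti f (path_class (points Y) p)"
    then obtain q where "p \<simeq> q" "homotopic_paths Salvetti (f \<circ> q) r" by (auto simp: lift_map_def path_class_def)
    then show "r \<in> path_class Salvetti (f \<circ> p)"
      unfolding path_class_def using f_homotopic homotopic_paths_trans by blast
  next
    fix r assume "r \<in> path_class Salvetti (f \<circ> p)"
    moreover have "p \<in> path_class (points Y) p" using p by (simp add: path_class_def)
    ultimately show "r \<in> lift_map Salvetti f (path_class (points Y) p)"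
      unfolding lift_map_def path_class_def by blast
  qed
  show ?thesis
  proof (rule Set.set_eqI, rule iffI)
    fix g assume "g \<in> V"
    then obtain c where g: "g \<in> carrier (raag E)" and c: "c \<in> universal_cover (points Y) y0"
      "deck Salvetti g (path_class Salvetti (\<lambda>_. 1)) = lift_map Salvetti f c"
      unfolding special_elements_def by blast
    obtain w where w: "g = word_class E w" using g by (rule raag_carrierE)
    obtain p where p: "path p" "path_image p \<subseteq> points Y" "pathstart p = y0" "c = path_class (points Y) p"
      using c(1) unfolding universal_cover_def by blast
    have "path_class Salvetti (word_loop w) = path_class Salvetti (f \<circ> p)"
      using c(2) unfolding w deck p(4) lift[OF p(1,2)] .
    then have wp: "homotopic_paths Salvetti (word_loop w) (f \<circ> p)"
      by (subst (asm) path_class_eq_iff) (auto simp: word_loop_image)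
    then have "f (pathfinish p) = 1"
      using homotopic_paths_imp_pathfinish[OF wp] by (simp add: pathfinish_compose)
    moreover have "pathfinish p \<in> points Y" using p(2) pathfinish_in_path_image by blast
    ultimately have "p 1 \<in> vertices Y" using f_eq_1_iff_vertex by (simp add: pathfinish_def)
    moreover have p0: "p 0 = y0" using p(3) by (simp add: pathstart_def)
    ultimately obtain u where u: "spelled y0 u" "p \<simeq> epath y0 u"
      using path_homotopic_epath[OF p(1,2)] y0 by auto
    note wp
    also have "homotopic_paths Salvetti (f \<circ> p) (f \<circ> epath y0 u)" using u(2) by (rule f_homotopic)
    also have "homotopic_paths Salvetti (f \<circ> epath y0 u) (word_loop u)" by (rule f_epath_homotopic[OF u(1)])
    finally have "w \<sim>\<^sub>R u"
      using homotopic_word_loops_imp_equiv homotopic_paths_subset[OF _ Salvetti_subset_T_A] by blast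
    then have "g = word_class E u" unfolding w word_class_eq_iff .
    then show "g \<in> {word_class E w | w. spelled y0 w}" using u(1) by blast
  next
    fix g assume "g \<in> {word_class E w | w. spelled y0 w}"
    then obtain w where w: "g = word_class E w" "spelled y0 w" by blast
    have "path_class (points Y) (epath y0 w) \<in> universal_cover (points Y) y0"
      unfolding universal_cover_def using epath[OF w(2)] by blast
    moreover have "lift_map Salvetti f (path_class (points Y) (epath y0 w)) = path_class Salvetti (word_loop w)"
    proof -
      have h: "homotopic_paths Salvetti (f \<circ> epath y0 w) (word_loop w)" by (rule f_epath_homotopic[OF w(2)])
      show ?thesis
        unfolding lift[OF epath(1,2)[OF w(2)]] using h homotopic_paths_imp_path[OF h] homotopic_paths_imp_subset[OF h]
        by (subst path_class_eq_iff) auto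
    qed
    ultimately show "g \<in> V"
      unfolding special_elements_def using deck[of w] w(1) by (auto intro!: image_eqI[of _ _ "path_class (points Y) (epath y0 w)"])
  qed
qed

lemma V_carrier: "V \<subseteq> carrier (raag E)"
  unfolding special_elements_def by blast

text \<open>
  An edge path and a short word for \<open>g\<close> have a common reduct: it is spelled by an
  edge path because it is a reduct of the former, and short because it is a reduct of the latter.
\<close>
lemma short_spelled:
  assumes "g \<in> V"
  shows "\<exists>w. spelled y0 w \<and> g = word_class E w \<and> length w \<le> CARD('e) * clique_norm g"
proof -
  obtain u where u: "spelled y0 u" "g = word_class E u" using assms unfolding special_elements_eq by blast
  obtain w where w: "g = word_class E w" "length w \<le> CARD('e) * clique_norm g"
    using short_representative assms V_carrier by blast
  have "u \<sim>\<^sub>R w" using u(2) w(1) unfolding word_class_eq_iff[symmetric] by simp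
  then obtain m where m: "u \<rightarrow>\<^sub>R m" "w \<rightarrow>\<^sub>R m" using confluence by blast
  have "spelled y0 m" using spelled_reduces[OF m(1) u(1)] by blast
  moreover have "g = word_class E m" using u(2) reduces_imp_equiv[OF m(1)] by (simp add: word_class_eq_iff)
  moreover have "length m \<le> CARD('e) * clique_norm g" using length_reduces[OF m(2)] w(2) by linarith
  ultimately show ?thesis by blast
qed

subsection \<open>Generators and growth\<close>

text \<open>
  The vertices joined to the base vertex by an edge path.
\<close>
definition reach :: "'y set" where
  "reach = {endv y0 w | w. spelled y0 w}"

text \<open>
  A chosen edge path from the base vertex to \<open>v\<close>. It is trivial for the base vertex,
  so that closing up a loop does not change it.
\<close>
definition home :: "'y \<Rightarrow> 'e word" where
  "home v = (if v = y0 then [] else SOME w. spelled y0 w \<and> endv y0 w = v)"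

lemma home: "v \<in> reach \<Longrightarrow> spelled y0 (home v) \<and> endv y0 (home v) = v"
proof (cases "v = y0")
  case False
  assume "v \<in> reach"
  then have "\<exists>w. spelled y0 w \<and> endv y0 w = v" unfolding reach_def by blast
  then have "spelled y0 (SOME w. spelled y0 w \<and> endv y0 w = v) \<and> endv y0 (SOME w. spelled y0 w \<and> endv y0 w = v) = v"
    by (rule someI_ex)
  then show ?thesis using False by (simp add: home_def)
qed (use y0 in \<open>simp add: home_def\<close>)

lemma y0_reach: "y0 \<in> reach"
  unfolding reach_def using y0 by (intro CollectI exI[of _ "[]"]) simp

text \<open>
  The edge path \<open>w\<close> from \<open>v\<close>, closed up to a loop at the base vertex
  along the chosen paths.
\<close>
definition round_trip :: "'y \<Rightarrow> 'e word \<Rightarrow> 'e word" where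
  "round_trip v w = home v @ w @ inv_word (home (endv v w))"

lemma endv_reach: "v \<in> reach \<Longrightarrow> spelled v w \<Longrightarrow> endv v w \<in> reach"
proof -
  assume v: "v \<in> reach" and w: "spelled v w"
  have "spelled y0 (home v @ w)" "endv y0 (home v @ w) = endv v w"
    using home[OF v] w by (simp_all add: spelled_append endv_append)
  then show ?thesis unfolding reach_def by (intro CollectI exI[of _ "home v @ w"]) simp
qed

lemma round_trip: "v \<in> reach \<Longrightarrow> spelled v w \<Longrightarrow> loop_word (round_trip v w)"
proof -
  assume v: "v \<in> reach" and w: "spelled v w"
  have "spelled (endv v w) (inv_word (home (endv v w))) \<and> endv (endv v w) (inv_word (home (endv v w))) = y0"
    using spelled_inverse[of y0 "home (endv v w)"] home[OF endv_reach[OF v w]] by simp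
  then show ?thesis
    unfolding loop_word_def round_trip_def using home[OF v] w by (simp add: spelled_append endv_append)
qed

definition gens :: "(real \<Rightarrow> 'y) set set" where
  "gens = {loop_class (round_trip v [x]) | v x. v \<in> reach \<and> spelled v [x]}"

lemma finite_gens: "finite gens"
proof (rule finite_subset)
  show "gens \<subseteq> (\<lambda>(v, x). loop_class (round_trip v [x])) ` (vertices Y \<times> UNIV)"
  proof
    fix a assume "a \<in> gens"
    then obtain v x where vx: "spelled v [x]" "a = loop_class (round_trip v [x])" unfolding gens_def by blast
    then have "(v, x) \<in> vertices Y \<times> UNIV" using spelled_vertex by blast
    then show "a \<in> (\<lambda>(v, x). loop_class (round_trip v [x])) ` (vertices Y \<times> UNIV)"
      using vx(2) by (intro image_eqI[of _ _ "(v, x)"]) simp_all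
  qed
  show "finite ((\<lambda>(v, x). loop_class (round_trip v [x])) ` (vertices Y \<times> (UNIV :: ('e \<times> bool) set)))"
    using finite_vertices[OF compact] by simp
qed

lemma gens_carrier: "gens \<subseteq> carrier \<pi>"
  unfolding gens_def using loop_class_carrier round_trip by blast

text \<open>
  The return along a chosen path cancels with the next departure along it, so a round trip is the
  product of those of its single edges.
\<close>
lemma round_trip_product:
  "v \<in> reach \<Longrightarrow> spelled v w \<Longrightarrow>
     \<exists>ts. set ts \<subseteq> gens \<and> loop_class (round_trip v w) = list_prod \<pi> ts \<and> length ts = length w"
proof (induction w arbitrary: v)
  case Nil
  have l: "loop_word (round_trip v [])" "loop_word []" using round_trip[OF Nil] y0 by (simp_all add: loop_word_def)
  have "round_trip v [] \<sim>\<^sub>R []"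
    unfolding round_trip_def using reduces_imp_equiv[OF reduces_right_inverse] by simp
  then have "loop_class (round_trip v []) = \<one>\<^bsub>\<pi>\<^esub>" using loop_class_eq_iff[OF l] loop_class_Nil by simp
  then show ?case by (intro exI[of _ "[]"]) simp
next
  case (Cons x w)
  have x: "spelled v [x]" "spelled (tgt v x) w" using Cons.prems(2) by (auto dest: spelled_vertex)
  have t: "tgt v x \<in> reach" using endv_reach[OF Cons.prems(1) x(1)] by simp
  obtain ts where ts: "set ts \<subseteq> gens" "loop_class (round_trip (tgt v x) w) = list_prod \<pi> ts" "length ts = length w"
    using Cons.IH[OF t x(2)] by blast
  note l = round_trip[OF Cons.prems] round_trip[OF Cons.prems(1) x(1)] round_trip[OF t x(2)]
  let ?h = "home (tgt v x)" and ?e = "inv_word (home (endv (tgt v x) w))"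
  have "(home v @ [x]) @ (inv_word ?h @ ?h) @ (w @ ?e) \<sim>\<^sub>R (home v @ [x]) @ [] @ (w @ ?e)"
    by (rule equiv_context[OF equiv_left_inverse])
  then have "round_trip v [x] @ round_trip (tgt v x) w \<sim>\<^sub>R round_trip v (x # w)"
    by (simp add: round_trip_def)
  then have "loop_class (round_trip v (x # w)) = loop_class (round_trip v [x] @ round_trip (tgt v x) w)"
    using loop_class_eq_iff[OF loop_word_append[OF l(2,3)] l(1)] by simp
  also have "\<dots> = loop_class (round_trip v [x]) \<otimes>\<^bsub>\<pi>\<^esub> list_prod \<pi> ts"
    using loop_class_append[OF l(2,3)] ts(2) by simp
  finally have "loop_class (round_trip v (x # w)) = list_prod \<pi> (loop_class (round_trip v [x]) # ts)" by simp
  moreover have "loop_class (round_trip v [x]) \<in> gens" unfolding gens_def using Cons.prems(1) x(1) by blast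
  ultimately show ?case using ts by (intro exI[of _ "loop_class (round_trip v [x]) # ts"]) simp
qed

lemma round_trip_y0: "round_trip y0 w = w @ inv_word (home (endv y0 w))"
  by (simp add: round_trip_def home_def)

lemma gens_generate: "finite_generating_set \<pi> gens"
proof -
  have "a \<in> generate \<pi> gens" if a: "a \<in> carrier \<pi>" for a
  proof -
    obtain w where w: "loop_word w" "a = loop_class w" using loop_class_surj[OF a] by blast
    then have "round_trip y0 w = w" unfolding round_trip_y0 by (simp add: loop_word_def home_def)
    then show ?thesis
      using round_trip_product[OF y0_reach, of w] w P.list_prod_generate by (auto simp: loop_word_def)
  qed
  then show ?thesis
    unfolding finite_generating_set_def using finite_gens gens_carrier P.generate_incl[OF gens_carrier] by blast
qed

definition word_of :: "(real \<Rightarrow> 'y) set \<Rightarrow> 'e word" where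
  "word_of a = (SOME w. loop_word w \<and> a = loop_class w)"

lemma word_of:
  assumes "a \<in> carrier \<pi>" shows "loop_word (word_of a) \<and> a = loop_class (word_of a)"
  unfolding word_of_def using loop_class_surj[OF assms] by (rule someI_ex)

definition spelling :: "'e word set \<Rightarrow> 'e word" where
  "spelling g = (SOME w. spelled y0 w \<and> g = word_class E w \<and> length w \<le> CARD('e) * clique_norm g)"

lemma spelling:
  assumes "g \<in> V"
  shows "spelled y0 (spelling g) \<and> g = word_class E (spelling g) \<and> length (spelling g) \<le> CARD('e) * clique_norm g"
  unfolding spelling_def using short_spelled[OF assms] by (rule someI_ex)

lemma list_prod_loop_class:
  "\<forall>w\<in>set ws. loop_word w \<Longrightarrow> loop_word (concat ws) \<and> list_prod \<pi> (map loop_class ws) = loop_class (concat ws)"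
proof (induction ws)
  case Nil
  then show ?case using y0 loop_class_Nil by (simp add: loop_word_def)
next
  case (Cons w ws)
  then show ?case using loop_class_append[of w "concat ws"] loop_word_append[of w "concat ws"] by simp
qed

text \<open>
  \<open>\<phi>\<close> is the embedding of the fundamental group, and \<open>\<psi>\<close>
  closes up a short edge path for an element of \<open>V\<close>. An element of \<open>V\<close>
  is determined by its value under \<open>\<psi>\<close> and the end vertex of this path, so the
  fibres have at most as many elements as there are vertices, of which a compact complex has
  finitely many.
\<close>
theorem growth_special: "is_growth_of (\<lambda>n. card {g \<in> V. clique_norm g = Suc n}) \<pi>"
  unfolding is_growth_of_def
proof (intro conjI allI impI)
  show "\<exists>S. finite_generating_set \<pi> S" using gens_generate by blast
  fix S assume S: "finite_generating_set \<pi> S"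
  define \<phi> where "\<phi> a = word_class E (word_of a)" for a
  define \<psi> where "\<psi> g = loop_class (round_trip y0 (spelling g))" for g
  have \<phi>_loop: "\<phi> (loop_class w) = word_class E w" if "loop_word w" for w
  proof -
    have "loop_word (word_of (loop_class w)) \<and> loop_class w = loop_class (word_of (loop_class w))"
      using word_of[OF loop_class_carrier[OF that]] .
    then have "w \<sim>\<^sub>R word_of (loop_class w)" using loop_class_eq_iff[OF that] by blast
    then show ?thesis unfolding \<phi>_def by (simp add: word_class_eq_iff equivclp_sym)
  qed
  have inj: "inj_on \<phi> (carrier \<pi>)"
  proof (rule inj_onI)
    fix a b assume ab: "a \<in> carrier \<pi>" "b \<in> carrier \<pi>" "\<phi> a = \<phi> b"
    then have "word_of a \<sim>\<^sub>R word_of b" by (simp add: \<phi>_def word_class_eq_iff)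
    then show "a = b" using word_of[OF ab(1)] word_of[OF ab(2)] loop_class_eq_iff by metis
  qed
  have ran: "\<phi> ` carrier \<pi> \<subseteq> V"
    unfolding special_elements_eq \<phi>_def using word_of by (auto simp: loop_word_def)
  have bound: "\<exists>C. \<forall>ts. set ts \<subseteq> T \<longrightarrow> clique_norm (\<phi> (list_prod \<pi> ts)) \<le> C * length ts"
    if T: "finite T" "T \<subseteq> carrier \<pi>" for T
  proof -
    define C where "C = Max (insert 0 ((length \<circ> word_of) ` T))"
    have C: "length (word_of t) \<le> C" if "t \<in> T" for t
      unfolding C_def using that T(1) by (intro Max_ge) auto
    have "clique_norm (\<phi> (list_prod \<pi> ts)) \<le> C * length ts" if ts: "set ts \<subseteq> T" for ts
    proof -
      have "\<forall>w\<in>set (map word_of ts). loop_word w" using ts T(2) word_of by auto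
      note L = list_prod_loop_class[OF this]
      have "loop_class (word_of t) = t" if "t \<in> set ts" for t using word_of[of t] ts T(2) that by auto
      then have "map loop_class (map word_of ts) = ts" by (simp add: map_idI)
      then have "\<phi> (list_prod \<pi> ts) = word_class E (concat (map word_of ts))"
        using L \<phi>_loop by metis
      moreover have "length (concat (map word_of ts)) \<le> C * length ts"
        using ts C by (induction ts) (auto intro: add_mono)
      ultimately show ?thesis using clique_norm_word_class[of "concat (map word_of ts)"] by simp
    qed
    then show ?thesis by blast
  qed
  have rep: "\<exists>ts. set ts \<subseteq> gens \<and> \<psi> g = list_prod \<pi> ts \<and> length ts \<le> CARD('e) * clique_norm g + CARD('e)"
    if g: "g \<in> V" for g
  proof -
    note s = spelling[OF g]
    obtain ts where "set ts \<subseteq> gens" "\<psi> g = list_prod \<pi> ts" "length ts = length (spelling g)"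
      using round_trip_product[OF y0_reach] s unfolding \<psi>_def by blast
    then show ?thesis using s by (intro exI[of _ ts]) auto
  qed
  have fibres: "finite {g \<in> V. \<psi> g = a} \<and> card {g \<in> V. \<psi> g = a} \<le> card (vertices Y)" for a
  proof -
    let ?F = "{g \<in> V. \<psi> g = a}"
    have inj: "inj_on (\<lambda>g. endv y0 (spelling g)) ?F"
    proof (rule inj_onI)
      fix g h assume gh: "g \<in> ?F" "h \<in> ?F" "endv y0 (spelling g) = endv y0 (spelling h)"
      then have V: "g \<in> V" "h \<in> V" "\<psi> g = \<psi> h" by auto
      note g = spelling[OF V(1)] and h = spelling[OF V(2)]
      have "round_trip y0 (spelling g) \<sim>\<^sub>R round_trip y0 (spelling h)"
        using loop_class_eq_iff[OF round_trip[OF y0_reach] round_trip[OF y0_reach]] g h V(3) unfolding \<psi>_def by blast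
      then have "spelling g \<sim>\<^sub>R spelling h"
        unfolding round_trip_y0 gh(3) by (rule equiv_cancel_right)
      then show "g = h" using g h by (metis word_class_eq_iff)
    qed
    have im: "(\<lambda>g. endv y0 (spelling g)) ` ?F \<subseteq> vertices Y" using spelling spelled_end by auto
    show ?thesis
      using inj_on_finite[OF inj im finite_vertices[OF compact]] card_inj_on_le[OF inj im finite_vertices[OF compact]] by blast
  qed
  show "growth_equivalent (\<lambda>n. card {g \<in> V. clique_norm g = Suc n}) (growth_function \<pi> S)"
    by (rule P.growth_equivalent_orbit[OF S finite_ball_subset[OF V_carrier] center_le_1[OF V_carrier] inj ran bound
          finite_gens gens_carrier rep fibres])
qed

end

end

theorem theorem3:
  fixes E :: "'e::finite \<Rightarrow> 'e \<Rightarrow> bool"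
  assumes "symp E" and "irreflp E"
  shows "(\<forall>n. finite (non_ideal_tiles (tiling E (carrier (raag E)) n))) \<and>
         is_growth_of (\<lambda>n. card (non_ideal_tiles (tiling E (carrier (raag E)) n))) (raag E) \<and>
         (\<forall>(Y :: ('y::topological_space, 'c) cubed_space) f y0.
            special_cube_complex E Y f \<and> compact (points Y) \<and> y0 \<in> vertices Y \<longrightarrow>
            (\<forall>n. finite (non_ideal_tiles (tiling E (special_elements E Y f y0) n))) \<and>
            is_growth_of (\<lambda>n. card (non_ideal_tiles (tiling E (special_elements E Y f y0) n)))
                         (fundamental_group (points Y) y0))"
proof -
  interpret raag_graph E using assms by unfold_locales
  have raag: "(\<forall>n. finite (non_ideal_tiles (tiling E (carrier (raag E)) n))) \<and>
      is_growth_of (\<lambda>n. card (non_ideal_tiles (tiling E (carrier (raag E)) n))) (raag E)"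
    using card_non_ideal_tiles[OF order_refl] growth_raag by simp
  have special: "(\<forall>n. finite (non_ideal_tiles (tiling E (special_elements E Y f y0) n))) \<and>
      is_growth_of (\<lambda>n. card (non_ideal_tiles (tiling E (special_elements E Y f y0) n)))
                   (fundamental_group (points Y) y0)"
    if Y: "special_cube_complex E Y f" "compact (points Y)" "y0 \<in> vertices Y"
    for Y :: "('y::topological_space, 'c) cubed_space" and f y0
  proof -
    interpret special_complex E Y f using Y(1) by unfold_locales
    show ?thesis
      using card_non_ideal_tiles[OF V_carrier[OF Y(2,3)]] growth_special[OF Y(2,3)] by simp
  qed
  show ?thesis using raag special by blast
qed

end
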